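(* Let $n\ge 3$ and $0<k<n-2$. There exists a constant $Q_k>0$ (depending only on $n$ and $k$) such that the following holds. Let $g:\mathbb{R}^n\times\mathbb{R}\times\mathbb{R}^n\to\mathbb{R}$, $g=g(x,z,p)$, satisfy: (H1) for every $x\in\mathbb{R}^n$, $g(x,\cdot,\cdot)\in C^1\big((\mathbb{R}\times\mathbb{R}^n)\setminus\{(0,0)\}\big)\cap C(\mathbb{R}\times\mathbb{R}^n)$; (H2) the function $x\mapsto g(x,0,0)$ belongs to $E_{k+2}$; (H3) there exists $\delta>0$ such that $\sup_{0<\|w\|_{F_k}\le\delta}\|D_{(z,p)}g(\cdot,w,Dw)\|_{E_2}<\infty$. Suppose there is $\varepsilon>0$ such that $$G_\varepsilon:=\sup_{0<\|w\|_{F_k}\le\varepsilon}\|D_{(z,p)}g(\cdot,w,Dw)\|_{E_2}<Q_k\quad\text{and}\quad \|g(\cdot,0,0)\|_{E_{k+2}}\le\varepsilon Q_k .$$ Then the integral equation $$u(x)=\frac{1}{(n-2)\omega_n}\int_{\mathbb{R}^n}\frac{1}{|x-y|^{n-2}}\,g(y,u(y),Du(y))\,dy,\qquad x\in\mathbb{R}^n,$$ has a unique solution $u\in F_k$ with $\|u\|_{F_k}\le\varepsilon$, and this $u$ is in particular a weak solution of $$\Delta u+g(x,u,Du)=0\ \text{ in }\mathbb{R}^n,\qquad u(x)\to0\ \text{ as }|x|\to\infty .$$ Furthermore, if $g\in C^{m,\alpha}_{loc}(\mathbb{R}^n\times\mathbb{R}\times\mathbb{R}^n)$ for an integer $m\ge0$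 and some $0<\alpha<1$, then $u\in C^{m+2,\alpha}_{loc}(\mathbb{R}^n)$ and $u$ satisfies this boundary value problem classically.
   Context: $\omega_n$ is the area of the unit sphere in $\mathbb{R}^n$. For $k\in\mathbb{R}$, $E_k$ is the Banach space of measurable functions $u$ on $\mathbb{R}^n$ with $\|u\|_{E_k}=\operatorname{ess\,sup}_{x\in\mathbb{R}^n}(1+|x|)^k|u(x)|<\infty$ (for vector-valued functions, $|\cdot|$ is the Euclidean norm). $F_k$ is the Banach space of $u\in C^1(\mathbb{R}^n)$ with $\|u\|_{F_k}=\sup_{x\in\mathbb{R}^n}(1+|x|)^k(|u(x)|+|Du(x)|)<\infty$. $D_{(z,p)}g(x,z,p)\in\mathbb{R}^{n+1}$ denotes the gradient of $g$ with respect to the last $n+1$ variables $(z,p)$, and $D_{(z,p)}g(\cdot,w,Dw)$ is the function $x\mapsto D_{(z,p)}g(x,w(x),Dw(x))$. The suprema are over $w\in F_k$ with the indicated norm bounds; since $g(x,\cdot,\cdot)$ need not be differentiable at $(0,0)$, the norm $\|D_{(z,p)}g(\cdot,w,Dw)\|_{E_2}$ is computed over those $x$ with $(w(x),Dw(x))\ne(0,0)$. The finiteness of these norms includes the requirement that the functions involved are measurable. Weak solution means: $\int_{\mathbb{R}^n}Du\cdot D\varphi\,dx=\int_{\mathbb{R}^n}g(x,u,Du)\varphi\,dx$ for all $\varphi\in C_c^\infty(\mathbb{R}^n)$, together with $u(x)\to0$ as $|x|\to\infty$. *)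

theory Defs
  imports "HOL-Analysis.Analysis" "HOL-Probability.Essential_Supremum"
begin

section \<open>Gradients and function classes\<close>

definition gradient :: "('a::euclidean_space \<Rightarrow> real) \<Rightarrow> 'a \<Rightarrow> 'a" where
  "gradient f x = (THE D. GDERIV f x :> D)"

lemma gradient_eqI:
  assumes "GDERIV f x :> D"
  shows "gradient f x = D"
  unfolding gradient_def
proof (rule the_equality, rule assms)
  fix D' assume "GDERIV f x :> D'"
  then have "(\<lambda>h. inner h D') = (\<lambda>h. inner h D)"
    using assms has_derivative_unique unfolding gderiv_def by blast
  then show "D' = D"
    by (metis euclidean_eqI inner_commute)
qed

lemma differentiable_imp_GDERIV_gradient:
  assumes "f differentiable (at x)"
  shows "GDERIV f x :> gradient f x"
proof -
  obtain f' where f': "(f has_derivative f') (at x)"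
    using assms unfolding differentiable_def by blast
  then interpret bounded_linear f' by (rule has_derivative_bounded_linear)
  have "f' = (\<lambda>h. inner h (\<Sum>b\<in>Basis. f' b *\<^sub>R b))"
  proof
    fix h
    have "f' h = f' (\<Sum>b\<in>Basis. inner h b *\<^sub>R b)"
      by (simp add: euclidean_representation)
    also have "\<dots> = inner h (\<Sum>b\<in>Basis. f' b *\<^sub>R b)"
      by (simp add: sum scaleR inner_sum_right mult.commute)
    finally show "f' h = inner h (\<Sum>b\<in>Basis. f' b *\<^sub>R b)" .
  qed
  with f' have "GDERIV f x :> (\<Sum>b\<in>Basis. f' b *\<^sub>R b)"
    unfolding gderiv_def by simp
  then show ?thesis
    using gradient_eqI by metis
qed

text \<open>\<open>Ck_on m S f\<close>: \<open>f\<close> is of class \<open>C^m\<close> on the \<^emph>\<open>open\<close> set \<open>S\<close>.  The functions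
  \<open>\<lambda>x. gradient f x \<bullet> b\<close> for \<open>b \<in> Basis\<close> are the partial derivatives of \<open>f\<close>.\<close>

primrec Ck_on :: "nat \<Rightarrow> 'a::euclidean_space set \<Rightarrow> ('a \<Rightarrow> real) \<Rightarrow> bool" where
  "Ck_on 0 S f \<longleftrightarrow> continuous_on S f"
| "Ck_on (Suc m) S f \<longleftrightarrow>
     (\<forall>x\<in>S. f differentiable (at x)) \<and> (\<forall>b\<in>Basis. Ck_on m S (\<lambda>x. gradient f x \<bullet> b))"

definition locally_Hoelder :: "real \<Rightarrow> ('a::euclidean_space \<Rightarrow> real) \<Rightarrow> bool" where
  "locally_Hoelder \<alpha> f \<longleftrightarrow>
     (\<forall>K. compact K \<longrightarrow> (\<exists>C. \<forall>x\<in>K. \<forall>y\<in>K. \<bar>f x - f y\<bar> \<le> C * dist x y powr \<alpha>))"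

text \<open>\<open>Ckalpha_loc m \<alpha> f\<close>: \<open>f\<close> belongs to \<open>C^{m,\<alpha>}_{loc}\<close> of the whole space, i.e. \<open>f\<close> has
  partial derivatives up to order \<open>m\<close> and those of order \<open>m\<close> are locally
  \<open>\<alpha>\<close>-Hoelder continuous.\<close>

primrec Ckalpha_loc :: "nat \<Rightarrow> real \<Rightarrow> ('a::euclidean_space \<Rightarrow> real) \<Rightarrow> bool" where
  "Ckalpha_loc 0 \<alpha> f \<longleftrightarrow> locally_Hoelder \<alpha> f"
| "Ckalpha_loc (Suc m) \<alpha> f \<longleftrightarrow>
     (\<forall>x. f differentiable (at x)) \<and> (\<forall>b\<in>Basis. Ckalpha_loc m \<alpha> (\<lambda>x. gradient f x \<bullet> b))"

definition test_function :: "('a::euclidean_space \<Rightarrow> real) \<Rightarrow> bool" where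
  "test_function \<phi> \<longleftrightarrow> (\<forall>m. Ck_on m UNIV \<phi>) \<and> compact (closure (support_on UNIV \<phi>))"

definition laplacian :: "('a::euclidean_space \<Rightarrow> real) \<Rightarrow> 'a \<Rightarrow> real" where
  "laplacian u x = (\<Sum>b\<in>Basis. gradient (\<lambda>y. gradient u y \<bullet> b) x \<bullet> b)"

section \<open>Weighted spaces\<close>

text \<open>The \<open>E_k\<close> norm of a function considered on \<open>S\<close> only.  Measurability of \<open>u\<close> has to be asked
  for separately: \<open>esssup\<close> only looks at the measurability of the norm of \<open>u\<close>.\<close>

definition E_norm_on :: "'a::euclidean_space set \<Rightarrow> real \<Rightarrow> ('a \<Rightarrow> 'b::euclidean_space) \<Rightarrow> ennreal" where
  "E_norm_on S k u =
     (if u \<in> borel_measurable (lebesgue_on S)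
      then esssup (lebesgue_on S) (\<lambda>x. ennreal ((1 + norm x) powr k * norm (u x)))
      else \<infinity>)"

abbreviation E_norm :: "real \<Rightarrow> ('a::euclidean_space \<Rightarrow> 'b::euclidean_space) \<Rightarrow> ennreal" where
  "E_norm \<equiv> E_norm_on UNIV"

definition E_space :: "real \<Rightarrow> ('a::euclidean_space \<Rightarrow> 'b::euclidean_space) set" where
  "E_space k = {u. E_norm k u < \<infinity>}"

definition F_norm :: "real \<Rightarrow> ('a::euclidean_space \<Rightarrow> real) \<Rightarrow> ennreal" where
  "F_norm k u = (SUP x. ennreal ((1 + norm x) powr k * (\<bar>u x\<bar> + norm (gradient u x))))"

definition F_space :: "real \<Rightarrow> ('a::euclidean_space \<Rightarrow> real) set" where
  "F_space k = {u. Ck_on 1 UNIV u \<and> F_norm k u < \<infinity>}"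

section \<open>The nonlinearity\<close>

definition grad_zp :: "('a::euclidean_space \<Rightarrow> real \<Rightarrow> 'a \<Rightarrow> real) \<Rightarrow> 'a \<Rightarrow> real \<Rightarrow> 'a \<Rightarrow> real \<times> 'a" where
  "grad_zp g x z p = gradient (\<lambda>(z, p). g x z p) (z, p)"

text \<open>The supremum of the \<open>E_2\<close> norms of \<open>D_{(z,p)}g(x,w,Dw)\<close> over all \<open>w\<close> in \<open>F_k\<close> of norm
  in \<open>(0,r]\<close>.  As \<open>g(x,_,_)\<close> may fail to be differentiable at the origin, the norm is computed
  over the points where \<open>(w,Dw)\<close> does not vanish.\<close>

definition grad_zp_sup :: "real \<Rightarrow> ('a::euclidean_space \<Rightarrow> real \<Rightarrow> 'a \<Rightarrow> real) \<Rightarrow> real \<Rightarrow> ennreal" where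
  "grad_zp_sup k g r =
     (SUP w\<in>{w \<in> F_space k. 0 < F_norm k w \<and> F_norm k w \<le> ennreal r}.
        E_norm_on {x. (w x, gradient w x) \<noteq> (0, 0)} 2 (\<lambda>x. grad_zp g x (w x) (gradient w x)))"

section \<open>Notions of solution\<close>

text \<open>The surface measure of a subset \<open>A\<close> of the unit sphere, normalised as in polar coordinates:
  the dimension times the volume of the cone over \<open>A\<close>.\<close>

definition sphere_area :: "'a::euclidean_space set \<Rightarrow> real" where
  "sphere_area A = real DIM('a) * measure lebesgue {r *\<^sub>R y | r y. 0 < r \<and> r \<le> 1 \<and> y \<in> A}"

lemma sphere_area_unit_sphere:
  "sphere_area (sphere 0 1 :: 'a::euclidean_space set) = 2 * pi powr (DIM('a) / 2) / Gamma (DIM('a) / 2)"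
proof -
  have eq: "{r *\<^sub>R y | r y. 0 < r \<and> r \<le> 1 \<and> y \<in> sphere (0::'a) 1} = cball 0 1 - {0}" (is "?L = ?R")
  proof
    show "?L \<subseteq> ?R" by (auto simp: dist_norm)
    show "?R \<subseteq> ?L"
    proof
      fix x :: 'a assume "x \<in> ?R"
      then have "x = norm x *\<^sub>R (x /\<^sub>R norm x) \<and> 0 < norm x \<and> norm x \<le> 1 \<and> x /\<^sub>R norm x \<in> sphere 0 1"
        by (auto simp: dist_norm)
      then show "x \<in> ?L" by blast
    qed
  qed
  have "measure lebesgue (cball (0::'a) 1 - {0}) = measure lebesgue (cball (0::'a) 1)"
    by (rule measure_Diff_null_set) auto
  also have "\<dots> = unit_ball_vol DIM('a)"
    by (simp add: content_cball)
  finally have "sphere_area (sphere 0 1 :: 'a set) = DIM('a) * unit_ball_vol DIM('a)"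
    unfolding sphere_area_def eq by simp
  moreover have "Gamma (real DIM('a) / 2 + 1) = real DIM('a) / 2 * Gamma (real DIM('a) / 2)"
    by (rule Gamma_plus1) (use DIM_positive[where 'a='a] in \<open>auto dest: nonpos_Ints_nonpos\<close>)
  ultimately show ?thesis
    by (simp add: unit_ball_vol_def)
qed

text \<open>The value of the kernel at \<open>y = x\<close>, where Isabelle's division by zero yields \<open>0\<close>, is
  irrelevant for the integral.\<close>

definition integral_solution :: "('a::euclidean_space \<Rightarrow> real \<Rightarrow> 'a \<Rightarrow> real) \<Rightarrow> ('a \<Rightarrow> real) \<Rightarrow> bool" where
  "integral_solution g u \<longleftrightarrow>
     (\<forall>x. integrable lebesgue (\<lambda>y. 1 / norm (x - y) ^ (DIM('a) - 2) * g y (u y) (gradient u y)) \<and>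
          u x = 1 / ((real DIM('a) - 2) * sphere_area (sphere 0 1 :: 'a set)) *
                (LINT y|lebesgue. 1 / norm (x - y) ^ (DIM('a) - 2) * g y (u y) (gradient u y)))"

definition weak_solution :: "('a::euclidean_space \<Rightarrow> real \<Rightarrow> 'a \<Rightarrow> real) \<Rightarrow> ('a \<Rightarrow> real) \<Rightarrow> bool" where
  "weak_solution g u \<longleftrightarrow>
     Ck_on 1 UNIV u \<and>
     (\<forall>\<phi>. test_function \<phi> \<longrightarrow>
        integrable lebesgue (\<lambda>x. gradient u x \<bullet> gradient \<phi> x) \<and>
        integrable lebesgue (\<lambda>x. g x (u x) (gradient u x) * \<phi> x) \<and>
        (LINT x|lebesgue. gradient u x \<bullet> gradient \<phi> x) =
        (LINT x|lebesgue. g x (u x) (gradient u x) * \<phi> x)) \<and>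
     (u \<longlongrightarrow> 0) at_infinity"

definition classical_solution :: "('a::euclidean_space \<Rightarrow> real \<Rightarrow> 'a \<Rightarrow> real) \<Rightarrow> ('a \<Rightarrow> real) \<Rightarrow> bool" where
  "classical_solution g u \<longleftrightarrow>
     Ck_on 2 UNIV u \<and>
     (\<forall>x. laplacian u x + g x (u x) (gradient u x) = 0) \<and>
     (u \<longlongrightarrow> 0) at_infinity"

end

theory Submission
  imports Defs
begin

text \<open>
  The function \<open>norm w powr (2 - n)\<close> is, up to a constant, the superposition over all scales
  \<open>s > 0\<close> of \<open>s powr (1 - n) * \<psi> (w / s)\<close>, where \<open>\<psi>\<close> is a radial bump on the unit ball.  Hence the
  Newtonian potential of a density \<open>f\<close> is an integral over \<open>s\<close> of \<open>s\<close> times the \<open>\<psi>\<close>-weighted mean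
  of \<open>f\<close> at scale \<open>s\<close>, and each derivative of it replaces \<open>\<psi>\<close> by a derivative and lowers the power
  of \<open>s\<close> by one, without any singular kernel.  The mean at scale \<open>s\<close> of a density decaying like
  \<open>(1 + norm y) powr - \<beta>\<close> is of size \<open>max s (1 + norm x) powr - \<beta>\<close>, which gives the decay of the
  potential and of its gradient for \<open>2 < \<beta> < n\<close>.  The kernels of the second derivatives have mean
  zero, so at small scales they only see the oscillation of \<open>f\<close>, which gives the Schauder estimate.
  Finally the Laplacian of \<open>\<psi>\<close> at scale \<open>s\<close> is an \<open>s\<close>-derivative, so that the Poisson equation
  (weak or classical) is the fundamental theorem of calculus in \<open>s\<close>.

  By the smallness of \<open>D_{(z,p)}g\<close> the superposition operator maps the ball of radius \<open>\<epsilon>\<close> of \<open>F_k\<close> to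
  \<open>E_{k+2}\<close> with a small Lipschitz constant, so that its composition with the Newtonian potential is
  a contraction of that ball.  The gradient of a fixed point is Hoelder continuous because the density
  is locally bounded; from there Hoelder regularity is bootstrapped with the Schauder estimate.
\<close>

section \<open>Calculus of the function classes\<close>

text \<open>Differentiating the Newtonian kernel twice leaves a singularity of order
  \<open>-n\<close>, which calls for principal values; at a fixed scale every kernel is continuous
  with compact support, and all convergence questions concern powers of \<open>s\<close> near 0 and
  infinity. With \<beta> = k + 2 the conditions on \<open>k\<close> say exactly 2 < \<beta> < n: the
  lower bound makes \<open>s * s powr - \<beta>\<close> integrable at infinity, the upper one lets
  the mean of the density over a ball of radius \<open>s\<close> decay like
  \<open>s powr - \<beta>\<close>. The constant is Q = 1 / (2 C), where \<open>C\<close> bounds the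
  Newtonian potential as a map from \<open>E_{k+2}\<close> to \<open>F_k\<close>; it serves both for
  mapping the ball into itself and for the contraction factor 1/2. Two obstacles come from
  \<open>g\<close>. Its behaviour in \<open>x\<close> is controlled only through (H2) and (H3), so
  the measurability of \<open>g(x,u,Du)\<close> has to be extracted from that of
  \<open>D_{(z,p)}g\<close> along functions of the ball. And the bound on this gradient holds, for
  each \<open>w\<close>, outside a null set that depends on \<open>w\<close>, while
  \<open>g(x,_,_)\<close> may fail to be differentiable at the origin.\<close>

lemma GDERIV_imp_differentiable: "GDERIV f x :> D \<Longrightarrow> f differentiable (at x)"
  unfolding gderiv_def differentiable_def by blast

lemma gradient_add:
  assumes "f differentiable (at x)" "g differentiable (at x)"
  shows "gradient (\<lambda>x. f x + g x) x = gradient f x + gradient g x"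
  by (intro gradient_eqI GDERIV_add differentiable_imp_GDERIV_gradient assms)

lemma gradient_diff:
  assumes "f differentiable (at x)" "g differentiable (at x)"
  shows "gradient (\<lambda>x. f x - g x) x = gradient f x - gradient g x"
  by (intro gradient_eqI GDERIV_diff differentiable_imp_GDERIV_gradient assms)

lemma gradient_mult:
  assumes "f differentiable (at x)" "g differentiable (at x)"
  shows "gradient (\<lambda>x. f x * g x) x = f x *\<^sub>R gradient g x + g x *\<^sub>R gradient f x"
  by (intro gradient_eqI GDERIV_mult differentiable_imp_GDERIV_gradient assms)

lemma gradient_const [simp]: "gradient (\<lambda>x. c) x = 0"
  by (intro gradient_eqI GDERIV_const)

lemma GDERIV_inner_left: "GDERIV (\<lambda>x. x \<bullet> b) x :> b"
  unfolding gderiv_def by (auto intro!: derivative_eq_intros)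

lemma gradient_inner_left [simp]: "gradient (\<lambda>x. x \<bullet> b) x = b"
  by (intro gradient_eqI GDERIV_inner_left)

lemma gradient_cmult:
  assumes "f differentiable (at x)"
  shows "gradient (\<lambda>x. c * f x) x = c *\<^sub>R gradient f x"
  using gradient_mult[of "\<lambda>_. c" x f] assms by simp

lemma GDERIV_componentI:
  assumes "\<And>e. e \<in> Basis \<Longrightarrow> (\<lambda>x. \<Phi> x \<bullet> e) differentiable (at x)"
  shows "(\<Phi> has_derivative (\<lambda>h. \<Sum>e\<in>Basis. (h \<bullet> gradient (\<lambda>x. \<Phi> x \<bullet> e) x) *\<^sub>R e)) (at x)"
proof -
  have "((\<lambda>x. \<Sum>e\<in>Basis. (\<Phi> x \<bullet> e) *\<^sub>R e) has_derivative
      (\<lambda>h. \<Sum>e\<in>Basis. (h \<bullet> gradient (\<lambda>x. \<Phi> x \<bullet> e) x) *\<^sub>R e)) (at x)"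
    using assms by (intro has_derivative_sum has_derivative_scaleR_left)
      (simp add: differentiable_imp_GDERIV_gradient flip: gderiv_def)
  then show ?thesis by (simp add: euclidean_representation)
qed

lemma GDERIV_compose:
  assumes G: "G differentiable (at (\<Phi> x))"
    and \<Phi>: "\<And>e. e \<in> Basis \<Longrightarrow> (\<lambda>x. \<Phi> x \<bullet> e) differentiable (at x)"
  shows "GDERIV (\<lambda>x. G (\<Phi> x)) x :>
    (\<Sum>e\<in>Basis. (gradient G (\<Phi> x) \<bullet> e) *\<^sub>R gradient (\<lambda>x. \<Phi> x \<bullet> e) x)"
proof -
  have "((\<lambda>x. G (\<Phi> x)) has_derivative
     (\<lambda>h. (\<Sum>e\<in>Basis. (h \<bullet> gradient (\<lambda>x. \<Phi> x \<bullet> e) x) *\<^sub>R e) \<bullet> gradient G (\<Phi> x))) (at x)"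
    using has_derivative_compose[OF GDERIV_componentI[OF \<Phi>]
      differentiable_imp_GDERIV_gradient[OF G, unfolded gderiv_def]] by simp
  then show ?thesis
    unfolding gderiv_def
    by (rule has_derivative_eq_rhs)
      (auto simp: inner_sum_left inner_sum_right inner_commute mult.commute)
qed

section \<open>Functions of class \<open>C^j\<close> on the whole space\<close>

lemma Ck_on_differentiable: "Ck_on (Suc j) UNIV f \<Longrightarrow> f differentiable (at x)"
  by simp

lemma Ck_on_SucI:
  assumes "\<And>x. GDERIV f x :> D x" and "\<And>b. b \<in> Basis \<Longrightarrow> Ck_on j UNIV (\<lambda>x. D x \<bullet> b)"
  shows "Ck_on (Suc j) UNIV f"
proof -
  have "gradient f = D" using assms(1) by (auto intro: gradient_eqI)
  moreover have "f differentiable (at x)" for x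
    using assms(1) by (rule GDERIV_imp_differentiable)
  ultimately show ?thesis using assms(2) by simp
qed

lemma Ck_on_SucD: "Ck_on (Suc j) UNIV f \<Longrightarrow> Ck_on j UNIV f"
proof (induction j arbitrary: f)
  case 0
  then show ?case
    by (auto intro!: continuous_at_imp_continuous_on differentiable_imp_continuous_within)
next
  case (Suc j)
  show ?case
    unfolding Ck_on.simps(2)[of j] using Suc.IH Suc.prems by simp
qed

lemma Ck_on_mono:
  assumes "Ck_on j UNIV f" "i \<le> j"
  shows "Ck_on i UNIV f"
  using assms(2,1) by (rule inc_induct[where P = "\<lambda>i. Ck_on i UNIV f"]) (erule Ck_on_SucD)

lemma Ck_on_continuous: "Ck_on j UNIV f \<Longrightarrow> continuous_on UNIV f"
  using Ck_on_mono[of j f 0] by simp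

lemma continuous_gradientI:
  assumes "\<And>b. b \<in> Basis \<Longrightarrow> continuous_on S (\<lambda>x. gradient f x \<bullet> b)"
  shows "continuous_on S (gradient f)"
  using assms by (subst continuous_on_componentwise) auto

lemma Ck_on_1_continuous_gradient: "Ck_on (Suc j) UNIV f \<Longrightarrow> continuous_on UNIV (gradient f)"
  by (rule continuous_gradientI) (auto intro: Ck_on_continuous)

lemma Ck_on_const: "Ck_on j UNIV (\<lambda>_. c)"
  by (induction j arbitrary: c) auto

lemma Ck_on_inner_left: "Ck_on j UNIV (\<lambda>x. x \<bullet> b)"
  by (cases j) (auto simp: Ck_on_const differentiable_def intro!: continuous_intros derivative_intros)

lemma Ck_on_add: "Ck_on j UNIV f \<Longrightarrow> Ck_on j UNIV g \<Longrightarrow> Ck_on j UNIV (\<lambda>x. f x + g x)"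
  by (induction j arbitrary: f g) (auto simp: gradient_add inner_add_left intro!: continuous_on_add)

lemma Ck_on_mult: "Ck_on j UNIV f \<Longrightarrow> Ck_on j UNIV g \<Longrightarrow> Ck_on j UNIV (\<lambda>x. f x * g x)"
proof (induction j arbitrary: f g)
  case 0
  then show ?case by (auto intro!: continuous_on_mult)
next
  case (Suc j)
  then show ?case
    using Ck_on_SucD[OF Suc.prems(1)] Ck_on_SucD[OF Suc.prems(2)]
    by (auto simp: gradient_mult inner_add_left intro!: Ck_on_add Suc.IH)
qed

lemma Ck_on_cmult: "Ck_on j UNIV f \<Longrightarrow> Ck_on j UNIV (\<lambda>x. c * f x)"
  by (intro Ck_on_mult Ck_on_const)

text \<open>The codomain is any metric space, so that vector-valued maps such as
  \<open>x \<mapsto> (x, u x, Du x)\<close> are covered. Balls around the origin replace arbitrary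
  compact sets, and the constant is nonnegative so that it can be multiplied through
  estimates.\<close>

definition ball_Hoelder :: "real \<Rightarrow> ('a::euclidean_space \<Rightarrow> 'b::metric_space) \<Rightarrow> bool" where
  "ball_Hoelder \<alpha> f \<longleftrightarrow> (\<forall>R. \<exists>C\<ge>0. \<forall>x\<in>cball 0 R. \<forall>y\<in>cball 0 R. dist (f x) (f y) \<le> C * dist x y powr \<alpha>)"

lemma ball_HoelderD:
  assumes "ball_Hoelder \<alpha> f"
  obtains C where "C \<ge> 0" "\<And>x y. norm x \<le> R \<Longrightarrow> norm y \<le> R \<Longrightarrow> dist (f x) (f y) \<le> C * dist x y powr \<alpha>"
  using assms unfolding ball_Hoelder_def by (metis mem_cball_0)

lemma locally_Hoelder_iff: "locally_Hoelder \<alpha> f \<longleftrightarrow> ball_Hoelder \<alpha> f"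
proof
  assume L: "locally_Hoelder \<alpha> f"
  show "ball_Hoelder \<alpha> f" unfolding ball_Hoelder_def
  proof
    fix R
    from L obtain C where C: "\<forall>x\<in>cball 0 R. \<forall>y\<in>cball 0 R. \<bar>f x - f y\<bar> \<le> C * dist x y powr \<alpha>"
      unfolding locally_Hoelder_def using compact_cball by blast
    have "dist (f x) (f y) \<le> \<bar>C\<bar> * dist x y powr \<alpha>" if "x \<in> cball 0 R" "y \<in> cball 0 R" for x y
    proof -
      have "\<bar>f x - f y\<bar> \<le> C * dist x y powr \<alpha>" using C that by blast
      also have "\<dots> \<le> \<bar>C\<bar> * dist x y powr \<alpha>" by (intro mult_right_mono) auto
      finally show ?thesis by (simp add: dist_real_def)
    qed
    then show "\<exists>C\<ge>0. \<forall>x\<in>cball 0 R. \<forall>y\<in>cball 0 R. dist (f x) (f y) \<le> C * dist x y powr \<alpha>"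
      by (intro exI[of _ "\<bar>C\<bar>"]) auto
  qed
next
  assume H: "ball_Hoelder \<alpha> f"
  show "locally_Hoelder \<alpha> f" unfolding locally_Hoelder_def
  proof (intro allI impI)
    fix K :: "'a set" assume "compact K"
    then obtain R where "\<forall>x\<in>K. norm x \<le> R"
      using compact_imp_bounded bounded_iff by blast
    with ball_HoelderD[OF H, of R] show "\<exists>C. \<forall>x\<in>K. \<forall>y\<in>K. \<bar>f x - f y\<bar> \<le> C * dist x y powr \<alpha>"
      by (metis dist_real_def)
  qed
qed

lemma ball_Hoelder_continuous:
  assumes "ball_Hoelder \<alpha> f" "0 < \<alpha>"
  shows "continuous_on UNIV f"
proof (intro continuous_at_imp_continuous_on ballI)
  fix x :: 'a
  obtain C where C: "\<And>y z. norm y \<le> norm x + 1 \<Longrightarrow> norm z \<le> norm x + 1 \<Longrightarrow> dist (f y) (f z) \<le> C * dist y z powr \<alpha>"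
    using ball_HoelderD[OF assms(1), of "norm x + 1"] by metis
  have "((\<lambda>y. dist (f y) (f x)) \<longlongrightarrow> 0) (at x)"
  proof (rule real_tendsto_sandwich[where f = "\<lambda>_. 0" and h = "\<lambda>y. C * dist y x powr \<alpha>"])
    show "\<forall>\<^sub>F y in at x. dist (f y) (f x) \<le> C * dist y x powr \<alpha>"
      unfolding eventually_at
    proof (intro exI[of _ 1] conjI ballI impI)
      fix y assume "y \<noteq> x \<and> dist y x < 1"
      then have "norm y \<le> norm x + 1" by norm
      then show "dist (f y) (f x) \<le> C * dist y x powr \<alpha>" using C by simp
    qed simp
    have "((\<lambda>y. dist y x) \<longlongrightarrow> dist x x) (at x)"
      by (intro tendsto_intros)
    then have "((\<lambda>y. dist y x powr \<alpha>) \<longlongrightarrow> 0) (at x)"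
      using assms(2) by (intro tendsto_zero_powrI[OF _ tendsto_const]) auto
    then show "((\<lambda>y. C * dist y x powr \<alpha>) \<longlongrightarrow> 0) (at x)"
      by (rule tendsto_mult_right_zero)
  qed auto
  then show "isCont f x"
    unfolding isCont_def using tendsto_dist_iff by blast
qed

lemma continuous_bounded_on_cball:
  fixes f :: "'a::euclidean_space \<Rightarrow> 'b::real_normed_vector"
  assumes "continuous_on UNIV f"
  obtains B where "B > 0" "\<And>x. norm x \<le> R \<Longrightarrow> norm (f x) \<le> B"
proof -
  have "bounded (f ` cball 0 R)"
    by (intro compact_imp_bounded compact_continuous_image continuous_on_subset[OF assms]) auto
  then obtain B where "\<And>x. norm x \<le> R \<Longrightarrow> norm (f x) \<le> B"
    unfolding bounded_iff by (metis imageI mem_cball_0)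
  then have "norm (f x) \<le> max B 1" if "norm x \<le> R" for x
    using that by fastforce
  then show thesis using that[of "max B 1"] by simp
qed

lemma powr_le_on_ball:
  fixes x y :: "'a::euclidean_space"
  assumes "norm x \<le> R" "norm y \<le> R" "\<alpha> \<le> \<beta>"
  shows "dist x y powr \<beta> \<le> (2 * R) powr (\<beta> - \<alpha>) * dist x y powr \<alpha>"
proof (cases "x = y")
  case False
  have "dist x y \<le> 2 * R" using assms(1,2) by norm
  then have "dist x y powr (\<beta> - \<alpha>) \<le> (2 * R) powr (\<beta> - \<alpha>)"
    using assms(3) by (intro powr_mono2) auto
  moreover have "dist x y powr \<beta> = dist x y powr (\<beta> - \<alpha>) * dist x y powr \<alpha>"
    by (simp flip: powr_add)
  ultimately show ?thesis by (simp add: mult_right_mono)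
qed (use assms in auto)

lemma ball_Hoelder_mono:
  assumes "ball_Hoelder \<beta> f" "\<alpha> \<le> \<beta>"
  shows "ball_Hoelder \<alpha> f"
  unfolding ball_Hoelder_def
proof
  fix R
  obtain C where C: "C \<ge> 0" "\<And>x y. norm x \<le> R \<Longrightarrow> norm y \<le> R \<Longrightarrow> dist (f x) (f y) \<le> C * dist x y powr \<beta>"
    using ball_HoelderD[OF assms(1)] by metis
  have "dist (f x) (f y) \<le> (C * (2 * R) powr (\<beta> - \<alpha>)) * dist x y powr \<alpha>" if "norm x \<le> R" "norm y \<le> R" for x y
    using C(2)[OF that] mult_left_mono[OF powr_le_on_ball[OF that assms(2)] C(1)] by (simp add: mult.assoc)
  then show "\<exists>C\<ge>0. \<forall>x\<in>cball 0 R. \<forall>y\<in>cball 0 R. dist (f x) (f y) \<le> C * dist x y powr \<alpha>"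
    using C(1) by (intro exI[of _ "C * (2 * R) powr (\<beta> - \<alpha>)"]) auto
qed

text \<open>Continuity of \<open>\<Phi>\<close> sends a ball into a ball, on which \<open>G\<close>
  has a single Hoelder constant. The exponents multiply, a genuine loss unless \<beta> = 1; the
  regularity of the fixed point enters with \<beta> = 1/2 and continues with \<beta> = 1.\<close>

lemma ball_Hoelder_compose:
  fixes G :: "'e::euclidean_space \<Rightarrow> 'b::metric_space" and \<Phi> :: "'a::euclidean_space \<Rightarrow> 'e"
  assumes G: "ball_Hoelder \<alpha> G" and \<Phi>: "ball_Hoelder \<beta> \<Phi>" and "0 < \<alpha>" "0 < \<beta>"
  shows "ball_Hoelder (\<alpha> * \<beta>) (\<lambda>x. G (\<Phi> x))"
  unfolding ball_Hoelder_def
proof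
  fix R
  obtain B where B: "B > 0" "\<And>x. norm x \<le> R \<Longrightarrow> norm (\<Phi> x) \<le> B"
    using continuous_bounded_on_cball[OF ball_Hoelder_continuous[OF \<Phi> \<open>0 < \<beta>\<close>]] by metis
  obtain C where C: "C \<ge> 0" "\<And>x y. norm x \<le> B \<Longrightarrow> norm y \<le> B \<Longrightarrow> dist (G x) (G y) \<le> C * dist x y powr \<alpha>"
    using ball_HoelderD[OF G] by metis
  obtain D where D: "D \<ge> 0" "\<And>x y. norm x \<le> R \<Longrightarrow> norm y \<le> R \<Longrightarrow> dist (\<Phi> x) (\<Phi> y) \<le> D * dist x y powr \<beta>"
    using ball_HoelderD[OF \<Phi>] by metis
  have "dist (G (\<Phi> x)) (G (\<Phi> y)) \<le> (C * D powr \<alpha>) * dist x y powr (\<alpha> * \<beta>)"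
    if "norm x \<le> R" "norm y \<le> R" for x y
  proof -
    have "dist (G (\<Phi> x)) (G (\<Phi> y)) \<le> C * dist (\<Phi> x) (\<Phi> y) powr \<alpha>"
      using C(2) B(2) that by blast
    also have "\<dots> \<le> C * (D * dist x y powr \<beta>) powr \<alpha>"
      using D(2)[OF that] C(1) \<open>0 < \<alpha>\<close> by (intro mult_left_mono powr_mono2) auto
    also have "\<dots> = (C * D powr \<alpha>) * dist x y powr (\<alpha> * \<beta>)"
      by (simp add: powr_mult D(1) powr_powr mult.commute)
    finally show ?thesis .
  qed
  then show "\<exists>C\<ge>0. \<forall>x\<in>cball 0 R. \<forall>y\<in>cball 0 R. dist (G (\<Phi> x)) (G (\<Phi> y)) \<le> C * dist x y powr (\<alpha> * \<beta>)"
    using C(1) by (intro exI[of _ "C * D powr \<alpha>"]) auto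
qed

lemma ball_Hoelder_componentI:
  fixes \<Phi> :: "'a::euclidean_space \<Rightarrow> 'e::euclidean_space"
  assumes "\<And>e. e \<in> Basis \<Longrightarrow> ball_Hoelder \<alpha> (\<lambda>x. \<Phi> x \<bullet> e)"
  shows "ball_Hoelder \<alpha> \<Phi>"
  unfolding ball_Hoelder_def
proof
  fix R
  have "\<forall>e\<in>Basis. \<exists>C\<ge>0. \<forall>x\<in>cball 0 R. \<forall>y\<in>cball 0 R. dist (\<Phi> x \<bullet> e) (\<Phi> y \<bullet> e) \<le> C * dist x y powr \<alpha>"
    using assms unfolding ball_Hoelder_def by blast
  then obtain C where C: "\<And>e. e \<in> Basis \<Longrightarrow> C e \<ge> 0"
    "\<And>e x y. e \<in> Basis \<Longrightarrow> x \<in> cball 0 R \<Longrightarrow> y \<in> cball 0 R \<Longrightarrow> dist (\<Phi> x \<bullet> e) (\<Phi> y \<bullet> e) \<le> C e * dist x y powr \<alpha>"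
    using bchoice[of Basis "\<lambda>e C. C \<ge> 0 \<and> (\<forall>x\<in>cball 0 R. \<forall>y\<in>cball 0 R. dist (\<Phi> x \<bullet> e) (\<Phi> y \<bullet> e) \<le> C * dist x y powr \<alpha>)"]
    by blast
  have "dist (\<Phi> x) (\<Phi> y) \<le> (\<Sum>e\<in>Basis. C e) * dist x y powr \<alpha>" if "x \<in> cball 0 R" "y \<in> cball 0 R" for x y
  proof -
    have "dist (\<Phi> x) (\<Phi> y) \<le> (\<Sum>e\<in>Basis. \<bar>(\<Phi> x - \<Phi> y) \<bullet> e\<bar>)"
      unfolding dist_norm by (rule norm_le_l1)
    also have "\<dots> \<le> (\<Sum>e\<in>Basis. C e * dist x y powr \<alpha>)"
      using C(2)[OF _ that] by (intro sum_mono) (auto simp: dist_real_def inner_diff_left)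
    finally show ?thesis by (simp add: sum_distrib_right)
  qed
  then show "\<exists>C\<ge>0. \<forall>x\<in>cball 0 R. \<forall>y\<in>cball 0 R. dist (\<Phi> x) (\<Phi> y) \<le> C * dist x y powr \<alpha>"
    using C(1) by (intro exI[of _ "\<Sum>e\<in>Basis. C e"]) (auto intro: sum_nonneg)
qed

lemma ball_Hoelder_Lipschitz_C1:
  assumes f: "\<And>x. f differentiable (at x)" and "continuous_on UNIV (gradient f)"
  shows "ball_Hoelder 1 f"
  unfolding ball_Hoelder_def
proof
  fix R :: real
  obtain B where B: "B > 0" "\<And>x. norm x \<le> R \<Longrightarrow> norm (gradient f x) \<le> B"
    using continuous_bounded_on_cball[OF assms(2)] by metis
  have "norm (f x - f y) \<le> B * norm (x - y)" if "x \<in> cball 0 R" "y \<in> cball 0 R" for x y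
  proof (rule differentiable_bound[OF convex_cball _ _ that])
    fix z :: 'a assume z: "z \<in> cball 0 R"
    show "(f has_derivative (\<lambda>h. h \<bullet> gradient f z)) (at z within cball 0 R)"
      using differentiable_imp_GDERIV_gradient[OF f] has_derivative_at_withinI unfolding gderiv_def by blast
    show "onorm (\<lambda>h. h \<bullet> gradient f z) \<le> B"
    proof (rule onorm_bound)
      show "norm (h \<bullet> gradient f z) \<le> B * norm h" for h
        using Cauchy_Schwarz_ineq2[of h "gradient f z"] mult_left_mono[OF B(2)[of z], of "norm h"] z
        by (simp add: mult.commute)
    qed (use B(1) in simp)
  qed
  then show "\<exists>C\<ge>0. \<forall>x\<in>cball 0 R. \<forall>y\<in>cball 0 R. dist (f x) (f y) \<le> C * dist x y powr 1"
    using B(1) by (intro exI[of _ B]) (auto simp: dist_norm)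
qed

lemma Ck_on_ball_Hoelder: "Ck_on (Suc j) UNIV f \<Longrightarrow> ball_Hoelder 1 f"
  using ball_Hoelder_Lipschitz_C1 Ck_on_1_continuous_gradient Ck_on_differentiable by metis

lemma ball_Hoelder_add:
  fixes f g :: "'a::euclidean_space \<Rightarrow> real"
  assumes "ball_Hoelder \<alpha> f" "ball_Hoelder \<alpha> g"
  shows "ball_Hoelder \<alpha> (\<lambda>x. f x + g x)"
  unfolding ball_Hoelder_def
proof
  fix R
  obtain C where C: "C \<ge> 0" "\<And>x y. norm x \<le> R \<Longrightarrow> norm y \<le> R \<Longrightarrow> dist (f x) (f y) \<le> C * dist x y powr \<alpha>"
    using ball_HoelderD[OF assms(1)] by metis
  obtain D where D: "D \<ge> 0" "\<And>x y. norm x \<le> R \<Longrightarrow> norm y \<le> R \<Longrightarrow> dist (g x) (g y) \<le> D * dist x y powr \<alpha>"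
    using ball_HoelderD[OF assms(2)] by metis
  have "dist (f x + g x) (f y + g y) \<le> (C + D) * dist x y powr \<alpha>" if "norm x \<le> R" "norm y \<le> R" for x y
    using C(2)[OF that] D(2)[OF that] by (simp add: dist_real_def algebra_simps)
  then show "\<exists>C\<ge>0. \<forall>x\<in>cball 0 R. \<forall>y\<in>cball 0 R. dist (f x + g x) (f y + g y) \<le> C * dist x y powr \<alpha>"
    using C(1) D(1) by (intro exI[of _ "C + D"]) auto
qed

lemma ball_Hoelder_mult:
  fixes f g :: "'a::euclidean_space \<Rightarrow> real"
  assumes "ball_Hoelder \<alpha> f" "ball_Hoelder \<alpha> g" "0 < \<alpha>"
  shows "ball_Hoelder \<alpha> (\<lambda>x. f x * g x)"
  unfolding ball_Hoelder_def
proof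
  fix R
  obtain C where C: "C \<ge> 0" "\<And>x y. norm x \<le> R \<Longrightarrow> norm y \<le> R \<Longrightarrow> dist (f x) (f y) \<le> C * dist x y powr \<alpha>"
    using ball_HoelderD[OF assms(1)] by metis
  obtain D where D: "D \<ge> 0" "\<And>x y. norm x \<le> R \<Longrightarrow> norm y \<le> R \<Longrightarrow> dist (g x) (g y) \<le> D * dist x y powr \<alpha>"
    using ball_HoelderD[OF assms(2)] by metis
  obtain A where A: "A > 0" "\<And>x. norm x \<le> R \<Longrightarrow> norm (f x) \<le> A"
    using continuous_bounded_on_cball[OF ball_Hoelder_continuous[OF assms(1,3)]] by metis
  obtain B where B: "B > 0" "\<And>x. norm x \<le> R \<Longrightarrow> norm (g x) \<le> B"
    using continuous_bounded_on_cball[OF ball_Hoelder_continuous[OF assms(2,3)]] by metis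
  have "dist (f x * g x) (f y * g y) \<le> (A * D + B * C) * dist x y powr \<alpha>" if "norm x \<le> R" "norm y \<le> R" for x y
  proof -
    have "f x * g x - f y * g y = f x * (g x - g y) + g y * (f x - f y)" by algebra
    then have "dist (f x * g x) (f y * g y) \<le> \<bar>f x\<bar> * \<bar>g x - g y\<bar> + \<bar>g y\<bar> * \<bar>f x - f y\<bar>"
      by (metis abs_mult abs_triangle_ineq dist_real_def)
    also have "\<dots> \<le> A * (D * dist x y powr \<alpha>) + B * (C * dist x y powr \<alpha>)"
      using A(2)[OF that(1)] B(2)[OF that(2)] C(2)[OF that] D(2)[OF that] A(1) B(1)
      by (intro add_mono mult_mono) (auto simp: dist_real_def)
    finally show ?thesis by (simp add: algebra_simps)
  qed
  then show "\<exists>C\<ge>0. \<forall>x\<in>cball 0 R. \<forall>y\<in>cball 0 R. dist (f x * g x) (f y * g y) \<le> C * dist x y powr \<alpha>"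
    using A(1) B(1) C(1) D(1) by (intro exI[of _ "A * D + B * C"]) auto
qed

lemma ball_Hoelder_const: "ball_Hoelder \<alpha> (\<lambda>_. c)"
  unfolding ball_Hoelder_def by (auto intro!: exI[of _ 0])

section \<open>Calculus in the classes \<open>C^{m,\<alpha>}_loc\<close>\<close>

lemma Ckalpha_loc_SucI:
  assumes "\<And>x. GDERIV f x :> D x" and "\<And>b. b \<in> Basis \<Longrightarrow> Ckalpha_loc j \<alpha> (\<lambda>x. D x \<bullet> b)"
  shows "Ckalpha_loc (Suc j) \<alpha> f"
proof -
  have "gradient f = D" using assms(1) by (auto intro: gradient_eqI)
  moreover have "f differentiable (at x)" for x
    using assms(1) by (rule GDERIV_imp_differentiable)
  ultimately show ?thesis using assms(2) by simp
qed

lemma Ckalpha_loc_imp_Ck_on: "Ckalpha_loc j \<alpha> f \<Longrightarrow> 0 < \<alpha> \<Longrightarrow> Ck_on j UNIV f"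
  by (induction j arbitrary: f) (auto simp: locally_Hoelder_iff intro: ball_Hoelder_continuous)

text \<open>A \<open>C^1\<close> function is Lipschitz on balls by the mean value inequality, and on
  bounded sets this is stronger than the Hoelder condition of exponent \<alpha> \<le> 1. The large
  scales of a potential and the coordinate functions enter the Hoelder classes this way.\<close>

lemma Ck_on_imp_Ckalpha_loc: "Ck_on (Suc j) UNIV f \<Longrightarrow> \<alpha> \<le> 1 \<Longrightarrow> Ckalpha_loc j \<alpha> f"
proof (induction j arbitrary: f)
  case 0
  then show ?case
    using ball_Hoelder_mono[OF Ck_on_ball_Hoelder] by (simp add: locally_Hoelder_iff del: Ck_on.simps)
next
  case (Suc j)
  then show ?case by simp
qed

lemma Ckalpha_loc_SucD: "Ckalpha_loc (Suc j) \<alpha> f \<Longrightarrow> 0 < \<alpha> \<Longrightarrow> \<alpha> \<le> 1 \<Longrightarrow> Ckalpha_loc j \<alpha> f"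
  using Ckalpha_loc_imp_Ck_on Ck_on_imp_Ckalpha_loc by blast

lemma Ckalpha_loc_mono:
  assumes "Ckalpha_loc j \<alpha> f" "i \<le> j" "0 < \<alpha>" "\<alpha> \<le> 1"
  shows "Ckalpha_loc i \<alpha> f"
  using assms(2,1)
  by (rule inc_induct[where P = "\<lambda>i. Ckalpha_loc i \<alpha> f"]) (erule Ckalpha_loc_SucD[OF _ assms(3,4)])

lemma Ckalpha_loc_const: "Ckalpha_loc j \<alpha> (\<lambda>_. c)"
  by (induction j arbitrary: c) (auto simp: locally_Hoelder_iff ball_Hoelder_const)

lemma Ckalpha_loc_add:
  "Ckalpha_loc j \<alpha> f \<Longrightarrow> Ckalpha_loc j \<alpha> g \<Longrightarrow> Ckalpha_loc j \<alpha> (\<lambda>x. f x + g x)"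
  by (induction j arbitrary: f g)
    (auto simp: gradient_add inner_add_left locally_Hoelder_iff intro!: ball_Hoelder_add)

lemma Ckalpha_loc_mult:
  assumes "0 < \<alpha>" "\<alpha> \<le> 1"
  shows "Ckalpha_loc j \<alpha> f \<Longrightarrow> Ckalpha_loc j \<alpha> g \<Longrightarrow> Ckalpha_loc j \<alpha> (\<lambda>x. f x * g x)"
proof (induction j arbitrary: f g)
  case 0
  then show ?case using assms by (auto simp: locally_Hoelder_iff intro!: ball_Hoelder_mult)
next
  case (Suc j)
  then show ?case
    using Ckalpha_loc_SucD[OF Suc.prems(1) assms] Ckalpha_loc_SucD[OF Suc.prems(2) assms]
    by (auto simp: gradient_mult inner_add_left intro!: Ckalpha_loc_add Suc.IH)
qed

lemma Ckalpha_loc_cmult: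
  assumes "0 < \<alpha>" "\<alpha> \<le> 1"
  shows "Ckalpha_loc j \<alpha> f \<Longrightarrow> Ckalpha_loc j \<alpha> (\<lambda>x. c * f x)"
  by (intro Ckalpha_loc_mult Ckalpha_loc_const assms)

lemma Ckalpha_loc_sum:
  "(\<And>i. i \<in> I \<Longrightarrow> Ckalpha_loc j \<alpha> (f i)) \<Longrightarrow> Ckalpha_loc j \<alpha> (\<lambda>x. \<Sum>i\<in>I. f i x)"
  by (induction I rule: infinite_finite_induct) (auto intro: Ckalpha_loc_const Ckalpha_loc_add)

text \<open>The class \<open>C^1\<close> of \<open>\<Phi>\<close> is what preserves the exponent: in
  the base case \<open>\<Phi>\<close> is locally Lipschitz, so composing with it does not lower
  \<alpha>. The induction generalises over \<open>G\<close> because the chain rule composes the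
  partial derivatives of \<open>G\<close> with the same \<open>\<Phi>\<close>.\<close>

lemma Ckalpha_loc_compose:
  fixes G :: "'e::euclidean_space \<Rightarrow> real" and \<Phi> :: "'a::euclidean_space \<Rightarrow> 'e"
  assumes \<alpha>: "0 < \<alpha>" "\<alpha> \<le> 1"
    and C1: "\<And>e. e \<in> Basis \<Longrightarrow> Ck_on 1 UNIV (\<lambda>x. \<Phi> x \<bullet> e)"
  shows "Ckalpha_loc j \<alpha> G \<Longrightarrow> (\<And>e. e \<in> Basis \<Longrightarrow> Ckalpha_loc j \<alpha> (\<lambda>x. \<Phi> x \<bullet> e)) \<Longrightarrow>
    Ckalpha_loc j \<alpha> (\<lambda>x. G (\<Phi> x))"
proof (induction j arbitrary: G)
  case 0
  have "ball_Hoelder 1 \<Phi>"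
    using C1[unfolded One_nat_def] by (rule ball_Hoelder_componentI[OF Ck_on_ball_Hoelder])
  then show ?case
    using 0 ball_Hoelder_compose[of \<alpha> G 1 \<Phi>] \<alpha> by (simp add: locally_Hoelder_iff)
next
  case (Suc j)
  have IH: "Ckalpha_loc j \<alpha> (\<lambda>x. gradient G (\<Phi> x) \<bullet> e)" if "e \<in> Basis" for e
    by (rule Suc.IH) (use Suc.prems(1) that Ckalpha_loc_SucD[OF Suc.prems(2) \<alpha>] in simp_all)
  show ?case
  proof (rule Ckalpha_loc_SucI)
    show "GDERIV (\<lambda>x. G (\<Phi> x)) x :>
      (\<Sum>e\<in>Basis. (gradient G (\<Phi> x) \<bullet> e) *\<^sub>R gradient (\<lambda>x. \<Phi> x \<bullet> e) x)" for x
      using Suc.prems(1) C1 by (intro GDERIV_compose) simp_all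
    show "Ckalpha_loc j \<alpha> (\<lambda>x. (\<Sum>e\<in>Basis. (gradient G (\<Phi> x) \<bullet> e) *\<^sub>R gradient (\<lambda>x. \<Phi> x \<bullet> e) x) \<bullet> b)"
      if "b \<in> Basis" for b
      unfolding inner_sum_left inner_scaleR_left
      using Suc.prems(2) that by (intro Ckalpha_loc_sum Ckalpha_loc_mult \<alpha> IH) simp_all
  qed
qed

section \<open>Integration tools\<close>

lemma GDERIV_increment_bound:
  assumes "dist x x0 < r"
    and deriv: "\<And>x. dist x x0 < r \<Longrightarrow> GDERIV f x :> G x"
    and bound: "\<And>x. dist x x0 < r \<Longrightarrow> norm (G x) \<le> B"
  shows "\<bar>f x - f x0\<bar> \<le> B * norm (x - x0)"
proof -
  have "norm (f x - f x0) \<le> B * norm (x - x0)"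
  proof (rule differentiable_bound[OF convex_ball[of x0 r]])
    show "x \<in> ball x0 r" "x0 \<in> ball x0 r"
      using assms(1) le_less_trans[OF zero_le_dist assms(1)] by (auto simp: dist_commute)
    fix z assume "z \<in> ball x0 r"
    then have z: "dist z x0 < r" by (simp add: dist_commute)
    show "(f has_derivative (\<lambda>h. h \<bullet> G z)) (at z within ball x0 r)"
      using deriv[OF z] has_derivative_at_withinI unfolding gderiv_def by blast
    show "onorm (\<lambda>h. h \<bullet> G z) \<le> B"
    proof (rule onorm_bound)
      show "norm (h \<bullet> G z) \<le> B * norm h" for h
        using Cauchy_Schwarz_ineq2[of h "G z"] mult_left_mono[OF bound[OF z], of "norm h"]
        by (simp add: mult.commute)
    qed (use bound[OF z] norm_ge_zero order_trans in blast)
  qed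
  then show ?thesis by simp
qed

text \<open>Dominated convergence for the remainder quotient, which the mean value inequality and
  Cauchy-Schwarz bound by \<open>2 * B\<close>. Measurability of the gradient in \<open>w\<close> is
  a by-product: its components are limits of difference quotients of integrable functions.\<close>

lemma
  fixes F :: "'p::euclidean_space \<Rightarrow> 'w \<Rightarrow> real"
  assumes r: "0 < r"
    and F: "\<And>x. dist x x0 < r \<Longrightarrow> integrable M (F x)"
    and deriv: "\<And>x w. w \<in> space M \<Longrightarrow> dist x x0 < r \<Longrightarrow> GDERIV (\<lambda>x. F x w) x :> G x w"
    and bound: "\<And>x w. w \<in> space M \<Longrightarrow> dist x x0 < r \<Longrightarrow> norm (G x w) \<le> B w"
    and B: "integrable M B"
  shows integrable_dominated_gradient: "integrable M (G x0)"
    and GDERIV_integral: "GDERIV (\<lambda>x. \<integral>w. F x w \<partial>M) x0 :> (\<integral>w. G x0 w \<partial>M)"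
proof -
  have D0: "((\<lambda>x. F x w) has_derivative (\<lambda>h. h \<bullet> G x0 w)) (at x0)" if "w \<in> space M" for w
    using deriv[OF that, of x0] r by (simp add: gderiv_def)
  have ev: "\<forall>\<^sub>F n in sequentially. dist (X n) x0 < r" if "X \<longlonglongrightarrow> x0" for X
    using that r by (rule tendstoD)
  have meas_comp: "(\<lambda>w. G x0 w \<bullet> b) \<in> borel_measurable M" if b: "b \<in> Basis" for b
  proof -
    define X where "X n = x0 + (1 / real (Suc n)) *\<^sub>R b" for n
    have l0: "(\<lambda>n. 1 / real (Suc n)) \<longlonglongrightarrow> 0"
      using LIMSEQ_inverse_real_of_nat by (simp add: divide_inverse)
    have Xlim: "X \<longlonglongrightarrow> x0"
      unfolding X_def using tendsto_add[OF tendsto_const tendsto_scaleR[OF l0 tendsto_const], of x0 b]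
      by simp
    then obtain N where N: "\<And>n. n \<ge> N \<Longrightarrow> dist (X n) x0 < r"
      using ev[OF Xlim] unfolding eventually_sequentially by blast
    \<comment> \<open>The index is shifted by \<open>N\<close> because \<open>F (X n)\<close> is
      known to be integrable, hence measurable, only within distance \<open>r\<close> of
      \<open>x0\<close>.\<close>
    define q where "q n w = (F (X (n + N)) w - F x0 w) * real (Suc (n + N))" for n w
    have "\<And>w. w \<in> space M \<Longrightarrow> (\<lambda>n. q n w) \<longlonglongrightarrow> G x0 w \<bullet> b"
    proof -
      fix w assume w: "w \<in> space M"
      have "((\<lambda>t. F (x0 + t *\<^sub>R b) w) has_derivative (\<lambda>t. (t *\<^sub>R b) \<bullet> G x0 w)) (at 0)"
        by (rule has_derivative_compose[where f = "\<lambda>t. x0 + t *\<^sub>R b"])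
          (use D0[OF w] in \<open>auto intro!: derivative_eq_intros\<close>)
      then have "DERIV (\<lambda>t. F (x0 + t *\<^sub>R b) w) 0 :> G x0 w \<bullet> b"
        unfolding has_field_derivative_def
        by (rule has_derivative_eq_rhs) (auto simp: inner_commute)
      then have lim: "((\<lambda>t. (F (x0 + t *\<^sub>R b) w - F x0 w) / t) \<longlongrightarrow> G x0 w \<bullet> b) (at 0)"
        unfolding DERIV_def by simp
      have "filterlim (\<lambda>n. 1 / real (Suc n)) (at 0) sequentially"
        unfolding filterlim_at using l0 by simp
      then have "(\<lambda>n. (F (x0 + (1 / real (Suc n)) *\<^sub>R b) w - F x0 w) / (1 / real (Suc n))) \<longlonglongrightarrow> G x0 w \<bullet> b"
        by (rule filterlim_compose[OF lim])
      from LIMSEQ_ignore_initial_segment[OF this, of N] show "(\<lambda>n. q n w) \<longlonglongrightarrow> G x0 w \<bullet> b"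
        unfolding q_def X_def by simp
    qed
    moreover have "q n \<in> borel_measurable M" for n
      unfolding q_def[abs_def] using F[OF N[of "n + N"]] F[of x0] r
      by (auto intro!: borel_measurable_times borel_measurable_diff borel_measurable_integrable)
    ultimately show ?thesis by (rule borel_measurable_LIMSEQ_real)
  qed
  have meas: "G x0 \<in> borel_measurable M"
    by (subst borel_measurable_euclidean_space) (use meas_comp in auto)
  show int: "integrable M (G x0)"
    by (rule Bochner_Integration.integrable_bound[OF B meas])
      (use bound[of _ x0] r in \<open>auto intro!: AE_I2 intro: order_trans[OF _ abs_ge_self]\<close>)
  show "GDERIV (\<lambda>x. \<integral>w. F x w \<partial>M) x0 :> (\<integral>w. G x0 w \<partial>M)"
    unfolding gderiv_def has_derivative_iff_norm
  proof (intro conjI)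
    show "bounded_linear (\<lambda>h. h \<bullet> (\<integral>w. G x0 w \<partial>M))"
      by (rule bounded_linear_inner_left)
    show "((\<lambda>x. norm ((\<integral>w. F x w \<partial>M) - (\<integral>w. F x0 w \<partial>M) - (x - x0) \<bullet> (\<integral>w. G x0 w \<partial>M)) / norm (x - x0)) \<longlongrightarrow> 0) (at x0)"
      unfolding tendsto_at_iff_sequentially comp_def
    proof (intro allI impI)
      fix X assume X: "\<forall>i. X i \<in> UNIV - {x0}" and Xlim: "X \<longlonglongrightarrow> x0"
      obtain N where N: "\<And>n. n \<ge> N \<Longrightarrow> dist (X n) x0 < r"
        using ev[OF Xlim] unfolding eventually_sequentially by blast
      define Y where "Y n = X (n + N)" for n
      have Y: "Y n \<noteq> x0" "dist (Y n) x0 < r" for n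
        using X N unfolding Y_def by auto
      have Ylim: "Y \<longlonglongrightarrow> x0" unfolding Y_def using Xlim by (rule LIMSEQ_ignore_initial_segment)
      define q where "q n w = (F (Y n) w - F x0 w - (Y n - x0) \<bullet> G x0 w) / norm (Y n - x0)" for n w
      have qi: "integrable M (q n)" for n
        unfolding q_def using F[OF Y(2)[of n]] F[of x0] r int
        by (intro integrable_divide Bochner_Integration.integrable_diff integrable_inner_right) auto
      have "(\<lambda>n. \<integral>w. q n w \<partial>M) \<longlonglongrightarrow> (\<integral>w. 0 \<partial>M)"
      proof (rule integral_dominated_convergence)
        show "integrable M (\<lambda>w. 2 * B w)" using B by simp
        show "AE w in M. (\<lambda>n. q n w) \<longlonglongrightarrow> 0"
        proof (rule AE_I2)
          fix w assume "w \<in> space M"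
          from D0[OF this] have "((\<lambda>x. norm (F x w - F x0 w - (x - x0) \<bullet> G x0 w) / norm (x - x0)) \<longlongrightarrow> 0) (at x0)"
            unfolding has_derivative_iff_norm by blast
          then have "(\<lambda>n. norm (F (Y n) w - F x0 w - (Y n - x0) \<bullet> G x0 w) / norm (Y n - x0)) \<longlonglongrightarrow> 0"
            using Y(1) Ylim unfolding tendsto_at_iff_sequentially comp_def by blast
          then show "(\<lambda>n. q n w) \<longlonglongrightarrow> 0"
            unfolding q_def by (subst tendsto_rabs_zero_iff[symmetric]) simp
        qed
        show "AE w in M. norm (q n w) \<le> 2 * B w" for n
        proof (rule AE_I2)
          fix w assume w: "w \<in> space M"
          have 1: "\<bar>F (Y n) w - F x0 w\<bar> \<le> B w * norm (Y n - x0)"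
            by (rule GDERIV_increment_bound[OF Y(2) deriv[OF w] bound[OF w]])
          have "\<bar>(Y n - x0) \<bullet> G x0 w\<bar> \<le> norm (Y n - x0) * norm (G x0 w)"
            by (rule Cauchy_Schwarz_ineq2)
          also have "\<dots> \<le> norm (Y n - x0) * B w"
            using bound[OF w, of x0] r by (intro mult_left_mono) auto
          also have "\<dots> = B w * norm (Y n - x0)" by (rule mult.commute)
          finally have 2: "\<bar>F (Y n) w - F x0 w - (Y n - x0) \<bullet> G x0 w\<bar> \<le> 2 * (B w * norm (Y n - x0))"
            using 1 by linarith
          have "norm (Y n - x0) > 0" using Y(1) by simp
          with 2 show "norm (q n w) \<le> 2 * B w"
            unfolding q_def by (simp add: divide_le_eq)
        qed
      qed (use qi in auto)
      then have lim: "(\<lambda>n. \<bar>\<integral>w. q n w \<partial>M\<bar>) \<longlonglongrightarrow> 0"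
        by (simp add: tendsto_rabs_zero)
      have "\<bar>\<integral>w. q n w \<partial>M\<bar> = norm ((\<integral>w. F (Y n) w \<partial>M) - (\<integral>w. F x0 w \<partial>M) - (Y n - x0) \<bullet> (\<integral>w. G x0 w \<partial>M)) / norm (Y n - x0)" for n
        unfolding q_def using F[OF Y(2)[of n]] F[of x0] r int by simp
      with lim have "(\<lambda>n. norm ((\<integral>w. F (Y n) w \<partial>M) - (\<integral>w. F x0 w \<partial>M) - (Y n - x0) \<bullet> (\<integral>w. G x0 w \<partial>M)) / norm (Y n - x0)) \<longlonglongrightarrow> 0"
        by simp
      then show "(\<lambda>n. norm ((\<integral>w. F (X n) w \<partial>M) - (\<integral>w. F x0 w \<partial>M) - (X n - x0) \<bullet> (\<integral>w. G x0 w \<partial>M)) / norm (X n - x0)) \<longlonglongrightarrow> 0"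
        unfolding Y_def by (rule LIMSEQ_offset)
    qed
  qed
qed

section \<open>Affine substitutions and integrals of radial weights\<close>

lemma nn_integral_affine:
  fixes f :: "'a::euclidean_space \<Rightarrow> ennreal"
  assumes [measurable]: "f \<in> borel_measurable borel" and c: "c \<noteq> 0"
  shows "(\<integral>\<^sup>+x. f x \<partial>lborel) = ennreal (\<bar>c\<bar> ^ DIM('a)) * (\<integral>\<^sup>+x. f (t + c *\<^sub>R x) \<partial>lborel)"
  by (subst lborel_affine[OF c, of t])
     (simp add: nn_integral_density nn_integral_distr nn_integral_cmult ennreal_power)

lemma lborel_integral_affine:
  fixes f :: "'a::euclidean_space \<Rightarrow> 'b::{banach, second_countable_topology}"
  assumes [measurable]: "f \<in> borel_measurable borel" and c: "c \<noteq> 0"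
  shows "(\<integral>x. f x \<partial>lborel) = (\<bar>c\<bar> ^ DIM('a)) *\<^sub>R (\<integral>x. f (t + c *\<^sub>R x) \<partial>lborel)"
  by (subst lborel_affine[OF c, of t])
     (simp add: integral_density integral_distr)

lemma lborel_integrable_affine:
  fixes f :: "'a::euclidean_space \<Rightarrow> 'b::{banach, second_countable_topology}"
  assumes [measurable]: "f \<in> borel_measurable borel" and c: "c \<noteq> 0"
  shows "integrable lborel (\<lambda>x. f (t + c *\<^sub>R x)) \<longleftrightarrow> integrable lborel f"
  unfolding integrable_iff_bounded
  by (subst (2) nn_integral_affine[OF _ c, of _ t])
    (auto simp: ennreal_mult_less_top ennreal_mult_eq_top_iff less_top c)

text \<open>The weight \<open>max s R powr - \<beta>\<close> is the size of the mean over the ball of radius \<open>s\<close> around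
  \<open>x\<close> of a density decaying like \<open>(1 + norm y) powr - \<beta>\<close>, where \<open>R = 1 + norm x\<close>.\<close>

lemma weight_nn_integral:
  fixes a \<beta> R :: real
  assumes "-1 < a" "a + 1 < \<beta>" "0 < R"
  shows "(\<integral>\<^sup>+s. ennreal (s powr a * max s R powr - \<beta>) * indicator {0<..} s \<partial>lborel) \<le>
    ennreal ((1 / (a + 1) + 1 / (\<beta> - a - 1)) * R powr (a + 1 - \<beta>))"
proof -
  have 1: "(\<integral>\<^sup>+s. ennreal (s powr a) * indicator {0..R} s \<partial>lborel) = ennreal (R powr (a + 1) / (a + 1))"
    using assms by (intro nn_integral_has_integral_lebesgue' has_integral_powr_from_0) auto
  have 2: "(\<integral>\<^sup>+s. ennreal (s powr (a - \<beta>)) * indicator {R..} s \<partial>lborel) = ennreal (- (R powr (a - \<beta> + 1)) / (a - \<beta> + 1))"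
    using assms by (intro nn_integral_has_integral_lebesgue' has_integral_powr_to_inf) auto
  have "(\<integral>\<^sup>+s. ennreal (s powr a * max s R powr - \<beta>) * indicator {0<..} s \<partial>lborel) \<le>
     (\<integral>\<^sup>+s. (ennreal (R powr - \<beta>) * (ennreal (s powr a) * indicator {0..R} s)
        + ennreal (s powr (a - \<beta>)) * indicator {R..} s) \<partial>lborel)"
  proof (intro nn_integral_mono)
    fix s
    show "ennreal (s powr a * max s R powr - \<beta>) * indicator {0<..} s \<le>
      ennreal (R powr - \<beta>) * (ennreal (s powr a) * indicator {0..R} s)
        + ennreal (s powr (a - \<beta>)) * indicator {R..} s"
      using assms
      by (cases "s \<le> R") (auto split: split_indicator simp: max_def mult.commute powr_add[symmetric] ennreal_mult[symmetric]
         simp flip: ennreal_plus intro!: ennreal_leI)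
  qed
  also have "\<dots> = ennreal (R powr - \<beta>) * ennreal (R powr (a + 1) / (a + 1)) + ennreal (- (R powr (a - \<beta> + 1)) / (a - \<beta> + 1))"
    by (subst nn_integral_add, simp, simp, subst nn_integral_cmult, simp) (simp add: 1 2)
  also have "\<dots> = ennreal (R powr - \<beta> * (R powr (a + 1) / (a + 1)) + (- (R powr (a - \<beta> + 1)) / (a - \<beta> + 1)))"
    using assms by (subst ennreal_mult'[symmetric], simp, subst ennreal_plus[symmetric])
      (auto intro: divide_nonneg_neg)
  also have "R powr - \<beta> * (R powr (a + 1) / (a + 1)) + (- (R powr (a - \<beta> + 1)) / (a - \<beta> + 1)) =
      (1 / (a + 1) + 1 / (\<beta> - a - 1)) * R powr (a + 1 - \<beta>)"
  proof -
    have 1: "R powr - \<beta> * R powr (a + 1) = R powr (a + 1 - \<beta>)" "a - \<beta> + 1 = a + 1 - \<beta>"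
      by (simp_all add: powr_add[symmetric])
    have 2: "- X / (a + 1 - \<beta>) = X / (\<beta> - a - 1)" for X
      using minus_divide_divide[of X "\<beta> - a - 1"] by (simp add: algebra_simps)
    show ?thesis by (simp only: 1 2 times_divide_eq_right distrib_right times_divide_eq_left mult_1)
  qed
  finally show ?thesis .
qed

lemma weight_integrable:
  fixes a \<beta> R :: real
  assumes "-1 < a" "a + 1 < \<beta>" "0 < R"
  shows "set_integrable lborel {0<..} (\<lambda>s. s powr a * max s R powr - \<beta>)"
  unfolding set_integrable_def
proof (rule integrableI_nonneg)
  have "(\<integral>\<^sup>+s. ennreal (indicator {0<..} s *\<^sub>R (s powr a * max s R powr - \<beta>)) \<partial>lborel) =
     (\<integral>\<^sup>+s. ennreal (s powr a * max s R powr - \<beta>) * indicator {0<..} s \<partial>lborel)"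
    by (intro nn_integral_cong) (auto split: split_indicator)
  then show "(\<integral>\<^sup>+s. ennreal (indicator {0<..} s *\<^sub>R (s powr a * max s R powr - \<beta>)) \<partial>lborel) < \<infinity>"
    using weight_nn_integral[OF assms] by (simp add: le_less_trans)
qed auto

lemma weight_integral_le:
  fixes a \<beta> R :: real
  assumes "-1 < a" "a + 1 < \<beta>" "0 < R"
  shows "(LBINT s:{0<..}. s powr a * max s R powr - \<beta>) \<le>
    (1 / (a + 1) + 1 / (\<beta> - a - 1)) * R powr (a + 1 - \<beta>)"
proof -
  have "ennreal (LBINT s:{0<..}. s powr a * max s R powr - \<beta>) =
     (\<integral>\<^sup>+s. ennreal (indicator {0<..} s *\<^sub>R (s powr a * max s R powr - \<beta>)) \<partial>lborel)"
    unfolding set_lebesgue_integral_def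
    by (rule nn_integral_eq_integral[symmetric]) (use weight_integrable[OF assms] in \<open>auto simp: set_integrable_def\<close>)
  also have "\<dots> = (\<integral>\<^sup>+s. ennreal (s powr a * max s R powr - \<beta>) * indicator {0<..} s \<partial>lborel)"
    by (intro nn_integral_cong) (auto split: split_indicator)
  finally have "ennreal (LBINT s:{0<..}. s powr a * max s R powr - \<beta>) \<le>
      ennreal ((1 / (a + 1) + 1 / (\<beta> - a - 1)) * R powr (a + 1 - \<beta>))"
    using weight_nn_integral[OF assms] by simp
  then show ?thesis using assms by (subst (asm) ennreal_le_iff) auto
qed

text \<open>A layer-cake argument: \<open>(1 + norm y) powr - \<beta>\<close> is
  \<open>(1 + R) powr - \<beta>\<close> plus the integral of
  \<open>\<beta> * \<sigma> powr (- \<beta> - 1)\<close> over 1 + norm y \<le> \<sigma> \<le> 1 + R.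
  After Tonelli only volumes of balls remain, which replaces polar coordinates; since n - \<beta> >
  0, the upper end of the \<sigma>-integral dominates.\<close>

lemma weighted_ball_integral_le:
  fixes \<beta> R :: real
  defines "n \<equiv> real DIM('a::euclidean_space)"
  assumes "0 < \<beta>" "\<beta> < n" "0 \<le> R"
  shows "(\<integral>\<^sup>+y\<in>cball 0 R. ennreal ((1 + norm y) powr - \<beta>) \<partial>(lborel :: 'a measure)) \<le>
    ennreal (unit_ball_vol n * (1 + \<beta> / (n - \<beta>)) * (1 + R) powr (n - \<beta>))"
proof -
  let ?V = "unit_ball_vol n"
  have V: "0 \<le> ?V" by (simp add: n_def)
  have ball: "emeasure lborel (cball (0::'a) r) = ennreal (?V * r powr n)" if "0 < r" for r
    using emeasure_cball[of r "0::'a"] that by (simp add: n_def powr_realpow)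
  have layer: "ennreal ((1 + norm y) powr - \<beta>) = ennreal ((1 + R) powr - \<beta>) +
      (\<integral>\<^sup>+\<sigma>. ennreal (\<beta> * \<sigma> powr (- \<beta> - 1)) * indicator {1 + norm y..1 + R} \<sigma> \<partial>lborel)"
    if "y \<in> cball 0 R" for y :: 'a
  proof -
    have "(\<integral>\<^sup>+\<sigma>. ennreal (\<beta> * \<sigma> powr (- \<beta> - 1)) * indicator {1 + norm y..1 + R} \<sigma> \<partial>lborel) =
        ennreal (- ((1 + R) powr - \<beta>) - - ((1 + norm y) powr - \<beta>))"
    proof (rule nn_integral_FTC_Icc)
      fix x assume "x \<in> {1 + norm y..1 + R}"
      then have "x > 0" using norm_ge_zero[of y] unfolding atLeastAtMost_iff by linarith
      then show "DERIV (\<lambda>x. - (x powr - \<beta>)) x :> \<beta> * x powr (- \<beta> - 1)"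
        by (auto intro!: derivative_eq_intros)
    qed (use that assms in auto)
    moreover have "(1 + R) powr - \<beta> \<le> (1 + norm y) powr - \<beta>"
      using that assms by (intro powr_mono2') (auto simp: add_pos_nonneg)
    ultimately show ?thesis by (simp flip: ennreal_plus)
  qed
  define J where "J p = ennreal (\<beta> * fst p powr (- \<beta> - 1)) *
      indicator {p. 1 + norm (snd p) \<le> fst p \<and> fst p \<le> 1 + R} p" for p :: "real \<times> 'a"
  have J: "ennreal (\<beta> * \<sigma> powr (- \<beta> - 1)) * indicator {1 + norm y..1 + R} \<sigma> = J (\<sigma>, y)" for y \<sigma>
    by (simp add: J_def indicator_def)
  have Jm: "J \<in> borel_measurable (lborel \<Otimes>\<^sub>M lborel)"
    unfolding J_def
  proof (intro borel_measurable_times_ennreal borel_measurable_indicator)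
    have "closed {p :: real \<times> 'a. 1 + norm (snd p) \<le> fst p \<and> fst p \<le> 1 + R}"
      by (intro closed_Collect_conj closed_Collect_le continuous_intros)
    from borel_closed[OF this]
    show "{p :: real \<times> 'a. 1 + norm (snd p) \<le> fst p \<and> fst p \<le> 1 + R} \<in> sets (lborel \<Otimes>\<^sub>M lborel)"
      by (simp only: lborel_prod sets_lborel)
  qed simp
  have Jm2: "(\<lambda>y. \<integral>\<^sup>+\<sigma>. J (\<sigma>, y) \<partial>lborel) \<in> borel_measurable lborel"
    by (rule lborel.borel_measurable_nn_integral) (use measurable_pair_swap[OF Jm] in \<open>simp add: case_prod_beta\<close>)
  have pointwise: "ennreal ((1 + norm y) powr - \<beta>) * indicator (cball 0 R) y =
      ennreal ((1 + R) powr - \<beta>) * indicator (cball 0 R) y + (\<integral>\<^sup>+\<sigma>. J (\<sigma>, y) \<partial>lborel)" for y :: 'a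
  proof (cases "y \<in> cball 0 R")
    case True
    then show ?thesis using layer[OF True] J[of _ y] by simp
  next
    case False
    then have "J (\<sigma>, y) = 0" for \<sigma> by (auto simp: J_def)
    with False show ?thesis by simp
  qed
  have split: "(\<integral>\<^sup>+y\<in>cball (0::'a) R. ennreal ((1 + norm y) powr - \<beta>) \<partial>lborel) =
      (\<integral>\<^sup>+y. ennreal ((1 + R) powr - \<beta>) * indicator (cball (0::'a) R) y \<partial>lborel) +
      (\<integral>\<^sup>+y. (\<integral>\<^sup>+\<sigma>. J (\<sigma>, y) \<partial>lborel) \<partial>lborel)"
  proof -
    have 1: "(\<lambda>y::'a. ennreal ((1 + R) powr - \<beta>) * indicator (cball 0 R) y) \<in> borel_measurable lborel"
      by (intro borel_measurable_times_ennreal borel_measurable_indicator) auto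
    show ?thesis by (simp only: pointwise nn_integral_add[OF 1 Jm2])
  qed
  have "(\<integral>\<^sup>+y. (\<integral>\<^sup>+\<sigma>. J (\<sigma>, y) \<partial>lborel) \<partial>lborel)
     = (\<integral>\<^sup>+\<sigma>. (\<integral>\<^sup>+y. J (\<sigma>, y) \<partial>lborel) \<partial>lborel)"
    by (rule lborel_pair.Fubini[OF Jm])
  also have "\<dots> \<le> (\<integral>\<^sup>+\<sigma>. ennreal (\<beta> * ?V * \<sigma> powr (n - \<beta> - 1)) * indicator {1..1 + R} \<sigma> \<partial>lborel)"
  proof (rule nn_integral_mono)
    fix \<sigma> :: real
    have "(\<integral>\<^sup>+y. J (\<sigma>, y) \<partial>lborel)
      \<le> (\<integral>\<^sup>+y. (ennreal (\<beta> * \<sigma> powr (- \<beta> - 1)) * indicator {1..1 + R} \<sigma>) * indicator (cball (0::'a) \<sigma>) y \<partial>lborel)"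
    proof (rule nn_integral_mono)
      fix y :: 'a
      show "J (\<sigma>, y)
        \<le> (ennreal (\<beta> * \<sigma> powr (- \<beta> - 1)) * indicator {1..1 + R} \<sigma>) * indicator (cball 0 \<sigma>) y"
      proof -
        \<comment> \<open>The inner ball has radius \<sigma> - 1; enlarging it to \<sigma> makes its
          volume a pure power.\<close>
        have "1 \<le> \<sigma> \<and> norm y \<le> \<sigma>" if "1 + norm y \<le> \<sigma>"
          using that norm_ge_zero[of y] by linarith
        then show ?thesis unfolding J[symmetric] by (auto simp: indicator_def)
      qed
    qed
    also have "\<dots> = ennreal (\<beta> * \<sigma> powr (- \<beta> - 1)) * indicator {1..1 + R} \<sigma> * emeasure lborel (cball (0::'a) \<sigma>)"
      by (subst nn_integral_cmult_indicator) auto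
    also have "\<dots> = ennreal (\<beta> * ?V * \<sigma> powr (n - \<beta> - 1)) * indicator {1..1 + R} \<sigma>"
    proof (cases "\<sigma> \<in> {1..1 + R}")
      case True
      then have "\<sigma> > 0" by auto
      have "\<sigma> powr (- \<beta> - 1) * \<sigma> powr n = \<sigma> powr (n - \<beta> - 1)"
        by (simp add: powr_add[symmetric] algebra_simps)
      then have "\<beta> * \<sigma> powr (- \<beta> - 1) * (?V * \<sigma> powr n) = \<beta> * ?V * \<sigma> powr (n - \<beta> - 1)"
        by (simp add: mult.assoc mult.left_commute)
      then show ?thesis
        using True assms V \<open>\<sigma> > 0\<close> by (simp add: ball ennreal_mult[symmetric])
    qed simp
    finally show "(\<integral>\<^sup>+y. J (\<sigma>, y) \<partial>lborel)
       \<le> ennreal (\<beta> * ?V * \<sigma> powr (n - \<beta> - 1)) * indicator {1..1 + R} \<sigma>" .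
  qed
  also have "\<dots> = ennreal (\<beta> * ?V / (n - \<beta>) * (1 + R) powr (n - \<beta>) - \<beta> * ?V / (n - \<beta>) * 1 powr (n - \<beta>))"
  proof (rule nn_integral_FTC_Icc)
    fix x :: real assume "x \<in> {1..1 + R}"
    then have "x > 0" by auto
    then show "DERIV (\<lambda>x. \<beta> * ?V / (n - \<beta>) * x powr (n - \<beta>)) x :> \<beta> * ?V * x powr (n - \<beta> - 1)"
      using assms by (auto intro!: derivative_eq_intros)
  qed (use assms V in auto)
  also have "\<dots> \<le> ennreal (\<beta> * ?V / (n - \<beta>) * (1 + R) powr (n - \<beta>))"
    using assms V by (intro ennreal_leI) auto
  finally have 2: "(\<integral>\<^sup>+y. (\<integral>\<^sup>+\<sigma>. J (\<sigma>, y) \<partial>lborel) \<partial>lborel) \<le> ennreal (\<beta> * ?V / (n - \<beta>) * (1 + R) powr (n - \<beta>))" .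
  have "(\<integral>\<^sup>+y. ennreal ((1 + R) powr - \<beta>) * indicator (cball (0::'a) R) y \<partial>lborel) =
      ennreal ((1 + R) powr - \<beta>) * emeasure lborel (cball (0::'a) R)"
    by (rule nn_integral_cmult_indicator) simp
  also have "\<dots> \<le> ennreal ((1 + R) powr - \<beta>) * emeasure lborel (cball (0::'a) (1 + R))"
    by (intro mult_left_mono emeasure_mono) auto
  also have "emeasure lborel (cball (0::'a) (1 + R)) = ennreal (?V * (1 + R) powr n)"
    using assms by (intro ball) auto
  also have "ennreal ((1 + R) powr - \<beta>) * ennreal (?V * (1 + R) powr n) = ennreal (?V * (1 + R) powr (n - \<beta>))"
    using V by (simp add: ennreal_mult[symmetric] powr_add[symmetric] mult.left_commute)
  finally have 1: "(\<integral>\<^sup>+y. ennreal ((1 + R) powr - \<beta>) * indicator (cball (0::'a) R) y \<partial>lborel) \<le> ennreal (?V * (1 + R) powr (n - \<beta>))" .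
  have "(\<integral>\<^sup>+y\<in>cball (0::'a) R. ennreal ((1 + norm y) powr - \<beta>) \<partial>lborel) \<le>
      ennreal (?V * (1 + R) powr (n - \<beta>)) + ennreal (\<beta> * ?V / (n - \<beta>) * (1 + R) powr (n - \<beta>))"
    unfolding split by (intro add_mono 1 2)
  also have "\<dots> = ennreal (?V * (1 + R) powr (n - \<beta>) + \<beta> * ?V / (n - \<beta>) * (1 + R) powr (n - \<beta>))"
    using assms V by (intro ennreal_plus[symmetric]) auto
  also have "?V * (1 + R) powr (n - \<beta>) + \<beta> * ?V / (n - \<beta>) * (1 + R) powr (n - \<beta>) =
      ?V * (1 + \<beta> / (n - \<beta>)) * (1 + R) powr (n - \<beta>)"
    by (simp add: algebra_simps)
  finally show ?thesis .
qed

section \<open>Kernels on the unit ball and rescaled averages\<close>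

text \<open>Vanishing on the unit sphere is included; continuity forces it once the kernel vanishes
  outside the closed ball. The codomain is Euclidean so that gradients of kernels are kernels
  again.\<close>

definition unit_kernel :: "('a::euclidean_space \<Rightarrow> 'b::euclidean_space) \<Rightarrow> bool" where
  "unit_kernel \<kappa> \<longleftrightarrow> continuous_on UNIV \<kappa> \<and> (\<forall>z. 1 \<le> norm z \<longrightarrow> \<kappa> z = 0)"

definition loc_bounded :: "('a::euclidean_space \<Rightarrow> real) \<Rightarrow> bool" where
  "loc_bounded f \<longleftrightarrow> f \<in> borel_measurable borel \<and> (\<forall>R. \<exists>B. \<forall>y. norm y \<le> R \<longrightarrow> \<bar>f y\<bar> \<le> B)"

text \<open>This is the convolution of \<open>f\<close> with the rescaled kernel
  \<open>s^{-n} \<kappa>(z / s)\<close>; the substitution in \<open>z\<close> has absorbed the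
  factor \<open>s^{-n}\<close>. Here the density carries the scale, and
  \<open>avg_kernel_form\<close> moves it to the kernel.\<close>

definition avg :: "('a::euclidean_space \<Rightarrow> 'b::euclidean_space) \<Rightarrow> real \<Rightarrow> ('a \<Rightarrow> real) \<Rightarrow> 'a \<Rightarrow> 'b" where
  "avg \<kappa> s f x = (\<integral>z. f (x - s *\<^sub>R z) *\<^sub>R \<kappa> z \<partial>lborel)"

lemma kernel_bounded:
  assumes "unit_kernel \<kappa>"
  obtains M where "M > 0" "\<And>z. norm (\<kappa> z) \<le> M * indicator (cball 0 1) z" "\<And>z. norm (\<kappa> z) \<le> M"
proof -
  obtain M where M: "M > 0" "\<And>z. norm z \<le> 1 \<Longrightarrow> norm (\<kappa> z) \<le> M"
    using continuous_bounded_on_cball[of \<kappa> 1] assms unfolding unit_kernel_def by metis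
  have "norm (\<kappa> z) \<le> M * indicator (cball 0 1) z" for z
    using M assms by (cases "norm z \<le> 1") (auto simp: unit_kernel_def)
  moreover have "norm (\<kappa> z) \<le> M" for z
    using M assms by (cases "norm z \<le> 1") (auto simp: unit_kernel_def)
  ultimately show thesis using M(1) that by blast
qed

lemma kernel_measurable: "unit_kernel \<kappa> \<Longrightarrow> \<kappa> \<in> borel_measurable borel"
  unfolding unit_kernel_def by (auto intro: borel_measurable_continuous_onI)

lemma kernel_inner: "unit_kernel \<kappa> \<Longrightarrow> unit_kernel (\<lambda>z. \<kappa> z \<bullet> b)"
  unfolding unit_kernel_def by (auto intro!: continuous_intros)

text \<open>Outside the closed unit ball the kernel is locally constant, so its gradient is 0; on
  the sphere itself the gradient is a limit of such values along the outward ray, by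
  continuity.\<close>

lemma kernel_gradient:
  assumes "unit_kernel \<kappa>" "Ck_on (Suc j) UNIV \<kappa>"
  shows "unit_kernel (gradient \<kappa>)"
proof -
  have cont: "continuous_on UNIV (gradient \<kappa>)"
    by (rule Ck_on_1_continuous_gradient[OF assms(2)])
  have out: "gradient \<kappa> z = 0" if "1 < norm z" for z
  proof (rule gradient_eqI)
    have o: "open {z::'a. 1 < norm z}" by (intro open_Collect_less continuous_intros)
    have "((\<lambda>_. 0) has_derivative (\<lambda>_. 0)) (at z)" by (rule has_derivative_const)
    then have "(\<kappa> has_derivative (\<lambda>_. 0)) (at z)"
      by (rule has_derivative_transform_within_open[OF _ o]) (use that assms(1) in \<open>auto simp: unit_kernel_def\<close>)
    then show "GDERIV \<kappa> z :> 0" by (simp add: gderiv_def)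
  qed
  have "gradient \<kappa> z = 0" if "1 \<le> norm z" for z
  proof -
    have l0: "(\<lambda>n. 1 / real (Suc n)) \<longlonglongrightarrow> 0"
      using LIMSEQ_inverse_real_of_nat by (simp add: divide_inverse)
    have "(\<lambda>n. (1 + 1 / real (Suc n)) *\<^sub>R z) \<longlonglongrightarrow> (1 + 0) *\<^sub>R z"
      by (intro tendsto_intros l0)
    then have "(\<lambda>n. gradient \<kappa> ((1 + 1 / real (Suc n)) *\<^sub>R z)) \<longlonglongrightarrow> gradient \<kappa> z"
      using continuous_on_tendsto_compose[OF cont] by simp
    moreover have "gradient \<kappa> ((1 + 1 / real (Suc n)) *\<^sub>R z) = 0" for n
    proof (rule out)
      have "1 * 1 < (1 + 1 / real (Suc n)) * norm z"
        using that by (intro mult_less_le_imp_less) auto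
      then show "1 < norm ((1 + 1 / real (Suc n)) *\<^sub>R z)" by simp
    qed
    ultimately show ?thesis by (simp add: LIMSEQ_const_iff)
  qed
  with cont show ?thesis by (auto simp: unit_kernel_def)
qed

lemma loc_bounded_continuous: "continuous_on UNIV f \<Longrightarrow> loc_bounded f"
  unfolding loc_bounded_def
  using continuous_bounded_on_cball[of f] borel_measurable_continuous_onI[of f]
  by (metis real_norm_def)

lemma indicator_ball_integrable:
  "integrable lborel (\<lambda>z::'a::euclidean_space. c * indicator (cball a r) z :: real)"
  by (intro integrable_mult_right integrable_real_indicator) (use emeasure_bounded_finite[OF bounded_cball] in auto)

lemma avg_integrable:
  assumes "unit_kernel \<kappa>" "loc_bounded f"
  shows "integrable lborel (\<lambda>z. f (x - s *\<^sub>R z) *\<^sub>R \<kappa> z)"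
proof -
  note [measurable] = kernel_measurable[OF assms(1)]
  have [measurable]: "f \<in> borel_measurable borel" using assms(2) by (simp add: loc_bounded_def)
  obtain M where M: "M > 0" "\<And>z. norm (\<kappa> z) \<le> M * indicator (cball 0 1) z"
    using kernel_bounded[OF assms(1)] by metis
  obtain B where B: "\<And>y. norm y \<le> norm x + \<bar>s\<bar> \<Longrightarrow> \<bar>f y\<bar> \<le> B"
    using assms(2) unfolding loc_bounded_def by meson
  show ?thesis
  proof (rule Bochner_Integration.integrable_bound[OF indicator_ball_integrable[of "B * M" 0 1]])
    show "AE z in lborel. norm (f (x - s *\<^sub>R z) *\<^sub>R \<kappa> z) \<le> norm (B * M * indicator (cball 0 1) z)"
    proof (rule AE_I2)
      fix z :: 'a
      show "norm (f (x - s *\<^sub>R z) *\<^sub>R \<kappa> z) \<le> norm (B * M * indicator (cball 0 1) z)"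
      proof (cases "norm z \<le> 1")
        case True
        have "norm (x - s *\<^sub>R z) \<le> norm x + \<bar>s\<bar> * norm z"
          using norm_triangle_ineq4[of x "s *\<^sub>R z"] by simp
        also have "\<dots> \<le> norm x + \<bar>s\<bar>" using True mult_left_mono[of "norm z" 1 "\<bar>s\<bar>"] by simp
        finally have "\<bar>f (x - s *\<^sub>R z)\<bar> \<le> B" by (rule B)
        then have "\<bar>f (x - s *\<^sub>R z)\<bar> * norm (\<kappa> z) \<le> B * M"
          using M(2)[of z] True by (intro mult_mono) auto
        then show ?thesis using True by auto
      qed (use assms(1) in \<open>auto simp: unit_kernel_def\<close>)
    qed
  qed measurable
qed

lemma avg_measurable:
  assumes "unit_kernel \<kappa>" "f \<in> borel_measurable borel"
  shows "(\<lambda>p. avg \<kappa> (fst p) f (snd p)) \<in> borel_measurable borel"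
proof -
  note [measurable] = kernel_measurable[OF assms(1)] assms(2)
  have "(\<lambda>(p, z). f (snd p - fst p *\<^sub>R z) *\<^sub>R \<kappa> z) \<in> borel_measurable ((borel \<Otimes>\<^sub>M borel) \<Otimes>\<^sub>M lborel)"
    by measurable
  then have "(\<lambda>p. avg \<kappa> (fst p) f (snd p)) \<in> borel_measurable (borel \<Otimes>\<^sub>M borel)" unfolding avg_def
    by (rule lborel.borel_measurable_lebesgue_integral)
  then show ?thesis by (simp only: borel_prod)
qed

lemma avg_measurable_s:
  assumes "unit_kernel \<kappa>" "f \<in> borel_measurable borel"
  shows "(\<lambda>s. avg \<kappa> s f x) \<in> borel_measurable borel"
proof -
  have "(\<lambda>s. (s, x)) \<in> borel_measurable borel" by (intro borel_measurable_continuous_onI continuous_intros)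
  from measurable_compose[OF this avg_measurable[OF assms]] show ?thesis by simp
qed

lemma avg_inner:
  assumes "unit_kernel \<kappa>" "loc_bounded f"
  shows "avg \<kappa> s f x \<bullet> b = avg (\<lambda>z. \<kappa> z \<bullet> b) s f x"
  unfolding avg_def using integral_inner_left[OF avg_integrable[OF assms, of x s], of b] by simp

text \<open>The substitution \<open>y = x - s z\<close> moves both \<open>x\<close> and
  \<open>s\<close> into the kernel, so that derivatives in either variable can be taken although
  \<open>f\<close> is merely locally bounded.\<close>

lemma avg_kernel_form:
  fixes \<kappa> :: "'a::euclidean_space \<Rightarrow> 'b::euclidean_space"
  assumes "unit_kernel \<kappa>" "loc_bounded f" "0 < s"
  shows "integrable lborel (\<lambda>y. f y *\<^sub>R \<kappa> ((1 / s) *\<^sub>R (x - y)))" (is "integrable lborel ?g")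
    and "avg \<kappa> s f x = (1 / s ^ DIM('a)) *\<^sub>R (\<integral>y. f y *\<^sub>R \<kappa> ((1 / s) *\<^sub>R (x - y)) \<partial>lborel)"
proof -
  note [measurable] = kernel_measurable[OF assms(1)]
  have [measurable]: "f \<in> borel_measurable borel" using assms(2) by (simp add: loc_bounded_def)
  have g: "?g \<in> borel_measurable borel" by measurable
  have s: "- s \<noteq> 0" using assms(3) by simp
  have eq: "?g (x + (- s) *\<^sub>R z) = f (x - s *\<^sub>R z) *\<^sub>R \<kappa> z" for z using assms(3) by simp
  show "integrable lborel ?g"
    using lborel_integrable_affine[OF g s, of x] avg_integrable[OF assms(1,2)] unfolding eq by simp
  show "avg \<kappa> s f x = (1 / s ^ DIM('a)) *\<^sub>R (\<integral>y. ?g y \<partial>lborel)"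
    using lborel_integral_affine[OF g s, of x] assms(3) unfolding eq avg_def[symmetric] by simp
qed

lemma GDERIV_avg:
  fixes \<kappa> :: "'a::euclidean_space \<Rightarrow> real"
  assumes \<kappa>: "unit_kernel \<kappa>" "Ck_on (Suc j) UNIV \<kappa>" and f: "loc_bounded f" and s: "0 < s"
  shows "GDERIV (avg \<kappa> s f) x :> (1 / s) *\<^sub>R avg (gradient \<kappa>) s f x"
proof -
  note kg = kernel_gradient[OF \<kappa>]
  obtain M where M: "M > 0" "\<And>z. norm (gradient \<kappa> z) \<le> M * indicator (cball 0 1) z"
    using kernel_bounded[OF kg] by metis
  define R where "R = norm x + 1 + s"
  obtain B where B: "\<And>y. norm y \<le> R \<Longrightarrow> \<bar>f y\<bar> \<le> B"
    using f unfolding loc_bounded_def by meson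
  have B0: "0 \<le> B" using B[of 0] s by (simp add: R_def)
  define G where "G x y = (1 / s) *\<^sub>R f y *\<^sub>R gradient \<kappa> ((1 / s) *\<^sub>R (x - y))" for x y
  have "GDERIV (\<lambda>x. \<integral>y. f y *\<^sub>R \<kappa> ((1 / s) *\<^sub>R (x - y)) \<partial>lborel) x :> (\<integral>y. G x y \<partial>lborel)"
  proof (rule GDERIV_integral[where r = 1])
    show "integrable lborel (\<lambda>y. f y *\<^sub>R \<kappa> ((1 / s) *\<^sub>R (x - y)))" for x
      by (rule avg_kernel_form[OF \<kappa>(1) f s])
    show "GDERIV (\<lambda>x. f y *\<^sub>R \<kappa> ((1 / s) *\<^sub>R (x - y))) x :> G x y" for x y
    proof -
      have "((\<lambda>x. \<kappa> ((1 / s) *\<^sub>R (x - y))) has_derivative (\<lambda>h. ((1 / s) *\<^sub>R h) \<bullet> gradient \<kappa> ((1 / s) *\<^sub>R (x - y)))) (at x)"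
      proof (rule has_derivative_compose[where f = "\<lambda>x. (1 / s) *\<^sub>R (x - y)" and f' = "\<lambda>h. (1 / s) *\<^sub>R h"])
        show "((\<lambda>x. (1 / s) *\<^sub>R (x - y)) has_derivative (\<lambda>h. (1 / s) *\<^sub>R h)) (at x)"
          by (auto intro!: derivative_eq_intros)
        show "(\<kappa> has_derivative (\<lambda>h. h \<bullet> gradient \<kappa> ((1 / s) *\<^sub>R (x - y)))) (at ((1 / s) *\<^sub>R (x - y)))"
          using differentiable_imp_GDERIV_gradient[OF Ck_on_differentiable[OF \<kappa>(2)]] by (simp add: gderiv_def)
      qed
      from has_derivative_scaleR_right[OF this, of "f y"] show ?thesis
        unfolding gderiv_def G_def by (rule has_derivative_eq_rhs) (simp add: algebra_simps)
    qed
    show "norm (G x' y) \<le> (B * M / s) * indicator (cball 0 R) y" if d: "dist x' x < 1" for x' y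
    proof (cases "norm ((1 / s) *\<^sub>R (x' - y)) \<le> 1")
      case True
      then have "norm (x' - y) \<le> s" using s by (simp add: divide_le_eq)
      then have "norm y \<le> R" using d unfolding R_def by norm
      then have "\<bar>f y\<bar> * norm (gradient \<kappa> ((1 / s) *\<^sub>R (x' - y))) \<le> B * M"
        using B M(2)[of "(1 / s) *\<^sub>R (x' - y)"] True B0 by (intro mult_mono) auto
      then show ?thesis using \<open>norm y \<le> R\<close> s by (simp add: G_def divide_right_mono)
    next
      case False
      then have "gradient \<kappa> ((1 / s) *\<^sub>R (x' - y)) = 0" using kg unfolding unit_kernel_def by auto
      then show ?thesis using B0 M(1) s unfolding G_def by simp
    qed
  qed (auto intro: indicator_ball_integrable)
  from GDERIV_mult[OF GDERIV_const this, of "1 / s ^ DIM('a)"]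
  have "GDERIV (\<lambda>x. 1 / s ^ DIM('a) * (\<integral>y. f y *\<^sub>R \<kappa> ((1 / s) *\<^sub>R (x - y)) \<partial>lborel)) x :> (1 / s ^ DIM('a)) *\<^sub>R (\<integral>y. G x y \<partial>lborel)"
    by simp
  moreover have "avg \<kappa> s f = (\<lambda>x. 1 / s ^ DIM('a) * (\<integral>y. f y *\<^sub>R \<kappa> ((1 / s) *\<^sub>R (x - y)) \<partial>lborel))"
    using avg_kernel_form(2)[OF \<kappa>(1) f s] by auto
  moreover have "(1 / s ^ DIM('a)) *\<^sub>R (\<integral>y. G x y \<partial>lborel) = (1 / s) *\<^sub>R avg (gradient \<kappa>) s f x"
    unfolding avg_kernel_form(2)[OF kg f s] G_def integral_scaleR_right by (simp add: mult.commute)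
  ultimately show ?thesis by simp
qed

text \<open>For \<open>s\<close> up to half of 1 + norm x the weight on the ball around
  \<open>x\<close> is comparable to its value at \<open>x\<close>. For larger \<open>s\<close> the
  ball lies in the ball of radius 3 s around the origin, whose weighted volume is of order
  \<open>s powr (n - \<beta>)\<close>; dividing by \<open>s ^ n\<close> leaves
  \<open>s powr - \<beta>\<close>. This second regime is where \<beta> < n enters.\<close>

lemma decay_ball_mean:
  fixes \<beta> :: real
  assumes \<beta>: "0 < \<beta>" "\<beta> < real DIM('a::euclidean_space)"
  shows "\<exists>C>0. \<forall>(x::'a) s. 0 < s \<longrightarrow>
    (\<integral>\<^sup>+z\<in>cball 0 1. ennreal ((1 + norm (x - s *\<^sub>R z)) powr - \<beta>) \<partial>lborel) \<le> ennreal (C * max s (1 + norm x) powr - \<beta>)"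
proof -
  define n where "n = real DIM('a)"
  define V where "V = unit_ball_vol n"
  have V: "0 < V" unfolding V_def n_def by simp
  have n: "\<beta> < n" using \<beta> by (simp add: n_def)
  define C1 where "C1 = V * 2 powr \<beta>"
  define C2 where "C2 = V * (1 + \<beta> / (n - \<beta>)) * 5 powr (n - \<beta>) * 2 powr \<beta>"
  have C12: "0 < C1" "0 < C2" unfolding C1_def C2_def using V n \<beta> by (auto intro!: mult_pos_pos add_pos_pos divide_pos_pos)
  have main: "(\<integral>\<^sup>+z\<in>cball 0 1. ennreal ((1 + norm (x - s *\<^sub>R z)) powr - \<beta>) \<partial>lborel) \<le> ennreal (max C1 C2 * max s (1 + norm x) powr - \<beta>)"
    if s: "0 < s" for x :: 'a and s
  proof (cases "s \<le> (1 + norm x) / 2")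
    case True
    have "(\<integral>\<^sup>+z\<in>cball 0 1. ennreal ((1 + norm (x - s *\<^sub>R z)) powr - \<beta>) \<partial>lborel) \<le>
        (\<integral>\<^sup>+z. ennreal (((1 + norm x) / 2) powr - \<beta>) * indicator (cball (0::'a) 1) z \<partial>lborel)"
    proof (rule nn_integral_mono)
      fix z :: 'a
      show "ennreal ((1 + norm (x - s *\<^sub>R z)) powr - \<beta>) * indicator (cball 0 1) z \<le>
         ennreal (((1 + norm x) / 2) powr - \<beta>) * indicator (cball (0::'a) 1) z"
      proof (cases "norm z \<le> 1")
        case z: True
        have "s * norm z \<le> s" using z s by (simp add: mult_left_le)
        moreover have "norm x \<le> norm (x - s *\<^sub>R z) + s * norm z"
          using norm_triangle_ineq[of "x - s *\<^sub>R z" "s *\<^sub>R z"] s by simp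
        ultimately have "(1 + norm x) / 2 \<le> 1 + norm (x - s *\<^sub>R z)" using True by simp
        then have "(1 + norm (x - s *\<^sub>R z)) powr - \<beta> \<le> ((1 + norm x) / 2) powr - \<beta>"
          using \<beta> by (intro powr_mono2') (auto intro: add_pos_nonneg)
        then show ?thesis using z by (simp add: ennreal_leI)
      qed simp
    qed
    also have "\<dots> = ennreal (((1 + norm x) / 2) powr - \<beta>) * ennreal V"
      by (subst nn_integral_cmult_indicator) (auto simp: emeasure_cball V_def n_def)
    also have "\<dots> = ennreal (C1 * max s (1 + norm x) powr - \<beta>)"
    proof -
      have "((1 + norm x) / 2) powr - \<beta> = 2 powr \<beta> * (1 + norm x) powr - \<beta>"
        by (simp add: powr_divide powr_minus field_simps)
      moreover have "max s (1 + norm x) = 1 + norm x" using True s by auto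
      ultimately show ?thesis using V by (simp add: C1_def ennreal_mult[symmetric] mult_ac)
    qed
    also have "\<dots> \<le> ennreal (max C1 C2 * max s (1 + norm x) powr - \<beta>)"
      by (intro ennreal_leI mult_right_mono) auto
    finally show ?thesis .
  next
    case False
    define H where "H y = ennreal ((1 + norm y) powr - \<beta>) * indicator (cball x s) y" for y :: 'a
    have Hm: "H \<in> borel_measurable borel" unfolding H_def
      by (intro borel_measurable_times_ennreal borel_measurable_indicator) auto
    define I where "I = (\<integral>\<^sup>+z\<in>cball 0 1. ennreal ((1 + norm (x - s *\<^sub>R z)) powr - \<beta>) \<partial>lborel)"
    have "I = (\<integral>\<^sup>+z. H (x + (- s) *\<^sub>R z) \<partial>lborel)"
      unfolding I_def H_def using s by (intro nn_integral_cong) (simp add: indicator_def dist_norm)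
    then have HI: "ennreal (s ^ DIM('a)) * I = (\<integral>\<^sup>+y. H y \<partial>lborel)"
      using nn_integral_affine[OF Hm, of "- s" x] s by simp
    also have "\<dots> \<le> (\<integral>\<^sup>+y\<in>cball (0::'a) (3 * s). ennreal ((1 + norm y) powr - \<beta>) \<partial>lborel)"
    proof (rule nn_integral_mono)
      fix y :: 'a
      have "norm y \<le> 3 * s" if "dist x y \<le> s" using that False by norm
      then show "H y \<le> ennreal ((1 + norm y) powr - \<beta>) * indicator (cball 0 (3 * s)) y"
        unfolding H_def by (auto simp: indicator_def)
    qed
    also have "\<dots> \<le> ennreal (V * (1 + \<beta> / (n - \<beta>)) * (1 + 3 * s) powr (n - \<beta>))"
      unfolding V_def n_def using \<beta> s by (intro weighted_ball_integral_le) auto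
    also have "\<dots> \<le> ennreal (V * (1 + \<beta> / (n - \<beta>)) * (5 * s) powr (n - \<beta>))"
    proof -
      \<comment> \<open>As norm x \<ge> 0, the case yields 1 < 2 s, which absorbs the additive
        1.\<close>
      from False have "1 + norm x < 2 * s" by (simp add: field_simps)
      then have "1 + 3 * s \<le> 5 * s" using norm_ge_zero[of x] by linarith
      then show ?thesis using V n \<beta> s by (intro ennreal_leI mult_left_mono powr_mono2) auto
    qed
    finally have le: "ennreal (s ^ DIM('a)) * I \<le> ennreal (V * (1 + \<beta> / (n - \<beta>)) * (5 * s) powr (n - \<beta>))" .
    have "I = ennreal (s powr - n) * (ennreal (s ^ DIM('a)) * I)"
      using s by (simp add: mult.assoc[symmetric] ennreal_mult[symmetric] n_def powr_realpow[symmetric] powr_add[symmetric])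
    also have "\<dots> \<le> ennreal (s powr - n) * ennreal (V * (1 + \<beta> / (n - \<beta>)) * (5 * s) powr (n - \<beta>))"
      by (intro mult_left_mono le) simp
    also have "\<dots> = ennreal (V * (1 + \<beta> / (n - \<beta>)) * 5 powr (n - \<beta>) * s powr - \<beta>)"
    proof -
      have "s powr - n * (5 * s) powr (n - \<beta>) = 5 powr (n - \<beta>) * (s powr - n * s powr (n - \<beta>))"
        using s by (simp add: powr_mult)
      also have "\<dots> = 5 powr (n - \<beta>) * s powr - \<beta>" by (simp add: powr_add[symmetric])
      finally have eq: "s powr - n * (V * (1 + \<beta> / (n - \<beta>)) * (5 * s) powr (n - \<beta>)) = V * (1 + \<beta> / (n - \<beta>)) * 5 powr (n - \<beta>) * s powr - \<beta>"
        by (metis (no_types, lifting) mult.assoc mult.left_commute)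
      show ?thesis by (subst ennreal_mult'[symmetric]) (simp, simp only: eq)
    qed
    also have "\<dots> \<le> ennreal (C2 * max s (1 + norm x) powr - \<beta>)"
    proof -
      have "s powr - \<beta> = 2 powr \<beta> * (2 * s) powr - \<beta>"
        using s by (simp add: powr_mult powr_minus field_simps)
      also have "\<dots> \<le> 2 powr \<beta> * max s (1 + norm x) powr - \<beta>"
        using False s \<beta> by (intro mult_left_mono powr_mono2') auto
      finally have "V * (1 + \<beta> / (n - \<beta>)) * 5 powr (n - \<beta>) * s powr - \<beta> \<le>
          V * (1 + \<beta> / (n - \<beta>)) * 5 powr (n - \<beta>) * (2 powr \<beta> * max s (1 + norm x) powr - \<beta>)"
        using V n \<beta> by (intro mult_left_mono) auto
      then show ?thesis unfolding C2_def by (intro ennreal_leI) (simp add: mult.assoc)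
    qed
    also have "\<dots> \<le> ennreal (max C1 C2 * max s (1 + norm x) powr - \<beta>)"
      by (intro ennreal_leI mult_right_mono) auto
    finally show ?thesis unfolding I_def .
  qed
  show ?thesis using C12 main by (intro exI[of _ "max C1 C2"]) auto
qed

text \<open>Membership in \<open>decaying \<beta> A\<close> is the pointwise form of \<open>E_norm \<beta> f \<le> A\<close>.\<close>

definition decaying :: "real \<Rightarrow> real \<Rightarrow> ('a::euclidean_space \<Rightarrow> real) \<Rightarrow> bool" where
  "decaying \<beta> A f \<longleftrightarrow> f \<in> borel_measurable borel \<and> (\<forall>y. \<bar>f y\<bar> \<le> A * (1 + norm y) powr - \<beta>)"

lemma decaying_nonneg: "decaying \<beta> A f \<Longrightarrow> 0 \<le> A"
proof -
  assume "decaying \<beta> A f"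
  then have "\<bar>f 0\<bar> \<le> A" unfolding decaying_def by (metis add.right_neutral mult.right_neutral norm_zero powr_one_eq_one)
  then show ?thesis by linarith
qed

lemma decaying_loc_bounded:
  fixes f :: "'a::euclidean_space \<Rightarrow> real"
  assumes "decaying \<beta> A f" "0 < \<beta>"
  shows "loc_bounded f"
  unfolding loc_bounded_def
proof (intro conjI allI exI impI)
  show "f \<in> borel_measurable borel" using assms by (simp add: decaying_def)
  fix y :: 'a
  have "(1 + norm y) powr - \<beta> \<le> 1 powr - \<beta>" using assms(2) by (intro powr_mono2') auto
  then have "A * (1 + norm y) powr - \<beta> \<le> A * 1"
    using decaying_nonneg[OF assms(1)] by (intro mult_left_mono) auto
  moreover have "\<bar>f y\<bar> \<le> A * (1 + norm y) powr - \<beta>" using assms(1) by (simp add: decaying_def)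
  ultimately show "\<bar>f y\<bar> \<le> A" by linarith
qed

text \<open>The constant is chosen before the kernel and the density, which enter only through
  \<open>M\<close> and \<open>A\<close>. This uniformity, and the linearity in \<open>A\<close>, are
  what finally give one threshold \<open>Q\<close> for all nonlinearities.\<close>

lemma avg_decay:
  fixes \<beta> :: real
  assumes \<beta>: "0 < \<beta>" "\<beta> < real DIM('a::euclidean_space)"
  shows "\<exists>C>0. \<forall>(\<kappa> :: 'a \<Rightarrow> 'b::euclidean_space) M A f x s. unit_kernel \<kappa> \<longrightarrow> (\<forall>z. norm (\<kappa> z) \<le> M) \<longrightarrow>
    decaying \<beta> A f \<longrightarrow> 0 < s \<longrightarrow> norm (avg \<kappa> s f x) \<le> C * M * A * max s (1 + norm x) powr - \<beta>"
proof -
  obtain C where C: "0 < C" "\<forall>(x::'a) s. 0 < s \<longrightarrow>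
    (\<integral>\<^sup>+z\<in>cball 0 1. ennreal ((1 + norm (x - s *\<^sub>R z)) powr - \<beta>) \<partial>lborel) \<le> ennreal (C * max s (1 + norm x) powr - \<beta>)"
    using decay_ball_mean[OF \<beta>] by blast
  have "norm (avg \<kappa> s f x) \<le> C * M * A * max s (1 + norm x) powr - \<beta>"
    if k: "unit_kernel \<kappa>" and M: "\<And>z. norm (\<kappa> z) \<le> M" and f: "decaying \<beta> A f" and s: "0 < s"
    for \<kappa> :: "'a \<Rightarrow> 'b" and M A f x s
  proof -
    have A: "0 \<le> A" by (rule decaying_nonneg[OF f])
    have M0: "0 \<le> M" using M[of 0] norm_ge_zero order_trans by blast
    have "ennreal (norm (avg \<kappa> s f x)) \<le> (\<integral>\<^sup>+z. ennreal (norm (f (x - s *\<^sub>R z) *\<^sub>R \<kappa> z)) \<partial>lborel)"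
      unfolding avg_def by (rule integral_norm_bound_ennreal[OF avg_integrable[OF k decaying_loc_bounded[OF f \<beta>(1)]]])
    also have "\<dots> \<le> (\<integral>\<^sup>+z. ennreal (M * A) * (ennreal ((1 + norm (x - s *\<^sub>R z)) powr - \<beta>) * indicator (cball 0 1) z) \<partial>lborel)"
    proof (rule nn_integral_mono)
      fix z :: 'a
      show "ennreal (norm (f (x - s *\<^sub>R z) *\<^sub>R \<kappa> z)) \<le> ennreal (M * A) * (ennreal ((1 + norm (x - s *\<^sub>R z)) powr - \<beta>) * indicator (cball 0 1) z)"
      proof (cases "norm z \<le> 1")
        case True
        have "\<bar>f (x - s *\<^sub>R z)\<bar> * norm (\<kappa> z) \<le> (A * (1 + norm (x - s *\<^sub>R z)) powr - \<beta>) * M"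
          using f M A M0 by (intro mult_mono) (auto simp: decaying_def)
        then show ?thesis using True A M0 by (simp add: ennreal_mult[symmetric] mult_ac ennreal_leI)
      qed (use k in \<open>auto simp: unit_kernel_def\<close>)
    qed
    also have "\<dots> = ennreal (M * A) * (\<integral>\<^sup>+z\<in>cball 0 1. ennreal ((1 + norm (x - s *\<^sub>R z)) powr - \<beta>) \<partial>lborel)"
    proof (rule nn_integral_cmult)
      have [measurable]: "cball (0::'a) 1 \<in> sets borel" by simp
      show "(\<lambda>z. ennreal ((1 + norm (x - s *\<^sub>R z)) powr - \<beta>) * indicator (cball 0 1) z) \<in> borel_measurable lborel"
        by measurable
    qed
    also have "\<dots> \<le> ennreal (M * A) * ennreal (C * max s (1 + norm x) powr - \<beta>)"
      by (intro mult_left_mono C(2)[rule_format] s) simp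
    also have "\<dots> = ennreal (C * M * A * max s (1 + norm x) powr - \<beta>)"
      using A M0 C(1) by (simp add: ennreal_mult[symmetric] mult_ac)
    finally show ?thesis
      using A M0 C(1) by (subst (asm) ennreal_le_iff) auto
  qed
  with C(1) show ?thesis by blast
qed

text \<open>A power of the positive part of 1 - |z|^2 rather than an infinitely smooth function: its
  gradient is a multiple of the next lower power times \<open>z\<close>, and its integral and its
  superposition over scales reduce to one-dimensional integrals. Finite smoothness suffices, since
  the exponent can be taken as large as an argument requires.\<close>

definition bump :: "nat \<Rightarrow> 'a::euclidean_space \<Rightarrow> real" where
  "bump N z = (max 0 (1 - z \<bullet> z)) ^ N"

lemma bump_nonneg: "0 \<le> bump N z"
  by (simp add: bump_def)

lemma bump_le_1: "bump N z \<le> 1"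
  unfolding bump_def by (rule power_le_one) auto

lemma bump_kernel: "unit_kernel (bump (Suc N) :: 'a::euclidean_space \<Rightarrow> real)"
  unfolding unit_kernel_def bump_def
proof (intro conjI allI impI)
  fix z :: 'a assume "1 \<le> norm z"
  then have "1 \<le> z \<bullet> z" by (simp add: norm_eq_sqrt_inner)
  then show "(max 0 (1 - z \<bullet> z)) ^ Suc N = 0" by simp
qed (intro continuous_intros)

lemma DERIV_max_power: "DERIV (\<lambda>t::real. (max 0 t) ^ Suc (Suc N)) t :> real (Suc (Suc N)) * (max 0 t) ^ Suc N"
proof -
  consider "t > 0" | "t < 0" | "t = 0" by linarith
  then show ?thesis
  proof cases
    case 1
    have "DERIV (\<lambda>t::real. t ^ Suc (Suc N)) t :> real (Suc (Suc N)) * t ^ Suc N"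
      using DERIV_pow[of "Suc (Suc N)" t] by simp
    then have "DERIV (\<lambda>t::real. (max 0 t) ^ Suc (Suc N)) t :> real (Suc (Suc N)) * t ^ Suc N"
      by (rule has_field_derivative_transform_within_open[OF _ open_greaterThan[of 0]]) (use 1 in \<open>auto simp: max_def\<close>)
    with 1 show ?thesis by (simp add: max_def)
  next
    case 2
    have "DERIV (\<lambda>t::real. 0) t :> 0" by simp
    then have "DERIV (\<lambda>t::real. (max 0 t) ^ Suc (Suc N)) t :> 0"
      by (rule has_field_derivative_transform_within_open[OF _ open_lessThan[of 0]]) (use 2 in \<open>auto simp: max_def\<close>)
    with 2 show ?thesis by (simp add: max_def)
  next
    case 3
    have "((\<lambda>h::real. (max 0 h) ^ Suc (Suc N) / h) \<longlongrightarrow> 0) (at 0)"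
    proof (rule Lim_null_comparison)
      show "\<forall>\<^sub>F h in at 0. norm ((max 0 h) ^ Suc (Suc N) / h) \<le> (max 0 h) ^ Suc N"
        by (rule always_eventually) (auto simp: max_def)
      have "isCont (\<lambda>h::real. (max 0 h) ^ Suc N) 0" by (intro continuous_intros)
      then show "((\<lambda>h::real. (max 0 h) ^ Suc N) \<longlongrightarrow> 0) (at 0)" by (simp add: isCont_def)
    qed
    with 3 show ?thesis by (simp add: DERIV_def)
  qed
qed

lemma GDERIV_bump: "GDERIV (bump (Suc (Suc N))) z :> (- 2 * real (Suc (Suc N)) * bump (Suc N) z) *\<^sub>R z"
proof -
  have "GDERIV (\<lambda>z. 1 - z \<bullet> z) z :> - 2 *\<^sub>R z"
    unfolding gderiv_def by (auto intro!: derivative_eq_intros simp: inner_commute)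
  from GDERIV_DERIV_compose[OF this DERIV_max_power[of N]]
  show ?thesis unfolding bump_def[abs_def] by (simp add: algebra_simps)
qed

lemma gradient_bump: "gradient (bump (Suc (Suc N))) = (\<lambda>z. (- 2 * real (Suc (Suc N)) * bump (Suc N) z) *\<^sub>R z)"
  by (intro ext gradient_eqI GDERIV_bump)

lemma Ck_on_bump: "Ck_on j UNIV (bump (Suc (j + i)) :: 'a::euclidean_space \<Rightarrow> real)"
proof (induction j arbitrary: i)
  case 0
  show ?case using bump_kernel[where 'a = 'a, of i] by (auto simp: unit_kernel_def)
next
  case (Suc j)
  show ?case
    unfolding add_Suc
  proof (rule Ck_on_SucI[OF GDERIV_bump])
    fix b :: 'a
    have "Ck_on j UNIV (\<lambda>z::'a. (- 2 * real (Suc (Suc (j + i))) * bump (Suc (j + i)) z) * (z \<bullet> b))"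
      by (intro Ck_on_mult Ck_on_const Suc.IH Ck_on_inner_left)
    then show "Ck_on j UNIV (\<lambda>z. ((- 2 * real (Suc (Suc (j + i))) * bump (Suc (j + i)) z) *\<^sub>R z) \<bullet> b)"
      by simp
  qed
qed

section \<open>Potentials as integrals of averages over all scales\<close>

text \<open>The Newtonian potential has \<open>a = 1\<close>; every derivative falling on the kernel
  lowers \<open>a\<close> by one, so gradients have \<open>a = 0\<close> and second derivatives
  \<open>a = - 1\<close>. The set \<open>S\<close> allows splitting at scale 1: small scales decide
  regularity, large scales use the decay of the density.\<close>

definition pot :: "real set \<Rightarrow> real \<Rightarrow> ('a::euclidean_space \<Rightarrow> 'b::euclidean_space) \<Rightarrow> ('a \<Rightarrow> real) \<Rightarrow> 'a \<Rightarrow> 'b" where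
  "pot S a \<kappa> f x = (LBINT s:S. s powr a *\<^sub>R avg \<kappa> s f x)"

lemma pot_measurable_integrand:
  assumes "unit_kernel \<kappa>" "f \<in> borel_measurable borel" "S \<in> sets borel"
  shows "(\<lambda>s. indicator S s *\<^sub>R s powr a *\<^sub>R avg \<kappa> s f x) \<in> borel_measurable borel"
  using avg_measurable_s[OF assms(1,2), of x] assms(3) by measurable

lemma pot_integrableI:
  assumes "unit_kernel \<kappa>" "f \<in> borel_measurable borel" "S \<in> sets borel"
    and B: "set_integrable lborel S B"
    and le: "\<And>s. s \<in> S \<Longrightarrow> norm (s powr a *\<^sub>R avg \<kappa> s f x) \<le> B s"
  shows "set_integrable lborel S (\<lambda>s. s powr a *\<^sub>R avg \<kappa> s f x)"
  unfolding set_integrable_def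
proof (rule Bochner_Integration.integrable_bound[OF B[unfolded set_integrable_def]])
  show "AE s in lborel. norm (indicator S s *\<^sub>R s powr a *\<^sub>R avg \<kappa> s f x) \<le> norm (indicator S s *\<^sub>R B s)"
    using le by (intro AE_I2) (auto simp: indicator_def intro: order_trans[OF _ abs_ge_self])
qed (use pot_measurable_integrand[OF assms(1-3)] in simp)

lemma pot_norm_le:
  assumes "unit_kernel \<kappa>" "f \<in> borel_measurable borel" "S \<in> sets borel"
    and B: "set_integrable lborel S B"
    and le: "\<And>s. s \<in> S \<Longrightarrow> norm (s powr a *\<^sub>R avg \<kappa> s f x) \<le> B s"
  shows "norm (pot S a \<kappa> f x) \<le> (LBINT s:S. B s)"
proof -
  have "norm (pot S a \<kappa> f x) \<le> (LBINT s:S. norm (s powr a *\<^sub>R avg \<kappa> s f x))"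
    unfolding pot_def by (rule set_integral_norm_bound[OF pot_integrableI[OF assms]])
  also have "\<dots> \<le> (LBINT s:S. B s)"
    by (intro set_integral_mono set_integrable_norm pot_integrableI[OF assms] B le)
  finally show ?thesis .
qed

lemma pot_inner:
  assumes "unit_kernel \<kappa>" "loc_bounded f" and "set_integrable lborel S (\<lambda>s. s powr a *\<^sub>R avg \<kappa> s f x)"
  shows "pot S a \<kappa> f x \<bullet> b = pot S a (\<lambda>z. \<kappa> z \<bullet> b) f x"
proof -
  have "pot S a \<kappa> f x \<bullet> b = (\<integral>s. (indicator S s *\<^sub>R s powr a *\<^sub>R avg \<kappa> s f x) \<bullet> b \<partial>lborel)"
    unfolding pot_def set_lebesgue_integral_def
    by (rule integral_inner_left[symmetric]) (use assms(3) in \<open>simp add: set_integrable_def\<close>)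
  then show ?thesis
    unfolding pot_def set_lebesgue_integral_def inner_scaleR_left avg_inner[OF assms(1,2)] by simp
qed

text \<open>The chain rule gives a factor \<open>1 / s\<close> at each scale, which joins
  \<open>s powr a\<close>. The dominating function \<open>B\<close> is left open because it is found
  in different ways: from decay at large scales, from boundedness or from mean zero at small
  ones.\<close>

lemma GDERIV_pot:
  fixes \<kappa> :: "'a::euclidean_space \<Rightarrow> real"
  assumes \<kappa>: "unit_kernel \<kappa>" "Ck_on (Suc j) UNIV \<kappa>" and f: "loc_bounded f"
    and S: "S \<in> sets borel" "S \<subseteq> {0<..}" and r: "0 < r"
    and int: "\<And>x'. dist x' x < r \<Longrightarrow> set_integrable lborel S (\<lambda>s. s powr a *\<^sub>R avg \<kappa> s f x')"
    and B: "set_integrable lborel S B"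
    and le: "\<And>x' s. dist x' x < r \<Longrightarrow> s \<in> S \<Longrightarrow> s powr (a - 1) * norm (avg (gradient \<kappa>) s f x') \<le> B s"
  shows "GDERIV (pot S a \<kappa> f) x :> pot S (a - 1) (gradient \<kappa>) f x"
  unfolding pot_def set_lebesgue_integral_def
proof (rule GDERIV_integral[OF r])
  show "integrable lborel (\<lambda>s. indicat_real S s *\<^sub>R s powr a *\<^sub>R avg \<kappa> s f x')" if "dist x' x < r" for x'
    using int[OF that] by (simp add: set_integrable_def)
  show "integrable lborel (\<lambda>s. indicat_real S s *\<^sub>R B s)" using B by (simp add: set_integrable_def)
  fix x' s assume x': "dist x' x < r"
  show "norm (indicat_real S s *\<^sub>R s powr (a - 1) *\<^sub>R avg (gradient \<kappa>) s f x') \<le> indicat_real S s *\<^sub>R B s"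
    using le[OF x', of s] by (simp add: indicator_def)
  show "GDERIV (\<lambda>x. indicat_real S s *\<^sub>R s powr a *\<^sub>R avg \<kappa> s f x) x' :>
      indicat_real S s *\<^sub>R s powr (a - 1) *\<^sub>R avg (gradient \<kappa>) s f x'"
  proof (cases "s \<in> S")
    case True
    then have s: "0 < s" using S(2) by auto
    have "s powr a * (1 / s) = s powr (a - 1)" using s by (simp add: powr_diff)
    then show ?thesis
      using True GDERIV_mult[OF GDERIV_const GDERIV_avg[OF \<kappa> f s], of "s powr a" x'] by simp
  qed (simp add: GDERIV_const)
qed

text \<open>The lower bound on \<open>a\<close> is convergence at small scales, the upper bound
  convergence at large scales, where averages decay like \<open>s powr - \<beta>\<close>.\<close>

lemma decaying_pot_bound:
  fixes \<beta> :: real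
  assumes \<beta>: "0 < \<beta>" "\<beta> < real DIM('a::euclidean_space)" and a: "-1 < a" "a + 1 < \<beta>"
  shows "\<exists>C>0. \<forall>(\<kappa> :: 'a \<Rightarrow> 'b::euclidean_space) M A f x. unit_kernel \<kappa> \<longrightarrow> (\<forall>z. norm (\<kappa> z) \<le> M) \<longrightarrow>
    decaying \<beta> A f \<longrightarrow> set_integrable lborel {0<..} (\<lambda>s. s powr a *\<^sub>R avg \<kappa> s f x) \<and>
    norm (pot {0<..} a \<kappa> f x) \<le> C * M * A * (1 + norm x) powr (a + 1 - \<beta>)"
proof -
  obtain C where C: "0 < C" "\<forall>(\<kappa> :: 'a \<Rightarrow> 'b::euclidean_space) M A f x s. unit_kernel \<kappa> \<longrightarrow> (\<forall>z. norm (\<kappa> z) \<le> M) \<longrightarrow>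
    decaying \<beta> A f \<longrightarrow> 0 < s \<longrightarrow> norm (avg \<kappa> s f x) \<le> C * M * A * max s (1 + norm x) powr - \<beta>"
    using avg_decay[OF \<beta>, where 'b = 'b] by blast
  define D where "D = 1 / (a + 1) + 1 / (\<beta> - a - 1)"
  have D: "0 < D" using a unfolding D_def by (intro add_pos_pos) auto
  have R: "0 < 1 + norm x" for x :: 'a by (simp add: add_pos_nonneg)
  have le: "norm (s powr a *\<^sub>R avg \<kappa> s f x) \<le> (C * M * A) * (s powr a * max s (1 + norm x) powr - \<beta>)"
    if "unit_kernel \<kappa>" "\<And>z. norm (\<kappa> z) \<le> M" "decaying \<beta> A f" "s \<in> {0<..}" for \<kappa> :: "'a \<Rightarrow> 'b" and M A f x s
    using mult_left_mono[OF C(2)[rule_format, OF that(1-3), of s x], of "s powr a"] that(4) by (simp add: mult_ac)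
  have int: "set_integrable lborel {0<..} (\<lambda>s. c * (s powr a * max s (1 + norm x) powr - \<beta>))" for c and x :: 'a
    by (intro set_integrable_mult_right weight_integrable[OF a R])
  have 1: "set_integrable lborel {0<..} (\<lambda>s. s powr a *\<^sub>R avg \<kappa> s f x)"
    if "unit_kernel \<kappa>" "\<And>z. norm (\<kappa> z) \<le> M" "decaying \<beta> A f" for \<kappa> :: "'a \<Rightarrow> 'b" and M A f x
    using that by (intro pot_integrableI[OF _ _ _ int le]) (auto simp: decaying_def)
  have 2: "norm (pot {0<..} a \<kappa> f x) \<le> (C * D) * M * A * (1 + norm x) powr (a + 1 - \<beta>)"
    if k: "unit_kernel \<kappa>" and M: "\<And>z. norm (\<kappa> z) \<le> M" and f: "decaying \<beta> A f" for \<kappa> :: "'a \<Rightarrow> 'b" and M A f x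
  proof -
    have "0 \<le> M" using M[of 0] norm_ge_zero order_trans by blast
    then have 0: "0 \<le> C * M * A" using decaying_nonneg[OF f] C(1) by simp
    have "norm (pot {0<..} a \<kappa> f x) \<le> (LBINT s:{0<..}. (C * M * A) * (s powr a * max s (1 + norm x) powr - \<beta>))"
      using k f by (intro pot_norm_le[OF _ _ _ int le[OF k M f]]) (auto simp: decaying_def)
    also have "\<dots> = (C * M * A) * (LBINT s:{0<..}. s powr a * max s (1 + norm x) powr - \<beta>)"
      by (rule set_integral_mult_right)
    also have "\<dots> \<le> (C * M * A) * (D * (1 + norm x) powr (a + 1 - \<beta>))"
      unfolding D_def by (intro mult_left_mono weight_integral_le a R 0)
    finally show ?thesis by (simp add: mult_ac)
  qed
  show ?thesis
  proof (intro exI[of _ "C * D"] conjI allI impI)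
    show "0 < C * D" using C(1) D by simp
  qed (use 1 2 in blast)+
qed

section \<open>The Newtonian potential\<close>

text \<open>The constant in the representation of a power of the norm by bumps of all scales, obtained by
  substituting \<open>s = norm w * \<sigma>\<close>; the bump at scale \<open>s\<close> vanishes at \<open>w\<close> unless \<open>1 < \<sigma>\<close>.\<close>

definition layer_const :: "real \<Rightarrow> nat \<Rightarrow> real" where
  "layer_const q N = (LBINT \<sigma>:{1<..}. \<sigma> powr q * (1 - 1 / \<sigma>\<^sup>2) ^ N)"

lemma layer_base_bounds:
  fixes \<sigma> :: real
  assumes "1 < \<sigma>"
  shows "\<bar>1 - 1 / \<sigma>\<^sup>2\<bar> \<le> 1" "0 \<le> 1 - 1 / \<sigma>\<^sup>2"
proof -
  have "1 \<le> \<sigma>\<^sup>2" using assms by (simp add: one_le_power)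
  then have "1 / \<sigma>\<^sup>2 \<le> 1 / 1" by (intro divide_left_mono) auto
  moreover have "0 \<le> 1 / \<sigma>\<^sup>2" by simp
  ultimately show "\<bar>1 - 1 / \<sigma>\<^sup>2\<bar> \<le> 1" "0 \<le> 1 - 1 / \<sigma>\<^sup>2" by linarith+
qed

lemma layer_const_integrable:
  fixes q :: real
  assumes "q < -1"
  shows "set_integrable lborel {1<..} (\<lambda>\<sigma>. \<sigma> powr q * (1 - 1 / \<sigma>\<^sup>2) ^ N)"
  unfolding set_integrable_def
proof (rule Bochner_Integration.integrable_bound)
  show "integrable lborel (\<lambda>\<sigma>. indicat_real {0<..} \<sigma> *\<^sub>R (\<sigma> powr 0 * max \<sigma> 1 powr - (- q)))"
    using weight_integrable[of 0 "- q" 1] assms by (simp only: set_integrable_def)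
  show "AE \<sigma> in lborel. norm (indicat_real {1<..} \<sigma> *\<^sub>R (\<sigma> powr q * (1 - 1 / \<sigma>\<^sup>2) ^ N))
      \<le> norm (indicat_real {0<..} \<sigma> *\<^sub>R (\<sigma> powr 0 * max \<sigma> 1 powr - (- q)))"
  proof (rule AE_I2)
    fix \<sigma> :: real
    show "norm (indicat_real {1<..} \<sigma> *\<^sub>R (\<sigma> powr q * (1 - 1 / \<sigma>\<^sup>2) ^ N))
      \<le> norm (indicat_real {0<..} \<sigma> *\<^sub>R (\<sigma> powr 0 * max \<sigma> 1 powr - (- q)))"
    proof (cases "1 < \<sigma>")
      case True
      have "\<bar>1 - 1 / \<sigma>\<^sup>2\<bar> \<le> 1" by (rule layer_base_bounds[OF True])
      then have "\<bar>1 - 1 / \<sigma>\<^sup>2\<bar> ^ N \<le> 1" by (intro power_le_one) auto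
      then have "\<sigma> powr q * \<bar>1 - 1 / \<sigma>\<^sup>2\<bar> ^ N \<le> \<sigma> powr q * 1" by (intro mult_left_mono) auto
      then show ?thesis using True by (simp add: abs_mult power_abs)
    qed simp
  qed
qed measurable

text \<open>The part of the integral over \<open>{2..3}\<close> is already positive: there the
  integrand is at least \<open>3 powr q * (3 / 4) ^ N\<close>. Positivity permits the division in
  \<open>newton_const\<close>.\<close>

lemma layer_const_pos:
  assumes "q < -1"
  shows "0 < layer_const q N"
proof -
  have "(\<integral>\<sigma>. indicat_real {2..3::real} \<sigma> *\<^sub>R (3 powr q * (3 / 4) ^ N) \<partial>lborel) \<le> layer_const q N"
    unfolding layer_const_def set_lebesgue_integral_def
  proof (rule integral_mono)
    show "integrable lborel (\<lambda>\<sigma>. indicat_real {1<..} \<sigma> *\<^sub>R (\<sigma> powr q * (1 - 1 / \<sigma>\<^sup>2) ^ N))"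
      using layer_const_integrable[OF assms] by (simp add: set_integrable_def)
    fix \<sigma> :: real
    show "indicat_real {2..3::real} \<sigma> *\<^sub>R (3 powr q * (3 / 4) ^ N) \<le> indicat_real {1<..} \<sigma> *\<^sub>R (\<sigma> powr q * (1 - 1 / \<sigma>\<^sup>2) ^ N)"
    proof (cases "\<sigma> \<in> {2..3}")
      case True
      have "3 powr q \<le> \<sigma> powr q" using True assms by (intro powr_mono2') auto
      moreover have "(2::real)\<^sup>2 \<le> \<sigma>\<^sup>2" using True by (intro power_mono) auto
      then have "1 / \<sigma>\<^sup>2 \<le> 1 / 4" by (intro divide_left_mono) auto
      then have "(3 / 4) ^ N \<le> (1 - 1 / \<sigma>\<^sup>2) ^ N" by (intro power_mono) auto
      ultimately show ?thesis using True by (auto intro!: mult_mono)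
    next
      case False
      have "0 \<le> 1 - 1 / \<sigma>\<^sup>2" if "1 < \<sigma>" by (rule layer_base_bounds[OF that])
      with False show ?thesis by (auto simp: indicator_def)
    qed
  qed (auto intro!: integrable_real_indicator)
  moreover have "(\<integral>\<sigma>. indicat_real {2..3::real} \<sigma> *\<^sub>R (3 powr q * (3 / 4) ^ N) \<partial>lborel) = 3 powr q * (3 / 4) ^ N"
    by simp
  moreover have "0 < 3 powr q * (3 / 4 :: real) ^ N" by simp
  ultimately show ?thesis by linarith
qed

text \<open>Integration by parts: \<open>\<sigma> powr q * (1 - 1 / \<sigma>^2) ^ Suc N\<close>
  vanishes at 1 because of the positive exponent and at infinity because \<open>q < 0\<close>. Two
  uses of the recursion link the normalising constant of the potential to the integral of a
  bump.\<close>

lemma layer_const_rec: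
  assumes "q < 0"
  shows "- q * layer_const (q - 1) (Suc N) = 2 * real (Suc N) * layer_const (q - 3) N"
proof -
  define F where "F \<sigma> = \<sigma> powr q * (1 - 1 / \<sigma>\<^sup>2) ^ Suc N" for \<sigma> :: real
  define f where "f \<sigma> = q * (\<sigma> powr (q - 1) * (1 - 1 / \<sigma>\<^sup>2) ^ Suc N) +
      2 * real (Suc N) * (\<sigma> powr (q - 3) * (1 - 1 / \<sigma>\<^sup>2) ^ N)" for \<sigma> :: real
  have int: "set_integrable lborel {1<..} (\<lambda>\<sigma>. \<sigma> powr (q - 1) * (1 - 1 / \<sigma>\<^sup>2) ^ Suc N)"
     "set_integrable lborel {1<..} (\<lambda>\<sigma>. \<sigma> powr (q - 3) * (1 - 1 / \<sigma>\<^sup>2) ^ N)"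
    using assms by (intro layer_const_integrable; simp)+
  have fi: "set_integrable lborel {1<..} f"
    unfolding f_def by (intro set_integral_add set_integrable_mult_right int)
  have ei: "einterval 1 \<infinity> = {1<..}" by (auto simp: einterval_def one_ereal_def)
  have D: "DERIV F x :> f x" if "1 < x" for x
  proof -
    have p: "x powr q / x ^ 3 = x powr (q - 3)" using that by (simp add: powr_diff)
    have "DERIV F x :> q * x powr (q - 1) * (1 - 1 / x\<^sup>2) ^ Suc N + x powr q * (real (Suc N) * (1 - 1 / x\<^sup>2) ^ N * (2 / x ^ 3))"
      unfolding F_def using that
      by (auto intro!: derivative_eq_intros simp: field_simps power2_eq_square power3_eq_cube simp del: power_Suc)
    also have "x powr q * (real (Suc N) * (1 - 1 / x\<^sup>2) ^ N * (2 / x ^ 3)) = 2 * real (Suc N) * ((x powr q / x ^ 3) * (1 - 1 / x\<^sup>2) ^ N)"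
      by simp
    finally show ?thesis unfolding f_def p by (simp only: mult.assoc)
  qed
  have "(LBINT x=1..\<infinity>. f x) = 0 - 0"
  proof (rule interval_integral_FTC_integrable)
    show "(F has_vector_derivative f x) (at x)" if "1 < ereal x" "ereal x < \<infinity>" for x
      using D[of x] that by (simp add: has_real_derivative_iff_has_vector_derivative one_ereal_def)
    show "isCont f x" if "1 < ereal x" "ereal x < \<infinity>" for x
      unfolding f_def using that by (intro continuous_intros) (auto simp: one_ereal_def)
    show "set_integrable lborel (einterval 1 \<infinity>) f" unfolding ei by (rule fi)
    have "isCont F 1" unfolding F_def by (intro continuous_intros) auto
    then have "(F \<longlongrightarrow> 0) (at_right 1)"
      by (simp add: isCont_def F_def filterlim_at_split)
    then show "((F \<circ> real_of_ereal) \<longlongrightarrow> 0) (at_right 1)"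
      unfolding one_ereal_def by (rule ereal_tendsto_simps1(2)[THEN iffD2])
    have "(F \<longlongrightarrow> 0) at_top"
    proof (rule Lim_null_comparison)
      show "\<forall>\<^sub>F x in at_top. norm (F x) \<le> x powr q"
        using eventually_gt_at_top[of 1]
      proof eventually_elim
        case (elim x)
        have "\<bar>1 - 1 / x\<^sup>2\<bar> \<le> 1" by (rule layer_base_bounds[OF elim])
        then have "\<bar>1 - 1 / x\<^sup>2\<bar> ^ Suc N \<le> 1" by (intro power_le_one) auto
        then have "x powr q * \<bar>1 - 1 / x\<^sup>2\<bar> ^ Suc N \<le> x powr q * 1" by (intro mult_left_mono) auto
        then show ?case unfolding F_def by (simp add: abs_mult power_abs)
      qed
      show "((\<lambda>x. x powr q) \<longlongrightarrow> 0) at_top"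
        by (rule tendsto_neg_powr[OF assms filterlim_ident])
    qed
    then show "((F \<circ> real_of_ereal) \<longlongrightarrow> 0) (at_left \<infinity>)"
      by (simp add: ereal_tendsto_simps)
  qed simp
  then have "(LBINT x:{1<..}. f x) = 0"
    by (simp add: interval_lebesgue_integral_def ei)
  moreover have "(LBINT x:{1<..}. f x) = q * layer_const (q - 1) (Suc N) + 2 * real (Suc N) * layer_const (q - 3) N"
    unfolding f_def layer_const_def
    by (subst set_integral_add(2)) (intro set_integrable_mult_right int, intro set_integrable_mult_right int, simp only: set_integral_mult_right)
  ultimately show ?thesis by simp
qed

text \<open>For q = 1 - n this is a multiple of \<open>r powr (2 - n)\<close>, the Newtonian kernel.
  The bump cuts the integral off at s \<le> r, so only infinity restricts \<open>q\<close>.\<close>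

lemma layer_scaling:
  assumes r: "0 < r" and q: "q < -1"
  shows "has_bochner_integral lborel (\<lambda>s. indicat_real {0<..} s * (s powr q * (max 0 (1 - (r / s)\<^sup>2)) ^ Suc N))
    (r powr (q + 1) * layer_const q (Suc N))"
proof -
  let ?g = "\<lambda>s. indicat_real {0<..} s * (s powr q * (max 0 (1 - (r / s)\<^sup>2)) ^ Suc N)"
  have eq: "?g (0 + r * \<sigma>) = r powr q * (indicat_real {1<..} \<sigma> *\<^sub>R (\<sigma> powr q * (1 - 1 / \<sigma>\<^sup>2) ^ Suc N))" for \<sigma>
  proof -
    consider "\<sigma> \<le> 0" | "0 < \<sigma>" "\<sigma> \<le> 1" | "1 < \<sigma>" by linarith
    then show ?thesis
    proof cases
      case 1
      then show ?thesis using r by (simp add: indicator_def zero_less_mult_iff)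
    next
      case 2
      then have "1 \<le> 1 / \<sigma>\<^sup>2" by (simp add: field_simps power_le_one)
      then show ?thesis using 2 r by (simp add: power_divide max_def)
    next
      case 3
      then have "1 / \<sigma>\<^sup>2 \<le> 1" by (simp add: field_simps one_le_power)
      then show ?thesis using 3 r by (simp add: power_divide max_def powr_mult)
    qed
  qed
  have "has_bochner_integral lborel (\<lambda>\<sigma>. indicat_real {1<..} \<sigma> *\<^sub>R (\<sigma> powr q * (1 - 1 / \<sigma>\<^sup>2) ^ Suc N)) (layer_const q (Suc N))"
    unfolding layer_const_def set_lebesgue_integral_def
    by (rule has_bochner_integral_integrable) (use layer_const_integrable[OF q, of "Suc N"] in \<open>simp only: set_integrable_def\<close>)
  then have "has_bochner_integral lborel (\<lambda>\<sigma>. ?g (0 + r * \<sigma>)) (r powr q * layer_const q (Suc N))"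
    unfolding eq by (rule has_bochner_integral_mult_right)
  moreover have "(r powr (q + 1) * layer_const q (Suc N)) /\<^sub>R \<bar>r\<bar> = r powr q * layer_const q (Suc N)"
    using r by (simp add: powr_add)
  ultimately have "has_bochner_integral lborel (\<lambda>\<sigma>. ?g (0 + r * \<sigma>)) ((r powr (q + 1) * layer_const q (Suc N)) /\<^sub>R \<bar>r\<bar>)"
    by (simp only:)
  then show ?thesis
    using lborel_has_bochner_integral_real_affine_iff[of r ?g "r powr (q + 1) * layer_const q (Suc N)" 0] r by blast
qed

lemma bump_scaled: "bump N ((1 / s) *\<^sub>R w) = (max 0 (1 - (norm w / s)\<^sup>2)) ^ N"
  by (simp add: bump_def power_divide power2_norm_eq_inner power2_eq_square[of s])

text \<open>Fubini in \<open>(s, y)\<close>: integrating over \<open>y\<close> first yields averages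
  of \<open>f\<close>, over \<open>s\<close> first the Newtonian kernel by
  \<open>layer_scaling\<close>. Absolute integrability follows from the bound on potentials applied
  to the absolute value of \<open>f\<close>, because \<open>K\<close> is nonnegative.\<close>

lemma
  fixes f :: "'a::euclidean_space \<Rightarrow> real"
  defines "n \<equiv> real DIM('a)"
  assumes \<beta>: "2 < \<beta>" "\<beta> < n" and f: "decaying \<beta> A f"
  shows newton_integrable: "integrable lborel (\<lambda>y. norm (x - y) powr (2 - n) * f y)"
    and newton_eq_pot: "layer_const (1 - n) (Suc N) * (\<integral>y. norm (x - y) powr (2 - n) * f y \<partial>lborel) = pot {0<..} 1 (bump (Suc N)) f x"
proof -
  have fm [measurable]: "f \<in> borel_measurable borel" using f by (simp add: decaying_def)
  have n2: "1 - n < -1" using \<beta> by simp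
  have fl: "loc_bounded f" using decaying_loc_bounded[OF f] \<beta> by simp
  have fa: "decaying \<beta> A (\<lambda>y. \<bar>f y\<bar>)" using f by (simp add: decaying_def)
  have fla: "loc_bounded (\<lambda>y. \<bar>f y\<bar>)" using decaying_loc_bounded[OF fa] \<beta> by simp
  \<comment> \<open>The factor \<open>s powr (1 - n)\<close> is the weight \<open>s\<close> of the
    scale times the normalisation \<open>s powr - n\<close> of the average.\<close>
  define K where "K N s y = indicat_real {0<..} s * (s powr (1 - n) * bump (Suc N) ((1 / s) *\<^sub>R (x - y)))" for N s y
  have bm: "bump (Suc N) \<in> borel_measurable (borel :: 'a measure)" for N
    by (rule kernel_measurable[OF bump_kernel])
  have slice: "(\<integral>y. K N s y * h y \<partial>lborel) = indicat_real {0<..} s *\<^sub>R s powr 1 *\<^sub>R avg (bump (Suc N)) s h x"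
    "integrable lborel (\<lambda>y. K N s y * h y)"
    if h: "loc_bounded h" for h N s
  proof -
    have "(\<lambda>y. K N s y * h y) = (\<lambda>y. (indicat_real {0<..} s * s powr (1 - n)) * (h y *\<^sub>R bump (Suc N) ((1 / s) *\<^sub>R (x - y))))"
      by (simp add: K_def mult_ac)
    moreover have "s powr (1 - n) = s / s ^ DIM('a)" if "0 < s"
      using that by (simp add: powr_diff n_def powr_realpow)
    ultimately show "(\<integral>y. K N s y * h y \<partial>lborel) = indicat_real {0<..} s *\<^sub>R s powr 1 *\<^sub>R avg (bump (Suc N)) s h x"
      using avg_kernel_form(2)[OF bump_kernel h, of s N x] by (cases "0 < s") auto
    show "integrable lborel (\<lambda>y. K N s y * h y)"
      using avg_kernel_form(1)[OF bump_kernel h, of s N x] \<open>(\<lambda>y. K N s y * h y) = _\<close>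
      by (cases "0 < s") (auto simp: K_def)
  qed
  have pair: "integrable (lborel \<Otimes>\<^sub>M lborel) (\<lambda>(s, y). K N s y * f y)" for N
  proof (rule lborel_pair.Fubini_integrable)
    show "(\<lambda>(s, y). K N s y * f y) \<in> borel_measurable (lborel \<Otimes>\<^sub>M lborel)"
      unfolding K_def using bm[of N] by measurable
    have abs: "norm (K N s y * f y) = K N s y * \<bar>f y\<bar>" for s y
      by (simp add: K_def abs_mult bump_nonneg)
    have "\<beta> < real DIM('a)" using \<beta> by (simp add: n_def)
    then obtain C where "\<forall>(\<kappa> :: 'a \<Rightarrow> real) M A f x. unit_kernel \<kappa> \<longrightarrow> (\<forall>z. norm (\<kappa> z) \<le> M) \<longrightarrow>
      decaying \<beta> A f \<longrightarrow> set_integrable lborel {0<..} (\<lambda>s. s powr 1 *\<^sub>R avg \<kappa> s f x) \<and>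
      norm (pot {0<..} 1 \<kappa> f x) \<le> C * M * A * (1 + norm x) powr (1 + 1 - \<beta>)"
      using decaying_pot_bound[of \<beta> 1, where 'a = 'a and 'b = real] \<beta> by auto
    from this[rule_format, OF bump_kernel _ fa, of N 1 x]
    have "set_integrable lborel {0<..} (\<lambda>s. s powr 1 *\<^sub>R avg (bump (Suc N)) s (\<lambda>y. \<bar>f y\<bar>) x)"
      by (simp add: bump_nonneg bump_le_1)
    then show "integrable lborel (\<lambda>s. \<integral>y. norm (case (s, y) of (s, y) \<Rightarrow> K N s y * f y) \<partial>lborel)"
      by (simp only: case_prod_conv abs slice(1)[OF fla] set_integrable_def)
    show "AE s in lborel. integrable lborel (\<lambda>y. case (s, y) of (s, y) \<Rightarrow> K N s y * f y)"
      by (intro AE_I2) (simp add: slice(2)[OF fl])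
  qed
  \<comment> \<open>At \<open>y = x\<close> the scale integral diverges at 0; the point is discarded
    as a null set.\<close>
  have AEx: "AE y in lborel. y \<noteq> x" by (rule AE_lborel_singleton)
  have inner: "(\<integral>s. K N s y * f y \<partial>lborel) = layer_const (1 - n) (Suc N) * (norm (x - y) powr (2 - n) * f y)"
    if "y \<noteq> x" for N y
  proof -
    have "has_bochner_integral lborel (\<lambda>s. K N s y) (norm (x - y) powr ((1 - n) + 1) * layer_const (1 - n) (Suc N))"
      unfolding K_def bump_scaled by (rule layer_scaling) (use that n2 in auto)
    then show ?thesis by (simp add: has_bochner_integral_iff mult_ac)
  qed
  have I: "integrable lborel (\<lambda>y. layer_const (1 - n) (Suc N) * (norm (x - y) powr (2 - n) * f y))" for N
  proof (rule integrable_cong_AE_imp[OF lborel_pair.integrable_snd[OF pair[of N]]])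
    show "AE y in lborel. (\<integral>s. K N s y * f y \<partial>lborel) = layer_const (1 - n) (Suc N) * (norm (x - y) powr (2 - n) * f y)"
      using AEx by eventually_elim (rule inner)
  qed measurable
  show "integrable lborel (\<lambda>y. norm (x - y) powr (2 - n) * f y)"
    using I[of 0] layer_const_pos[OF n2, of 1] by simp
  have "pot {0<..} 1 (bump (Suc N)) f x = (\<integral>s. (\<integral>y. K N s y * f y \<partial>lborel) \<partial>lborel)"
    unfolding pot_def set_lebesgue_integral_def by (simp only: slice(1)[OF fl])
  also have "\<dots> = (\<integral>y. (\<integral>s. K N s y * f y \<partial>lborel) \<partial>lborel)"
    by (rule lborel_pair.Fubini_integral[OF pair, symmetric])
  also have "\<dots> = (\<integral>y. layer_const (1 - n) (Suc N) * (norm (x - y) powr (2 - n) * f y) \<partial>lborel)"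
  proof (rule integral_cong_AE)
    show "(\<lambda>y. \<integral>s. K N s y * f y \<partial>lborel) \<in> borel_measurable lborel"
      using lborel_pair.integrable_snd[OF pair[of N]] by (rule borel_measurable_integrable)
    show "AE y in lborel. (\<integral>s. K N s y * f y \<partial>lborel) = layer_const (1 - n) (Suc N) * (norm (x - y) powr (2 - n) * f y)"
      using AEx by eventually_elim (rule inner)
  qed measurable
  finally show "layer_const (1 - n) (Suc N) * (\<integral>y. norm (x - y) powr (2 - n) * f y \<partial>lborel) = pot {0<..} 1 (bump (Suc N)) f x"
    by simp
qed

section \<open>Normalisation of the Newtonian kernel\<close>

lemma sphere_area_eq_ball_vol:
  "sphere_area (sphere 0 1 :: 'a::euclidean_space set) = real DIM('a) * unit_ball_vol (real DIM('a))"
proof -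
  have g: "Gamma (real DIM('a) / 2 + 1) = real DIM('a) / 2 * Gamma (real DIM('a) / 2)"
    by (rule Gamma_plus1) (use DIM_positive[where 'a='a] in \<open>auto dest: nonpos_Ints_nonpos\<close>)
  have "0 < Gamma (real DIM('a) / 2)" by (rule Gamma_real_pos) simp
  then show ?thesis
    unfolding sphere_area_unit_sphere unit_ball_vol_def g by simp
qed

lemma bump_integrable: "integrable lborel (bump (Suc N) :: 'a::euclidean_space \<Rightarrow> real)"
  using avg_integrable[OF bump_kernel[of N, where 'a = 'a], of "\<lambda>_. 1" 0 1] loc_bounded_continuous[of "\<lambda>_. 1"] by simp

lemma bump_C1: "Ck_on (Suc 0) UNIV (bump (Suc (Suc N)) :: 'a::euclidean_space \<Rightarrow> real)"
  using Ck_on_bump[of "Suc 0" N] by (simp only: add_Suc add_0)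

text \<open>The bump is a superposition of indicators of balls of radius
  \<open>1 / \<sigma>\<close>, whose density is the derivative of
  \<open>(1 - 1 / \<sigma>^2) ^ Suc M\<close>: integrate it from 1 to \<open>1 / norm z\<close>.
  Tonelli then turns the integral of the bump into ball volumes.\<close>

lemma bump_layer_cake:
  fixes z :: "'a::euclidean_space"
  assumes "z \<noteq> 0"
  shows "(\<integral>\<^sup>+\<sigma>. ennreal (2 * real (Suc M) * (\<sigma> powr - 3 * (1 - 1 / \<sigma>\<^sup>2) ^ M)) * indicator {p. 1 < fst p \<and> norm (snd p) * fst p \<le> 1} (\<sigma>, z) \<partial>lborel)
    = ennreal (bump (Suc M) z)"
proof (cases "norm z < 1")
  case True
  have z: "0 < norm z" using assms by simp
  have z1: "1 \<le> 1 / norm z" using True z by simp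
  have ae: "AE \<sigma> in lborel. \<sigma> \<noteq> (1::real)" by (rule AE_lborel_singleton)
  have "(\<integral>\<^sup>+\<sigma>. ennreal (2 * real (Suc M) * (\<sigma> powr - 3 * (1 - 1 / \<sigma>\<^sup>2) ^ M)) * indicator {p. 1 < fst p \<and> norm (snd p) * fst p \<le> 1} (\<sigma>, z) \<partial>lborel)
     = (\<integral>\<^sup>+\<sigma>. ennreal (2 * real (Suc M) * (\<sigma> powr - 3 * (1 - 1 / \<sigma>\<^sup>2) ^ M)) * indicator {1..1 / norm z} \<sigma> \<partial>lborel)"
    using ae by (intro nn_integral_cong_AE, eventually_elim) (use z in \<open>auto simp: indicator_def field_simps\<close>)
  also have "\<dots> = ennreal ((1 - 1 / (1 / norm z)\<^sup>2) ^ Suc M - (1 - 1 / 1\<^sup>2) ^ Suc M)"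
  proof (rule nn_integral_FTC_Icc[OF _ _ _ z1])
    fix x :: real assume x: "x \<in> {1..1 / norm z}"
    then have x0: "0 < x" by auto
    have p: "x powr - 3 = 1 / x ^ 3" using x0 by (simp add: powr_minus_divide)
    have "DERIV (\<lambda>\<sigma>. (1 - 1 / \<sigma>\<^sup>2) ^ Suc M) x :> real (Suc M) * (1 - 1 / x\<^sup>2) ^ M * (2 / x ^ 3)"
      using x0 by (auto intro!: derivative_eq_intros simp: field_simps power2_eq_square power3_eq_cube simp del: power_Suc)
    then show "DERIV (\<lambda>\<sigma>. (1 - 1 / \<sigma>\<^sup>2) ^ Suc M) x :> 2 * real (Suc M) * (x powr - 3 * (1 - 1 / x\<^sup>2) ^ M)"
      by (rule DERIV_cong) (simp add: p mult_ac del: of_nat_Suc)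
    have "1 \<le> x\<^sup>2" using x by (simp add: one_le_power)
    then have "1 / x\<^sup>2 \<le> 1 / 1" by (intro divide_left_mono) auto
    then show "0 \<le> 2 * real (Suc M) * (x powr - 3 * (1 - 1 / x\<^sup>2) ^ M)" by (intro mult_nonneg_nonneg) auto
  qed measurable
  also have "(1 - 1 / (1 / norm z)\<^sup>2) ^ Suc M - (1 - 1 / 1\<^sup>2) ^ Suc M = bump (Suc M) z"
  proof -
    have "1 - 1 / (1 / norm z)\<^sup>2 = 1 - z \<bullet> z" by (simp add: power_divide power2_norm_eq_inner)
    moreover have "z \<bullet> z \<le> 1" using True by (simp add: norm_eq_sqrt_inner)
    ultimately show ?thesis by (simp add: bump_def max_def)
  qed
  finally show ?thesis .
next
  case False
  have "indicator {p. 1 < fst p \<and> norm (snd p) * fst p \<le> 1} (\<sigma>, z) = (0::ennreal)" for \<sigma> :: real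
  proof -
    have "1 < norm z * \<sigma>" if "1 < \<sigma>" using mult_le_less_imp_less[of 1 "norm z" 1 \<sigma>] False that by simp
    then show ?thesis by (fastforce simp: indicator_def)
  qed
  moreover have "bump (Suc M) z = 0" using bump_kernel[where 'a = 'a, of M] False by (simp add: unit_kernel_def)
  ultimately show ?thesis by simp
qed

lemma integral_bump:
  "(\<integral>z. bump (Suc M) z \<partial>(lborel :: 'a::euclidean_space measure)) =
    2 * real (Suc M) * unit_ball_vol (real DIM('a)) * layer_const (- real DIM('a) - 3) M"
proof -
  let ?V = "unit_ball_vol (real DIM('a))"
  let ?n = "real DIM('a)"
  define J where "J p = ennreal (2 * real (Suc M) * (fst p powr - 3 * (1 - 1 / (fst p)\<^sup>2) ^ M)) *
     indicator {p. 1 < fst p \<and> norm (snd p) * fst p \<le> 1} p" for p :: "real \<times> 'a"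
  have Jm: "J \<in> borel_measurable (lborel \<Otimes>\<^sub>M lborel)"
    unfolding J_def
  proof (intro borel_measurable_times_ennreal borel_measurable_indicator)
    have "{p :: real \<times> 'a. 1 < fst p \<and> norm (snd p) * fst p \<le> 1} =
        {p. 1 < fst p} \<inter> {p. norm (snd p) * fst p \<le> 1}" by auto
    also have "\<dots> \<in> sets borel"
      by (intro sets.Int borel_open borel_closed open_Collect_less closed_Collect_le continuous_intros)
    finally show "{p :: real \<times> 'a. 1 < fst p \<and> norm (snd p) * fst p \<le> 1} \<in> sets (lborel \<Otimes>\<^sub>M lborel)"
      by (simp only: lborel_prod sets_lborel)
  qed simp
  have AE0: "AE z in lborel. z \<noteq> (0::'a)" by (rule AE_lborel_singleton)
  have "ennreal (\<integral>z. bump (Suc M) z \<partial>(lborel :: 'a measure)) = (\<integral>\<^sup>+z. ennreal (bump (Suc M) z) \<partial>(lborel :: 'a measure))"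
    by (rule nn_integral_eq_integral[symmetric, OF bump_integrable]) (simp add: bump_nonneg)
  also have "\<dots> = (\<integral>\<^sup>+z. (\<integral>\<^sup>+\<sigma>. J (\<sigma>, z) \<partial>lborel) \<partial>lborel)"
  proof (rule nn_integral_cong_AE)
    have cake: "ennreal (bump (Suc M) z) = (\<integral>\<^sup>+\<sigma>. J (\<sigma>, z) \<partial>lborel)" if "z \<noteq> 0" for z
      using bump_layer_cake[OF that, of M] by (simp only: J_def fst_conv)
    show "AE z in lborel. ennreal (bump (Suc M) z) = (\<integral>\<^sup>+\<sigma>. J (\<sigma>, z) \<partial>lborel)"
      using AE0 by eventually_elim (rule cake)
  qed
  also have "\<dots> = (\<integral>\<^sup>+\<sigma>. (\<integral>\<^sup>+z. J (\<sigma>, z) \<partial>lborel) \<partial>lborel)"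
    by (rule lborel_pair.Fubini[OF Jm])
  also have "\<dots> = (\<integral>\<^sup>+\<sigma>. ennreal (indicat_real {1<..} \<sigma> *\<^sub>R (2 * real (Suc M) * ?V * (\<sigma> powr (- ?n - 3) * (1 - 1 / \<sigma>\<^sup>2) ^ M))) \<partial>lborel)"
  proof (rule nn_integral_cong)
    fix \<sigma> :: real
    show "(\<integral>\<^sup>+z. J (\<sigma>, z) \<partial>lborel) = ennreal (indicat_real {1<..} \<sigma> *\<^sub>R (2 * real (Suc M) * ?V * (\<sigma> powr (- ?n - 3) * (1 - 1 / \<sigma>\<^sup>2) ^ M)))"
    proof (cases "1 < \<sigma>")
      case True
      let ?c = "2 * real (Suc M) * (\<sigma> powr - 3 * (1 - 1 / \<sigma>\<^sup>2) ^ M)"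
      have c: "0 \<le> ?c" using layer_base_bounds(2)[OF True] by (intro mult_nonneg_nonneg) auto
      have "J (\<sigma>, z) = ennreal ?c * indicator (cball (0::'a) (1 / \<sigma>)) z" for z
        using True by (simp add: J_def indicator_def field_simps)
      then have "(\<integral>\<^sup>+z. J (\<sigma>, z) \<partial>lborel) = ennreal ?c * emeasure lborel (cball (0::'a) (1 / \<sigma>))"
        by (simp add: nn_integral_cmult_indicator)
      also have "emeasure lborel (cball (0::'a) (1 / \<sigma>)) = ennreal (?V * \<sigma> powr - ?n)"
        using True emeasure_cball[of "1 / \<sigma>" "0::'a"] by (simp add: power_one_over powr_minus_divide powr_realpow)
      also have "ennreal ?c * ennreal (?V * \<sigma> powr - ?n) = ennreal (?c * (?V * \<sigma> powr - ?n))"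
        using c by (intro ennreal_mult[symmetric]) auto
      also have "?c * (?V * \<sigma> powr - ?n) = 2 * real (Suc M) * ?V * ((\<sigma> powr - 3 * \<sigma> powr - ?n) * (1 - 1 / \<sigma>\<^sup>2) ^ M)"
        by (simp add: mult_ac)
      also have "\<sigma> powr - 3 * \<sigma> powr - ?n = \<sigma> powr (- ?n - 3)"
        by (simp add: powr_add[symmetric] algebra_simps)
      finally show ?thesis using True by simp
    next
      case False
      then have "J (\<sigma>, z) = 0" for z by (simp add: J_def)
      with False show ?thesis by simp
    qed
  qed
  also have "\<dots> = ennreal (\<integral>\<sigma>. indicat_real {1<..} \<sigma> *\<^sub>R (2 * real (Suc M) * ?V * (\<sigma> powr (- ?n - 3) * (1 - 1 / \<sigma>\<^sup>2) ^ M)) \<partial>lborel)"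
  proof (rule nn_integral_eq_integral)
    have "- ?n - 3 < -1" by simp
    from set_integrable_mult_right[OF layer_const_integrable[OF this], of "2 * real (Suc M) * ?V" M]
    show "integrable lborel (\<lambda>\<sigma>. indicat_real {1<..} \<sigma> *\<^sub>R (2 * real (Suc M) * ?V * (\<sigma> powr (- ?n - 3) * (1 - 1 / \<sigma>\<^sup>2) ^ M)))"
      by (simp only: set_integrable_def)
    show "AE \<sigma> in lborel. 0 \<le> indicat_real {1<..} \<sigma> *\<^sub>R (2 * real (Suc M) * ?V * (\<sigma> powr (- ?n - 3) * (1 - 1 / \<sigma>\<^sup>2) ^ M))"
      using layer_base_bounds(2) by (intro AE_I2) (auto simp: indicator_def intro!: mult_nonneg_nonneg)
  qed
  also have "(\<integral>\<sigma>. indicat_real {1<..} \<sigma> *\<^sub>R (2 * real (Suc M) * ?V * (\<sigma> powr (- ?n - 3) * (1 - 1 / \<sigma>\<^sup>2) ^ M)) \<partial>lborel)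
      = 2 * real (Suc M) * ?V * layer_const (- ?n - 3) M"
    unfolding layer_const_def by (simp only: set_lebesgue_integral_def[symmetric] set_integral_mult_right)
  finally show ?thesis
    using layer_const_pos[of "- ?n - 3" M] by (subst (asm) ennreal_inj) (auto simp: bump_nonneg)
qed

text \<open>The first two factors of the denominator belong to the fundamental solution, the third
  converts it into an integral over scales. The exponent \<open>Suc (Suc N)\<close> guarantees a
  bump of class \<open>C^1\<close>; the type argument supplies the dimension.\<close>

definition newton_const :: "'a::euclidean_space itself \<Rightarrow> nat \<Rightarrow> real" where
  "newton_const _ N = 1 / ((real DIM('a) - 2) * sphere_area (sphere 0 1 :: 'a set) * layer_const (1 - real DIM('a)) (Suc (Suc N)))"

lemma newton_const_pos:
  assumes "3 \<le> DIM('a::euclidean_space)"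
  shows "0 < newton_const TYPE('a) N"
  unfolding newton_const_def sphere_area_eq_ball_vol
  using assms layer_const_pos[of "1 - real DIM('a)" "Suc (Suc N)"] by simp

text \<open>Two steps of \<open>layer_const_rec\<close>, from \<open>1 - n\<close> through
  \<open>- n - 1\<close> to \<open>- n - 3\<close>, arrive at the constant in the integral of the
  bump; the sphere area, \<open>n\<close> times the volume of the unit ball, supplies the factor
  \<open>n\<close> of the second step. As \<open>2 * real (Suc (Suc N))\<close> comes from the
  gradient of the bump, the identity expresses the unit flux of the fundamental solution.\<close>

lemma newton_const_flux:
  assumes "3 \<le> DIM('a::euclidean_space)"
  shows "newton_const TYPE('a) N * (2 * real (Suc (Suc N)) * (\<integral>z. bump (Suc N) z \<partial>(lborel :: 'a measure))) = 1"
proof -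
  define n where "n = real DIM('a)"
  define V where "V = unit_ball_vol n"
  have n: "3 \<le> n" using assms by (simp add: n_def)
  have V: "0 < V" by (simp add: V_def n_def)
  have 1: "(n - 2) * layer_const (1 - n) (Suc (Suc N)) = 2 * real (Suc (Suc N)) * layer_const (- n - 1) (Suc N)"
  proof -
    have "2 - n < 0" "- (2 - n) = n - 2" "2 - n - 1 = 1 - n" "2 - n - 3 = - n - 1" using n by auto
    then show ?thesis using layer_const_rec[of "2 - n" "Suc N"] by (simp only:)
  qed
  have 2: "n * layer_const (- n - 1) (Suc N) = 2 * real (Suc N) * layer_const (- n - 3) N"
  proof -
    have "- n < 0" "- (- n) = n" using n by auto
    then show ?thesis using layer_const_rec[of "- n" N] by (simp only:)
  qed
  have pos: "0 < layer_const (- n - 3) N" using n by (intro layer_const_pos) simp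
  have "(n - 2) * (n * V) * layer_const (1 - n) (Suc (Suc N)) = n * V * ((n - 2) * layer_const (1 - n) (Suc (Suc N)))"
    by simp
  also have "\<dots> = V * (2 * real (Suc (Suc N))) * (n * layer_const (- n - 1) (Suc N))"
    unfolding 1 by simp
  also have "\<dots> = 2 * real (Suc (Suc N)) * (2 * real (Suc N) * V * layer_const (- n - 3) N)"
    unfolding 2 by simp
  finally have 3: "(n - 2) * (n * V) * layer_const (1 - n) (Suc (Suc N)) = 2 * real (Suc (Suc N)) * (2 * real (Suc N) * V * layer_const (- n - 3) N)" .
  have "2 * real (Suc (Suc N)) * (2 * real (Suc N) * V * layer_const (- n - 3) N) \<noteq> 0"
    using pos V by simp
  then show ?thesis
    unfolding newton_const_def sphere_area_eq_ball_vol integral_bump n_def[symmetric] V_def[symmetric] 3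
      times_divide_eq_left mult_1
    by (rule divide_self)
qed

section \<open>The Newtonian potential of a decaying density: representation, gradient,
  decay\<close>

definition newton :: "('a::euclidean_space \<Rightarrow> real) \<Rightarrow> 'a \<Rightarrow> real" where
  "newton f x = 1 / ((real DIM('a) - 2) * sphere_area (sphere 0 1 :: 'a set)) *
     (\<integral>y. norm (x - y) powr (2 - real DIM('a)) * f y \<partial>lborel)"

locale decaying_density =
  fixes \<beta> A :: real and f :: "'a::euclidean_space \<Rightarrow> real"
  assumes \<beta>: "2 < \<beta>" "\<beta> < real DIM('a)" and f: "decaying \<beta> A f"
begin

lemma dim: "3 \<le> DIM('a)" using \<beta> by simp

lemma f_loc_bounded: "loc_bounded f"
  using decaying_loc_bounded[OF f] \<beta> by simp

lemma f_measurable: "f \<in> borel_measurable borel"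
  using f by (simp add: decaying_def)

text \<open>The left side is independent of \<open>N\<close>: one and the same potential is
  represented by bumps of any smoothness, and \<open>N\<close> is chosen afresh according to the
  number of derivatives to be taken.\<close>

lemma newton_pot: "newton f x = newton_const TYPE('a) N * pot {0<..} 1 (bump (Suc (Suc N))) f x"
proof -
  have "0 < layer_const (1 - real DIM('a)) (Suc (Suc N))" using dim by (intro layer_const_pos) simp
  then show ?thesis
    unfolding newton_def newton_const_def newton_eq_pot[OF \<beta> f, symmetric] by simp
qed

text \<open>Dependence on \<open>x\<close> is given up for a bound that is uniform in
  \<open>x\<close>, which supplies the dominating functions for differentiating in
  \<open>x\<close>.\<close>

lemma avg_bound_uniform:
  assumes "unit_kernel (\<kappa> :: 'a \<Rightarrow> 'b::euclidean_space)"
  shows "\<exists>P>0. \<forall>x s. 0 < s \<longrightarrow> norm (avg \<kappa> s f x) \<le> P * max s 1 powr - \<beta>"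
proof -
  obtain C where C: "0 < C" "\<forall>(\<kappa> :: 'a \<Rightarrow> 'b) M A f x s. unit_kernel \<kappa> \<longrightarrow> (\<forall>z. norm (\<kappa> z) \<le> M) \<longrightarrow>
    decaying \<beta> A f \<longrightarrow> 0 < s \<longrightarrow> norm (avg \<kappa> s f x) \<le> C * M * A * max s (1 + norm x) powr - \<beta>"
    using avg_decay[of \<beta>, where 'a = 'a and 'b = 'b] \<beta> by auto
  obtain M where M: "M > 0" "\<And>z. norm (\<kappa> z) \<le> M"
    using kernel_bounded[OF assms] by metis
  have A: "0 \<le> A" by (rule decaying_nonneg[OF f])
  have "norm (avg \<kappa> s f x) \<le> (C * M * A + 1) * max s 1 powr - \<beta>" if "0 < s" for x s
  proof -
    have "norm (avg \<kappa> s f x) \<le> C * M * A * max s (1 + norm x) powr - \<beta>"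
      using C(2) assms M(2) f that by blast
    also have "\<dots> \<le> C * M * A * max s 1 powr - \<beta>"
      using C(1) M(1) A \<beta> that max.mono[OF order_refl, of 1 "1 + norm x" s]
      by (intro mult_left_mono powr_mono2') (auto simp: less_max_iff_disj)
    also have "\<dots> \<le> (C * M * A + 1) * max s 1 powr - \<beta>" by (intro mult_right_mono) auto
    finally show ?thesis .
  qed
  moreover have "0 < C * M * A + 1" using C(1) M(1) A by (simp add: add_nonneg_pos)
  ultimately show ?thesis by blast
qed

lemma weight_uniform_integrable:
  assumes "-1 < a" "a \<le> 1"
  shows "set_integrable lborel {0<..} (\<lambda>s. P * (s powr a * max s 1 powr - \<beta>))"
  using assms \<beta> by (intro set_integrable_mult_right weight_integrable) auto

lemma pot_integrable:
  assumes "unit_kernel (\<kappa> :: 'a \<Rightarrow> 'b::euclidean_space)" "-1 < a" "a \<le> 1"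
  shows "set_integrable lborel {0<..} (\<lambda>s. s powr a *\<^sub>R avg \<kappa> s f x)"
proof -
  obtain P where P: "P > 0" "\<And>x s. 0 < s \<Longrightarrow> norm (avg \<kappa> s f x) \<le> P * max s 1 powr - \<beta>"
    using avg_bound_uniform[OF assms(1)] by blast
  show ?thesis
  proof (rule pot_integrableI[OF assms(1) f_measurable _ weight_uniform_integrable[OF assms(2,3), of P]])
    fix s :: real assume "s \<in> {0<..}"
    then show "norm (s powr a *\<^sub>R avg \<kappa> s f x) \<le> P * (s powr a * max s 1 powr - \<beta>)"
      using mult_left_mono[OF P(2)[of s x], of "s powr a"] by (simp add: mult_ac)
  qed simp
qed

lemma GDERIV_pot_1:
  assumes "unit_kernel (\<kappa> :: 'a \<Rightarrow> real)" "Ck_on (Suc j) UNIV \<kappa>"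
  shows "GDERIV (pot {0<..} 1 \<kappa> f) x :> pot {0<..} 0 (gradient \<kappa>) f x"
proof -
  obtain P where P: "P > 0" "\<And>x s. 0 < s \<Longrightarrow> norm (avg (gradient \<kappa>) s f x) \<le> P * max s 1 powr - \<beta>"
    using avg_bound_uniform[OF kernel_gradient[OF assms]] by blast
  have "GDERIV (pot {0<..} 1 \<kappa> f) x :> pot {0<..} (1 - 1) (gradient \<kappa>) f x"
  proof (rule GDERIV_pot[OF assms f_loc_bounded _ _ zero_less_one])
    show "set_integrable lborel {0<..} (\<lambda>s. P * (s powr 0 * max s 1 powr - \<beta>))"
      by (rule weight_uniform_integrable) auto
  qed (use pot_integrable[OF assms(1), of 1] P in auto)
  then show ?thesis by simp
qed

lemma GDERIV_newton:
  "GDERIV (newton f) x :> newton_const TYPE('a) N *\<^sub>R pot {0<..} 0 (gradient (bump (Suc (Suc N)))) f x"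
proof -
  have "newton f = (\<lambda>x. newton_const TYPE('a) N * pot {0<..} 1 (bump (Suc (Suc N))) f x)"
    by (intro ext newton_pot)
  then show ?thesis
    using GDERIV_mult[OF GDERIV_const GDERIV_pot_1[OF bump_kernel bump_C1, of N x], of "newton_const TYPE('a) N"] by simp
qed

text \<open>This is \<open>min 1 t \<le> t powr \<theta>\<close> for \<open>t = h / s\<close>;
  \<open>v\<close> stands for the oscillation of an average at scale \<open>s\<close> over a
  distance \<open>h\<close>.\<close>

lemma min_le_interpolate:
  fixes h s \<theta> :: real
  assumes "0 \<le> h" "0 < s" "0 < \<theta>" "\<theta> \<le> 1" "0 \<le> P"
    and "v \<le> 2 * P" "v \<le> P * (h / s)"
  shows "v \<le> 2 * P * (h powr \<theta> * s powr - \<theta>)"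
proof -
  have eq: "h powr \<theta> * s powr - \<theta> = (h / s) powr \<theta>"
    using assms by (simp add: powr_divide powr_minus_divide)
  show ?thesis
  proof (cases "h / s \<le> 1")
    case True
    then have "h / s \<le> (h / s) powr \<theta>"
    proof (cases "h = 0")
      case False
      then have "0 < h / s" using assms by simp
      then have "(h / s) powr 1 \<le> (h / s) powr \<theta>" using True assms by (intro powr_mono') auto
      moreover have "(h / s) powr 1 = h / s" using \<open>0 < h / s\<close> by (intro powr_one) linarith
      ultimately show ?thesis by (simp only:)
    qed simp
    then have "P * (h / s) \<le> P * (h / s) powr \<theta>" using assms by (intro mult_left_mono) auto
    also have "\<dots> \<le> 2 * P * (h / s) powr \<theta>" using assms by (intro mult_right_mono) auto
    finally show ?thesis unfolding eq using assms by linarith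
  next
    case False
    then have "1 \<le> (h / s) powr \<theta>" using assms by (intro ge_one_powr_ge_zero) auto
    then have "2 * P * 1 \<le> 2 * P * (h / s) powr \<theta>" using assms by (intro mult_left_mono) auto
    then show ?thesis unfolding eq using assms by linarith
  qed
qed

text \<open>Over a distance \<open>h\<close> an average at scale \<open>s\<close> changes at most by
  twice its bound and at most by \<open>h / s\<close> times the bound for the gradient kernel.
  Interpolation leaves \<open>s powr - \<theta>\<close>, integrable at 0 for \<theta> < 1; the
  endpoint \<theta> = 1 is missed.\<close>

lemma pot_0_Hoelder:
  assumes k: "unit_kernel (\<kappa> :: 'a \<Rightarrow> real)" "Ck_on (Suc j) UNIV \<kappa>" and \<theta>: "0 < \<theta>" "\<theta> < 1"
  shows "ball_Hoelder \<theta> (pot {0<..} 0 \<kappa> f)"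
proof -
  obtain P1 where P1: "P1 > 0" "\<And>x s. 0 < s \<Longrightarrow> norm (avg \<kappa> s f x) \<le> P1 * max s 1 powr - \<beta>"
    using avg_bound_uniform[OF k(1)] by blast
  obtain P2 where P2: "P2 > 0" "\<And>x s. 0 < s \<Longrightarrow> norm (avg (gradient \<kappa>) s f x) \<le> P2 * max s 1 powr - \<beta>"
    using avg_bound_uniform[OF kernel_gradient[OF k]] by blast
  define P where "P = max P1 P2"
  have P: "P > 0" "P1 \<le> P" "P2 \<le> P" using P1(1) unfolding P_def by auto
  define K where "K = (LBINT s:{0<..}. s powr - \<theta> * max s 1 powr - \<beta>)"
  have int: "set_integrable lborel {0<..} (\<lambda>s. c * (s powr - \<theta> * max s 1 powr - \<beta>))" for c
    using \<theta> by (intro weight_uniform_integrable) auto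
  have K0: "0 \<le> K" unfolding K_def set_lebesgue_integral_def by (intro integral_nonneg_AE) auto
  have "dist (pot {0<..} 0 \<kappa> f x) (pot {0<..} 0 \<kappa> f y) \<le> (2 * P * K) * dist x y powr \<theta>" for x y
  proof -
    have i: "set_integrable lborel {0<..} (\<lambda>s. s powr 0 *\<^sub>R avg \<kappa> s f x)" for x
      using pot_integrable[OF k(1), of 0] by simp
    have le: "norm (s powr 0 *\<^sub>R avg \<kappa> s f x - s powr 0 *\<^sub>R avg \<kappa> s f y) \<le> (2 * P * dist x y powr \<theta>) * (s powr - \<theta> * max s 1 powr - \<beta>)"
      if s: "s \<in> {0<..}" for s
    proof -
      let ?w = "max s 1 powr - \<beta>"
      let ?v = "\<bar>avg \<kappa> s f x - avg \<kappa> s f y\<bar>"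
      have w: "0 \<le> ?w" by simp
      have Pw: "P1 * ?w \<le> P * ?w" "P2 * ?w \<le> P * ?w" using P by (intro mult_right_mono w; simp)+
      have 1: "?v \<le> 2 * (P * ?w)"
        using P1(2)[of s x] P1(2)[of s y] s Pw(1) by (auto simp: abs_le_iff)
      have "?v \<le> P2 * ?w / s * norm (x - y)"
      proof (rule GDERIV_increment_bound[where r = "dist x y + 1"])
        show "GDERIV (avg \<kappa> s f) z :> (1 / s) *\<^sub>R avg (gradient \<kappa>) s f z" for z
          using s by (intro GDERIV_avg[OF k f_loc_bounded]) auto
        show "norm ((1 / s) *\<^sub>R avg (gradient \<kappa>) s f z) \<le> P2 * ?w / s" for z
          using P2(2)[of s z] s by (simp add: divide_right_mono)
      qed simp
      also have "\<dots> = (P2 * ?w) * (dist x y / s)" by (simp add: dist_norm)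
      also have "\<dots> \<le> (P * ?w) * (dist x y / s)" using s by (intro mult_right_mono Pw) auto
      finally have 2: "?v \<le> (P * ?w) * (dist x y / s)" .
      have "?v \<le> 2 * (P * ?w) * (dist x y powr \<theta> * s powr - \<theta>)"
        using s \<theta> P by (intro min_le_interpolate 1 2) auto
      then show ?thesis using s by (simp add: mult_ac)
    qed
    have d: "pot {0<..} 0 \<kappa> f x - pot {0<..} 0 \<kappa> f y = (LBINT s:{0<..}. s powr 0 *\<^sub>R avg \<kappa> s f x - s powr 0 *\<^sub>R avg \<kappa> s f y)"
      unfolding pot_def by (rule set_integral_diff(2)[OF i i, symmetric])
    have "dist (pot {0<..} 0 \<kappa> f x) (pot {0<..} 0 \<kappa> f y) \<le> (LBINT s:{0<..}. norm (s powr 0 *\<^sub>R avg \<kappa> s f x - s powr 0 *\<^sub>R avg \<kappa> s f y))"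
      unfolding dist_norm d by (intro set_integral_norm_bound set_integral_diff(1)[OF i i])
    also have "\<dots> \<le> (LBINT s:{0<..}. (2 * P * dist x y powr \<theta>) * (s powr - \<theta> * max s 1 powr - \<beta>))"
      by (intro set_integral_mono set_integrable_norm set_integral_diff(1)[OF i i] int le)
    also have "\<dots> = (2 * P * K) * dist x y powr \<theta>"
      unfolding K_def set_integral_mult_right by simp
    finally show ?thesis .
  qed
  then show ?thesis
    unfolding ball_Hoelder_def using P(1) K0 by (intro allI exI[of _ "2 * P * K"]) auto
qed

lemma gradient_newton_component:
  "gradient (newton f) x \<bullet> b = newton_const TYPE('a) N * pot {0<..} 0 (\<lambda>z. gradient (bump (Suc (Suc N))) z \<bullet> b) f x"
proof -
  have k: "unit_kernel (gradient (bump (Suc (Suc N)) :: 'a \<Rightarrow> real))"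
    by (rule kernel_gradient[OF bump_kernel bump_C1])
  have "set_integrable lborel {0<..} (\<lambda>s. s powr 0 *\<^sub>R avg (gradient (bump (Suc (Suc N)))) s f x)"
    by (rule pot_integrable[OF k]) auto
  then show ?thesis
    using gradient_eqI[OF GDERIV_newton[of x N]] pot_inner[OF k f_loc_bounded, of "{0<..}" 0 x b] by simp
qed

lemma gradient_newton_Hoelder:
  assumes "0 < \<theta>" "\<theta> < 1" "b \<in> Basis"
  shows "ball_Hoelder \<theta> (\<lambda>x. gradient (newton f) x \<bullet> b)"
proof -
  \<comment> \<open>The exponent 3 leaves a derivative to spare: \<open>pot_0_Hoelder\<close> asks
    the component of the gradient kernel to be of class \<open>C^1\<close>.\<close>
  let ?\<kappa> = "\<lambda>z. gradient (bump (Suc (Suc 1)) :: 'a \<Rightarrow> real) z \<bullet> b"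
  have C2: "Ck_on (Suc (Suc 0)) UNIV (bump (Suc (Suc 1)) :: 'a \<Rightarrow> real)"
    using Ck_on_bump[of "Suc (Suc 0)" 0] by simp
  have "unit_kernel ?\<kappa>" by (rule kernel_inner[OF kernel_gradient[OF bump_kernel C2]])
  moreover have "Ck_on (Suc 0) UNIV ?\<kappa>" using C2 assms(3) unfolding Ck_on.simps(2)[of "Suc 0"] by blast
  ultimately have "ball_Hoelder \<theta> (\<lambda>x. newton_const TYPE('a) 1 * pot {0<..} 0 ?\<kappa> f x)"
    by (intro ball_Hoelder_mult ball_Hoelder_const pot_0_Hoelder assms)
  then show ?thesis by (simp only: gradient_newton_component[of _ b 1])
qed

lemma newton_C1: "Ck_on 1 UNIV (newton f)"
  unfolding One_nat_def Ck_on.simps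
proof (intro conjI ballI)
  show "newton f differentiable (at x)" for x
    using GDERIV_imp_differentiable[OF GDERIV_newton[of x 0]] .
  show "continuous_on UNIV (\<lambda>x. gradient (newton f) x \<bullet> b)" if "b \<in> Basis" for b
    using gradient_newton_Hoelder[of "1/2" b] that by (intro ball_Hoelder_continuous[of "1/2"]) auto
qed

end

text \<open>This constant determines \<open>Q\<close>. The bound for the gradient is one power
  better than that for the potential, but \<open>F_norm\<close> weighs both alike, so the gain is
  discarded.\<close>

lemma newton_decay:
  fixes \<beta> :: real
  assumes \<beta>: "2 < \<beta>" "\<beta> < real DIM('a::euclidean_space)"
  shows "\<exists>C>0. \<forall>A (f :: 'a \<Rightarrow> real) x. decaying \<beta> A f \<longrightarrow>
    \<bar>newton f x\<bar> + norm (gradient (newton f) x) \<le> C * A * (1 + norm x) powr (2 - \<beta>)"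
proof -
  let ?\<psi> = "bump (Suc (Suc 0)) :: 'a \<Rightarrow> real"
  let ?c = "newton_const TYPE('a) 0"
  have dim: "3 \<le> DIM('a)" using \<beta> by simp
  note c = newton_const_pos[OF dim, of 0]
  obtain C1 where C1: "0 < C1" "\<forall>(\<kappa> :: 'a \<Rightarrow> real) M A f x. unit_kernel \<kappa> \<longrightarrow> (\<forall>z. norm (\<kappa> z) \<le> M) \<longrightarrow>
    decaying \<beta> A f \<longrightarrow> set_integrable lborel {0<..} (\<lambda>s. s powr 1 *\<^sub>R avg \<kappa> s f x) \<and>
    norm (pot {0<..} 1 \<kappa> f x) \<le> C1 * M * A * (1 + norm x) powr (1 + 1 - \<beta>)"
    using decaying_pot_bound[OF _ \<beta>(2), of 1, where 'b = real] \<beta> by (simp, blast)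
  obtain C0 where C0: "0 < C0" "\<forall>(\<kappa> :: 'a \<Rightarrow> 'a) M A f x. unit_kernel \<kappa> \<longrightarrow> (\<forall>z. norm (\<kappa> z) \<le> M) \<longrightarrow>
    decaying \<beta> A f \<longrightarrow> set_integrable lborel {0<..} (\<lambda>s. s powr 0 *\<^sub>R avg \<kappa> s f x) \<and>
    norm (pot {0<..} 0 \<kappa> f x) \<le> C0 * M * A * (1 + norm x) powr (0 + 1 - \<beta>)"
    using decaying_pot_bound[OF _ \<beta>(2), of 0, where 'b = 'a] \<beta> by (simp, blast)
  have kg: "unit_kernel (gradient ?\<psi>)"
    by (rule kernel_gradient[OF bump_kernel bump_C1])
  obtain M where M: "M > 0" "\<And>z. norm (gradient ?\<psi> z) \<le> M"
    using kernel_bounded[OF kg] by metis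
  have "\<bar>newton f x\<bar> + norm (gradient (newton f) x) \<le> (?c * (C1 + C0 * M)) * A * (1 + norm x) powr (2 - \<beta>)"
    if f: "decaying \<beta> A f" for A f and x :: 'a
  proof -
    interpret decaying_density \<beta> A f using \<beta> f by unfold_locales
    have A: "0 \<le> A" by (rule decaying_nonneg[OF f])
    have "\<forall>z. norm (?\<psi> z) \<le> 1" by (simp add: bump_nonneg bump_le_1)
    then have "norm (pot {0<..} 1 ?\<psi> f x) \<le> C1 * 1 * A * (1 + norm x) powr (1 + 1 - \<beta>)"
      using C1(2)[rule_format, OF bump_kernel _ f, of "Suc 0" 1 x] by simp
    then have 1: "\<bar>newton f x\<bar> \<le> ?c * (C1 * A * (1 + norm x) powr (2 - \<beta>))"
      using c by (simp add: newton_pot[of x 0] abs_mult)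
    have "norm (pot {0<..} 0 (gradient ?\<psi>) f x) \<le> C0 * M * A * (1 + norm x) powr (0 + 1 - \<beta>)"
      using C0(2)[rule_format, OF kg M(2) f, of x] by simp
    also have "\<dots> \<le> C0 * M * A * (1 + norm x) powr (2 - \<beta>)"
      using C0(1) M(1) A by (intro mult_left_mono powr_mono) auto
    finally have 2: "norm (gradient (newton f) x) \<le> ?c * (C0 * M * A * (1 + norm x) powr (2 - \<beta>))"
      using c by (simp add: gradient_eqI[OF GDERIV_newton[of x 0]])
    show ?thesis using add_mono[OF 1 2] by (simp add: algebra_simps)
  qed
  moreover have "0 < ?c * (C1 + C0 * M)" using c C1(1) C0(1) M(1) by (simp add: add_pos_pos)
  ultimately show ?thesis by blast
qed

section \<open>The Newtonian potential solves the Poisson equation\<close>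

text \<open>Exhaustion by compact intervals and dominated convergence. In the applications
  \<open>s\<close> is the scale: the limit at 0 produces the density, the limit at infinity is
  0.\<close>

lemma improper_FTC:
  fixes A T :: "real \<Rightarrow> real"
  assumes D: "\<And>s. 0 < s \<Longrightarrow> DERIV A s :> T s"
    and int: "set_integrable lborel {0<..} T"
    and L0: "(A \<longlongrightarrow> L0) (at_right 0)" and L1: "(A \<longlongrightarrow> L1) at_top"
  shows "(LBINT s:{0<..}. T s) = L1 - L0"
proof -
  define a where "a n = 1 / real (Suc n)" for n
  define b where "b n = real n + 2" for n
  have a0: "0 < a n" and ab: "a n \<le> b n" for n
    by (auto simp: a_def b_def field_simps)
  have alim: "a \<longlonglongrightarrow> 0" unfolding a_def using LIMSEQ_inverse_real_of_nat by (simp add: divide_inverse)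
  have blim: "filterlim b at_top sequentially"
    unfolding b_def using filterlim_tendsto_add_at_top[OF tendsto_const filterlim_real_sequentially, of 2] by (simp add: add.commute)
  have part: "(LBINT s:{a n..b n}. T s) = A (b n) - A (a n)" for n
  proof -
    have "set_integrable lborel {a n..b n} T"
      by (rule set_integrable_subset[OF int]) (use a0[of n] in auto)
    then have "(LBINT s:{a n..b n}. T s) = integral {a n..b n} T"
      by (rule set_borel_integral_eq_integral(2))
    also have "(T has_integral (A (b n) - A (a n))) {a n..b n}"
    proof (rule fundamental_theorem_of_calculus[OF ab])
      fix s assume "s \<in> {a n..b n}"
      then have "0 < s" using a0[of n] by auto
      then show "(A has_vector_derivative T s) (at s within {a n..b n})"
        using D has_field_derivative_at_within has_real_derivative_iff_has_vector_derivative by blast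
    qed
    then have "integral {a n..b n} T = A (b n) - A (a n)" by (rule integral_unique)
    finally show ?thesis .
  qed
  have "(\<lambda>n. LBINT s:{a n..b n}. T s) \<longlonglongrightarrow> (LBINT s:{0<..}. T s)"
    unfolding set_lebesgue_integral_def
  proof (rule integral_dominated_convergence)
    show "integrable lborel (\<lambda>s. norm (indicat_real {0<..} s *\<^sub>R T s))"
      using int by (intro integrable_norm) (simp add: set_integrable_def)
    show m: "(\<lambda>s. indicat_real {0<..} s *\<^sub>R T s) \<in> borel_measurable lborel"
      using int by (auto simp: set_integrable_def)
    show "(\<lambda>s. indicat_real {a n..b n} s *\<^sub>R T s) \<in> borel_measurable lborel" for n
    proof -
      have "(\<lambda>s. indicat_real {a n..b n} s *\<^sub>R T s) = (\<lambda>s. indicat_real {a n..b n} s *\<^sub>R (indicat_real {0<..} s *\<^sub>R T s))"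
        using a0[of n] by (auto simp: indicator_def fun_eq_iff)
      then show ?thesis using m by simp
    qed
    show "AE s in lborel. norm (indicat_real {a n..b n} s *\<^sub>R T s) \<le> norm (indicat_real {0<..} s *\<^sub>R T s)" for n
      using a0[of n] by (intro AE_I2) (auto simp: indicator_def)
    show "AE s in lborel. (\<lambda>n. indicat_real {a n..b n} s *\<^sub>R T s) \<longlonglongrightarrow> indicat_real {0<..} s *\<^sub>R T s"
    proof (rule AE_I2)
      fix s :: real
      show "(\<lambda>n. indicat_real {a n..b n} s *\<^sub>R T s) \<longlonglongrightarrow> indicat_real {0<..} s *\<^sub>R T s"
      proof (cases "0 < s")
        case True
        have "\<forall>\<^sub>F n in sequentially. a n < s" using order_tendstoD(2)[OF alim True] .
        moreover have "\<forall>\<^sub>F n in sequentially. s \<le> b n" using blim by (simp add: filterlim_at_top)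
        ultimately have "\<forall>\<^sub>F n in sequentially. indicat_real {a n..b n} s *\<^sub>R T s = indicat_real {0<..} s *\<^sub>R T s"
          by eventually_elim (use True in auto)
        then show ?thesis by (rule tendsto_eventually)
      next
        case False
        have "indicat_real {a n..b n} s *\<^sub>R T s = indicat_real {0<..} s *\<^sub>R T s" for n
          using False a0[of n] by (auto simp: indicator_def)
        then show ?thesis by (simp only: tendsto_const)
      qed
    qed
  qed
  moreover have "(\<lambda>n. A (b n) - A (a n)) \<longlonglongrightarrow> L1 - L0"
  proof (rule tendsto_diff)
    show "(\<lambda>n. A (b n)) \<longlonglongrightarrow> L1" by (rule filterlim_compose[OF L1 blim])
    have "filterlim a (at_right 0) sequentially"
      unfolding filterlim_at using alim a0 less_imp_neq[OF a0] by (auto intro!: always_eventually)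
    then show "(\<lambda>n. A (a n)) \<longlonglongrightarrow> L0" by (rule filterlim_compose[OF L0])
  qed
  ultimately show ?thesis unfolding part by (rule LIMSEQ_unique)
qed

lemma integrable_bounded_support:
  fixes h :: "'c::euclidean_space \<Rightarrow> real"
  assumes "h \<in> borel_measurable borel" "\<And>p. \<bar>h p\<bar> \<le> B" "\<And>p. R < norm p \<Longrightarrow> h p = 0"
  shows "integrable lborel h"
proof (rule Bochner_Integration.integrable_bound[OF indicator_ball_integrable[of B 0 R]])
  show "AE p in lborel. norm (h p) \<le> norm (B * indicat_real (cball 0 R) p)"
    using assms(2,3) by (intro AE_I2) (auto simp: indicator_def not_le intro: order_trans[OF _ abs_ge_self])
qed (use assms in simp)

lemma norm_pair_cases:
  assumes "R + S < norm (p :: 'a::real_normed_vector \<times> 'b::real_normed_vector)"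
  shows "R < norm (fst p) \<or> S < norm (snd p)"
  using norm_Pair_le[of "fst p" "snd p"] assms by auto

text \<open>The substitution \<open>x = y + s z\<close> shifts the scale from the density to
  \<open>\<Phi>\<close>, so that the right side can be differentiated in \<open>s\<close> although
  \<open>f\<close> is only locally bounded.\<close>

lemma
  fixes \<kappa> :: "'a::euclidean_space \<Rightarrow> 'b::euclidean_space"
  assumes \<kappa>: "unit_kernel \<kappa>" and f: "loc_bounded f"
    and \<Phi>: "continuous_on UNIV \<Phi>" "\<And>x. R < norm x \<Longrightarrow> \<Phi> x = 0"
  shows pairing_integrable: "integrable lborel (\<lambda>p. f (fst p) * (\<kappa> (snd p) \<bullet> \<Phi> (fst p + s *\<^sub>R snd p)))"
    and pairing_swap: "(\<integral>x. \<Phi> x \<bullet> avg \<kappa> s f x \<partial>lborel) =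
      (\<integral>p. f (fst p) * (\<kappa> (snd p) \<bullet> \<Phi> (fst p + s *\<^sub>R snd p)) \<partial>lborel)"
proof -
  note [measurable] = kernel_measurable[OF \<kappa>] borel_measurable_continuous_onI[OF \<Phi>(1)]
  have [measurable]: "f \<in> borel_measurable borel" using f by (simp add: loc_bounded_def)
  obtain M where M: "M > 0" "\<And>z. norm (\<kappa> z) \<le> M"
    using kernel_bounded[OF \<kappa>] by metis
  have k0: "\<kappa> z = 0" if "1 < norm z" for z using \<kappa> that by (simp add: unit_kernel_def)
  obtain L where L: "L > 0" "\<And>x. norm x \<le> R \<Longrightarrow> norm (\<Phi> x) \<le> L"
    using continuous_bounded_on_cball[OF \<Phi>(1)] by metis
  have L': "norm (\<Phi> x) \<le> L" for x using L \<Phi>(2)[of x] by (cases "norm x \<le> R") auto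
  obtain B where B: "\<And>y. norm y \<le> R + \<bar>s\<bar> \<Longrightarrow> \<bar>f y\<bar> \<le> B"
    using f unfolding loc_bounded_def by meson
  have in1: "norm (x - s *\<^sub>R z) \<le> R + \<bar>s\<bar>" if "norm x \<le> R" "norm z \<le> 1" for x z :: 'a
  proof -
    have "\<bar>s\<bar> * norm z \<le> \<bar>s\<bar>" using that by (simp add: mult_left_le)
    then show ?thesis using norm_triangle_ineq4[of x "s *\<^sub>R z"] that by simp
  qed
  \<comment> \<open>The three variables are kept independent so that one estimate serves
    \<open>G\<close>, where \<open>y = x - s z\<close>, and \<open>H\<close>, where
    \<open>x = y + s z\<close>.\<close>
  have bound: "\<bar>f y * (\<kappa> z \<bullet> \<Phi> x)\<bar> \<le> \<bar>B\<bar> * (M * L)" if "norm x \<le> R \<Longrightarrow> norm z \<le> 1 \<Longrightarrow> norm y \<le> R + \<bar>s\<bar>" for x y z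
  proof (cases "norm x \<le> R \<and> norm z \<le> 1")
    case True
    have "\<bar>\<kappa> z \<bullet> \<Phi> x\<bar> \<le> norm (\<kappa> z) * norm (\<Phi> x)" by (rule Cauchy_Schwarz_ineq2)
    also have "\<dots> \<le> M * L" using M L' by (intro mult_mono) auto
    finally show ?thesis
      unfolding abs_mult using B[of y] that True by (intro mult_mono) auto
  next
    case False
    then have "\<kappa> z \<bullet> \<Phi> x = 0" using k0[of z] \<Phi>(2)[of x] by auto
    then show ?thesis using M(1) L(1) by simp
  qed
  define G where "G x z = f (x - s *\<^sub>R z) * (\<kappa> z \<bullet> \<Phi> x)" for x z
  define H where "H y z = f y * (\<kappa> z \<bullet> \<Phi> (y + s *\<^sub>R z))" for y z
  have "integrable (lborel :: ('a \<times> 'a) measure) (\<lambda>p. G (fst p) (snd p))"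
  proof (rule integrable_bounded_support)
    have "(\<lambda>p. G (fst p) (snd p)) \<in> borel_measurable (borel \<Otimes>\<^sub>M borel)" unfolding G_def by measurable
    then show "(\<lambda>p. G (fst p) (snd p)) \<in> borel_measurable borel" by (simp only: borel_prod)
    show "\<bar>G (fst p) (snd p)\<bar> \<le> \<bar>B\<bar> * (M * L)" for p
      unfolding G_def using in1 by (intro bound) auto
    show "G (fst p) (snd p) = 0" if "R + 1 < norm p" for p
      using norm_pair_cases[OF that] k0[of "snd p"] \<Phi>(2)[of "fst p"] unfolding G_def by auto
  qed
  then have Gi: "integrable (lborel \<Otimes>\<^sub>M lborel) (\<lambda>(x, z). G x z)" by (simp only: lborel_prod case_prod_unfold)
  have H: "integrable (lborel :: ('a \<times> 'a) measure) (\<lambda>p. H (fst p) (snd p))"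
  proof (rule integrable_bounded_support)
    have "(\<lambda>p. H (fst p) (snd p)) \<in> borel_measurable (borel \<Otimes>\<^sub>M borel)" unfolding H_def by measurable
    then show "(\<lambda>p. H (fst p) (snd p)) \<in> borel_measurable borel" by (simp only: borel_prod)
    show "\<bar>H (fst p) (snd p)\<bar> \<le> \<bar>B\<bar> * (M * L)" for p
      unfolding H_def
    proof (rule bound)
      assume "norm (fst p + s *\<^sub>R snd p) \<le> R" "norm (snd p) \<le> 1"
      from in1[OF this] show "norm (fst p) \<le> R + \<bar>s\<bar>" by simp
    qed
    show "H (fst p) (snd p) = 0" if "(R + \<bar>s\<bar>) + 1 < norm p" for p
    proof (cases "norm (snd p) \<le> 1 \<and> norm (fst p + s *\<^sub>R snd p) \<le> R")
      case True
      then have "norm (fst p) \<le> R + \<bar>s\<bar>" using in1[of "fst p + s *\<^sub>R snd p" "snd p"] by simp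
      then show ?thesis using norm_pair_cases[OF that] True by auto
    next
      case False
      then show ?thesis using k0[of "snd p"] \<Phi>(2)[of "fst p + s *\<^sub>R snd p"] unfolding H_def by auto
    qed
  qed
  then have Hi: "integrable (lborel \<Otimes>\<^sub>M lborel) (\<lambda>(y, z). H y z)" by (simp only: lborel_prod case_prod_unfold)
  show "integrable lborel (\<lambda>p. f (fst p) * (\<kappa> (snd p) \<bullet> \<Phi> (fst p + s *\<^sub>R snd p)))"
    using H unfolding H_def .
  have "(\<integral>x. \<Phi> x \<bullet> avg \<kappa> s f x \<partial>lborel) = (\<integral>x. (\<integral>z. G x z \<partial>lborel) \<partial>lborel)"
  proof (rule Bochner_Integration.integral_cong[OF refl])
    fix x
    have "\<Phi> x \<bullet> avg \<kappa> s f x = (\<integral>z. \<Phi> x \<bullet> (f (x - s *\<^sub>R z) *\<^sub>R \<kappa> z) \<partial>lborel)"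
      unfolding avg_def by (rule integral_inner_right[symmetric]) (rule avg_integrable[OF \<kappa> f])
    then show "\<Phi> x \<bullet> avg \<kappa> s f x = (\<integral>z. G x z \<partial>lborel)"
      by (simp add: G_def inner_commute)
  qed
  also have "\<dots> = (\<integral>z. (\<integral>x. G x z \<partial>lborel) \<partial>lborel)"
    by (rule lborel_pair.Fubini_integral[OF Gi, symmetric])
  also have "\<dots> = (\<integral>z. (\<integral>y. H y z \<partial>lborel) \<partial>lborel)"
  proof (rule Bochner_Integration.integral_cong[OF refl])
    fix z
    have "(\<lambda>x. G x z) \<in> borel_measurable borel" unfolding G_def by measurable
    from lborel_integral_affine[OF this, of 1 "s *\<^sub>R z"]
    show "(\<integral>x. G x z \<partial>lborel) = (\<integral>y. H y z \<partial>lborel)"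
      by (simp add: G_def H_def add.commute)
  qed
  also have "\<dots> = (\<integral>p. H (fst p) (snd p) \<partial>(lborel \<Otimes>\<^sub>M lborel))"
    using lborel_pair.integral_snd[OF Hi] by (simp only: case_prod_unfold)
  finally show "(\<integral>x. \<Phi> x \<bullet> avg \<kappa> s f x \<partial>lborel) =
      (\<integral>p. f (fst p) * (\<kappa> (snd p) \<bullet> \<Phi> (fst p + s *\<^sub>R snd p)) \<partial>lborel)"
    by (simp only: lborel_prod H_def)
qed

lemma gradient_support:
  fixes \<phi> :: "'a::euclidean_space \<Rightarrow> real"
  assumes "\<And>x. R < norm x \<Longrightarrow> \<phi> x = 0" "R < norm x"
  shows "gradient \<phi> x = 0"
proof (rule gradient_eqI)
  have o: "open {z::'a. R < norm z}" by (intro open_Collect_less continuous_intros)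
  have "((\<lambda>_. 0) has_derivative (\<lambda>_. 0)) (at x)" by (rule has_derivative_const)
  then have "(\<phi> has_derivative (\<lambda>_. 0)) (at x)"
    by (rule has_derivative_transform_within_open[OF _ o]) (use assms in auto)
  then show "GDERIV \<phi> x :> 0" by (simp add: gderiv_def)
qed

context decaying_density
begin

lemma DERIV_pairing:
  fixes \<eta> :: "'a \<Rightarrow> real" and \<phi> :: "'a \<Rightarrow> real"
  assumes k: "unit_kernel \<eta>"
    and \<phi>: "\<And>x. \<phi> differentiable (at x)" "continuous_on UNIV (gradient \<phi>)" "\<And>x. R < norm x \<Longrightarrow> \<phi> x = 0"
  shows "DERIV (\<lambda>s. \<integral>p. f (fst p) * (\<eta> (snd p) \<bullet> \<phi> (fst p + s *\<^sub>R snd p)) \<partial>lborel) s0 :>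
    (\<integral>p. f (fst p) * ((\<eta> (snd p) *\<^sub>R snd p) \<bullet> gradient \<phi> (fst p + s0 *\<^sub>R snd p)) \<partial>lborel)"
proof -
  have \<phi>c: "continuous_on UNIV \<phi>"
    using \<phi>(1) by (intro continuous_at_imp_continuous_on) (auto intro: differentiable_imp_continuous_within)
  obtain M where M: "M > 0" "\<And>z. norm (\<eta> z) \<le> M"
    using kernel_bounded[OF k] by metis
  have k0: "\<eta> z = 0" if "1 < norm z" for z using k that by (simp add: unit_kernel_def)
  obtain L where L: "L > 0" "\<And>x. norm x \<le> R \<Longrightarrow> norm (gradient \<phi> x) \<le> L"
    using continuous_bounded_on_cball[OF \<phi>(2)] by metis
  have g0: "gradient \<phi> x = 0" if "R < norm x" for x
    by (rule gradient_support[OF \<phi>(3) that])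
  have L': "norm (gradient \<phi> x) \<le> L" for x using L g0[of x] by (cases "norm x \<le> R") auto
  define S where "S = R + (\<bar>s0\<bar> + 1)"
  obtain B where B: "\<And>y. norm y \<le> S \<Longrightarrow> \<bar>f y\<bar> \<le> B"
    using f_loc_bounded unfolding loc_bounded_def by meson
  have "GDERIV (\<lambda>s. \<integral>p. f (fst p) * (\<eta> (snd p) \<bullet> \<phi> (fst p + s *\<^sub>R snd p)) \<partial>lborel) s0 :>
    (\<integral>p. f (fst p) * ((\<eta> (snd p) *\<^sub>R snd p) \<bullet> gradient \<phi> (fst p + s0 *\<^sub>R snd p)) \<partial>lborel)"
  proof (rule GDERIV_integral[where r = 1])
    show "integrable lborel (\<lambda>p. f (fst p) * (\<eta> (snd p) \<bullet> \<phi> (fst p + s *\<^sub>R snd p)))" for s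
      by (rule pairing_integrable[OF k f_loc_bounded \<phi>c \<phi>(3)])
    show "integrable lborel (\<lambda>p :: 'a \<times> 'a. \<bar>B\<bar> * (M * L) * indicator (cball 0 (S + 1)) p)"
      by (rule indicator_ball_integrable)
    fix s and p :: "'a \<times> 'a" assume s: "dist s s0 < 1"
    show "GDERIV (\<lambda>s. f (fst p) * (\<eta> (snd p) \<bullet> \<phi> (fst p + s *\<^sub>R snd p))) s :>
       f (fst p) * ((\<eta> (snd p) *\<^sub>R snd p) \<bullet> gradient \<phi> (fst p + s *\<^sub>R snd p))"
    proof -
      have "((\<lambda>s. \<phi> (fst p + s *\<^sub>R snd p)) has_derivative (\<lambda>h. (h *\<^sub>R snd p) \<bullet> gradient \<phi> (fst p + s *\<^sub>R snd p))) (at s)"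
      proof (rule has_derivative_compose[where f = "\<lambda>s. fst p + s *\<^sub>R snd p" and f' = "\<lambda>h. h *\<^sub>R snd p"])
        show "((\<lambda>s. fst p + s *\<^sub>R snd p) has_derivative (\<lambda>h. h *\<^sub>R snd p)) (at s)"
          by (auto intro!: derivative_eq_intros)
        show "(\<phi> has_derivative (\<lambda>h. h \<bullet> gradient \<phi> (fst p + s *\<^sub>R snd p))) (at (fst p + s *\<^sub>R snd p))"
          using differentiable_imp_GDERIV_gradient[OF \<phi>(1)] by (simp add: gderiv_def)
      qed
      then have "DERIV (\<lambda>s. \<phi> (fst p + s *\<^sub>R snd p)) s :> snd p \<bullet> gradient \<phi> (fst p + s *\<^sub>R snd p)"
        unfolding has_field_derivative_def by (rule has_derivative_eq_rhs) (auto simp: mult.commute)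
      from DERIV_cmult[OF this, of "f (fst p) * \<eta> (snd p)"] show ?thesis by (simp add: mult_ac)
    qed
    show "norm (f (fst p) * ((\<eta> (snd p) *\<^sub>R snd p) \<bullet> gradient \<phi> (fst p + s *\<^sub>R snd p)))
      \<le> \<bar>B\<bar> * (M * L) * indicator (cball 0 (S + 1)) p"
    proof (cases "norm (snd p) \<le> 1 \<and> norm (fst p + s *\<^sub>R snd p) \<le> R")
      case True
      have "\<bar>s\<bar> * norm (snd p) \<le> \<bar>s\<bar>" using True by (simp add: mult_left_le)
      moreover have "\<bar>s\<bar> \<le> \<bar>s0\<bar> + 1" using s by (simp add: dist_real_def)
      moreover have "norm (fst p) \<le> norm (fst p + s *\<^sub>R snd p) + \<bar>s\<bar> * norm (snd p)"
        using norm_triangle_ineq4[of "fst p + s *\<^sub>R snd p" "s *\<^sub>R snd p"] by simp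
      ultimately have S: "norm (fst p) \<le> S" using True unfolding S_def by linarith
      have p: "norm p \<le> S + 1" using norm_Pair_le[of "fst p" "snd p"] S True by simp
      have "\<bar>(\<eta> (snd p) *\<^sub>R snd p) \<bullet> gradient \<phi> (fst p + s *\<^sub>R snd p)\<bar>
          \<le> norm (\<eta> (snd p) *\<^sub>R snd p) * norm (gradient \<phi> (fst p + s *\<^sub>R snd p))"
        by (rule Cauchy_Schwarz_ineq2)
      also have "\<dots> \<le> M * L"
      proof (rule mult_mono)
        have "\<bar>\<eta> (snd p)\<bar> * norm (snd p) \<le> M * 1" using M True by (intro mult_mono) auto
        then show "norm (\<eta> (snd p) *\<^sub>R snd p) \<le> M" by simp
      qed (use L' M(1) in auto)
      finally have "\<bar>f (fst p)\<bar> * \<bar>(\<eta> (snd p) *\<^sub>R snd p) \<bullet> gradient \<phi> (fst p + s *\<^sub>R snd p)\<bar> \<le> \<bar>B\<bar> * (M * L)"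
        using B[OF S] by (intro mult_mono) auto
      then show ?thesis using p by (simp add: abs_mult)
    next
      case False
      then have z: "(\<eta> (snd p) *\<^sub>R snd p) \<bullet> gradient \<phi> (fst p + s *\<^sub>R snd p) = 0"
        using k0[of "snd p"] g0[of "fst p + s *\<^sub>R snd p"] by auto
      show ?thesis unfolding z using M(1) L(1) by simp
    qed
  qed simp
  then show ?thesis by simp
qed

text \<open>Let \<open>gradient \<psi> z = \<eta> z *\<^sub>R z\<close>. The pairing
  \<open>A s\<close> of \<phi> with the average of \<open>f\<close> against \<eta> has as its
  \<open>s\<close>-derivative the pairing of \<open>gradient \<phi>\<close> with the average against
  \<open>gradient \<psi>\<close>, which is the scale integrand of the left side. Integrating in
  \<open>s\<close> leaves \<open>- A 0\<close>, where \<open>A 0\<close> is the integral of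
  \<open>f * \<phi>\<close> times that of \<eta>, and the constants cancel by
  \<open>newton_const_flux\<close>.\<close>

lemma newton_weak:
  fixes \<phi> :: "'a \<Rightarrow> real"
  assumes \<phi>: "\<And>x. \<phi> differentiable (at x)" "continuous_on UNIV (gradient \<phi>)" "\<And>x. R < norm x \<Longrightarrow> \<phi> x = 0"
  shows "(\<integral>x. gradient (newton f) x \<bullet> gradient \<phi> x \<partial>lborel) = (\<integral>x. f x * \<phi> x \<partial>lborel)"
proof -
  let ?c = "newton_const TYPE('a) 0"
  define \<eta> where "\<eta> z = - 2 * real (Suc (Suc 0)) * bump (Suc 0) z" for z :: 'a
  have k: "unit_kernel \<eta>"
    using bump_kernel[of 0, where 'a = 'a] unfolding unit_kernel_def \<eta>_def by (auto intro!: continuous_intros)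
  have g: "gradient (bump (Suc (Suc 0))) = (\<lambda>z::'a. \<eta> z *\<^sub>R z)"
    unfolding gradient_bump \<eta>_def ..
  have kg: "unit_kernel (\<lambda>z. \<eta> z *\<^sub>R z)"
    using kernel_gradient[OF bump_kernel bump_C1, of 0, where 'a = 'a] unfolding g .
  have \<phi>c: "continuous_on UNIV \<phi>"
    using \<phi>(1) by (intro continuous_at_imp_continuous_on) (auto intro: differentiable_imp_continuous_within)
  note g0 = gradient_support[OF \<phi>(3)]
  have abs_int: "integrable lborel (\<lambda>x. norm (\<Phi> x))"
    if c: "continuous_on UNIV \<Phi>" and z: "\<And>x. R < norm x \<Longrightarrow> \<Phi> x = 0" for \<Phi> :: "'a \<Rightarrow> 'b::euclidean_space"
  proof -
    obtain L where L: "L > 0" "\<And>x. norm x \<le> R \<Longrightarrow> norm (\<Phi> x) \<le> L"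
      using continuous_bounded_on_cball[OF c] by metis
    have "norm (\<Phi> x) \<le> L" for x using L z[of x] by (cases "norm x \<le> R") auto
    then show ?thesis
      using borel_measurable_continuous_onI[OF c] z
      by (intro integrable_bounded_support[of _ L R]) auto
  qed
  define A where "A s = (\<integral>p. f (fst p) * (\<eta> (snd p) \<bullet> \<phi> (fst p + s *\<^sub>R snd p)) \<partial>lborel)" for s
  define T where "T s = (\<integral>x. gradient \<phi> x \<bullet> avg (\<lambda>z. \<eta> z *\<^sub>R z) s f x \<partial>lborel)" for s
  have D: "DERIV A s :> T s" for s
  proof -
    have "T s = (\<integral>p. f (fst p) * ((\<eta> (snd p) *\<^sub>R snd p) \<bullet> gradient \<phi> (fst p + s *\<^sub>R snd p)) \<partial>lborel)"
      unfolding T_def by (rule pairing_swap[OF kg f_loc_bounded \<phi>(2) g0])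
    then show ?thesis
      using DERIV_pairing[OF k \<phi>] unfolding A_def by (simp only:)
  qed
  obtain P where P: "P > 0" "\<And>x s. 0 < s \<Longrightarrow> norm (avg (\<lambda>z. \<eta> z *\<^sub>R z) s f x) \<le> P * max s 1 powr - \<beta>"
    using avg_bound_uniform[OF kg] by blast
  obtain P' where P': "P' > 0" "\<And>x s. 0 < s \<Longrightarrow> norm (avg \<eta> s f x) \<le> P' * max s 1 powr - \<beta>"
    using avg_bound_uniform[OF k] by blast
  \<comment> \<open>The dominating function is a product: \<open>norm (gradient \<phi> x)\<close>,
    of bounded support, and the integrable scale weight with \<open>a = 0\<close>.\<close>
  have pair: "integrable (lborel \<Otimes>\<^sub>M lborel) (\<lambda>(x, s). indicat_real {0<..} s * (gradient \<phi> x \<bullet> avg (\<lambda>z. \<eta> z *\<^sub>R z) s f x))"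
  proof (rule Bochner_Integration.integrable_bound)
    let ?b = "\<lambda>s. indicat_real {0<..} s *\<^sub>R (P * (s powr 0 * max s 1 powr - \<beta>))"
    have b: "integrable lborel ?b" using weight_uniform_integrable[of 0 P] by (simp add: set_integrable_def)
    note a = abs_int[OF \<phi>(2) g0]
    show "integrable (lborel \<Otimes>\<^sub>M lborel) (\<lambda>(x, s). norm (gradient \<phi> x) * ?b s)"
    proof (rule lborel_pair.Fubini_integrable)
      have [measurable]: "gradient \<phi> \<in> borel_measurable borel" by (rule borel_measurable_continuous_onI[OF \<phi>(2)])
      show "(\<lambda>(x, s). norm (gradient \<phi> x) * ?b s) \<in> borel_measurable (lborel \<Otimes>\<^sub>M lborel)" by measurable
      show "AE x in lborel. integrable lborel (\<lambda>s. case (x, s) of (x, s) \<Rightarrow> norm (gradient \<phi> x) * ?b s)"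
        using b by (intro AE_I2) simp
      have "(\<lambda>x. \<integral>s. norm (case (x, s) of (x, s) \<Rightarrow> norm (gradient \<phi> x) * ?b s) \<partial>lborel) = (\<lambda>x. norm (gradient \<phi> x) * (\<integral>s. norm (?b s) \<partial>lborel))"
        by (simp only: case_prod_conv real_norm_def abs_mult abs_norm_cancel integral_mult_right_zero)
      then show "integrable lborel (\<lambda>x. \<integral>s. norm (case (x, s) of (x, s) \<Rightarrow> norm (gradient \<phi> x) * ?b s) \<partial>lborel)"
        using a by simp
    qed
    have "(\<lambda>p. avg (\<lambda>z. \<eta> z *\<^sub>R z) (fst p) f (snd p)) \<in> borel_measurable (borel \<Otimes>\<^sub>M borel)"
      using avg_measurable[OF kg f_measurable] by (simp only: borel_prod)
    from measurable_compose[OF measurable_pair_swap' this]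
    have [measurable]: "(\<lambda>p. avg (\<lambda>z. \<eta> z *\<^sub>R z) (snd p) f (fst p)) \<in> borel_measurable (borel \<Otimes>\<^sub>M borel)"
      by (simp add: case_prod_beta)
    have [measurable]: "gradient \<phi> \<in> borel_measurable borel" by (rule borel_measurable_continuous_onI[OF \<phi>(2)])
    have "(\<lambda>p. indicat_real {0<..} (snd p) * (gradient \<phi> (fst p) \<bullet> avg (\<lambda>z. \<eta> z *\<^sub>R z) (snd p) f (fst p))) \<in> borel_measurable (borel \<Otimes>\<^sub>M borel)"
      by measurable
    then show "(\<lambda>(x, s). indicat_real {0<..} s * (gradient \<phi> x \<bullet> avg (\<lambda>z. \<eta> z *\<^sub>R z) s f x)) \<in> borel_measurable (lborel \<Otimes>\<^sub>M lborel)"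
      unfolding case_prod_unfold lborel_prod borel_prod by simp
    show "AE p in lborel \<Otimes>\<^sub>M lborel. norm (case p of (x, s) \<Rightarrow> indicat_real {0<..} s * (gradient \<phi> x \<bullet> avg (\<lambda>z. \<eta> z *\<^sub>R z) s f x))
        \<le> norm (case p of (x, s) \<Rightarrow> norm (gradient \<phi> x) * ?b s)"
    proof (rule AE_I2)
      fix p :: "'a \<times> real"
      obtain x s where p: "p = (x, s)" by fastforce
      show "norm (case p of (x, s) \<Rightarrow> indicat_real {0<..} s * (gradient \<phi> x \<bullet> avg (\<lambda>z. \<eta> z *\<^sub>R z) s f x))
        \<le> norm (case p of (x, s) \<Rightarrow> norm (gradient \<phi> x) * ?b s)"
      proof (cases "0 < s")
        case True
        have "\<bar>gradient \<phi> x \<bullet> avg (\<lambda>z. \<eta> z *\<^sub>R z) s f x\<bar> \<le> norm (gradient \<phi> x) * norm (avg (\<lambda>z. \<eta> z *\<^sub>R z) s f x)"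
          by (rule Cauchy_Schwarz_ineq2)
        also have "\<dots> \<le> norm (gradient \<phi> x) * (P * max s 1 powr - \<beta>)"
          using P(2)[OF True] by (intro mult_left_mono) auto
        finally show ?thesis using True P(1) by (simp add: p abs_mult)
      qed (simp add: p)
    qed
  qed
  have Tint: "set_integrable lborel {0<..} T"
    unfolding set_integrable_def using lborel_pair.integrable_snd[OF pair] by (simp add: T_def)
  \<comment> \<open>At scale 0 the shift disappears and the double integral factorises.\<close>
  have A0: "A 0 = (\<integral>x. f x * \<phi> x \<partial>lborel) * (\<integral>z. \<eta> z \<partial>lborel)"
  proof -
    have "integrable lborel (\<lambda>p. f (fst p) * (\<eta> (snd p) \<bullet> \<phi> (fst p + 0 *\<^sub>R snd p)))"
      by (rule pairing_integrable[OF k f_loc_bounded \<phi>c \<phi>(3)])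
    then have i: "integrable (lborel \<Otimes>\<^sub>M lborel) (\<lambda>(y, z). (f y * \<phi> y) * \<eta> z)"
      by (simp add: lborel_prod case_prod_unfold mult_ac)
    have "A 0 = (\<integral>p. (case p of (y, z) \<Rightarrow> (f y * \<phi> y) * \<eta> z) \<partial>(lborel \<Otimes>\<^sub>M lborel))"
      unfolding A_def lborel_prod by (simp add: case_prod_unfold mult_ac)
    also have "\<dots> = (\<integral>y. (\<integral>z. (f y * \<phi> y) * \<eta> z \<partial>lborel) \<partial>lborel)"
      using lborel_pair.integral_fst[OF i] by simp
    finally show ?thesis by simp
  qed
  have "isCont A 0" using D[of 0] by (rule DERIV_isCont)
  then have L0: "(A \<longlongrightarrow> A 0) (at_right 0)" by (simp add: isCont_def filterlim_at_split)
  have L1: "(A \<longlongrightarrow> 0) at_top"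
  proof (rule Lim_null_comparison)
    let ?I = "\<integral>x. norm (\<phi> x) \<partial>lborel"
    show "\<forall>\<^sub>F s in at_top. norm (A s) \<le> ?I * P' * s powr - \<beta>"
      using eventually_ge_at_top[of 1]
    proof eventually_elim
      case (elim s)
      have "A s = (\<integral>x. \<phi> x \<bullet> avg \<eta> s f x \<partial>lborel)"
        unfolding A_def by (rule pairing_swap[OF k f_loc_bounded \<phi>c \<phi>(3), symmetric])
      also have "norm \<dots> \<le> (\<integral>x. norm (\<phi> x) * (P' * s powr - \<beta>) \<partial>lborel)"
      proof (rule Bochner_Integration.integral_norm_bound_integral)
        show i: "integrable lborel (\<lambda>x. norm (\<phi> x) * (P' * s powr - \<beta>))"
          using abs_int[OF \<phi>c \<phi>(3)] by simp
        show le: "norm (\<phi> x \<bullet> avg \<eta> s f x) \<le> norm (\<phi> x) * (P' * s powr - \<beta>)" for x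
        proof -
          have "norm (avg \<eta> s f x) \<le> P' * s powr - \<beta>" using P'(2)[of s x] elim by (simp add: max_def)
          then show ?thesis by (simp add: abs_mult mult_left_mono)
        qed
        have "(\<lambda>x. (s, x)) \<in> borel_measurable borel" by (intro borel_measurable_continuous_onI continuous_intros)
        from measurable_compose[OF this avg_measurable[OF k f_measurable]]
        have [measurable]: "avg \<eta> s f \<in> borel_measurable borel" by simp
        have [measurable]: "\<phi> \<in> borel_measurable borel" by (rule borel_measurable_continuous_onI[OF \<phi>c])
        show "integrable lborel (\<lambda>x. \<phi> x \<bullet> avg \<eta> s f x)"
        proof (rule Bochner_Integration.integrable_bound[OF i])
          show "(\<lambda>x. \<phi> x \<bullet> avg \<eta> s f x) \<in> borel_measurable lborel" by measurable
          show "AE x in lborel. norm (\<phi> x \<bullet> avg \<eta> s f x) \<le> norm (norm (\<phi> x) * (P' * s powr - \<beta>))"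
            using le by (intro AE_I2) (auto intro: order_trans[OF _ abs_ge_self])
        qed
      qed
      finally show ?case by simp
    qed
    show "((\<lambda>s. ?I * P' * s powr - \<beta>) \<longlongrightarrow> 0) at_top"
      using \<beta> by (intro tendsto_mult_right_zero tendsto_neg_powr[OF _ filterlim_ident]) simp
  qed
  have "(\<integral>x. gradient (newton f) x \<bullet> gradient \<phi> x \<partial>lborel) = (\<integral>x. ?c * (\<integral>s. indicat_real {0<..} s * (gradient \<phi> x \<bullet> avg (\<lambda>z. \<eta> z *\<^sub>R z) s f x) \<partial>lborel) \<partial>lborel)"
  proof (rule Bochner_Integration.integral_cong[OF refl])
    fix x
    have i: "set_integrable lborel {0<..} (\<lambda>s. s powr 0 *\<^sub>R avg (\<lambda>z. \<eta> z *\<^sub>R z) s f x)"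
      using pot_integrable[OF kg, of 0] by simp
    have "gradient (newton f) x \<bullet> gradient \<phi> x = ?c * (gradient \<phi> x \<bullet> pot {0<..} 0 (\<lambda>z. \<eta> z *\<^sub>R z) f x)"
      using gradient_eqI[OF GDERIV_newton[of x 0]] by (simp add: g inner_commute)
    also have "gradient \<phi> x \<bullet> pot {0<..} 0 (\<lambda>z. \<eta> z *\<^sub>R z) f x =
        (\<integral>s. gradient \<phi> x \<bullet> (indicat_real {0<..} s *\<^sub>R s powr 0 *\<^sub>R avg (\<lambda>z. \<eta> z *\<^sub>R z) s f x) \<partial>lborel)"
      unfolding pot_def set_lebesgue_integral_def
      by (rule integral_inner_right[symmetric]) (use i in \<open>simp add: set_integrable_def\<close>)
    also have "\<dots> = (\<integral>s. indicat_real {0<..} s * (gradient \<phi> x \<bullet> avg (\<lambda>z. \<eta> z *\<^sub>R z) s f x) \<partial>lborel)"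
      by (rule Bochner_Integration.integral_cong[OF refl]) (simp add: indicator_def)
    finally show "gradient (newton f) x \<bullet> gradient \<phi> x = ?c * (\<integral>s. indicat_real {0<..} s * (gradient \<phi> x \<bullet> avg (\<lambda>z. \<eta> z *\<^sub>R z) s f x) \<partial>lborel)" .
  qed
  also have "\<dots> = ?c * (\<integral>s. (\<integral>x. indicat_real {0<..} s * (gradient \<phi> x \<bullet> avg (\<lambda>z. \<eta> z *\<^sub>R z) s f x) \<partial>lborel) \<partial>lborel)"
    using lborel_pair.Fubini_integral[OF pair] by simp
  also have "\<dots> = ?c * (LBINT s:{0<..}. T s)"
    unfolding T_def set_lebesgue_integral_def by simp
  also have "\<dots> = ?c * (0 - A 0)"
    using improper_FTC[OF D Tint L0 L1] by simp
  also have "\<dots> = (?c * (2 * real (Suc (Suc 0)) * (\<integral>z. bump (Suc 0) z \<partial>(lborel :: 'a measure)))) * (\<integral>x. f x * \<phi> x \<partial>lborel)"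
    unfolding A0 \<eta>_def by simp
  also have "?c * (2 * real (Suc (Suc 0)) * (\<integral>z. bump (Suc 0) z \<partial>(lborel :: 'a measure))) = 1"
    by (rule newton_const_flux[OF dim])
  finally show ?thesis by simp
qed

end

section \<open>Regularity of the Newtonian potential\<close>

text \<open>The average of the constant 1 does not depend on \<open>x\<close>, so its gradient is 0;
  by \<open>GDERIV_avg\<close> at scale 1 that gradient is the integral of
  \<open>gradient \<kappa>\<close>.\<close>

lemma integral_gradient_kernel:
  fixes \<kappa> :: "'a::euclidean_space \<Rightarrow> real"
  assumes "unit_kernel \<kappa>" "Ck_on (Suc j) UNIV \<kappa>"
  shows "(\<integral>z. gradient \<kappa> z \<partial>lborel) = 0"
proof -
  have l1: "loc_bounded (\<lambda>_::'a. 1)" by (intro loc_bounded_continuous continuous_on_const)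
  have "avg \<kappa> 1 (\<lambda>_. 1) = (\<lambda>x. \<integral>z. \<kappa> z \<partial>lborel)" by (simp add: avg_def fun_eq_iff)
  then have "gradient (avg \<kappa> 1 (\<lambda>_. 1)) 0 = 0" by simp
  moreover have "gradient (avg \<kappa> 1 (\<lambda>_. 1)) 0 = (1 / 1) *\<^sub>R avg (gradient \<kappa>) 1 (\<lambda>_. 1) 0"
    by (rule gradient_eqI[OF GDERIV_avg[OF assms l1]]) simp
  ultimately show ?thesis by (simp add: avg_def)
qed

lemma avg_diff_le:
  fixes \<kappa> :: "'a::euclidean_space \<Rightarrow> real"
  assumes \<kappa>: "unit_kernel \<kappa>" "Ck_on (Suc j) UNIV \<kappa>" and f: "loc_bounded f" and s: "0 < s"
    and le: "\<And>z. dist z y < dist x y + 1 \<Longrightarrow> norm (avg (gradient \<kappa>) s f z) \<le> Q"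
  shows "\<bar>avg \<kappa> s f x - avg \<kappa> s f y\<bar> \<le> Q * (dist x y / s)"
proof -
  have "\<bar>avg \<kappa> s f x - avg \<kappa> s f y\<bar> \<le> Q / s * norm (x - y)"
  proof (rule GDERIV_increment_bound[where r = "dist x y + 1"])
    show "GDERIV (avg \<kappa> s f) z :> (1 / s) *\<^sub>R avg (gradient \<kappa>) s f z" for z
      by (rule GDERIV_avg[OF \<kappa> f s])
    show "norm ((1 / s) *\<^sub>R avg (gradient \<kappa>) s f z) \<le> Q / s" if "dist z y < dist x y + 1" for z
      using le[OF that] s by (simp add: divide_right_mono)
  qed simp
  then show ?thesis by (simp add: dist_norm)
qed

section \<open>Averages and potentials at small scales\<close>

lemma avg_local_bound:
  fixes \<kappa> :: "'a::euclidean_space \<Rightarrow> 'b::euclidean_space"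
  assumes "unit_kernel \<kappa>"
    and f: "\<And>z. norm z \<le> 1 \<Longrightarrow> \<bar>f (x - s *\<^sub>R z)\<bar> \<le> B"
    and i: "integrable lborel (\<lambda>z. f (x - s *\<^sub>R z) *\<^sub>R \<kappa> z)"
    and M: "\<And>z. norm (\<kappa> z) \<le> M * indicator (cball 0 1) z"
  shows "norm (avg \<kappa> s f x) \<le> B * (M * measure lborel (cball (0::'a) 1))"
proof -
  have "norm (avg \<kappa> s f x) \<le> (\<integral>z. B * M * indicator (cball (0::'a) 1) z \<partial>lborel)"
    unfolding avg_def
  proof (rule Bochner_Integration.integral_norm_bound_integral[OF i indicator_ball_integrable])
    fix z :: 'a
    show "norm (f (x - s *\<^sub>R z) *\<^sub>R \<kappa> z) \<le> B * M * indicator (cball 0 1) z"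
    proof (cases "norm z \<le> 1")
      case True
      then have "\<bar>f (x - s *\<^sub>R z)\<bar> * norm (\<kappa> z) \<le> B * M"
        using f[OF True] M[of z] by (intro mult_mono) auto
      then show ?thesis using True by simp
    next
      case False
      then have "\<kappa> z = 0" using assms(1) by (simp add: unit_kernel_def)
      then show ?thesis using False by simp
    qed
  qed
  then show ?thesis by (simp add: mult.assoc)
qed

lemma norm_shift_le:
  fixes x z :: "'a::real_normed_vector"
  assumes "norm z \<le> 1" "0 < s" "s \<le> 1"
  shows "norm (x - s *\<^sub>R z) \<le> norm x + 1" "dist (x - s *\<^sub>R z) x \<le> s"
proof -
  have "s * norm z \<le> s" using assms by (simp add: mult_left_le)
  moreover have "norm (x - s *\<^sub>R z) \<le> norm x + s * norm z"
    using norm_triangle_ineq4[of x "s *\<^sub>R z"] assms by simp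
  ultimately show "norm (x - s *\<^sub>R z) \<le> norm x + 1" using assms by linarith
  show "dist (x - s *\<^sub>R z) x \<le> s" using assms \<open>s * norm z \<le> s\<close> by (simp add: dist_norm)
qed

lemma avg_small_scale_bound:
  fixes \<kappa> :: "'a::euclidean_space \<Rightarrow> 'b::euclidean_space"
  assumes k: "unit_kernel \<kappa>" and f: "loc_bounded f"
  shows "\<exists>C>0. \<forall>x s. norm x \<le> R \<longrightarrow> 0 < s \<longrightarrow> s \<le> 1 \<longrightarrow> norm (avg \<kappa> s f x) \<le> C"
proof -
  obtain M where M: "M > 0" "\<And>z. norm (\<kappa> z) \<le> M * indicator (cball 0 1) z"
    using kernel_bounded[OF k] by metis
  obtain B where B: "\<And>y. norm y \<le> R + 1 \<Longrightarrow> \<bar>f y\<bar> \<le> B"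
    using f unfolding loc_bounded_def by meson
  let ?C = "\<bar>B\<bar> * (M * measure lborel (cball (0::'a) 1))"
  have "norm (avg \<kappa> s f x) \<le> ?C + 1" if "norm x \<le> R" "0 < s" "s \<le> 1" for x s
  proof -
    have "norm (avg \<kappa> s f x) \<le> ?C"
    proof (rule avg_local_bound[OF k _ avg_integrable[OF k f] M(2)])
      fix z :: 'a assume "norm z \<le> 1"
      then have "norm (x - s *\<^sub>R z) \<le> R + 1" using norm_shift_le(1)[of z s x] that by linarith
      from B[OF this] show "\<bar>f (x - s *\<^sub>R z)\<bar> \<le> \<bar>B\<bar>" by linarith
    qed
    then show ?thesis by simp
  qed
  moreover have "0 < ?C + 1" using M(1) by (intro add_nonneg_pos) auto
  ultimately show ?thesis by blast
qed

text \<open>A kernel of mean zero only sees the oscillation of the density.\<close>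

lemma avg_mean_zero_bound:
  fixes \<kappa> :: "'a::euclidean_space \<Rightarrow> 'b::euclidean_space" and f :: "'a \<Rightarrow> real"
  assumes k: "unit_kernel \<kappa>" and zero: "(\<integral>z. \<kappa> z \<partial>lborel) = 0" and f: "ball_Hoelder \<alpha> f" and \<alpha>: "0 < \<alpha>"
  shows "\<exists>C>0. \<forall>x s. norm x \<le> R \<longrightarrow> 0 < s \<longrightarrow> s \<le> 1 \<longrightarrow> norm (avg \<kappa> s f x) \<le> C * s powr \<alpha>"
proof -
  obtain M where M: "M > 0" "\<And>z. norm (\<kappa> z) \<le> M * indicator (cball 0 1) z"
    using kernel_bounded[OF k] by metis
  obtain L where L: "L \<ge> 0" "\<And>x y. norm x \<le> R + 1 \<Longrightarrow> norm y \<le> R + 1 \<Longrightarrow> dist (f x) (f y) \<le> L * dist x y powr \<alpha>"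
    using ball_HoelderD[OF f] by metis
  have fl: "loc_bounded f" by (rule loc_bounded_continuous[OF ball_Hoelder_continuous[OF f \<alpha>]])
  have fl1: "loc_bounded (\<lambda>_::'a. 1)" by (intro loc_bounded_continuous continuous_on_const)
  let ?C = "L * (M * measure lborel (cball (0::'a) 1))"
  have "norm (avg \<kappa> s f x) \<le> (?C + 1) * s powr \<alpha>" if x: "norm x \<le> R" and s: "0 < s" "s \<le> 1" for x s
  proof -
    define h where "h y = f y - f x" for y
    have hl: "loc_bounded h"
      unfolding h_def by (intro loc_bounded_continuous continuous_intros ball_Hoelder_continuous[OF f \<alpha>])
    have i1: "integrable lborel \<kappa>" using avg_integrable[OF k fl1] by simp
    have "avg \<kappa> s h x = (\<integral>z. f (x - s *\<^sub>R z) *\<^sub>R \<kappa> z - f x *\<^sub>R \<kappa> z \<partial>lborel)"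
      by (simp add: avg_def h_def scaleR_diff_left)
    also have "\<dots> = avg \<kappa> s f x - f x *\<^sub>R (\<integral>z. \<kappa> z \<partial>lborel)"
      unfolding avg_def using avg_integrable[OF k fl, of x s] i1
      by (subst Bochner_Integration.integral_diff) auto
    finally have "avg \<kappa> s f x = avg \<kappa> s h x" using zero by simp
    also have "norm \<dots> \<le> (L * s powr \<alpha>) * (M * measure lborel (cball (0::'a) 1))"
    proof (rule avg_local_bound[OF k _ avg_integrable[OF k hl] M(2)])
      fix z :: 'a assume z: "norm z \<le> 1"
      note d = norm_shift_le[OF z s, of x]
      have "\<bar>h (x - s *\<^sub>R z)\<bar> \<le> L * dist (x - s *\<^sub>R z) x powr \<alpha>"
        using L(2)[of "x - s *\<^sub>R z" x] d(1) x by (simp add: h_def dist_real_def)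
      also have "\<dots> \<le> L * s powr \<alpha>"
        using d(2) L(1) \<alpha> by (intro mult_left_mono powr_mono2) auto
      finally show "\<bar>h (x - s *\<^sub>R z)\<bar> \<le> L * s powr \<alpha>" .
    qed
    also have "\<dots> \<le> (?C + 1) * s powr \<alpha>" by (simp add: algebra_simps)
    finally show ?thesis .
  qed
  moreover have "0 < ?C + 1" using M(1) L(1) by (intro add_nonneg_pos) auto
  ultimately show ?thesis by blast
qed

lemma scale_weight_integrable:
  fixes a :: real
  assumes "-1 < a"
  shows "set_integrable lborel {0<..1} (\<lambda>s. C * s powr a)"
proof -
  \<comment> \<open>Any decay exponent above \<open>a + 1\<close> would do, since
    \<open>max s 1\<close> equals 1 on \<open>{0<..1}\<close>.\<close>
  have "set_integrable lborel {0<..} (\<lambda>s. s powr a * max s 1 powr - (a + 2))"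
    using assms by (intro weight_integrable) auto
  then have "set_integrable lborel {0<..1} (\<lambda>s. s powr a * max s 1 powr - (a + 2))"
    by (rule set_integrable_subset) auto
  moreover have "set_integrable lborel {0<..1} (\<lambda>s. s powr a * max s 1 powr - (a + 2)) = set_integrable lborel {0<..1} (\<lambda>s. s powr a)"
    by (intro set_integrable_cong) (auto simp: max_def)
  ultimately show ?thesis by (intro set_integrable_mult_right) simp
qed

lemma small_pot_integrable:
  fixes \<kappa> :: "'a::euclidean_space \<Rightarrow> 'b::euclidean_space"
  assumes k: "unit_kernel \<kappa>" and f: "loc_bounded f" and "-1 < a"
  shows "set_integrable lborel {0<..1} (\<lambda>s. s powr a *\<^sub>R avg \<kappa> s f x)"
proof -
  obtain C where C: "C > 0" "\<forall>x' s. norm x' \<le> norm x \<longrightarrow> 0 < s \<longrightarrow> s \<le> 1 \<longrightarrow> norm (avg \<kappa> s f x') \<le> C"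
    using avg_small_scale_bound[OF k f] by blast
  have fm: "f \<in> borel_measurable borel" using f by (simp add: loc_bounded_def)
  show ?thesis
  proof (rule pot_integrableI[OF k fm _ scale_weight_integrable[OF assms(3), of C]])
    show "norm (s powr a *\<^sub>R avg \<kappa> s f x) \<le> C * s powr a" if "s \<in> {0<..1}" for s
      using C(2) that mult_left_mono[of "norm (avg \<kappa> s f x)" C "s powr a"] by (simp add: mult.commute)
  qed simp
qed

lemma small_pot_integrable_mean_zero:
  fixes \<kappa> :: "'a::euclidean_space \<Rightarrow> 'b::euclidean_space"
  assumes k: "unit_kernel \<kappa>" and zero: "(\<integral>z. \<kappa> z \<partial>lborel) = 0" and f: "ball_Hoelder \<alpha> f" and \<alpha>: "0 < \<alpha>"
  shows "set_integrable lborel {0<..1} (\<lambda>s. s powr - 1 *\<^sub>R avg \<kappa> s f x)"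
proof -
  obtain C where C: "C > 0" "\<forall>x' s. norm x' \<le> norm x \<longrightarrow> 0 < s \<longrightarrow> s \<le> 1 \<longrightarrow> norm (avg \<kappa> s f x') \<le> C * s powr \<alpha>"
    using avg_mean_zero_bound[OF k zero f \<alpha>] by blast
  have fm: "f \<in> borel_measurable borel"
    by (rule borel_measurable_continuous_onI[OF ball_Hoelder_continuous[OF f \<alpha>]])
  have "-1 < \<alpha> - 1" using \<alpha> by simp
  show ?thesis
  proof (rule pot_integrableI[OF k fm _ scale_weight_integrable[OF \<open>-1 < \<alpha> - 1\<close>, of C]])
    show "norm (s powr - 1 *\<^sub>R avg \<kappa> s f x) \<le> C * s powr (\<alpha> - 1)" if "s \<in> {0<..1}" for s
    proof -
      have "s powr - 1 * norm (avg \<kappa> s f x) \<le> s powr - 1 * (C * s powr \<alpha>)"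
        using C(2) that by (intro mult_left_mono) auto
      also have "\<dots> = C * (s powr - 1 * s powr \<alpha>)" by simp
      also have "s powr - 1 * s powr \<alpha> = s powr (\<alpha> - 1)" by (subst powr_add[symmetric]) simp
      finally show ?thesis by simp
    qed
  qed simp
qed

lemma GDERIV_small_pot_1:
  fixes \<kappa> :: "'a::euclidean_space \<Rightarrow> real"
  assumes \<kappa>: "unit_kernel \<kappa>" "Ck_on (Suc j) UNIV \<kappa>" and f: "loc_bounded f"
  shows "GDERIV (pot {0<..1} 1 \<kappa> f) x :> pot {0<..1} 0 (gradient \<kappa>) f x"
proof -
  obtain C where C: "C > 0" "\<forall>x' s. norm x' \<le> norm x + 1 \<longrightarrow> 0 < s \<longrightarrow> s \<le> 1 \<longrightarrow> norm (avg (gradient \<kappa>) s f x') \<le> C"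
    using avg_small_scale_bound[OF kernel_gradient[OF \<kappa>] f] by blast
  have "GDERIV (pot {0<..1} 1 \<kappa> f) x :> pot {0<..1} (1 - 1) (gradient \<kappa>) f x"
  proof (rule GDERIV_pot[OF \<kappa> f _ _ zero_less_one])
    show "set_integrable lborel {0<..1} (\<lambda>s. C * s powr 0)" by (rule scale_weight_integrable) simp
    show "set_integrable lborel {0<..1} (\<lambda>s. s powr 1 *\<^sub>R avg \<kappa> s f x')" for x'
      by (rule small_pot_integrable[OF \<kappa>(1) f]) simp
    show "s powr (1 - 1) * norm (avg (gradient \<kappa>) s f x') \<le> C * s powr 0" if "dist x' x < 1" "s \<in> {0<..1}" for x' s
    proof -
      have "norm x' \<le> norm x + 1" using that(1) by norm
      then show ?thesis using C(2) that(2) by simp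
    qed
  qed auto
  then show ?thesis by simp
qed

text \<open>The derivative carries the weight \<open>1 / s\<close>, which is not integrable at 0 by
  itself. Gradient kernels have mean zero, so Hoelder continuity of \<open>f\<close> contributes
  \<open>s powr \<alpha>\<close> and the dominating function is
  \<open>s powr (\<alpha> - 1)\<close>.\<close>

lemma GDERIV_small_pot_0:
  fixes \<kappa> :: "'a::euclidean_space \<Rightarrow> real"
  assumes \<kappa>: "unit_kernel \<kappa>" "Ck_on (Suc j) UNIV \<kappa>" and f: "ball_Hoelder \<alpha> f" and \<alpha>: "0 < \<alpha>"
  shows "GDERIV (pot {0<..1} 0 \<kappa> f) x :> pot {0<..1} (- 1) (gradient \<kappa>) f x"
proof -
  have fl: "loc_bounded f" by (rule loc_bounded_continuous[OF ball_Hoelder_continuous[OF f \<alpha>]])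
  obtain C where C: "C > 0" "\<forall>x' s. norm x' \<le> norm x + 1 \<longrightarrow> 0 < s \<longrightarrow> s \<le> 1 \<longrightarrow> norm (avg (gradient \<kappa>) s f x') \<le> C * s powr \<alpha>"
    using avg_mean_zero_bound[OF kernel_gradient[OF \<kappa>] integral_gradient_kernel[OF \<kappa>] f \<alpha>] by blast
  have "GDERIV (pot {0<..1} 0 \<kappa> f) x :> pot {0<..1} (0 - 1) (gradient \<kappa>) f x"
  proof (rule GDERIV_pot[OF \<kappa> fl _ _ zero_less_one])
    show "set_integrable lborel {0<..1} (\<lambda>s. C * s powr (\<alpha> - 1))" by (rule scale_weight_integrable) (use \<alpha> in simp)
    show "set_integrable lborel {0<..1} (\<lambda>s. s powr 0 *\<^sub>R avg \<kappa> s f x')" for x'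
      by (rule small_pot_integrable[OF \<kappa>(1) fl]) simp
    show "s powr (0 - 1) * norm (avg (gradient \<kappa>) s f x') \<le> C * s powr (\<alpha> - 1)" if "dist x' x < 1" "s \<in> {0<..1}" for x' s
    proof -
      have "norm x' \<le> norm x + 1" using that(1) by norm
      then have "s powr (0 - 1) * norm (avg (gradient \<kappa>) s f x') \<le> s powr (0 - 1) * (C * s powr \<alpha>)"
        using C(2) that(2) by (intro mult_left_mono) auto
      also have "\<dots> = C * (s powr (0 - 1) * s powr \<alpha>)" by simp
      also have "s powr (0 - 1) * s powr \<alpha> = s powr (\<alpha> - 1)" by (subst powr_add[symmetric]) simp
      finally show ?thesis .
    qed
  qed auto
  then show ?thesis by simp
qed

text \<open>The oscillation at scale \<open>s\<close> is at most \<open>s powr \<alpha> * min 2 (h / s)\<close> up to a constant, where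
  \<open>h = dist x y\<close>, and \<open>min 2 (h / s) \<le> 2 * h / max s h\<close> integrates to a multiple of \<open>h powr \<alpha>\<close>.\<close>

lemma small_pot_Hoelder:
  fixes \<kappa> :: "'a::euclidean_space \<Rightarrow> real"
  assumes \<kappa>: "unit_kernel \<kappa>" "Ck_on (Suc j) UNIV \<kappa>" and zero: "(\<integral>z. \<kappa> z \<partial>lborel) = 0"
    and f: "ball_Hoelder \<alpha> f" and \<alpha>: "0 < \<alpha>" "\<alpha> < 1"
  shows "ball_Hoelder \<alpha> (pot {0<..1} (- 1) \<kappa> f)"
  unfolding ball_Hoelder_def
proof
  fix R :: real
  have fl: "loc_bounded f" by (rule loc_bounded_continuous[OF ball_Hoelder_continuous[OF f \<alpha>(1)]])
  \<comment> \<open>The radius \<open>3 * R + 1\<close> covers all \<open>z\<close> with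
    \<open>dist z y < dist x y + 1\<close> when \<open>x\<close> and \<open>y\<close> lie in the
    ball of radius \<open>R\<close>, as the mean value estimate requires.\<close>
  obtain C1 where C1: "C1 > 0" "\<forall>x s. norm x \<le> 3 * R + 1 \<longrightarrow> 0 < s \<longrightarrow> s \<le> 1 \<longrightarrow> norm (avg \<kappa> s f x) \<le> C1 * s powr \<alpha>"
    using avg_mean_zero_bound[OF \<kappa>(1) zero f \<alpha>(1)] by blast
  obtain C2 where C2: "C2 > 0" "\<forall>x s. norm x \<le> 3 * R + 1 \<longrightarrow> 0 < s \<longrightarrow> s \<le> 1 \<longrightarrow> norm (avg (gradient \<kappa>) s f x) \<le> C2 * s powr \<alpha>"
    using avg_mean_zero_bound[OF kernel_gradient[OF \<kappa>] integral_gradient_kernel[OF \<kappa>] f \<alpha>(1)] by blast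
  define P where "P = max C1 C2"
  have P: "P > 0" "C1 \<le> P" "C2 \<le> P" using C1(1) unfolding P_def by auto
  define K where "K = 2 * P * (1 / \<alpha> + 1 / (1 - \<alpha>))"
  have K: "0 \<le> K" unfolding K_def using P(1) \<alpha> by simp
  have "dist (pot {0<..1} (- 1) \<kappa> f x) (pot {0<..1} (- 1) \<kappa> f y) \<le> K * dist x y powr \<alpha>"
    if x: "norm x \<le> R" and y: "norm y \<le> R" for x y
  proof (cases "x = y")
    case False
    define h where "h = dist x y"
    have h: "0 < h" using False by (simp add: h_def)
    note i = small_pot_integrable_mean_zero[OF \<kappa>(1) zero f \<alpha>(1)]
    let ?v = "\<lambda>s. s powr - 1 *\<^sub>R avg \<kappa> s f x - s powr - 1 *\<^sub>R avg \<kappa> s f y"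
    let ?w = "\<lambda>s. 2 * P * h * (s powr (\<alpha> - 1) * max s h powr - 1)"
    have wint: "set_integrable lborel {0<..} ?w"
      using \<alpha> h by (intro set_integrable_mult_right weight_integrable) auto
    have le: "norm (?v s) \<le> ?w s" if s: "s \<in> {0<..1}" for s
    proof -
      have sa: "0 \<le> s powr \<alpha>" by simp
      have 1: "\<bar>avg \<kappa> s f x - avg \<kappa> s f y\<bar> \<le> 2 * P * s powr \<alpha>"
      proof -
        have "norm (avg \<kappa> s f z) \<le> P * s powr \<alpha>" if "norm z \<le> R" for z
        proof -
          have "norm z \<le> 3 * R + 1" using that norm_ge_zero[of z] by linarith
          then have "norm (avg \<kappa> s f z) \<le> C1 * s powr \<alpha>" using C1(2) s by simp
          also have "\<dots> \<le> P * s powr \<alpha>" by (intro mult_right_mono P sa)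
          finally show ?thesis .
        qed
        from this[OF x] this[OF y] show ?thesis by (simp add: abs_le_iff)
      qed
      have 2: "\<bar>avg \<kappa> s f x - avg \<kappa> s f y\<bar> \<le> P * s powr \<alpha> * (h / s)"
        unfolding h_def
      proof (rule avg_diff_le[OF \<kappa> fl])
        fix z assume z: "dist z y < dist x y + 1"
        have "norm z \<le> 3 * R + 1" using z x y by norm
        then have "norm (avg (gradient \<kappa>) s f z) \<le> C2 * s powr \<alpha>" using C2(2) s by simp
        also have "\<dots> \<le> P * s powr \<alpha>" by (intro mult_right_mono P sa)
        finally show "norm (avg (gradient \<kappa>) s f z) \<le> P * s powr \<alpha>" .
      qed (use s in simp)
      have Ps: "0 \<le> P * s powr \<alpha>" using P(1) by simp
      have 3: "\<bar>avg \<kappa> s f x - avg \<kappa> s f y\<bar> \<le> P * s powr \<alpha> * (2 * h / max s h)"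
      proof (cases "s \<le> h")
        case True
        then show ?thesis using 1 h by (simp add: max_def mult_ac)
      next
        case False
        have "P * s powr \<alpha> * (h / s) \<le> P * s powr \<alpha> * (2 * h / s)"
          using h s by (intro mult_left_mono[OF _ Ps] divide_right_mono) auto
        then show ?thesis using 2 False by (simp add: max_def)
      qed
      have m: "max s h powr - 1 = 1 / max s h" using h by (simp add: powr_minus_divide)
      have p: "s powr - 1 * s powr \<alpha> = s powr (\<alpha> - 1)" by (subst powr_add[symmetric]) simp
      have "norm (?v s) = s powr - 1 * \<bar>avg \<kappa> s f x - avg \<kappa> s f y\<bar>"
        unfolding real_norm_def real_scaleR_def right_diff_distrib[symmetric] abs_mult by simp
      also have "\<dots> \<le> s powr - 1 * (P * s powr \<alpha> * (2 * h / max s h))"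
        by (intro mult_left_mono 3) simp
      also have "\<dots> = 2 * P * h * ((s powr - 1 * s powr \<alpha>) * (1 / max s h))" by simp
      finally show ?thesis unfolding p m .
    qed
    have "dist (pot {0<..1} (- 1) \<kappa> f x) (pot {0<..1} (- 1) \<kappa> f y) = norm (LBINT s:{0<..1}. ?v s)"
      unfolding dist_norm pot_def by (subst set_integral_diff(2)[OF i i]) simp
    also have "\<dots> \<le> (LBINT s:{0<..1}. norm (?v s))"
      by (intro set_integral_norm_bound set_integral_diff(1)[OF i i])
    also have "\<dots> \<le> (LBINT s:{0<..1}. ?w s)"
      by (intro set_integral_mono set_integrable_norm set_integral_diff(1)[OF i i] le set_integrable_subset[OF wint]) auto
    also have "\<dots> \<le> (LBINT s:{0<..}. ?w s)"
      unfolding set_lebesgue_integral_def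
    proof (rule integral_mono)
      show "integrable lborel (\<lambda>s. indicat_real {0<..1} s *\<^sub>R ?w s)"
      proof -
        have "set_integrable lborel {0<..1} ?w" by (rule set_integrable_subset[OF wint]) auto
        then show ?thesis by (simp only: set_integrable_def)
      qed
      show "integrable lborel (\<lambda>s. indicat_real {0<..} s *\<^sub>R ?w s)"
        using wint by (simp add: set_integrable_def)
      show "indicat_real {0<..1} s *\<^sub>R ?w s \<le> indicat_real {0<..} s *\<^sub>R ?w s" for s
        using P(1) h by (auto simp: indicator_def)
    qed
    also have "\<dots> = 2 * P * h * (LBINT s:{0<..}. s powr (\<alpha> - 1) * max s h powr - 1)"
      by (rule set_integral_mult_right)
    \<comment> \<open>The weight integral with exponents \<alpha> - 1 and 1; its two conditions are
      0 < \<alpha> and \<alpha> < 1, and this is the source of the two fractions in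
      \<open>K\<close>.\<close>
    also have "\<dots> \<le> 2 * P * h * ((1 / (\<alpha> - 1 + 1) + 1 / (1 - (\<alpha> - 1) - 1)) * h powr (\<alpha> - 1 + 1 - 1))"
      using \<alpha> h P(1) by (intro mult_left_mono weight_integral_le) auto
    also have "\<dots> = K * (h * h powr (\<alpha> - 1))" by (simp add: K_def)
    also have "h * h powr (\<alpha> - 1) = h powr \<alpha>" using h by (simp add: powr_diff)
    finally show ?thesis by (simp add: h_def)
  qed simp
  then show "\<exists>C\<ge>0. \<forall>x\<in>cball 0 R. \<forall>y\<in>cball 0 R. dist (pot {0<..1} (- 1) \<kappa> f x) (pot {0<..1} (- 1) \<kappa> f y) \<le> C * dist x y powr \<alpha>"
    using K by (intro exI[of _ K]) auto
qed

text \<open>Here the derivative falls on the density, in contrast to \<open>GDERIV_avg\<close>: no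
  factor \<open>1 / s\<close> appears, and a continuous kernel suffices.\<close>

lemma GDERIV_avg_density:
  fixes \<kappa> :: "'a::euclidean_space \<Rightarrow> real"
  assumes \<kappa>: "unit_kernel \<kappa>" and f: "\<And>x. f differentiable (at x)" "continuous_on UNIV (gradient f)"
  shows "GDERIV (avg \<kappa> s f) x :> (\<Sum>b\<in>Basis. avg \<kappa> s (\<lambda>y. gradient f y \<bullet> b) x *\<^sub>R b)"
proof -
  have fc: "continuous_on UNIV f"
    using f(1) by (intro continuous_at_imp_continuous_on) (auto intro: differentiable_imp_continuous_within)
  obtain M where M: "M > 0" "\<And>z. norm (\<kappa> z) \<le> M * indicator (cball 0 1) z"
    using kernel_bounded[OF \<kappa>] by metis
  obtain L where L: "L > 0" "\<And>y. norm y \<le> norm x + 1 + \<bar>s\<bar> \<Longrightarrow> norm (gradient f y) \<le> L"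
    using continuous_bounded_on_cball[OF f(2)] by metis
  have main: "integrable lborel (\<lambda>z. \<kappa> z *\<^sub>R gradient f (x - s *\<^sub>R z))"
      "GDERIV (\<lambda>x. \<integral>z. f (x - s *\<^sub>R z) *\<^sub>R \<kappa> z \<partial>lborel) x :> (\<integral>z. \<kappa> z *\<^sub>R gradient f (x - s *\<^sub>R z) \<partial>lborel)"
  \<comment> \<open>Integrability and the derivative rest on the same premises of dominated
    differentiation, so both goals are reduced at once and most premises occur twice.\<close>
  proof (atomize(full), intro conjI integrable_dominated_gradient[where r = 1 and B = "\<lambda>z. M * L * indicator (cball 0 1) z" and F = "\<lambda>x z. f (x - s *\<^sub>R z) *\<^sub>R \<kappa> z" and G = "\<lambda>x z. \<kappa> z *\<^sub>R gradient f (x - s *\<^sub>R z)"]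
      GDERIV_integral[where r = 1 and B = "\<lambda>z. M * L * indicator (cball 0 1) z"])
    have int: "integrable lborel (\<lambda>z. f (x - s *\<^sub>R z) *\<^sub>R \<kappa> z)" for x
      by (rule avg_integrable[OF \<kappa> loc_bounded_continuous[OF fc]])
    have D: "GDERIV (\<lambda>x. f (x - s *\<^sub>R z) *\<^sub>R \<kappa> z) x :> \<kappa> z *\<^sub>R gradient f (x - s *\<^sub>R z)" for x z
    proof -
      have "((\<lambda>x. f (x - s *\<^sub>R z)) has_derivative (\<lambda>h. h \<bullet> gradient f (x - s *\<^sub>R z))) (at x)"
        by (rule has_derivative_compose[where f = "\<lambda>x. x - s *\<^sub>R z" and f' = "\<lambda>h. h"])
          (use differentiable_imp_GDERIV_gradient[OF f(1)] in \<open>auto intro!: derivative_eq_intros simp: gderiv_def\<close>)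
      from has_derivative_mult_left[OF this, of "\<kappa> z"] show ?thesis
        unfolding gderiv_def real_scaleR_def by (rule has_derivative_eq_rhs) (auto simp: mult.commute)
    qed
    have bd: "norm (\<kappa> z *\<^sub>R gradient f (x' - s *\<^sub>R z)) \<le> M * L * indicator (cball 0 1) z" if d: "dist x' x < 1" for x' z
    proof (cases "norm z \<le> 1")
      case True
      have "\<bar>s\<bar> * norm z \<le> \<bar>s\<bar>" using True by (simp add: mult_left_le)
      then have "norm (x' - s *\<^sub>R z) \<le> norm x' + \<bar>s\<bar>" using norm_triangle_ineq4[of x' "s *\<^sub>R z"] by simp
      moreover have "norm x' \<le> norm x + 1" using d by norm
      ultimately have "norm (x' - s *\<^sub>R z) \<le> norm x + 1 + \<bar>s\<bar>" by linarith
      then have "\<bar>\<kappa> z\<bar> * norm (gradient f (x' - s *\<^sub>R z)) \<le> M * L"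
        using L M(1) M(2)[of z] True by (intro mult_mono) auto
      then show ?thesis using True by simp
    next
      case False
      then have "\<kappa> z = 0" using \<kappa> by (simp add: unit_kernel_def)
      then show ?thesis using False by simp
    qed
    fix x' z assume d: "dist x' x < 1"
    show "integrable lborel (\<lambda>z. f (x' - s *\<^sub>R z) *\<^sub>R \<kappa> z)" by (rule int)
    show "integrable lborel (\<lambda>z. f (x' - s *\<^sub>R z) *\<^sub>R \<kappa> z)" by (rule int)
    show "GDERIV (\<lambda>x. f (x - s *\<^sub>R z) *\<^sub>R \<kappa> z) x' :> \<kappa> z *\<^sub>R gradient f (x' - s *\<^sub>R z)" by (rule D)
    show "GDERIV (\<lambda>x. f (x - s *\<^sub>R z) *\<^sub>R \<kappa> z) x' :> \<kappa> z *\<^sub>R gradient f (x' - s *\<^sub>R z)" by (rule D)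
    show "norm (\<kappa> z *\<^sub>R gradient f (x' - s *\<^sub>R z)) \<le> M * L * indicator (cball 0 1) z" by (rule bd[OF d])
    show "norm (\<kappa> z *\<^sub>R gradient f (x' - s *\<^sub>R z)) \<le> M * L * indicator (cball 0 1) z" by (rule bd[OF d])
  qed (rule zero_less_one indicator_ball_integrable)+
  have "(\<integral>z. \<kappa> z *\<^sub>R gradient f (x - s *\<^sub>R z) \<partial>lborel) = (\<Sum>b\<in>Basis. avg \<kappa> s (\<lambda>y. gradient f y \<bullet> b) x *\<^sub>R b)"
  proof (rule euclidean_eqI)
    fix b :: 'a assume b: "b \<in> Basis"
    have "(\<integral>z. \<kappa> z *\<^sub>R gradient f (x - s *\<^sub>R z) \<partial>lborel) \<bullet> b = (\<integral>z. (\<kappa> z *\<^sub>R gradient f (x - s *\<^sub>R z)) \<bullet> b \<partial>lborel)"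
      by (rule integral_inner_left[symmetric]) (rule main(1))
    also have "\<dots> = avg \<kappa> s (\<lambda>y. gradient f y \<bullet> b) x" by (simp add: avg_def mult.commute)
    also have "\<dots> = (\<Sum>b\<in>Basis. avg \<kappa> s (\<lambda>y. gradient f y \<bullet> b) x *\<^sub>R b) \<bullet> b"
      using b by (simp add: inner_sum_left inner_Basis if_distrib cong: if_cong)
    finally show "(\<integral>z. \<kappa> z *\<^sub>R gradient f (x - s *\<^sub>R z) \<partial>lborel) \<bullet> b = (\<Sum>b\<in>Basis. avg \<kappa> s (\<lambda>y. gradient f y \<bullet> b) x *\<^sub>R b) \<bullet> b" .
  qed
  then show ?thesis using main(2) unfolding avg_def[abs_def] by simp
qed

lemma GDERIV_small_pot_density:
  fixes \<kappa> :: "'a::euclidean_space \<Rightarrow> real"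
  assumes \<kappa>: "unit_kernel \<kappa>" and f: "\<And>x. f differentiable (at x)" "continuous_on UNIV (gradient f)"
  shows "GDERIV (pot {0<..1} 1 \<kappa> f) x :> (\<Sum>b\<in>Basis. pot {0<..1} 1 \<kappa> (\<lambda>y. gradient f y \<bullet> b) x *\<^sub>R b)"
proof -
  have fl: "loc_bounded f"
    using f(1) by (intro loc_bounded_continuous continuous_at_imp_continuous_on) (auto intro: differentiable_imp_continuous_within)
  have gl: "loc_bounded (\<lambda>y. gradient f y \<bullet> b)" for b
    by (intro loc_bounded_continuous continuous_on_inner f(2) continuous_on_const)
  define D where "D s x = (\<Sum>b\<in>Basis. avg \<kappa> s (\<lambda>y. gradient f y \<bullet> b) x *\<^sub>R b)" for s x
  have "\<forall>b. \<exists>C>0. \<forall>x' s. norm x' \<le> norm x + 1 \<longrightarrow> 0 < s \<longrightarrow> s \<le> 1 \<longrightarrow> norm (avg \<kappa> s (\<lambda>y. gradient f y \<bullet> b) x') \<le> C"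
    using avg_small_scale_bound[OF \<kappa> gl] by blast
  then obtain C where C: "\<And>b. C b > 0"
    "\<And>b x' s. norm x' \<le> norm x + 1 \<Longrightarrow> 0 < s \<Longrightarrow> s \<le> 1 \<Longrightarrow> norm (avg \<kappa> s (\<lambda>y. gradient f y \<bullet> b) x') \<le> C b"
    by metis
  define K where "K = (\<Sum>b\<in>(Basis :: 'a set). C b)"
  have D: "norm (D s x') \<le> K" if "norm x' \<le> norm x + 1" "0 < s" "s \<le> 1" for x' s
    unfolding D_def K_def using C(2)[OF that] by (intro sum_norm_le) simp
  have "GDERIV (\<lambda>x. \<integral>s. indicat_real {0<..1} s *\<^sub>R s powr 1 *\<^sub>R avg \<kappa> s f x \<partial>lborel) x :>
      (\<integral>s. (indicat_real {0<..1} s * s powr 1) *\<^sub>R D s x \<partial>lborel)"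
  proof (rule GDERIV_integral[where r = 1])
    show "integrable lborel (\<lambda>s. indicat_real {0<..1} s *\<^sub>R s powr 1 *\<^sub>R avg \<kappa> s f x)" for x
      using small_pot_integrable[OF \<kappa> fl, of 1 x] by (simp add: set_integrable_def)
    show "GDERIV (\<lambda>x. indicat_real {0<..1} s *\<^sub>R s powr 1 *\<^sub>R avg \<kappa> s f x) x' :> (indicat_real {0<..1} s * s powr 1) *\<^sub>R D s x'" for s x'
      unfolding D_def using GDERIV_mult[OF GDERIV_const GDERIV_avg_density[OF \<kappa> f, of s x'], of "indicat_real {0<..1} s * s powr 1"]
      by (simp add: mult.assoc)
    show "integrable lborel (\<lambda>s. indicat_real {0<..1} s *\<^sub>R (K * s powr 1))"
      using scale_weight_integrable[of 1 K] by (simp add: set_integrable_def)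
    fix x' s assume d: "dist x' x < 1"
    show "norm ((indicat_real {0<..1} s * s powr 1) *\<^sub>R D s x') \<le> indicat_real {0<..1} s *\<^sub>R (K * s powr 1)"
    proof (cases "s \<in> {0<..1}")
      case True
      have "norm x' \<le> norm x + 1" using d by norm
      then have "s * norm (D s x') \<le> s * K" using True by (intro mult_left_mono D) auto
      then show ?thesis using True by (simp add: mult.commute)
    qed simp
  qed simp
  moreover have "(\<integral>s. (indicat_real {0<..1} s * s powr 1) *\<^sub>R D s x \<partial>lborel) =
      (\<Sum>b\<in>Basis. pot {0<..1} 1 \<kappa> (\<lambda>y. gradient f y \<bullet> b) x *\<^sub>R b)"
  proof -
    have i: "integrable lborel (\<lambda>s. indicat_real {0<..1} s *\<^sub>R s powr 1 *\<^sub>R avg \<kappa> s (\<lambda>y. gradient f y \<bullet> b) x)" for b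
      using small_pot_integrable[OF \<kappa> gl, of 1 b x] by (simp add: set_integrable_def)
    have "(\<integral>s. (indicat_real {0<..1} s * s powr 1) *\<^sub>R D s x \<partial>lborel) =
        (\<integral>s. (\<Sum>b\<in>Basis. (indicat_real {0<..1} s *\<^sub>R s powr 1 *\<^sub>R avg \<kappa> s (\<lambda>y. gradient f y \<bullet> b) x) *\<^sub>R b) \<partial>lborel)"
      by (simp add: D_def scaleR_sum_right mult.assoc)
    also have "\<dots> = (\<Sum>b\<in>Basis. (\<integral>s. (indicat_real {0<..1} s *\<^sub>R s powr 1 *\<^sub>R avg \<kappa> s (\<lambda>y. gradient f y \<bullet> b) x) *\<^sub>R b \<partial>lborel))"
      by (intro Bochner_Integration.integral_sum integrable_scaleR_left i)
    also have "\<dots> = (\<Sum>b\<in>Basis. pot {0<..1} 1 \<kappa> (\<lambda>y. gradient f y \<bullet> b) x *\<^sub>R b)"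
      unfolding pot_def set_lebesgue_integral_def by (intro sum.cong refl integral_scaleR_left i)
    finally show ?thesis .
  qed
  ultimately show ?thesis unfolding pot_def[abs_def] set_lebesgue_integral_def by simp
qed

text \<open>In the base case two derivatives fall on the kernel, the second leaving weight
  \<open>1 / s\<close>, and \<open>small_pot_Hoelder\<close> treats the result. Every further order
  is obtained by moving one derivative to the density, so the smoothness asked of the kernel does
  not grow with \<open>m\<close>.\<close>

lemma small_pot_Ckalpha:
  fixes \<kappa> :: "'a::euclidean_space \<Rightarrow> real"
  assumes \<kappa>: "unit_kernel \<kappa>" "Ck_on (Suc (Suc (Suc i))) UNIV \<kappa>" and \<alpha>: "0 < \<alpha>" "\<alpha> < 1"
  shows "Ckalpha_loc m \<alpha> f \<Longrightarrow> Ckalpha_loc (Suc (Suc m)) \<alpha> (pot {0<..1} 1 \<kappa> f)"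
proof (induction m arbitrary: f)
  case 0
  then have f: "ball_Hoelder \<alpha> f" by (simp add: locally_Hoelder_iff)
  have fl: "loc_bounded f" by (rule loc_bounded_continuous[OF ball_Hoelder_continuous[OF f \<alpha>(1)]])
  note k1 = kernel_gradient[OF \<kappa>]
  show ?case
  proof (rule Ckalpha_loc_SucI[OF GDERIV_small_pot_1[OF \<kappa> fl]])
    fix b :: 'a assume b: "b \<in> Basis"
    let ?\<kappa>b = "\<lambda>z. gradient \<kappa> z \<bullet> b"
    have kb: "unit_kernel ?\<kappa>b" by (rule kernel_inner[OF k1])
    have cb: "Ck_on (Suc (Suc i)) UNIV ?\<kappa>b" using \<kappa>(2) b unfolding Ck_on.simps(2)[of "Suc (Suc i)"] by blast
    note k2 = kernel_gradient[OF kb cb]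
    have zero: "(\<integral>z. gradient ?\<kappa>b z \<bullet> c \<partial>lborel) = 0" for c
    proof -
      have l1: "loc_bounded (\<lambda>_::'a. 1)" by (intro loc_bounded_continuous continuous_on_const)
      have "integrable lborel (gradient ?\<kappa>b)" using avg_integrable[OF k2 l1] by simp
      then show ?thesis using integral_inner_left[of c lborel "gradient ?\<kappa>b"] integral_gradient_kernel[OF kb cb] by simp
    qed
    have eq1: "pot {0<..1} 0 (gradient \<kappa>) f x \<bullet> b = pot {0<..1} 0 ?\<kappa>b f x" for x
      by (rule pot_inner[OF k1 fl small_pot_integrable[OF k1 fl]]) simp
    have "Ckalpha_loc (Suc 0) \<alpha> (pot {0<..1} 0 ?\<kappa>b f)"
    proof (rule Ckalpha_loc_SucI[OF GDERIV_small_pot_0[OF kb cb f \<alpha>(1)]])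
      fix c :: 'a assume c: "c \<in> Basis"
      let ?\<kappa>c = "\<lambda>z. gradient ?\<kappa>b z \<bullet> c"
      have kc: "unit_kernel ?\<kappa>c" by (rule kernel_inner[OF k2])
      have cc: "Ck_on (Suc i) UNIV ?\<kappa>c" using cb c unfolding Ck_on.simps(2)[of "Suc i"] by blast
      have eq2: "pot {0<..1} (- 1) (gradient ?\<kappa>b) f x \<bullet> c = pot {0<..1} (- 1) ?\<kappa>c f x" for x
        by (rule pot_inner[OF k2 fl small_pot_integrable_mean_zero[OF k2 integral_gradient_kernel[OF kb cb] f \<alpha>(1)]])
      show "Ckalpha_loc 0 \<alpha> (\<lambda>x. pot {0<..1} (- 1) (gradient ?\<kappa>b) f x \<bullet> c)"
        unfolding eq2 by (simp add: locally_Hoelder_iff small_pot_Hoelder[OF kc cc zero f \<alpha>])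
    qed
    then show "Ckalpha_loc (Suc 0) \<alpha> (\<lambda>x. pot {0<..1} 0 (gradient \<kappa>) f x \<bullet> b)" unfolding eq1 .
  qed
next
  case (Suc m)
  have "Ck_on (Suc m) UNIV f" by (rule Ckalpha_loc_imp_Ck_on[OF Suc.prems \<alpha>(1)])
  then have f: "\<And>x. f differentiable (at x)" "continuous_on UNIV (gradient f)"
    using Ck_on_differentiable Ck_on_1_continuous_gradient by blast+
  show ?case
  proof (rule Ckalpha_loc_SucI[OF GDERIV_small_pot_density[OF \<kappa>(1) f]])
    fix b :: 'a assume b: "b \<in> Basis"
    have "Ckalpha_loc m \<alpha> (\<lambda>y. gradient f y \<bullet> b)" using Suc.prems b by simp
    then have "Ckalpha_loc (Suc (Suc m)) \<alpha> (pot {0<..1} 1 \<kappa> (\<lambda>y. gradient f y \<bullet> b))" by (rule Suc.IH)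
    moreover have "(\<Sum>b\<in>Basis. pot {0<..1} 1 \<kappa> (\<lambda>y. gradient f y \<bullet> b) x *\<^sub>R b) \<bullet> b = pot {0<..1} 1 \<kappa> (\<lambda>y. gradient f y \<bullet> b) x" for x
      using b by (simp add: inner_sum_left inner_Basis if_distrib cong: if_cong)
    ultimately show "Ckalpha_loc (Suc (Suc m)) \<alpha> (\<lambda>x. (\<Sum>b\<in>Basis. pot {0<..1} 1 \<kappa> (\<lambda>y. gradient f y \<bullet> b) x *\<^sub>R b) \<bullet> b)"
      by (simp only:)
  qed
qed

context decaying_density
begin

section \<open>Large scales, regularity of the whole potential and the classical equation\<close>

lemma large_pot_integrable:
  fixes \<kappa> :: "'a \<Rightarrow> 'b::euclidean_space"
  assumes k: "unit_kernel \<kappa>" and "a \<le> 1"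
  shows "set_integrable lborel {1<..} (\<lambda>s. s powr a *\<^sub>R avg \<kappa> s f x)"
proof -
  have 1: "set_integrable lborel {1<..} (\<lambda>s. s powr 1 *\<^sub>R avg \<kappa> s f x)"
    by (rule set_integrable_subset[OF pot_integrable[OF k, of 1]]) auto
  show ?thesis
  proof (rule pot_integrableI[OF k f_measurable _ set_integrable_norm[OF 1]])
    show "norm (s powr a *\<^sub>R avg \<kappa> s f x) \<le> norm (s powr 1 *\<^sub>R avg \<kappa> s f x)" if "s \<in> {1<..}" for s
      using that assms(2) powr_mono[of a 1 s] by (simp add: mult_right_mono)
  qed simp
qed

lemma GDERIV_large_pot:
  fixes \<kappa> :: "'a \<Rightarrow> real"
  assumes \<kappa>: "unit_kernel \<kappa>" "Ck_on (Suc j) UNIV \<kappa>" and a: "a \<le> 1"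
  shows "GDERIV (pot {1<..} a \<kappa> f) x :> pot {1<..} (a - 1) (gradient \<kappa>) f x"
proof -
  obtain P where P: "P > 0" "\<forall>x s. 0 < s \<longrightarrow> norm (avg (gradient \<kappa>) s f x) \<le> P * max s 1 powr - \<beta>"
    using avg_bound_uniform[OF kernel_gradient[OF \<kappa>]] by blast
  show ?thesis
  proof (rule GDERIV_pot[OF \<kappa> f_loc_bounded _ _ zero_less_one])
    show "set_integrable lborel {1<..} (\<lambda>s. P * (s powr 1 * max s 1 powr - \<beta>))"
      by (rule set_integrable_subset[OF weight_uniform_integrable]) auto
    show "s powr (a - 1) * norm (avg (gradient \<kappa>) s f x') \<le> P * (s powr 1 * max s 1 powr - \<beta>)" if "s \<in> {1<..}" for x' s
    proof -
      have "s powr (a - 1) * norm (avg (gradient \<kappa>) s f x') \<le> s powr 1 * (P * max s 1 powr - \<beta>)"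
        by (intro mult_mono powr_mono P(2)[rule_format]) (use that a P in auto)
      then show ?thesis by (simp add: mult_ac)
    qed
  qed (use large_pot_integrable[OF \<kappa>(1) a] in auto)
qed

text \<open>Away from scale 0 differentiation costs no integrability, as lowering \<open>a\<close>
  only improves the weight on \<open>{1<..}\<close>. All derivatives fall on the kernel, whose
  smoothness is the only limit.\<close>

lemma large_pot_Ck:
  "unit_kernel (\<kappa> :: 'a \<Rightarrow> real) \<Longrightarrow> Ck_on (Suc j) UNIV \<kappa> \<Longrightarrow> a \<le> 1 \<Longrightarrow> Ck_on j UNIV (pot {1<..} a \<kappa> f)"
proof (induction j arbitrary: \<kappa> a)
  case 0
  have "pot {1<..} a \<kappa> f differentiable (at x)" for x
    by (rule GDERIV_imp_differentiable[OF GDERIV_large_pot[OF 0]])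
  then show ?case
    by (auto intro!: continuous_at_imp_continuous_on differentiable_imp_continuous_within)
next
  case (Suc j)
  note k1 = kernel_gradient[OF Suc.prems(1,2)]
  have a1: "a - 1 \<le> 1" using Suc.prems(3) by simp
  show ?case
  proof (rule Ck_on_SucI[OF GDERIV_large_pot[OF Suc.prems]])
    fix b :: 'a assume b: "b \<in> Basis"
    have cb: "Ck_on (Suc j) UNIV (\<lambda>z. gradient \<kappa> z \<bullet> b)" using Suc.prems(2) b unfolding Ck_on.simps(2)[of "Suc j"] by blast
    have "pot {1<..} (a - 1) (gradient \<kappa>) f x \<bullet> b = pot {1<..} (a - 1) (\<lambda>z. gradient \<kappa> z \<bullet> b) f x" for x
      by (rule pot_inner[OF k1 f_loc_bounded large_pot_integrable[OF k1 a1]])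
    then show "Ck_on j UNIV (\<lambda>x. pot {1<..} (a - 1) (gradient \<kappa>) f x \<bullet> b)"
      using Suc.IH[OF kernel_inner[OF k1] cb a1] by (simp only:)
  qed
qed

lemma pot_split:
  fixes \<kappa> :: "'a \<Rightarrow> 'b::euclidean_space"
  assumes "set_integrable lborel {0<..1} (\<lambda>s. s powr a *\<^sub>R avg \<kappa> s f x)"
    and "set_integrable lborel {1<..} (\<lambda>s. s powr a *\<^sub>R avg \<kappa> s f x)"
  shows "set_integrable lborel {0<..} (\<lambda>s. s powr a *\<^sub>R avg \<kappa> s f x)"
    and "pot {0<..} a \<kappa> f x = pot {0<..1} a \<kappa> f x + pot {1<..} a \<kappa> f x"
proof -
  have U: "{0<..} = {0<..1} \<union> {1::real<..}" by auto
  show "set_integrable lborel {0<..} (\<lambda>s. s powr a *\<^sub>R avg \<kappa> s f x)"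
    unfolding U by (intro set_integrable_Un assms) auto
  show "pot {0<..} a \<kappa> f x = pot {0<..1} a \<kappa> f x + pot {1<..} a \<kappa> f x"
    unfolding pot_def U by (intro set_integral_Un assms) auto
qed

lemma newton_Ckalpha:
  assumes "Ckalpha_loc m \<alpha> f" and \<alpha>: "0 < \<alpha>" "\<alpha> < 1"
  shows "Ckalpha_loc (Suc (Suc m)) \<alpha> (newton f)"
proof -
  \<comment> \<open>Exponent \<open>m + 5\<close> gives a kernel of class \<open>C^(m+4)\<close>,
    hence large scales of class \<open>C^(m+3)\<close>, which is contained in
    \<open>C^{m+2,\<alpha>}_loc\<close>.\<close>
  let ?\<psi> = "bump (Suc (Suc (m + 3))) :: 'a \<Rightarrow> real"
  have C: "Ck_on (Suc (Suc (Suc (Suc m)))) UNIV ?\<psi>"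
    using Ck_on_bump[of "Suc (Suc (Suc (Suc m)))" 0] by (simp only: numeral_3_eq_3 add_Suc_right add_0_right)
  have eq: "newton f x = newton_const TYPE('a) (m + 3) * (pot {0<..1} 1 ?\<psi> f x + pot {1<..} 1 ?\<psi> f x)" for x
    unfolding newton_pot[of x "m + 3"]
    by (subst pot_split(2)[OF small_pot_integrable[OF bump_kernel f_loc_bounded] large_pot_integrable[OF bump_kernel]]) simp_all
  have "Ckalpha_loc (Suc (Suc m)) \<alpha> (pot {0<..1} 1 ?\<psi> f)"
    by (rule small_pot_Ckalpha[OF bump_kernel C \<alpha> assms(1)])
  moreover have "Ckalpha_loc (Suc (Suc m)) \<alpha> (pot {1<..} 1 ?\<psi> f)"
    using \<alpha> by (intro Ck_on_imp_Ckalpha_loc large_pot_Ck[OF bump_kernel C]) auto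
  ultimately show ?thesis
    unfolding eq[abs_def] using \<alpha> by (intro Ckalpha_loc_cmult Ckalpha_loc_add) auto
qed

text \<open>For \<open>gradient \<psi> z = \<eta> z *\<^sub>R z\<close> the kernel below is the Laplacian of \<open>\<psi>\<close>, and
  its average at scale \<open>s\<close> is \<open>- s\<close> times the \<open>s\<close>-derivative of \<open>avg \<eta> s f x\<close>.\<close>

lemma radial_flux:
  fixes \<eta> :: "'a \<Rightarrow> real"
  defines "\<delta> \<equiv> \<lambda>z. real DIM('a) * \<eta> z + z \<bullet> gradient \<eta> z"
  assumes \<eta>: "unit_kernel \<eta>" "Ck_on (Suc j) UNIV \<eta>" and fc: "continuous_on UNIV f"
    and int: "set_integrable lborel {0<..} (\<lambda>s. s powr - 1 *\<^sub>R avg \<delta> s f x)"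
  shows "pot {0<..} (- 1) \<delta> f x = f x * (\<integral>z. \<eta> z \<partial>lborel)"
proof -
  let ?n = "DIM('a)"
  note kg = kernel_gradient[OF \<eta>]
  have kd: "unit_kernel \<delta>"
    using \<eta>(1) kg unfolding unit_kernel_def \<delta>_def by (auto intro!: continuous_intros)
  obtain M where M: "M > 0" "\<And>z. norm (\<eta> z) \<le> M * indicator (cball 0 1) z"
    using kernel_bounded[OF \<eta>(1)] by metis
  obtain Md where Md: "Md > 0" "\<And>z. norm (\<delta> z) \<le> Md"
    using kernel_bounded[OF kd] by metis
  define A where "A s = avg \<eta> s f x" for s
  have D: "DERIV A s0 :> - (s0 powr - 1 *\<^sub>R avg \<delta> s0 f x)" if s0: "0 < s0" for s0
  proof -
    \<comment> \<open>The neighbourhood of \<open>s0\<close> stays above \<open>r\<close>, which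
      bounds the negative powers of \<open>s\<close>.\<close>
    define r where "r = s0 / 2"
    have r: "0 < r" using s0 by (simp add: r_def)
    define R where "R = norm x + 2 * s0"
    obtain B where B: "\<And>y. norm y \<le> R \<Longrightarrow> \<bar>f y\<bar> \<le> B"
      using f_loc_bounded unfolding loc_bounded_def by meson
    have B0: "0 \<le> B" using B[of 0] s0 by (simp add: R_def)
    \<comment> \<open>The \<open>s\<close>-derivative of
      \<open>f y * \<eta> ((x - y) / s) / s ^ n\<close>: the power and the argument each contribute
      one summand of \<delta>.\<close>
    define G where "G s y = - (1 / s ^ Suc ?n) * (f y * \<delta> ((1 / s) *\<^sub>R (x - y)))" for s y
    have pos: "r < s" if "dist s s0 < r" for s
      using that unfolding r_def dist_real_def by linarith
    have "GDERIV (\<lambda>s. \<integral>y. (1 / s ^ ?n) * (f y * \<eta> ((1 / s) *\<^sub>R (x - y))) \<partial>lborel) s0 :> (\<integral>y. G s0 y \<partial>lborel)"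
    proof (rule GDERIV_integral[OF r])
      fix s assume s: "dist s s0 < r"
      have s_pos: "0 < s" using pos[OF s] r by linarith
      show "integrable lborel (\<lambda>y. (1 / s ^ ?n) * (f y * \<eta> ((1 / s) *\<^sub>R (x - y))))"
        using avg_kernel_form(1)[OF \<eta>(1) f_loc_bounded s_pos, of x] by simp
      fix y
      show "GDERIV (\<lambda>s. (1 / s ^ ?n) * (f y * \<eta> ((1 / s) *\<^sub>R (x - y)))) s :> G s y"
      proof -
        let ?z = "(1 / s) *\<^sub>R (x - y)"
        have "((\<lambda>s. (1 / s) *\<^sub>R (x - y)) has_derivative (\<lambda>h. (- h / s\<^sup>2) *\<^sub>R (x - y))) (at s)"
          using s_pos by (auto intro!: derivative_eq_intros simp: power2_eq_square divide_simps)
        moreover have "(\<eta> has_derivative (\<lambda>h. h \<bullet> gradient \<eta> ?z)) (at ?z)"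
          using differentiable_imp_GDERIV_gradient[OF Ck_on_differentiable[OF \<eta>(2)]] by (simp add: gderiv_def)
        ultimately have "((\<lambda>s. \<eta> ((1 / s) *\<^sub>R (x - y))) has_derivative (\<lambda>h. ((- h / s\<^sup>2) *\<^sub>R (x - y)) \<bullet> gradient \<eta> ?z)) (at s)"
          by (rule has_derivative_compose)
        moreover have "(\<lambda>h. ((- h / s\<^sup>2) *\<^sub>R (x - y)) \<bullet> gradient \<eta> ?z) = (*) (- (1 / s) * (?z \<bullet> gradient \<eta> ?z))"
          by (auto simp: fun_eq_iff power2_eq_square)
        ultimately have 1: "DERIV (\<lambda>s. \<eta> ((1 / s) *\<^sub>R (x - y))) s :> - (1 / s) * (?z \<bullet> gradient \<eta> ?z)"
          by (simp add: has_field_derivative_def)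
        have 2: "DERIV (\<lambda>s. 1 / s ^ ?n) s :> - real ?n / s ^ Suc ?n"
        proof -
          have "DERIV (\<lambda>s. inverse (s ^ ?n)) s :> - (inverse (s ^ ?n) * (real ?n * s ^ (?n - 1)) * inverse (s ^ ?n))"
            using s_pos by (intro DERIV_inverse' DERIV_pow[simplified]) auto
          moreover have "s ^ ?n = s * s ^ (?n - 1)" by (simp add: power_eq_if)
          ultimately show ?thesis using s_pos by (simp add: divide_simps)
        qed
        have "DERIV (\<lambda>s. (1 / s ^ ?n) * (f y * \<eta> ((1 / s) *\<^sub>R (x - y)))) s :>
            (- real ?n / s ^ Suc ?n) * (f y * \<eta> ?z) + (f y * (- (1 / s) * (?z \<bullet> gradient \<eta> ?z))) * (1 / s ^ ?n)"
          by (rule DERIV_mult[OF 2 DERIV_cmult[OF 1]])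
        also have "(- real ?n / s ^ Suc ?n) * (f y * \<eta> ?z) + (f y * (- (1 / s) * (?z \<bullet> gradient \<eta> ?z))) * (1 / s ^ ?n) = G s y"
          using s_pos unfolding G_def \<delta>_def by (simp add: field_simps)
        finally show ?thesis by simp
      qed
      show "norm (G s y) \<le> (1 / r ^ Suc ?n * (B * Md)) * indicator (cball 0 R) y"
      proof (cases "norm ((1 / s) *\<^sub>R (x - y)) < 1")
        case True
        have "norm (x - y) < s" using True s_pos by (simp add: divide_less_eq)
        moreover have "s \<le> 2 * s0" using s s0 unfolding r_def dist_real_def by linarith
        ultimately have y: "norm y \<le> R" unfolding R_def by norm
        have "1 / s ^ Suc ?n \<le> 1 / r ^ Suc ?n"
          using pos[OF s] r by (intro divide_left_mono power_mono mult_pos_pos zero_less_power) auto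
        then have "1 / s ^ Suc ?n * (\<bar>f y\<bar> * norm (\<delta> ((1 / s) *\<^sub>R (x - y)))) \<le> 1 / r ^ Suc ?n * (B * Md)"
          using B[OF y] Md B0 r s_pos by (intro mult_mono) auto
        then show ?thesis using y s_pos unfolding G_def by (simp add: abs_mult del: power_Suc)
      next
        case False
        then have "\<delta> ((1 / s) *\<^sub>R (x - y)) = 0" using kd unfolding unit_kernel_def by auto
        then show ?thesis using B0 Md(1) r unfolding G_def by simp
      qed
    qed (rule indicator_ball_integrable)
    then have 3: "DERIV (\<lambda>s. \<integral>y. (1 / s ^ ?n) * (f y * \<eta> ((1 / s) *\<^sub>R (x - y))) \<partial>lborel) s0 :> (\<integral>y. G s0 y \<partial>lborel)"
      by simp
    have "DERIV A s0 :> (\<integral>y. G s0 y \<partial>lborel)"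
    proof (rule has_field_derivative_transform_within_open[OF 3 open_greaterThan[of 0]])
      show "(\<integral>y. (1 / s ^ ?n) * (f y * \<eta> ((1 / s) *\<^sub>R (x - y))) \<partial>lborel) = A s" if "s \<in> {0<..}" for s
        using avg_kernel_form(2)[OF \<eta>(1) f_loc_bounded, of s x] that unfolding A_def by simp
    qed (use s0 in simp)
    moreover have "(\<integral>y. G s0 y \<partial>lborel) = - (s0 powr - 1 *\<^sub>R avg \<delta> s0 f x)"
      using avg_kernel_form(2)[OF kd f_loc_bounded s0, of x] s0 unfolding G_def
      by (simp add: powr_minus_divide)
    ultimately show ?thesis by simp
  qed
  \<comment> \<open>As the scale shrinks, continuity of \<open>f\<close> concentrates the average at
    \<open>x\<close>.\<close>
  have L0: "(A \<longlongrightarrow> f x * (\<integral>z. \<eta> z \<partial>lborel)) (at_right 0)"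
    unfolding tendsto_at_iff_sequentially comp_def
  proof (intro allI impI)
    fix X :: "nat \<Rightarrow> real" assume X: "\<forall>i. X i \<in> {0<..} - {0}" and Xlim: "X \<longlonglongrightarrow> 0"
    obtain K where K: "\<And>n. \<bar>X n\<bar> \<le> K"
      using convergent_imp_Bseq[OF convergentI[OF Xlim]] unfolding Bseq_def by auto
    obtain B where B: "\<And>y. norm y \<le> norm x + K \<Longrightarrow> \<bar>f y\<bar> \<le> B"
      using f_loc_bounded unfolding loc_bounded_def by meson
    have "(\<lambda>n. \<integral>z. f (x - X n *\<^sub>R z) *\<^sub>R \<eta> z \<partial>lborel) \<longlonglongrightarrow> (\<integral>z. f x *\<^sub>R \<eta> z \<partial>lborel)"
    proof (rule integral_dominated_convergence)
      show "integrable lborel (\<lambda>z::'a. \<bar>B\<bar> * M * indicator (cball 0 1) z)" by (rule indicator_ball_integrable)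
      have [measurable]: "\<eta> \<in> borel_measurable borel" by (rule kernel_measurable[OF \<eta>(1)])
      show "(\<lambda>z. f x *\<^sub>R \<eta> z) \<in> borel_measurable lborel" by measurable
      show "(\<lambda>z. f (x - X n *\<^sub>R z) *\<^sub>R \<eta> z) \<in> borel_measurable lborel" for n
        using avg_integrable[OF \<eta>(1) f_loc_bounded] by (rule borel_measurable_integrable)
      show "AE z in lborel. (\<lambda>n. f (x - X n *\<^sub>R z) *\<^sub>R \<eta> z) \<longlonglongrightarrow> f x *\<^sub>R \<eta> z"
      proof (rule AE_I2)
        fix z :: 'a
        have "(\<lambda>n. x - X n *\<^sub>R z) \<longlonglongrightarrow> x - 0 *\<^sub>R z" by (intro tendsto_intros Xlim)
        then have "(\<lambda>n. f (x - X n *\<^sub>R z)) \<longlonglongrightarrow> f x"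
          using continuous_on_tendsto_compose[OF fc] by simp
        then show "(\<lambda>n. f (x - X n *\<^sub>R z) *\<^sub>R \<eta> z) \<longlonglongrightarrow> f x *\<^sub>R \<eta> z" by (intro tendsto_intros)
      qed
      show "AE z in lborel. norm (f (x - X n *\<^sub>R z) *\<^sub>R \<eta> z) \<le> \<bar>B\<bar> * M * indicator (cball 0 1) z" for n
      proof (rule AE_I2)
        fix z :: 'a
        show "norm (f (x - X n *\<^sub>R z) *\<^sub>R \<eta> z) \<le> \<bar>B\<bar> * M * indicator (cball 0 1) z"
        proof (cases "norm z \<le> 1")
          case True
          have "\<bar>X n\<bar> * norm z \<le> K * 1" using True K[of n] by (intro mult_mono) auto
          then have "norm (x - X n *\<^sub>R z) \<le> norm x + K" using norm_triangle_ineq4[of x "X n *\<^sub>R z"] by simp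
          from B[OF this] have "\<bar>f (x - X n *\<^sub>R z)\<bar> * norm (\<eta> z) \<le> \<bar>B\<bar> * M"
            using M(2)[of z] True by (intro mult_mono) auto
          then show ?thesis using True by (simp add: abs_mult)
        next
          case False
          then have "\<eta> z = 0" using \<eta>(1) by (simp add: unit_kernel_def)
          then show ?thesis using M(1) by simp
        qed
      qed
    qed
    then show "(\<lambda>n. A (X n)) \<longlonglongrightarrow> f x * (\<integral>z. \<eta> z \<partial>lborel)"
      unfolding A_def avg_def by simp
  qed
  obtain P where P: "P > 0" "\<And>x s. 0 < s \<Longrightarrow> norm (avg \<eta> s f x) \<le> P * max s 1 powr - \<beta>"
    using avg_bound_uniform[OF \<eta>(1)] by blast
  have L1: "(A \<longlongrightarrow> 0) at_top"
  proof (rule Lim_null_comparison)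
    show "\<forall>\<^sub>F s in at_top. norm (A s) \<le> P * s powr - \<beta>"
      using eventually_ge_at_top[of 1]
    proof eventually_elim
      case (elim s)
      then show ?case using P(2)[of s x] by (simp add: A_def max_def)
    qed
    show "((\<lambda>s. P * s powr - \<beta>) \<longlongrightarrow> 0) at_top"
      using \<beta> by (intro tendsto_mult_right_zero tendsto_neg_powr[OF _ filterlim_ident]) simp
  qed
  have "set_integrable lborel {0<..} (\<lambda>s. - (s powr - 1 *\<^sub>R avg \<delta> s f x))"
    using int by (simp add: set_integrable_def)
  from improper_FTC[OF D this L0 L1]
  have "(LBINT s:{0<..}. - (s powr - 1 *\<^sub>R avg \<delta> s f x)) = - (f x * (\<integral>z. \<eta> z \<partial>lborel))" by simp
  then show ?thesis
    unfolding pot_def set_lebesgue_integral_def by simp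
qed

text \<open>The trace of the second derivatives of \<psi> is the kernel of
  \<open>radial_flux\<close>, whose potential is \<open>f x\<close> times the integral of \<eta>,
  and \<open>newton_const_flux\<close> turns the factor into -1. Hoelder continuity makes each
  second derivative integrable over all scales separately, so the trace can be taken under the scale
  integral. The parameter \<open>N = 2\<close> supplies a bump of class \<open>C^3\<close>.\<close>

lemma newton_classical:
  assumes "ball_Hoelder \<alpha> f" and \<alpha>: "0 < \<alpha>" "\<alpha> < 1"
  shows "laplacian (newton f) x = - f x"
proof -
  let ?c = "newton_const TYPE('a) 2"
  let ?\<psi> = "bump (Suc (Suc 2)) :: 'a \<Rightarrow> real"
  have fc: "continuous_on UNIV f" by (rule ball_Hoelder_continuous[OF assms(1) \<alpha>(1)])
  have C3: "Ck_on (Suc (Suc (Suc 0))) UNIV ?\<psi>"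
    using Ck_on_bump[of "Suc (Suc (Suc 0))" 0] by (simp only: numeral_2_eq_2 add_0_right)
  note k1 = kernel_gradient[OF bump_kernel C3]
  define \<eta> where "\<eta> z = - 2 * real (Suc (Suc 2)) * bump (Suc 2) z" for z :: 'a
  have g: "gradient ?\<psi> = (\<lambda>z. \<eta> z *\<^sub>R z)" unfolding gradient_bump \<eta>_def ..
  have k\<eta>: "unit_kernel \<eta>"
    using bump_kernel[of 2, where 'a = 'a] unfolding unit_kernel_def \<eta>_def by (auto intro!: continuous_intros)
  have C\<eta>: "Ck_on (Suc 0) UNIV \<eta>"
    unfolding \<eta>_def[abs_def] using bump_C1[of 1, where 'a = 'a] by (intro Ck_on_cmult) (simp only: numeral_2_eq_2 One_nat_def)
  define \<kappa> where "\<kappa> b z = gradient (\<lambda>z. gradient ?\<psi> z \<bullet> b) z \<bullet> b" for b z :: 'a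
  have kb: "unit_kernel (\<lambda>z. gradient ?\<psi> z \<bullet> b)" for b by (rule kernel_inner[OF k1])
  have cb: "Ck_on (Suc (Suc 0)) UNIV (\<lambda>z. gradient ?\<psi> z \<bullet> b)" if "b \<in> Basis" for b
    using C3 that unfolding Ck_on.simps(2)[of "Suc (Suc 0)"] by blast
  have int: "set_integrable lborel {0<..} (\<lambda>s. s powr - 1 *\<^sub>R avg (gradient (\<lambda>z. gradient ?\<psi> z \<bullet> b)) s f y)" if "b \<in> Basis" for b y
    using kernel_gradient[OF kb cb[OF that]] integral_gradient_kernel[OF kb cb[OF that]] assms(1) \<alpha>
    by (intro pot_split(1) small_pot_integrable_mean_zero large_pot_integrable) auto
  have sumeq: "(\<Sum>b\<in>Basis. \<kappa> b z) = real DIM('a) * \<eta> z + z \<bullet> gradient \<eta> z" for z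
  proof -
    have "\<kappa> b z = \<eta> z + (z \<bullet> b) * (gradient \<eta> z \<bullet> b)" if b: "b \<in> Basis" for b
    proof -
      have "(\<lambda>z. gradient ?\<psi> z \<bullet> b) = (\<lambda>z. \<eta> z * (z \<bullet> b))" unfolding g by simp
      moreover have "gradient (\<lambda>z. \<eta> z * (z \<bullet> b)) z = \<eta> z *\<^sub>R b + (z \<bullet> b) *\<^sub>R gradient \<eta> z"
        by (subst gradient_mult) (use Ck_on_differentiable[OF C\<eta>] GDERIV_imp_differentiable[OF GDERIV_inner_left] in auto)
      ultimately show ?thesis using b by (simp add: \<kappa>_def inner_add_left)
    qed
    then have "(\<Sum>b\<in>Basis. \<kappa> b z) = (\<Sum>b\<in>Basis. \<eta> z + (z \<bullet> b) * (gradient \<eta> z \<bullet> b))" by simp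
    also have "\<dots> = real DIM('a) * \<eta> z + z \<bullet> gradient \<eta> z"
      by (simp add: sum.distrib euclidean_inner[of z "gradient \<eta> z"])
    finally show ?thesis .
  qed
  have D: "GDERIV (\<lambda>x. gradient (newton f) x \<bullet> b) x :> ?c *\<^sub>R pot {0<..} (- 1) (gradient (\<lambda>z. gradient ?\<psi> z \<bullet> b)) f x"
    if b: "b \<in> Basis" for b
  proof -
    have s: "pot {0<..} 0 (\<lambda>z. gradient ?\<psi> z \<bullet> b) f y = pot {0<..1} 0 (\<lambda>z. gradient ?\<psi> z \<bullet> b) f y + pot {1<..} 0 (\<lambda>z. gradient ?\<psi> z \<bullet> b) f y" for y
      by (intro pot_split(2) small_pot_integrable large_pot_integrable kb f_loc_bounded) auto
    have "GDERIV (pot {1<..} 0 (\<lambda>z. gradient ?\<psi> z \<bullet> b) f) x :> pot {1<..} (0 - 1) (gradient (\<lambda>z. gradient ?\<psi> z \<bullet> b)) f x"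
      by (rule GDERIV_large_pot[OF kb cb[OF b]]) simp
    from GDERIV_add[OF GDERIV_small_pot_0[OF kb cb[OF b] assms(1) \<alpha>(1), of x] this]
    have "GDERIV (\<lambda>y. pot {0<..} 0 (\<lambda>z. gradient ?\<psi> z \<bullet> b) f y) x :> pot {0<..1} (- 1) (gradient (\<lambda>z. gradient ?\<psi> z \<bullet> b)) f x + pot {1<..} (- 1) (gradient (\<lambda>z. gradient ?\<psi> z \<bullet> b)) f x"
      unfolding s by simp
    also have "pot {0<..1} (- 1) (gradient (\<lambda>z. gradient ?\<psi> z \<bullet> b)) f x + pot {1<..} (- 1) (gradient (\<lambda>z. gradient ?\<psi> z \<bullet> b)) f x = pot {0<..} (- 1) (gradient (\<lambda>z. gradient ?\<psi> z \<bullet> b)) f x"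
      using kernel_gradient[OF kb cb[OF b]] integral_gradient_kernel[OF kb cb[OF b]] assms(1) \<alpha>
      by (intro pot_split(2)[symmetric] small_pot_integrable_mean_zero large_pot_integrable) auto
    finally have "GDERIV (\<lambda>y. pot {0<..} 0 (\<lambda>z. gradient ?\<psi> z \<bullet> b) f y) x :> pot {0<..} (- 1) (gradient (\<lambda>z. gradient ?\<psi> z \<bullet> b)) f x" .
    from GDERIV_mult[OF GDERIV_const this, of ?c] show ?thesis
      by (simp add: gradient_newton_component[of _ b 2])
  qed
  have inner_eq: "pot {0<..} (- 1) (gradient (\<lambda>z. gradient ?\<psi> z \<bullet> b)) f x \<bullet> b = pot {0<..} (- 1) (\<kappa> b) f x" if b: "b \<in> Basis" for b
    unfolding \<kappa>_def[abs_def] by (rule pot_inner[OF kernel_gradient[OF kb cb[OF b]] f_loc_bounded int[OF b]])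
  have k\<kappa>: "unit_kernel (\<kappa> b)" if "b \<in> Basis" for b
    unfolding \<kappa>_def[abs_def] by (rule kernel_inner[OF kernel_gradient[OF kb cb[OF that]]])
  have avg_sum: "avg (\<lambda>z. \<Sum>b\<in>Basis. \<kappa> b z) s f x = (\<Sum>b\<in>Basis. avg (\<kappa> b) s f x)" for s
    unfolding avg_def scaleR_sum_right
    by (intro Bochner_Integration.integral_sum avg_integrable k\<kappa> f_loc_bounded)
  have int\<kappa>: "integrable lborel (\<lambda>s. indicat_real {0<..} s *\<^sub>R s powr - 1 *\<^sub>R avg (\<kappa> b) s f x)" if b: "b \<in> Basis" for b
  proof -
    have "integrable lborel (\<lambda>s. (indicat_real {0<..} s *\<^sub>R s powr - 1 *\<^sub>R avg (gradient (\<lambda>z. gradient ?\<psi> z \<bullet> b)) s f x) \<bullet> b)"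
      using int[OF b, of x] unfolding set_integrable_def by (rule integrable_inner_left)
    then show ?thesis
      unfolding inner_scaleR_left avg_inner[OF kernel_gradient[OF kb cb[OF b]] f_loc_bounded] \<kappa>_def[abs_def] by simp
  qed
  have tot: "(\<lambda>s. indicat_real {0<..} s *\<^sub>R s powr - 1 *\<^sub>R avg (\<lambda>z. \<Sum>b\<in>Basis. \<kappa> b z) s f x) =
      (\<lambda>s. \<Sum>b\<in>Basis. indicat_real {0<..} s *\<^sub>R s powr - 1 *\<^sub>R avg (\<kappa> b) s f x)"
    unfolding avg_sum scaleR_sum_right ..
  have "laplacian (newton f) x = (\<Sum>b\<in>Basis. ?c * pot {0<..} (- 1) (\<kappa> b) f x)"
    unfolding laplacian_def by (intro sum.cong refl) (simp only: gradient_eqI[OF D] inner_scaleR_left inner_eq)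
  also have "\<dots> = ?c * (\<Sum>b\<in>Basis. pot {0<..} (- 1) (\<kappa> b) f x)" by (simp add: sum_distrib_left)
  also have "(\<Sum>b\<in>Basis. pot {0<..} (- 1) (\<kappa> b) f x) = pot {0<..} (- 1) (\<lambda>z. \<Sum>b\<in>Basis. \<kappa> b z) f x"
    unfolding pot_def set_lebesgue_integral_def tot by (intro Bochner_Integration.integral_sum[symmetric] int\<kappa>)
  also have "\<dots> = f x * (\<integral>z. \<eta> z \<partial>lborel)"
    unfolding sumeq
  proof (rule radial_flux[OF k\<eta> C\<eta> fc])
    show "set_integrable lborel {0<..} (\<lambda>s. s powr - 1 *\<^sub>R avg (\<lambda>z. real DIM('a) * \<eta> z + z \<bullet> gradient \<eta> z) s f x)"
      unfolding set_integrable_def sumeq[symmetric] tot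
      by (intro Bochner_Integration.integrable_sum int\<kappa>)
  qed
  also have "?c * (f x * (\<integral>z. \<eta> z \<partial>lborel)) = - f x * (?c * (2 * real (Suc (Suc 2)) * (\<integral>z. bump (Suc 2) z \<partial>(lborel :: 'a measure))))"
    unfolding \<eta>_def by simp
  also have "\<dots> = - f x" unfolding newton_const_flux[OF dim] by simp
  finally show ?thesis .
qed

end

section \<open>The superposition operator\<close>

text \<open>The closed ball of radius \<open>e\<close> of \<open>F_k\<close> in pointwise,
  real-valued form, which avoids suprema in \<open>ennreal\<close>.\<close>

definition F_bound :: "real \<Rightarrow> real \<Rightarrow> ('a::euclidean_space \<Rightarrow> real) \<Rightarrow> bool" where
  "F_bound k e u \<longleftrightarrow> Ck_on 1 UNIV u \<and> (\<forall>x. \<bar>u x\<bar> + norm (gradient u x) \<le> e * (1 + norm x) powr - k)"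

lemma F_bound_iff:
  assumes "0 \<le> e"
  shows "F_bound k e u \<longleftrightarrow> u \<in> F_space k \<and> F_norm k u \<le> ennreal e"
proof -
  have "(1 + norm x) powr k * v \<le> e \<longleftrightarrow> v \<le> e * (1 + norm x) powr - k" for x :: 'a and v
  proof -
    have "0 < 1 + norm x" by (simp add: add_pos_nonneg)
    then have "0 < (1 + norm x) powr k" by simp
    then show ?thesis by (simp add: powr_minus_divide pos_le_divide_eq mult.commute)
  qed
  then have "F_norm k u \<le> ennreal e \<longleftrightarrow> (\<forall>x. \<bar>u x\<bar> + norm (gradient u x) \<le> e * (1 + norm x) powr - k)"
    unfolding F_norm_def SUP_le_iff using assms by (simp add: ennreal_le_iff)
  moreover have "F_norm k u < \<infinity>" if "F_norm k u \<le> ennreal e"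
    using that by (rule le_less_trans) simp
  ultimately show ?thesis unfolding F_bound_def F_space_def by auto
qed

lemma F_bound_differentiable: "F_bound k e u \<Longrightarrow> u differentiable (at x)"
  unfolding F_bound_def by simp

lemma F_bound_continuous_gradient: "F_bound k e u \<Longrightarrow> continuous_on UNIV (gradient u)"
  unfolding F_bound_def using Ck_on_1_continuous_gradient[of 0 u] by simp

lemma F_bound_continuous: "F_bound k e u \<Longrightarrow> continuous_on UNIV u"
  unfolding F_bound_def using Ck_on_continuous by blast

text \<open>\<open>grad_zp_sup\<close> ranges over functions of positive norm. A function outside
  this range has an empty set of points at which the gradient of \<open>g\<close> would be
  evaluated, so nothing is lost.\<close>

lemma F_norm_pos_iff:
  "0 < F_norm k u \<longleftrightarrow> (\<exists>x. (u x, gradient u x) \<noteq> (0, 0))"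
proof -
  have "F_norm k u \<le> 0 \<longleftrightarrow> (\<forall>x. (1 + norm x) powr k * (\<bar>u x\<bar> + norm (gradient u x)) \<le> 0)"
    unfolding F_norm_def SUP_le_iff by (simp add: ennreal_eq_0_iff)
  also have "\<dots> \<longleftrightarrow> (\<forall>x. (u x, gradient u x) = (0, 0))"
  proof -
    have "(1 + norm x) powr k * (\<bar>u x\<bar> + norm (gradient u x)) \<le> 0 \<longleftrightarrow> (u x, gradient u x) = (0, 0)" for x
    proof -
      have "0 < 1 + norm x" by (simp add: add_pos_nonneg)
      then have "0 < (1 + norm x) powr k" by simp
      then have "(1 + norm x) powr k * (\<bar>u x\<bar> + norm (gradient u x)) \<le> 0 \<longleftrightarrow> \<bar>u x\<bar> + norm (gradient u x) \<le> 0"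
        unfolding mult_le_0_iff by (meson less_imp_le not_less)
      also have "\<dots> \<longleftrightarrow> \<bar>u x\<bar> = 0 \<and> norm (gradient u x) = 0"
        using norm_ge_zero[of "gradient u x"] by linarith
      finally show ?thesis by simp
    qed
    then show ?thesis by simp
  qed
  finally have "F_norm k u = 0 \<longleftrightarrow> (\<forall>x. (u x, gradient u x) = (0, 0))" by simp
  then show ?thesis by (simp add: zero_less_iff_neq_zero)
qed

text \<open>Bounds on \<open>D_{(z,p)}g\<close> are available only along functions of the ball;
  convexity provides them along the segment joining two of its members.\<close>

lemma F_bound_convex:
  assumes "F_bound k e u" "F_bound k e v" "0 \<le> t" "t \<le> 1"
  shows "F_bound k e (\<lambda>x. (1 - t) * u x + t * v x)"
    and "gradient (\<lambda>x. (1 - t) * u x + t * v x) x = (1 - t) *\<^sub>R gradient u x + t *\<^sub>R gradient v x"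
proof -
  note d = F_bound_differentiable[OF assms(1)] F_bound_differentiable[OF assms(2)]
  show g: "gradient (\<lambda>x. (1 - t) * u x + t * v x) x = (1 - t) *\<^sub>R gradient u x + t *\<^sub>R gradient v x" for x
    using d by (simp add: gradient_add gradient_cmult)
  have "Ck_on 1 UNIV (\<lambda>x. (1 - t) * u x + t * v x)"
    using assms(1,2) unfolding F_bound_def by (intro Ck_on_add Ck_on_cmult) auto
  moreover have "\<bar>(1 - t) * u x + t * v x\<bar> + norm (gradient (\<lambda>x. (1 - t) * u x + t * v x) x) \<le> e * (1 + norm x) powr - k" for x
  proof -
    have "\<bar>(1 - t) * u x + t * v x\<bar> \<le> (1 - t) * \<bar>u x\<bar> + t * \<bar>v x\<bar>"
      using assms(3,4) abs_triangle_ineq[of "(1 - t) * u x" "t * v x"] by (simp add: abs_mult)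
    moreover have "norm ((1 - t) *\<^sub>R gradient u x + t *\<^sub>R gradient v x) \<le> (1 - t) * norm (gradient u x) + t * norm (gradient v x)"
      using assms(3,4) norm_triangle_ineq[of "(1 - t) *\<^sub>R gradient u x" "t *\<^sub>R gradient v x"] by simp
    ultimately have "\<bar>(1 - t) * u x + t * v x\<bar> + norm ((1 - t) *\<^sub>R gradient u x + t *\<^sub>R gradient v x)
        \<le> (1 - t) * (\<bar>u x\<bar> + norm (gradient u x)) + t * (\<bar>v x\<bar> + norm (gradient v x))"
      by (simp add: algebra_simps)
    also have "\<dots> \<le> (1 - t) * (e * (1 + norm x) powr - k) + t * (e * (1 + norm x) powr - k)"
      using assms unfolding F_bound_def by (intro add_mono mult_left_mono) auto
    finally show ?thesis unfolding g by (simp add: algebra_simps)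
  qed
  ultimately show "F_bound k e (\<lambda>x. (1 - t) * u x + t * v x)" unfolding F_bound_def by blast
qed

text \<open>Finiteness carries measurability because the norm of a nonmeasurable function is set to
  \<infinity>; the weighted bound holds only almost everywhere, the norm being an essential
  supremum.\<close>

lemma E_norm_onD:
  fixes h :: "'a::euclidean_space \<Rightarrow> 'b::euclidean_space"
  assumes "E_norm_on S k h \<le> ennreal c" "0 \<le> c"
  shows "h \<in> borel_measurable (lebesgue_on S)"
    and "AE x in lebesgue_on S. norm (h x) \<le> c * (1 + norm x) powr - k"
proof -
  show m: "h \<in> borel_measurable (lebesgue_on S)"
  proof (rule ccontr)
    assume "h \<notin> borel_measurable (lebesgue_on S)"
    then have "E_norm_on S k h = \<infinity>" by (simp add: E_norm_on_def)
    with assms(1) show False by (simp add: top_unique)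
  qed
  have "AE x in lebesgue_on S. ennreal ((1 + norm x) powr k * norm (h x)) \<le> esssup (lebesgue_on S) (\<lambda>x. ennreal ((1 + norm x) powr k * norm (h x)))"
    by (rule esssup_AE)
  then show "AE x in lebesgue_on S. norm (h x) \<le> c * (1 + norm x) powr - k"
  proof eventually_elim
    case (elim x)
    also have "esssup (lebesgue_on S) (\<lambda>x. ennreal ((1 + norm x) powr k * norm (h x))) \<le> ennreal c"
      using assms(1) m by (simp add: E_norm_on_def)
    finally have "(1 + norm x) powr k * norm (h x) \<le> c" using assms(2) by (simp add: ennreal_le_iff)
    moreover have "0 < 1 + norm x" by (simp add: add_pos_nonneg)
    then have "0 < (1 + norm x) powr k" by simp
    ultimately show ?case by (simp add: powr_minus_divide pos_le_divide_eq mult.commute)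
  qed
qed

text \<open>The nodes do not depend on \<open>h\<close>. If \<open>h\<close> depends on a parameter,
  its increment is thus a pointwise limit of finite sums of derivatives at fixed nodes, and
  measurability in the parameter passes from the derivative to the increment without joint
  measurability.\<close>

lemma riemann_sum_tendsto:
  fixes h :: "real \<Rightarrow> real"
  assumes ab: "a < b" and D: "\<And>t. t \<in> {a..b} \<Longrightarrow> DERIV h t :> h' t" and c: "continuous_on {a..b} h'"
  shows "(\<lambda>j. \<Sum>i<Suc j. h' (a + real i * ((b - a) / real (Suc j))) * ((b - a) / real (Suc j))) \<longlonglongrightarrow> h b - h a"
proof (rule LIMSEQ_I)
  fix e :: real assume e: "0 < e"
  \<comment> \<open>With this tolerance for the oscillation of \<open>h'\<close> the total error is
    at most \<open>e' * (b - a) = e / 2\<close>.\<close>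
  define e' where "e' = e / (2 * (b - a))"
  have e': "0 < e'" using e ab by (simp add: e'_def)
  have "uniformly_continuous_on {a..b} h'" by (rule compact_uniformly_continuous[OF c compact_Icc])
  then obtain d where d: "0 < d" "\<And>s t. s \<in> {a..b} \<Longrightarrow> t \<in> {a..b} \<Longrightarrow> dist s t < d \<Longrightarrow> dist (h' s) (h' t) < e'"
    unfolding uniformly_continuous_on_def using e' by metis
  obtain N where N: "(b - a) / real (Suc N) < d"
  proof -
    obtain N :: nat where "(b - a) / d < real N" using reals_Archimedean2 by blast
    then have "(b - a) / d < real (Suc N)" by simp
    then have "(b - a) / real (Suc N) < d" using d(1) by (simp add: field_simps)
    then show thesis by (rule that)
  qed
  show "\<exists>n0. \<forall>j\<ge>n0. norm ((\<Sum>i<Suc j. h' (a + real i * ((b - a) / real (Suc j))) * ((b - a) / real (Suc j))) - (h b - h a)) < e"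
  proof (intro exI[of _ N] allI impI)
    fix j assume "N \<le> j"
    define \<Delta> where "\<Delta> = (b - a) / real (Suc j)"
    have \<Delta>0: "0 < \<Delta>" using ab by (simp add: \<Delta>_def)
    have "\<Delta> \<le> (b - a) / real (Suc N)" unfolding \<Delta>_def using ab \<open>N \<le> j\<close> by (intro divide_left_mono) auto
    then have \<Delta>d: "\<Delta> < d" using N by linarith
    define p where "p i = a + real i * \<Delta>" for i :: nat
    have top: "real (Suc j) * \<Delta> = b - a" by (simp add: \<Delta>_def)
    have step: "\<bar>h' (p i) * \<Delta> - (h (p (Suc i)) - h (p i))\<bar> \<le> e' * \<Delta>" if i: "i < Suc j" for i
    proof -
      have lt: "p i < p (Suc i)" using \<Delta>0 by (simp add: p_def algebra_simps)
      have "real (Suc i) * \<Delta> \<le> real (Suc j) * \<Delta>" using i \<Delta>0 by (intro mult_right_mono) auto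
      then have up: "p (Suc i) \<le> b" using top by (simp add: p_def)
      have lo: "a \<le> p i" using \<Delta>0 by (simp add: p_def)
      obtain z where z: "p i < z" "z < p (Suc i)" "h (p (Suc i)) - h (p i) = (p (Suc i) - p i) * h' z"
        using MVT2[OF lt, of h h'] D lo up by auto
      have "p (Suc i) - p i = \<Delta>" by (simp add: p_def algebra_simps)
      then have eq: "h' (p i) * \<Delta> - (h (p (Suc i)) - h (p i)) = (h' (p i) - h' z) * \<Delta>"
        using z(3) by (simp add: algebra_simps)
      have "dist (h' (p i)) (h' z) < e'"
        using z lo up lt \<open>p (Suc i) - p i = \<Delta>\<close> \<Delta>d by (intro d(2)) (auto simp: dist_real_def)
      then show ?thesis unfolding eq abs_mult using \<Delta>0 by (simp add: dist_real_def mult_right_mono)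
    qed
    have tel: "h b - h a = (\<Sum>i<Suc j. h (p (Suc i)) - h (p i))"
    proof -
      have "(\<Sum>i<Suc j. h (p (Suc i)) - h (p i)) = h (p (Suc j)) - h (p 0)"
        by (rule sum_lessThan_telescope)
      moreover have "p (Suc j) = b" "p 0 = a" using top by (auto simp: p_def)
      ultimately show ?thesis by (simp only:)
    qed
    have "\<bar>(\<Sum>i<Suc j. h' (p i) * \<Delta>) - (h b - h a)\<bar> = \<bar>\<Sum>i<Suc j. h' (p i) * \<Delta> - (h (p (Suc i)) - h (p i))\<bar>"
      unfolding tel sum_subtractf[symmetric] ..
    also have "\<dots> \<le> (\<Sum>i<Suc j. \<bar>h' (p i) * \<Delta> - (h (p (Suc i)) - h (p i))\<bar>)" by (rule sum_abs)
    also have "\<dots> \<le> (\<Sum>i<Suc j. e' * \<Delta>)" by (intro sum_mono step) auto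
    also have "\<dots> = e' * (b - a)" by (simp only: sum_constant card_lessThan top[symmetric] mult.left_commute)
    also have "\<dots> = e / 2" using ab unfolding e'_def by (simp add: divide_simps)
    also have "\<dots> < e" using e by simp
    finally show "norm ((\<Sum>i<Suc j. h' (a + real i * ((b - a) / real (Suc j))) * ((b - a) / real (Suc j))) - (h b - h a)) < e"
      by (simp only: real_norm_def p_def \<Delta>_def)
  qed
qed

text \<open>A function that is \<open>C^1\<close> off the origin is Lipschitz along a segment through the origin as
  well: the segment meets the origin at most once, and there continuity suffices.\<close>

lemma DERIV_along_segment:
  fixes h :: "'c::euclidean_space \<Rightarrow> real"
  assumes "h differentiable (at (p + t *\<^sub>R q))"
  shows "DERIV (\<lambda>t. h (p + t *\<^sub>R q)) t :> q \<bullet> gradient h (p + t *\<^sub>R q)"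
proof -
  have "((\<lambda>t. h (p + t *\<^sub>R q)) has_derivative (\<lambda>s. (s *\<^sub>R q) \<bullet> gradient h (p + t *\<^sub>R q))) (at t)"
  proof (rule has_derivative_compose[where f = "\<lambda>t. p + t *\<^sub>R q" and f' = "\<lambda>s. s *\<^sub>R q"])
    show "((\<lambda>t. p + t *\<^sub>R q) has_derivative (\<lambda>s. s *\<^sub>R q)) (at t)" by (auto intro!: derivative_eq_intros)
    show "(h has_derivative (\<lambda>v. v \<bullet> gradient h (p + t *\<^sub>R q))) (at (p + t *\<^sub>R q))"
      using differentiable_imp_GDERIV_gradient[OF assms] by (simp add: gderiv_def)
  qed
  then show ?thesis
    unfolding has_field_derivative_def by (rule has_derivative_eq_rhs) (auto simp: mult.commute)
qed

text \<open>Rational parameters are all that can be asked for: outside one null set the gradient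
  bound is available for countably many functions of the segment. Continuity of the gradient off the
  origin extends it, since a violation at one parameter persists on an interval, which contains a
  rational.\<close>

lemma punctured_Lipschitz:
  fixes h :: "'c::euclidean_space \<Rightarrow> real"
  assumes d: "\<And>q. q \<noteq> 0 \<Longrightarrow> h differentiable (at q)" and gc: "continuous_on (UNIV - {0}) (gradient h)"
    and hc: "continuous_on UNIV h"
    and le: "\<And>t. t \<in> \<rat> \<Longrightarrow> 0 \<le> t \<Longrightarrow> t \<le> 1 \<Longrightarrow> a + t *\<^sub>R (b - a) \<noteq> 0 \<Longrightarrow> norm (gradient h (a + t *\<^sub>R (b - a))) \<le> L"
  shows "\<bar>h b - h a\<bar> \<le> L * norm (b - a)"
proof (cases "a = b")
  case False
  define \<gamma> where "\<gamma> t = a + t *\<^sub>R (b - a)" for t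
  have \<gamma>c: "continuous_on S \<gamma>" for S unfolding \<gamma>_def by (intro continuous_intros)
  have bound: "norm (gradient h (\<gamma> t)) \<le> L" if t: "0 < t" "t < 1" "\<gamma> t \<noteq> 0" for t
  proof (rule ccontr)
    assume n: "\<not> norm (gradient h (\<gamma> t)) \<le> L"
    let ?T = "\<gamma> -` (UNIV - {0})"
    have oT: "open ?T" by (rule open_vimage[OF open_delete[OF open_UNIV] \<gamma>c])
    have "continuous_on ?T (\<lambda>t. norm (gradient h (\<gamma> t)))"
      by (intro continuous_on_norm continuous_on_compose2[OF gc \<gamma>c]) auto
    then have "open (?T \<inter> (\<lambda>t. norm (gradient h (\<gamma> t))) -` {L<..})"
      by (rule continuous_open_preimage[OF _ oT open_greaterThan])
    then have "open ((?T \<inter> (\<lambda>t. norm (gradient h (\<gamma> t))) -` {L<..}) \<inter> {0<..<1})"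
      by (rule open_Int) auto
    moreover have "t \<in> (?T \<inter> (\<lambda>t. norm (gradient h (\<gamma> t))) -` {L<..}) \<inter> {0<..<1}"
      using t n by auto
    ultimately obtain e where e: "0 < e" "ball t e \<subseteq> (?T \<inter> (\<lambda>t. norm (gradient h (\<gamma> t))) -` {L<..}) \<inter> {0<..<1}"
      unfolding open_contains_ball by blast
    obtain q where q: "q \<in> \<rat>" "t < q" "q < t + e" using Rats_dense_in_real[of t "t + e"] e(1) by auto
    then have "q \<in> ball t e" by (simp add: dist_real_def)
    with e(2) have "q \<in> {0<..<1}" "\<gamma> q \<noteq> 0" "L < norm (gradient h (\<gamma> q))" by auto
    with le[OF q(1)] show False unfolding \<gamma>_def by auto
  qed
  have piece: "\<bar>h (\<gamma> t) - h (\<gamma> s)\<bar> \<le> L * ((t - s) * norm (b - a))"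
    if st: "0 \<le> s" "s < t" "t \<le> 1" and nz: "\<And>r. s < r \<Longrightarrow> r < t \<Longrightarrow> \<gamma> r \<noteq> 0" for s t
  proof -
    have "continuous_on {s..t} (\<lambda>r. h (\<gamma> r))" by (intro continuous_on_compose2[OF hc \<gamma>c]) auto
    moreover have "((\<lambda>r. h (\<gamma> r)) has_derivative (\<lambda>v. v * ((b - a) \<bullet> gradient h (\<gamma> r)))) (at r)" if "s < r" "r < t" for r
      using DERIV_along_segment[of h a r "b - a"] d[OF nz[OF that]]
      unfolding \<gamma>_def has_field_derivative_def by (simp add: mult_commute_abs)
    ultimately obtain r where r: "r \<in> {s<..<t}" "norm (h (\<gamma> t) - h (\<gamma> s)) \<le> norm ((t - s) * ((b - a) \<bullet> gradient h (\<gamma> r)))"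
      using mvt_general[OF st(2), of "\<lambda>r. h (\<gamma> r)" "\<lambda>r v. v * ((b - a) \<bullet> gradient h (\<gamma> r))"] by blast
    have "\<bar>(b - a) \<bullet> gradient h (\<gamma> r)\<bar> \<le> norm (b - a) * norm (gradient h (\<gamma> r))" by (rule Cauchy_Schwarz_ineq2)
    also have "\<dots> \<le> norm (b - a) * L" using r(1) st nz by (intro mult_left_mono bound) auto
    finally have "(t - s) * \<bar>(b - a) \<bullet> gradient h (\<gamma> r)\<bar> \<le> (t - s) * (norm (b - a) * L)"
      using st by (intro mult_left_mono) auto
    moreover have "norm ((t - s) * ((b - a) \<bullet> gradient h (\<gamma> r))) = (t - s) * \<bar>(b - a) \<bullet> gradient h (\<gamma> r)\<bar>"
      using st by (simp add: abs_mult)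
    ultimately have "\<bar>h (\<gamma> t) - h (\<gamma> s)\<bar> \<le> (t - s) * (norm (b - a) * L)"
      using r(2) unfolding real_norm_def by linarith
    then show ?thesis by (simp only: mult_ac)
  qed
  have ends: "\<gamma> 0 = a" "\<gamma> 1 = b" by (auto simp: \<gamma>_def)
  show ?thesis
  proof (cases "\<exists>t0. 0 < t0 \<and> t0 < 1 \<and> \<gamma> t0 = 0")
    case True
    then obtain t0 where t0: "0 < t0" "t0 < 1" "\<gamma> t0 = 0" by blast
    have uniq: "r = t0" if "\<gamma> r = 0" for r
    proof -
      have "(r - t0) *\<^sub>R (b - a) = 0" using that t0(3) unfolding \<gamma>_def by (metis add_left_cancel right_minus_eq scaleR_left.diff)
      then show ?thesis using False by simp
    qed
    have nz: "\<gamma> r \<noteq> 0" if "r \<noteq> t0" for r using uniq that by blast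
    have "\<bar>h (\<gamma> t0) - h (\<gamma> 0)\<bar> \<le> L * ((t0 - 0) * norm (b - a))"
      by (rule piece) (use t0 in \<open>simp_all add: nz\<close>)
    moreover have "\<bar>h (\<gamma> 1) - h (\<gamma> t0)\<bar> \<le> L * ((1 - t0) * norm (b - a))"
      by (rule piece) (use t0 in \<open>simp_all add: nz\<close>)
    ultimately have "\<bar>h b - h a\<bar> \<le> L * ((t0 - 0) * norm (b - a)) + L * ((1 - t0) * norm (b - a))"
      unfolding ends by linarith
    then show ?thesis by (simp add: algebra_simps)
  next
    case False
    then have "\<bar>h (\<gamma> 1) - h (\<gamma> 0)\<bar> \<le> L * ((1 - 0) * norm (b - a))" by (intro piece) auto
    then show ?thesis unfolding ends by simp
  qed
qed simp

text \<open>A Lebesgue measurable function has a Borel version; resetting the version to 0 where it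
  violates the bound changes it on a null set only and makes the bound hold everywhere.\<close>

lemma borel_representative:
  fixes f :: "'a::euclidean_space \<Rightarrow> real"
  assumes "f \<in> borel_measurable lebesgue" "AE x in lebesgue. \<bar>f x\<bar> \<le> A * (1 + norm x) powr - \<beta>" "0 \<le> A"
  shows "\<exists>h. decaying \<beta> A h \<and> (AE x in lborel. f x = h x)"
proof -
  obtain f' where f': "f' \<in> borel_measurable lborel" "AE x in lborel. f x = f' x"
    using completion_ex_borel_measurable_real[OF assms(1)] by blast
  define h where "h x = (if \<bar>f' x\<bar> \<le> A * (1 + norm x) powr - \<beta> then f' x else 0)" for x
  have [measurable]: "f' \<in> borel_measurable borel" using f'(1) by simp
  have "decaying \<beta> A h"
    unfolding decaying_def
  proof (intro conjI allI)
    show "h \<in> borel_measurable borel" unfolding h_def by measurable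
    show "\<bar>h y\<bar> \<le> A * (1 + norm y) powr - \<beta>" for y using assms(3) by (simp add: h_def)
  qed
  moreover have "AE x in lborel. \<bar>f x\<bar> \<le> A * (1 + norm x) powr - \<beta>"
    using assms(2) by (simp add: AE_completion_iff)
  then have "AE x in lborel. f x = h x"
    using f'(2) by eventually_elim (simp add: h_def)
  ultimately show ?thesis by blast
qed

text \<open>\<open>L\<close> is a finite bound for \<open>grad_zp_sup k g \<epsilon>\<close>, used
  in the Lipschitz estimate, while \<open>Q\<close> is the threshold, which also measures
  \<open>g x 0 0\<close>.\<close>

locale nonlinearity =
  fixes k \<epsilon> L Q :: real and g :: "'a::euclidean_space \<Rightarrow> real \<Rightarrow> 'a \<Rightarrow> real"
  assumes k: "0 < k" "k < real DIM('a) - 2" and \<epsilon>: "0 < \<epsilon>"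
    and g: "\<And>x. Ck_on 1 (UNIV - {(0, 0)}) (\<lambda>(z, p). g x z p)" "\<And>x. continuous_on UNIV (\<lambda>(z, p). g x z p)"
    and L: "0 \<le> L" "L \<le> Q" "grad_zp_sup k g \<epsilon> \<le> ennreal L"
    and g0: "E_norm (k + 2) (\<lambda>x. g x 0 0) \<le> ennreal (\<epsilon> * Q)"
begin

lemma Q: "0 \<le> Q" using L by linarith

lemma gradient_bound:
  assumes "F_bound k \<epsilon> w"
  defines "S \<equiv> {x. (w x, gradient w x) \<noteq> (0, 0)}"
  shows "open S"
    and "(\<lambda>x. grad_zp g x (w x) (gradient w x)) \<in> borel_measurable (lebesgue_on S)"
    and "AE x in lebesgue. x \<in> S \<longrightarrow> norm (grad_zp g x (w x) (gradient w x)) \<le> L * (1 + norm x) powr - 2"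
proof -
  have Seq: "S = - ({x. w x = 0} \<inter> {x. gradient w x = 0})" by (auto simp: S_def)
  have "closed ({x. w x = 0} \<inter> {x. gradient w x = 0})"
    using F_bound_continuous[OF assms(1)] F_bound_continuous_gradient[OF assms(1)]
    by (intro closed_Int closed_Collect_eq continuous_on_const) auto
  then show o: "open S" unfolding Seq by (rule open_Compl)
  have "(\<lambda>x. grad_zp g x (w x) (gradient w x)) \<in> borel_measurable (lebesgue_on S) \<and>
    (AE x in lebesgue. x \<in> S \<longrightarrow> norm (grad_zp g x (w x) (gradient w x)) \<le> L * (1 + norm x) powr - 2)"
  proof (cases "S = {}")
    case True
    then show ?thesis by (simp add: measurable_def space_restrict_space)
  next
    case False
    then have "0 < F_norm k w" unfolding F_norm_pos_iff S_def by auto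
    moreover have "w \<in> F_space k" "F_norm k w \<le> ennreal \<epsilon>" using assms(1) F_bound_iff[of \<epsilon> k w] \<epsilon> by auto
    ultimately have "E_norm_on S 2 (\<lambda>x. grad_zp g x (w x) (gradient w x)) \<le> grad_zp_sup k g \<epsilon>"
      unfolding grad_zp_sup_def S_def by (intro SUP_upper) auto
    then have E: "E_norm_on S 2 (\<lambda>x. grad_zp g x (w x) (gradient w x)) \<le> ennreal L" using L(3) by simp
    have "S \<inter> space lebesgue \<in> sets lebesgue" using o by auto
    then show ?thesis
      using E_norm_onD[OF E L(1)] by (simp add: AE_restrict_space_iff)
  qed
  then show "(\<lambda>x. grad_zp g x (w x) (gradient w x)) \<in> borel_measurable (lebesgue_on S)"
    "AE x in lebesgue. x \<in> S \<longrightarrow> norm (grad_zp g x (w x) (gradient w x)) \<le> L * (1 + norm x) powr - 2" by auto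
qed

lemma g_differentiable: "q \<noteq> 0 \<Longrightarrow> (\<lambda>(z, p). g x z p) differentiable (at q)"
  using g(1)[of x] by (auto simp: zero_prod_def)

lemma g_gradient_continuous: "continuous_on (UNIV - {0}) (gradient (\<lambda>(z, p). g x z p))"
  using g(1)[of x] by (intro continuous_gradientI) (auto simp: zero_prod_def)

definition superpos :: "('a \<Rightarrow> real) \<Rightarrow> 'a \<Rightarrow> real" where
  "superpos u x = g x (u x) (gradient u x)"

text \<open>The null set on which the gradient bound fails varies along the segment from
  \<open>v\<close> to \<open>u\<close>. Restricted to rational parameters, the union is still a null
  set, and outside it \<open>punctured_Lipschitz\<close> applies to the pairs of value and
  gradient.\<close>

lemma superpos_Lipschitz:
  assumes u: "F_bound k \<epsilon> u" and v: "F_bound k \<epsilon> v"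
  shows "AE x in lebesgue. \<bar>superpos u x - superpos v x\<bar> \<le>
    L * (1 + norm x) powr - 2 * (\<bar>u x - v x\<bar> + norm (gradient u x - gradient v x))"
proof -
  define w where "w t x = (1 - t) * v x + t * u x" for t x
  have "AE x in lebesgue. \<forall>t\<in>\<rat> \<inter> {0..1}. (w t x, gradient (w t) x) \<noteq> (0, 0) \<longrightarrow>
      norm (grad_zp g x (w t x) (gradient (w t) x)) \<le> L * (1 + norm x) powr - 2"
  proof (rule AE_ball_countable')
    show "AE x in lebesgue. (w t x, gradient (w t) x) \<noteq> (0, 0) \<longrightarrow>
      norm (grad_zp g x (w t x) (gradient (w t) x)) \<le> L * (1 + norm x) powr - 2" if "t \<in> \<rat> \<inter> {0..1}" for t
    proof -
      have "F_bound k \<epsilon> (w t)" unfolding w_def using that by (intro F_bound_convex v u) auto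
      from gradient_bound(3)[OF this] show ?thesis by simp
    qed
    show "countable (\<rat> \<inter> {0..1::real})" by (intro countable_Int1 countable_rat)
  qed
  then show ?thesis
  proof eventually_elim
    case (elim x)
    let ?h = "\<lambda>(z, p). g x z p"
    let ?a = "(v x, gradient v x)" and ?b = "(u x, gradient u x)"
    have "\<bar>?h ?b - ?h ?a\<bar> \<le> L * (1 + norm x) powr - 2 * norm (?b - ?a)"
    proof (rule punctured_Lipschitz[OF g_differentiable g_gradient_continuous g(2)])
      fix t :: real assume t: "t \<in> \<rat>" "0 \<le> t" "t \<le> 1" and nz: "?a + t *\<^sub>R (?b - ?a) \<noteq> 0"
      have eq: "?a + t *\<^sub>R (?b - ?a) = (w t x, gradient (w t) x)"
        unfolding w_def F_bound_convex(2)[OF v u t(2,3)] by (simp add: algebra_simps)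
      show "norm (gradient ?h (?a + t *\<^sub>R (?b - ?a))) \<le> L * (1 + norm x) powr - 2"
        using elim t nz unfolding eq grad_zp_def by (auto simp: zero_prod_def)
    qed
    also have "\<dots> \<le> L * (1 + norm x) powr - 2 * (\<bar>u x - v x\<bar> + norm (gradient u x - gradient v x))"
      using L(1) norm_Pair_le[of "u x - v x" "gradient u x - gradient v x"] by (intro mult_left_mono) auto
    finally show ?case by (simp add: superpos_def)
  qed
qed

lemma F_bound_zero: "F_bound k \<epsilon> (\<lambda>_. 0)"
  unfolding F_bound_def using \<epsilon> by (simp add: Ck_on_const)

lemma superpos_zero: "superpos (\<lambda>_. 0) = (\<lambda>x. g x 0 0)"
  by (simp add: superpos_def fun_eq_iff)

lemma superpos_zero_measurable: "(\<lambda>x. g x 0 0) \<in> borel_measurable lebesgue"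
  and superpos_zero_bound: "AE x in lebesgue. \<bar>g x 0 0\<bar> \<le> \<epsilon> * Q * (1 + norm x) powr - (k + 2)"
proof -
  have c: "0 \<le> \<epsilon> * Q" using \<epsilon> Q by simp
  show "(\<lambda>x. g x 0 0) \<in> borel_measurable lebesgue"
    using E_norm_onD(1)[OF g0 c] by (simp only: lebesgue_on_UNIV_eq)
  show "AE x in lebesgue. \<bar>g x 0 0\<bar> \<le> \<epsilon> * Q * (1 + norm x) powr - (k + 2)"
    using E_norm_onD(2)[OF g0 c] by (simp only: lebesgue_on_UNIV_eq real_norm_def)
qed

text \<open>Only the gradient of \<open>g\<close> along functions of the ball is known to be
  measurable. For 0 < t \<le> 1 the function \<open>t * u\<close> lies in the ball and vanishes,
  together with its gradient, exactly where \<open>u\<close> does. So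
  \<open>superpos u x - g x 0 0\<close> is recovered on \<open>S\<close> by integrating the
  derivative in \<open>t\<close>, as a limit of Riemann sums.\<close>

lemma superpos_measurable:
  assumes u: "F_bound k \<epsilon> u"
  shows "superpos u \<in> borel_measurable lebesgue"
proof -
  define S where "S = {x. (u x, gradient u x) \<noteq> (0, 0)}"
  have oS: "open S" unfolding S_def by (rule gradient_bound(1)[OF u])
  define h where "h x t = g x (t * u x) (t *\<^sub>R gradient u x)" for x t
  define h' where "h' x t = (u x, gradient u x) \<bullet> grad_zp g x (t * u x) (t *\<^sub>R gradient u x)" for x t
  have D: "DERIV (h x) t :> h' x t" if "x \<in> S" "0 < t" for x t
  proof -
    have "0 + t *\<^sub>R (u x, gradient u x) \<noteq> 0" using that by (auto simp: S_def zero_prod_def)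
    from DERIV_along_segment[OF g_differentiable[OF this], of x]
    show ?thesis unfolding h_def h'_def grad_zp_def by simp
  qed
  have c: "continuous_on {a..b} (h' x)" if "x \<in> S" "0 < a" for x a b
  proof -
    have nz: "t *\<^sub>R (u x, gradient u x) \<noteq> 0" if "t \<in> {a..b}" for t
      using that \<open>0 < a\<close> \<open>x \<in> S\<close> by (auto simp: S_def zero_prod_def)
    have "continuous_on {a..b} (\<lambda>t. gradient (\<lambda>(z, p). g x z p) (t *\<^sub>R (u x, gradient u x)))"
      by (rule continuous_on_compose2[OF g_gradient_continuous]) (use nz in \<open>auto intro!: continuous_intros\<close>)
    then have "continuous_on {a..b} (\<lambda>t. (u x, gradient u x) \<bullet> gradient (\<lambda>(z, p). g x z p) (t *\<^sub>R (u x, gradient u x)))"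
      by (intro continuous_on_inner continuous_on_const)
    then show ?thesis by (simp add: h'_def grad_zp_def)
  qed
  have [measurable]: "(\<lambda>x. (u x, gradient u x)) \<in> borel_measurable (lebesgue_on S)"
  proof -
    have "(\<lambda>x. (u x, gradient u x)) \<in> borel_measurable borel"
      using F_bound_continuous[OF u] F_bound_continuous_gradient[OF u]
      by (intro borel_measurable_continuous_onI continuous_intros)
    then have "(\<lambda>x. (u x, gradient u x)) \<in> borel_measurable lebesgue"
      by (intro measurable_completion) simp
    then show ?thesis by (rule measurable_restrict_space1)
  qed
  have m': "(\<lambda>x. h' x t) \<in> borel_measurable (lebesgue_on S)" if t: "0 < t" "t \<le> 1" for t
  proof -
    have w: "F_bound k \<epsilon> (\<lambda>x. (1 - t) * 0 + t * u x)" "gradient (\<lambda>x. (1 - t) * 0 + t * u x) x = t *\<^sub>R gradient u x" for x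
      using F_bound_convex[OF F_bound_zero u, of t] t by simp_all
    have "{x. ((1 - t) * 0 + t * u x, gradient (\<lambda>x. (1 - t) * 0 + t * u x) x) \<noteq> (0, 0)} = S"
      unfolding w(2) S_def using t by auto
    with gradient_bound(2)[OF w(1)] have "(\<lambda>x. grad_zp g x (t * u x) (t *\<^sub>R gradient u x)) \<in> borel_measurable (lebesgue_on S)"
      unfolding w(2) by simp
    then show ?thesis unfolding h'_def by measurable
  qed
  have diff: "(\<lambda>x. h x 1 - h x (1 / real (Suc (Suc m)))) \<in> borel_measurable (lebesgue_on S)" for m
  proof -
    \<comment> \<open>The sums start at \<open>a > 0\<close>, away from the origin where
      \<open>g x\<close> may fail to be differentiable; letting \<open>a\<close> tend to 0
      afterwards uses only continuity. The double successor ensures \<open>a < 1\<close>.\<close>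
    define a where "a = 1 / real (Suc (Suc m))"
    have a: "0 < a" "a < 1" by (auto simp: a_def)
    have "(\<lambda>x. h x 1 - h x a) \<in> borel_measurable (lebesgue_on S)"
    proof (rule borel_measurable_LIMSEQ_real)
      show "(\<lambda>j. \<Sum>i<Suc j. h' x (a + real i * ((1 - a) / real (Suc j))) * ((1 - a) / real (Suc j))) \<longlonglongrightarrow> h x 1 - h x a"
        if "x \<in> space (lebesgue_on S)" for x
        using that D c a by (intro riemann_sum_tendsto) (auto simp: space_restrict_space)
      show "(\<lambda>x. \<Sum>i<Suc j. h' x (a + real i * ((1 - a) / real (Suc j))) * ((1 - a) / real (Suc j))) \<in> borel_measurable (lebesgue_on S)" for j
      proof (intro borel_measurable_sum borel_measurable_times borel_measurable_const m')
        fix i assume "i \<in> {..<Suc j}"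
        then have "real i * ((1 - a) / real (Suc j)) \<le> real (Suc j) * ((1 - a) / real (Suc j))"
          using a by (intro mult_right_mono) auto
        then show "a + real i * ((1 - a) / real (Suc j)) \<le> 1" by simp
        show "0 < a + real i * ((1 - a) / real (Suc j))" using a by (intro add_pos_nonneg) auto
      qed
    qed
    then show ?thesis by (simp add: a_def)
  qed
  have "(\<lambda>x. superpos u x - g x 0 0) \<in> borel_measurable (lebesgue_on S)"
  proof (rule borel_measurable_LIMSEQ_real[OF _ diff])
    fix x
    have "(\<lambda>m. 1 / real (Suc m)) \<longlonglongrightarrow> 0" using LIMSEQ_inverse_real_of_nat by (simp add: divide_inverse)
    then have l0: "(\<lambda>m. 1 / real (Suc (Suc m))) \<longlonglongrightarrow> 0" by (rule LIMSEQ_Suc)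
    have "(\<lambda>m. (1 / real (Suc (Suc m))) *\<^sub>R (u x, gradient u x)) \<longlonglongrightarrow> 0 *\<^sub>R (u x, gradient u x)"
      by (intro tendsto_scaleR l0 tendsto_const)
    then have "(\<lambda>m. (\<lambda>(z, p). g x z p) ((1 / real (Suc (Suc m))) *\<^sub>R (u x, gradient u x))) \<longlonglongrightarrow> (\<lambda>(z, p). g x z p) (0 *\<^sub>R (u x, gradient u x))"
      by (rule continuous_on_tendsto_compose[OF g(2)[of x]]) auto
    then have "(\<lambda>m. h x (1 / real (Suc (Suc m)))) \<longlonglongrightarrow> g x 0 0" by (simp add: h_def zero_prod_def)
    moreover have "h x 1 = superpos u x" by (simp add: h_def superpos_def)
    ultimately show "(\<lambda>m. h x 1 - h x (1 / real (Suc (Suc m)))) \<longlonglongrightarrow> superpos u x - g x 0 0"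
      by (simp add: tendsto_diff)
  qed
  then have "(\<lambda>x. if x \<in> S then superpos u x - g x 0 0 else 0) \<in> borel_measurable lebesgue"
    using oS by (subst borel_measurable_if) auto
  then have "(\<lambda>x. g x 0 0 + (if x \<in> S then superpos u x - g x 0 0 else 0)) \<in> borel_measurable lebesgue"
    using superpos_zero_measurable by (rule borel_measurable_add[rotated])
  moreover have "(\<lambda>x. g x 0 0 + (if x \<in> S then superpos u x - g x 0 0 else 0)) = superpos u"
    by (auto simp: fun_eq_iff superpos_def S_def)
  ultimately show ?thesis by simp
qed

lemma weight_mult: "(1 + norm x) powr - 2 * (1 + norm x) powr - k = (1 + norm x) powr - (k + 2)"
  by (subst powr_add[symmetric]) (simp add: algebra_simps)

text \<open>The factor 2 collects the Lipschitz estimate against the zero function, of size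
  \<open>L * \<epsilon> \<le> Q * \<epsilon>\<close>, and the bound \<open>\<epsilon> * Q\<close> on
  \<open>g x 0 0\<close>.\<close>

lemma superpos_bound:
  assumes u: "F_bound k \<epsilon> u"
  shows "AE x in lebesgue. \<bar>superpos u x\<bar> \<le> 2 * \<epsilon> * Q * (1 + norm x) powr - (k + 2)"
  using superpos_Lipschitz[OF u F_bound_zero] superpos_zero_bound
proof eventually_elim
  case (elim x)
  have "\<bar>superpos u x - g x 0 0\<bar> \<le> L * (1 + norm x) powr - 2 * (\<bar>u x\<bar> + norm (gradient u x))"
    using elim(1) unfolding superpos_zero by simp
  also have "\<dots> \<le> L * (1 + norm x) powr - 2 * (\<epsilon> * (1 + norm x) powr - k)"
    using u L(1) unfolding F_bound_def by (intro mult_left_mono) auto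
  also have "\<dots> = L * \<epsilon> * (1 + norm x) powr - (k + 2)" unfolding weight_mult[symmetric] by simp
  also have "\<dots> \<le> Q * \<epsilon> * (1 + norm x) powr - (k + 2)" using L \<epsilon> by (intro mult_right_mono) auto
  finally show ?case using elim(2) by (simp add: algebra_simps)
qed

end

section \<open>The fixed point\<close>

lemma halving_limit:
  fixes a :: "nat \<Rightarrow> 'b::banach"
  assumes "\<And>j m. j \<le> m \<Longrightarrow> norm (a m - a j) \<le> K * (1 / 2) ^ j"
  shows "\<exists>l. a \<longlonglongrightarrow> l"
proof -
  have "Cauchy a"
    unfolding Cauchy_altdef2
  proof (intro allI impI)
    fix e :: real assume "0 < e"
    have "(\<lambda>j. K * (1 / 2) ^ j) \<longlonglongrightarrow> 0"
      by (intro tendsto_mult_right_zero LIMSEQ_power_zero) simp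
    then have "\<forall>\<^sub>F j in sequentially. K * (1 / 2) ^ j < e" using \<open>0 < e\<close> by (rule order_tendstoD)
    then obtain j where "K * (1 / 2) ^ j < e" by (auto simp: eventually_sequentially)
    then have "\<forall>n\<ge>j. dist (a n) (a j) < e"
      using assms[of j] by (auto simp: dist_norm intro: le_less_trans)
    then show "\<exists>N. \<forall>n\<ge>N. dist (a n) (a N) < e" ..
  qed
  then show ?thesis using Cauchy_convergent_iff convergent_def by blast
qed

text \<open>This stands in for completeness of \<open>F_k\<close>: the increments are geometric, so
  values and gradients converge uniformly, and the limit of the gradients is the gradient of the
  limit. The factor 2 sums the geometric tail.\<close>

lemma F_bound_limit:
  fixes U :: "nat \<Rightarrow> 'a::euclidean_space \<Rightarrow> real"
  assumes k: "0 < k" and K: "0 \<le> K" and U: "\<And>j. F_bound k e (U j)"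
    and step: "\<And>j x. \<bar>U (Suc j) x - U j x\<bar> + norm (gradient (U (Suc j)) x - gradient (U j) x) \<le> K * (1 / 2) ^ j * (1 + norm x) powr - k"
  shows "\<exists>u. F_bound k e u \<and>
    (\<forall>j x. \<bar>u x - U j x\<bar> + norm (gradient u x - gradient (U j) x) \<le> 2 * K * (1 / 2) ^ j * (1 + norm x) powr - k)"
proof -
  let ?w = "\<lambda>x::'a. (1 + norm x) powr - k"
  have w: "0 \<le> ?w x" "?w x \<le> 1" for x
    using k powr_mono2'[of "- k" 1 "1 + norm x"] by auto
  have tail: "\<bar>U m x - U j x\<bar> + norm (gradient (U m) x - gradient (U j) x) \<le> 2 * K * ((1 / 2) ^ j - (1 / 2) ^ m) * ?w x"
    if "j \<le> m" for j m x
    using that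
  proof (induction m rule: dec_induct)
    case (step m)
    have "\<bar>U (Suc m) x - U j x\<bar> + norm (gradient (U (Suc m)) x - gradient (U j) x) \<le>
        (\<bar>U (Suc m) x - U m x\<bar> + norm (gradient (U (Suc m)) x - gradient (U m) x)) +
        (\<bar>U m x - U j x\<bar> + norm (gradient (U m) x - gradient (U j) x))"
      using norm_triangle_ineq[of "gradient (U (Suc m)) x - gradient (U m) x" "gradient (U m) x - gradient (U j) x"] by simp
    also have "\<dots> \<le> K * (1 / 2) ^ m * ?w x + 2 * K * ((1 / 2) ^ j - (1 / 2) ^ m) * ?w x"
      by (intro add_mono assms(4) step.IH)
    also have "\<dots> = 2 * K * ((1 / 2) ^ j - (1 / 2) ^ Suc m) * ?w x" by (simp add: algebra_simps)
    finally show ?case .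
  qed simp
  have tail': "\<bar>U m x - U j x\<bar> + norm (gradient (U m) x - gradient (U j) x) \<le> 2 * K * (1 / 2) ^ j * ?w x"
    if "j \<le> m" for j m x
  proof -
    have "2 * K * ((1 / 2) ^ j - (1 / 2) ^ m) * ?w x \<le> 2 * K * (1 / 2) ^ j * ?w x"
      using K w(1) by (intro mult_right_mono mult_left_mono) auto
    then show ?thesis using tail[OF that, of x] by linarith
  qed
  have tail1: "2 * K * (1 / 2) ^ j * ?w x \<le> 2 * K * (1 / 2) ^ j" for j x
    using K w by (intro mult_left_le) auto
  have "\<exists>l. (\<lambda>j. U j x) \<longlonglongrightarrow> l" for x
  proof (rule halving_limit[of _ "2 * K"])
    show "norm (U m x - U j x) \<le> 2 * K * (1 / 2) ^ j" if "j \<le> m" for j m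
      using tail'[OF that, of x] tail1[of j x] norm_ge_zero[of "gradient (U m) x - gradient (U j) x"]
      unfolding real_norm_def by linarith
  qed
  then obtain u where u: "\<And>x. (\<lambda>j. U j x) \<longlonglongrightarrow> u x" by metis
  have "\<exists>l. (\<lambda>j. gradient (U j) x) \<longlonglongrightarrow> l" for x
  proof (rule halving_limit[of _ "2 * K"])
    show "norm (gradient (U m) x - gradient (U j) x) \<le> 2 * K * (1 / 2) ^ j" if "j \<le> m" for j m
      using tail'[OF that, of x] tail1[of j x] by linarith
  qed
  then obtain p where p: "\<And>x. (\<lambda>j. gradient (U j) x) \<longlonglongrightarrow> p x" by metis
  have lim: "\<bar>u x - U j x\<bar> + norm (p x - gradient (U j) x) \<le> 2 * K * (1 / 2) ^ j * ?w x" for j x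
  proof (rule LIMSEQ_le_const2)
    show "(\<lambda>m. \<bar>U m x - U j x\<bar> + norm (gradient (U m) x - gradient (U j) x)) \<longlonglongrightarrow> \<bar>u x - U j x\<bar> + norm (p x - gradient (U j) x)"
      by (intro tendsto_intros u p)
    show "\<exists>N. \<forall>m\<ge>N. \<bar>U m x - U j x\<bar> + norm (gradient (U m) x - gradient (U j) x) \<le> 2 * K * (1 / 2) ^ j * ?w x"
      using tail' by blast
  qed
  have p_near: "norm (p x - gradient (U j) x) \<le> 2 * K * (1 / 2) ^ j" for j x
    using lim[of x j] tail1[of j x] by linarith
  have small: "\<forall>\<^sub>F j in sequentially. 2 * K * (1 / 2) ^ j < e'" if "0 < e'" for e'
  proof -
    have "(\<lambda>j. 2 * K * (1 / 2) ^ j) \<longlonglongrightarrow> 0"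
      by (intro tendsto_mult_right_zero LIMSEQ_power_zero) simp
    then show ?thesis using that by (rule order_tendstoD)
  qed
  have Ud: "(U j has_derivative (\<lambda>h. h \<bullet> gradient (U j) x)) (at x)" for j x
    using differentiable_imp_GDERIV_gradient[OF F_bound_differentiable[OF U]] by (simp add: gderiv_def)
  have "\<exists>v. \<forall>x\<in>UNIV. (\<lambda>j. U j x) \<longlonglongrightarrow> v x \<and> (v has_derivative (\<lambda>h. h \<bullet> p x)) (at x within UNIV)"
  proof (rule has_derivative_sequence[where f' = "\<lambda>j x h. h \<bullet> gradient (U j) x"])
    show "\<forall>\<^sub>F j in sequentially. \<forall>x\<in>UNIV. \<forall>h. norm (h \<bullet> gradient (U j) x - h \<bullet> p x) \<le> e' * norm h" if "0 < e'" for e'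
      using small[OF that]
    proof eventually_elim
      case (elim j)
      show ?case
      proof (intro ballI allI)
        fix x h
        have "norm (h \<bullet> gradient (U j) x - h \<bullet> p x) = \<bar>h \<bullet> (p x - gradient (U j) x)\<bar>"
          by (simp add: inner_diff_right abs_minus_commute)
        also have "\<dots> \<le> norm h * norm (p x - gradient (U j) x)" by (rule Cauchy_Schwarz_ineq2)
        also have "\<dots> \<le> norm h * e'" using p_near[of x j] elim by (intro mult_left_mono) auto
        finally show "norm (h \<bullet> gradient (U j) x - h \<bullet> p x) \<le> e' * norm h" by (simp add: mult.commute)
      qed
    qed
    show "(\<lambda>j. U j 0) \<longlonglongrightarrow> u 0" by (rule u)
  qed (use Ud in auto)
  then obtain v where v: "\<And>x. (\<lambda>j. U j x) \<longlonglongrightarrow> v x" "\<And>x. (v has_derivative (\<lambda>h. h \<bullet> p x)) (at x)" by auto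
  have "v = u" using v(1) u LIMSEQ_unique by blast
  then have G: "GDERIV u x :> p x" for x using v(2) by (simp add: gderiv_def)
  then have gu: "gradient u = p" by (auto intro: gradient_eqI)
  have "continuous_on UNIV p"
  proof (rule uniform_limit_theorem)
    show "uniform_limit UNIV (\<lambda>j. gradient (U j)) p sequentially"
    proof (rule uniform_limitI)
      fix e' :: real assume "0 < e'"
      from small[OF this] show "\<forall>\<^sub>F j in sequentially. \<forall>x\<in>UNIV. dist (gradient (U j) x) (p x) < e'"
        by eventually_elim (use p_near in \<open>auto simp: dist_norm norm_minus_commute intro: le_less_trans\<close>)
    qed
    show "\<forall>\<^sub>F j in sequentially. continuous_on UNIV (gradient (U j))"
      by (intro always_eventually allI F_bound_continuous_gradient[OF U])
  qed simp
  then have "Ck_on 1 UNIV u"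
    using GDERIV_imp_differentiable[OF G] by (auto simp: gu intro!: continuous_intros)
  moreover have "\<bar>u x\<bar> + norm (gradient u x) \<le> e * ?w x" for x
    unfolding gu
  proof (rule LIMSEQ_le_const2)
    show "(\<lambda>j. \<bar>U j x\<bar> + norm (gradient (U j) x)) \<longlonglongrightarrow> \<bar>u x\<bar> + norm (p x)" by (intro tendsto_intros u p)
    show "\<exists>N. \<forall>j\<ge>N. \<bar>U j x\<bar> + norm (gradient (U j) x) \<le> e * ?w x" using U unfolding F_bound_def by blast
  qed
  ultimately have "F_bound k e u" unfolding F_bound_def by blast
  then show ?thesis using lim unfolding gu[symmetric] by blast
qed

section \<open>From Lebesgue measurable densities to the Newtonian potential\<close>

lemma newton_AE_cong:
  assumes "f \<in> borel_measurable borel" "h \<in> borel_measurable borel" "AE x in lborel. f x = h x"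
  shows "newton f = newton h"
proof
  fix x
  note [measurable] = assms(1,2)
  have "(\<integral>y. norm (x - y) powr (2 - real DIM('a)) * f y \<partial>lborel) = (\<integral>y. norm (x - y) powr (2 - real DIM('a)) * h y \<partial>lborel)"
  proof (rule integral_cong_AE)
    show "AE y in lborel. norm (x - y) powr (2 - real DIM('a)) * f y = norm (x - y) powr (2 - real DIM('a)) * h y"
      using assms(3) by eventually_elim simp
  qed measurable
  then show "newton f x = newton h x" by (simp add: newton_def)
qed

lemma newton_diff:
  fixes f h :: "'a::euclidean_space \<Rightarrow> real"
  assumes "2 < \<beta>" "\<beta> < real DIM('a)" "decaying \<beta> A f" "decaying \<beta> B h"
  shows "newton (\<lambda>x. f x - h x) x = newton f x - newton h x"
  unfolding newton_def right_diff_distrib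
  using newton_integrable[OF assms(1,2,3), of x] newton_integrable[OF assms(1,2,4), of x]
  by (subst Bochner_Integration.integral_diff) (auto simp: right_diff_distrib)

text \<open>The bridge from the Lebesgue integrals of \<open>integral_solution\<close> to
  \<open>newton\<close>, which is treated for Borel densities: a change on a null set alters neither
  integrability nor value.\<close>

lemma lebesgue_newton:
  fixes h f :: "'a::euclidean_space \<Rightarrow> real"
  assumes \<beta>: "2 < \<beta>" "\<beta> < real DIM('a)" and h: "decaying \<beta> A h"
    and f: "f \<in> borel_measurable lebesgue" "AE x in lborel. f x = h x"
  shows "integrable lebesgue (\<lambda>y. 1 / norm (x - y) ^ (DIM('a) - 2) * f y)"
    and "1 / ((real DIM('a) - 2) * sphere_area (sphere 0 1 :: 'a set)) * (LINT y|lebesgue. 1 / norm (x - y) ^ (DIM('a) - 2) * f y) = newton h x"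
proof -
  have dim: "3 \<le> DIM('a)" using \<beta> by simp
  \<comment> \<open>At \<open>v = 0\<close> both sides are 0: the power \<open>n - 2\<close> is
    positive, division by 0 yields 0, and so does \<open>0 powr\<close> anything.\<close>
  have ker: "1 / norm v ^ (DIM('a) - 2) = norm v powr (2 - real DIM('a))" for v :: 'a
  proof (cases "v = 0")
    case True
    then show ?thesis using dim by (simp add: power_0_left)
  next
    case False
    have e: "2 - real DIM('a) = - real (DIM('a) - 2)" using dim by (simp add: of_nat_diff)
    show ?thesis unfolding e powr_minus_divide using False by (subst powr_realpow) auto
  qed
  let ?K = "\<lambda>y. norm (x - y) powr (2 - real DIM('a))"
  have hm [measurable]: "h \<in> borel_measurable borel" using h by (simp add: decaying_def)
  have Km [measurable]: "?K \<in> borel_measurable borel" by measurable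
  have m: "(\<lambda>y. ?K y * h y) \<in> borel_measurable lborel" by measurable
  have i: "integrable lebesgue (\<lambda>y. ?K y * h y)"
    using newton_integrable[OF \<beta> h, of x] by (subst integrable_completion[OF m])
  have mf: "(\<lambda>y. ?K y * f y) \<in> borel_measurable lebesgue"
    by (intro borel_measurable_times f(1), rule measurable_completion) simp
  have ae: "AE y in lebesgue. ?K y * h y = ?K y * f y"
    using AE_completion[OF f(2)] by eventually_elim simp
  show "integrable lebesgue (\<lambda>y. 1 / norm (x - y) ^ (DIM('a) - 2) * f y)"
    unfolding ker by (rule integrable_cong_AE_imp[OF i mf]) (use ae in \<open>eventually_elim, simp\<close>)
  have "(LINT y|lebesgue. ?K y * f y) = (LINT y|lebesgue. ?K y * h y)"
    by (rule integral_cong_AE[OF mf borel_measurable_integrable[OF i]]) (use ae in \<open>eventually_elim, auto\<close>)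
  also have "\<dots> = (\<integral>y. ?K y * h y \<partial>lborel)" by (rule integral_completion[OF m])
  finally show "1 / ((real DIM('a) - 2) * sphere_area (sphere 0 1 :: 'a set)) * (LINT y|lebesgue. 1 / norm (x - y) ^ (DIM('a) - 2) * f y) = newton h x"
    unfolding ker newton_def by simp
qed

text \<open>The condition \<open>2 * C * Q \<le> 1\<close> serves twice: densities of size
  \<open>2 * \<epsilon> * Q\<close> have potentials in the ball of radius \<epsilon>, and with
  \<open>L \<le> Q\<close> the map \<open>T\<close> halves distances.\<close>

locale contractive_nonlinearity = nonlinearity +
  fixes C :: real
  assumes C: "0 < C" "2 * C * Q \<le> 1"
    and newton_le: "\<And>A (f :: 'a \<Rightarrow> real) x. decaying (k + 2) A f \<Longrightarrow>
      \<bar>newton f x\<bar> + norm (gradient (newton f) x) \<le> C * A * (1 + norm x) powr (2 - (k + 2))"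
begin

lemma exponent_range: "2 < k + 2" "k + 2 < real DIM('a)" using k by auto

text \<open>The theory of the Newtonian potential is about Borel densities that satisfy their bound everywhere;
  \<open>superpos u\<close> is only Lebesgue measurable and bounded almost everywhere.\<close>

definition borel_superpos :: "('a \<Rightarrow> real) \<Rightarrow> 'a \<Rightarrow> real" where
  "borel_superpos u = (SOME h. decaying (k + 2) (2 * \<epsilon> * Q) h \<and> (AE x in lborel. superpos u x = h x))"

lemma borel_superpos:
  assumes "F_bound k \<epsilon> u"
  shows "decaying (k + 2) (2 * \<epsilon> * Q) (borel_superpos u)" "AE x in lborel. superpos u x = borel_superpos u x"
proof -
  have "\<exists>h. decaying (k + 2) (2 * \<epsilon> * Q) h \<and> (AE x in lborel. superpos u x = h x)"
    using superpos_measurable[OF assms] superpos_bound[OF assms] \<epsilon> Q by (intro borel_representative) auto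
  then have "decaying (k + 2) (2 * \<epsilon> * Q) (borel_superpos u) \<and> (AE x in lborel. superpos u x = borel_superpos u x)"
    unfolding borel_superpos_def by (rule someI_ex)
  then show "decaying (k + 2) (2 * \<epsilon> * Q) (borel_superpos u)" "AE x in lborel. superpos u x = borel_superpos u x" by auto
qed

definition T :: "('a \<Rightarrow> real) \<Rightarrow> 'a \<Rightarrow> real" where
  "T u = newton (borel_superpos u)"

lemma T_C1: "F_bound k \<epsilon> u \<Longrightarrow> Ck_on 1 UNIV (T u)"
  unfolding T_def by (rule decaying_density.newton_C1[of "k + 2" "2 * \<epsilon> * Q"]) (unfold_locales, use exponent_range borel_superpos in auto)

lemma T_differentiable: "F_bound k \<epsilon> u \<Longrightarrow> T u differentiable (at x)"
  using T_C1[of u] by simp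

lemma T_F_bound:
  assumes "F_bound k \<epsilon> u"
  shows "F_bound k \<epsilon> (T u)"
proof -
  have "C * (2 * \<epsilon> * Q) * (1 + norm x) powr (2 - (k + 2)) \<le> \<epsilon> * (1 + norm x) powr - k" for x :: 'a
  proof -
    have "(2 * C * Q) * \<epsilon> \<le> 1 * \<epsilon>" using C \<epsilon> by (intro mult_right_mono) auto
    then have "C * (2 * \<epsilon> * Q) \<le> \<epsilon>" by (simp add: mult_ac)
    then show ?thesis by (auto intro: mult_right_mono)
  qed
  then show ?thesis
    using newton_le[OF borel_superpos(1)[OF assms]] T_C1[OF assms] unfolding F_bound_def T_def by (auto intro: order_trans)
qed

text \<open>The difference of the two Borel densities is small only almost everywhere, so a
  representative \<open>h\<close> replaces it before \<open>newton_le\<close> is applied;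
  \<open>newton h\<close> is still the difference of the potentials, which ignore null sets. The
  factor is \<open>C * L \<le> 1 / 2\<close>.\<close>

lemma T_contraction:
  assumes u: "F_bound k \<epsilon> u" and v: "F_bound k \<epsilon> v" and e: "0 \<le> e"
    and le: "\<And>x. \<bar>u x - v x\<bar> + norm (gradient u x - gradient v x) \<le> e * (1 + norm x) powr - k"
  shows "\<bar>T u x - T v x\<bar> + norm (gradient (T u) x - gradient (T v) x) \<le> e / 2 * (1 + norm x) powr - k"
proof -
  have m [measurable]: "borel_superpos u \<in> borel_measurable borel" "borel_superpos v \<in> borel_measurable borel"
    using borel_superpos(1)[OF u] borel_superpos(1)[OF v] by (auto simp: decaying_def)
  define d where "d y = borel_superpos u y - borel_superpos v y" for y
  have dm: "d \<in> borel_measurable borel" unfolding d_def by measurable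
  have "AE y in lebesgue. \<bar>d y\<bar> \<le> (L * e) * (1 + norm y) powr - (k + 2)"
    using superpos_Lipschitz[OF u v] AE_completion[OF borel_superpos(2)[OF u]] AE_completion[OF borel_superpos(2)[OF v]]
  proof eventually_elim
    case (elim y)
    then have "\<bar>d y\<bar> \<le> L * (1 + norm y) powr - 2 * (\<bar>u y - v y\<bar> + norm (gradient u y - gradient v y))"
      by (simp add: d_def)
    also have "\<dots> \<le> L * (1 + norm y) powr - 2 * (e * (1 + norm y) powr - k)"
      using L(1) by (intro mult_left_mono le) auto
    also have "\<dots> = (L * e) * (1 + norm y) powr - (k + 2)" unfolding weight_mult[symmetric] by simp
    finally show ?case .
  qed
  moreover have "d \<in> borel_measurable lebesgue" using dm by (intro measurable_completion) simp
  ultimately obtain h where h: "decaying (k + 2) (L * e) h" "AE y in lborel. d y = h y"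
    using borel_representative[of d "L * e" "k + 2"] L(1) e by auto
  have eq: "newton h = (\<lambda>x. T u x - T v x)"
  proof -
    have "newton h = newton d"
      using newton_AE_cong[OF dm _ h(2)] h(1) by (simp add: decaying_def)
    also have "\<dots> = (\<lambda>x. T u x - T v x)"
      unfolding d_def T_def using newton_diff[OF exponent_range borel_superpos(1)[OF u] borel_superpos(1)[OF v]] by auto
    finally show ?thesis .
  qed
  have "\<bar>T u x - T v x\<bar> + norm (gradient (T u) x - gradient (T v) x) = \<bar>newton h x\<bar> + norm (gradient (newton h) x)"
    unfolding eq by (simp add: gradient_diff T_differentiable[OF u] T_differentiable[OF v])
  also have "\<dots> \<le> C * (L * e) * (1 + norm x) powr (2 - (k + 2))" by (rule newton_le[OF h(1)])
  also have "\<dots> \<le> e / 2 * (1 + norm x) powr - k"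
  proof -
    have "(2 * C) * L \<le> (2 * C) * Q" using C L by (intro mult_left_mono) auto
    then have "2 * C * L \<le> 1" using C(2) by linarith
    then have "(2 * C * L) * e \<le> 1 * e" using e by (rule mult_right_mono)
    then have "C * (L * e) \<le> e / 2" by simp
    then have "C * (L * e) * (1 + norm x) powr - k \<le> e / 2 * (1 + norm x) powr - k" by (rule mult_right_mono) simp
    then show ?thesis by simp
  qed
  finally show ?thesis .
qed

lemma integral_solution_iff:
  assumes "F_bound k \<epsilon> u"
  shows "integral_solution g u \<longleftrightarrow> T u = u"
  using lebesgue_newton[OF exponent_range borel_superpos(1)[OF assms] superpos_measurable[OF assms] borel_superpos(2)[OF assms]]
  unfolding integral_solution_def superpos_def T_def by (auto simp: fun_eq_iff)

lemma halving_zero: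
  fixes v :: real
  assumes "\<And>j. \<bar>v\<bar> \<le> K * (1 / 2) ^ j"
  shows "v = 0"
proof -
  have "(\<lambda>j. K * (1 / 2) ^ j) \<longlonglongrightarrow> 0"
    by (intro tendsto_mult_right_zero LIMSEQ_power_zero) simp
  then have "\<bar>v\<bar> \<le> 0" by (rule LIMSEQ_le_const) (use assms in auto)
  then show ?thesis by simp
qed

lemma weight_le_1: "(1 + norm x) powr - k \<le> 1"
  using k powr_mono2'[of "- k" 1 "1 + norm x"] by simp

text \<open>Iteration from 0: the first increment is bounded by \<epsilon> because the first iterate
  lies in the ball, and each further increment is halved. In the limit \<open>T u\<close> and
  \<open>u\<close> agree, both being within \<open>\<epsilon> * (1 / 2) ^ j\<close> of the iterate
  of index \<open>Suc j\<close>.\<close>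

lemma fixed_point_exists: "\<exists>u. F_bound k \<epsilon> u \<and> T u = u"
proof -
  define U where "U j = (T ^^ j) (\<lambda>_. 0)" for j
  have Us: "U (Suc j) = T (U j)" for j by (simp add: U_def)
  have U: "F_bound k \<epsilon> (U j)" for j
  proof (induction j)
    case 0
    show ?case using F_bound_zero by (simp add: U_def)
  qed (simp add: Us T_F_bound)
  have step: "\<bar>U (Suc j) x - U j x\<bar> + norm (gradient (U (Suc j)) x - gradient (U j) x) \<le> \<epsilon> * (1 / 2) ^ j * (1 + norm x) powr - k" for j x
  proof (induction j arbitrary: x)
    case 0
    have "U 0 = (\<lambda>_. 0)" by (simp add: U_def)
    then show ?case using U[of "Suc 0"] unfolding F_bound_def by simp
  next
    case (Suc j)
    have "\<bar>T (U (Suc j)) x - T (U j) x\<bar> + norm (gradient (T (U (Suc j))) x - gradient (T (U j)) x) \<le> \<epsilon> * (1 / 2) ^ j / 2 * (1 + norm x) powr - k"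
      using \<epsilon> by (intro T_contraction U Suc) auto
    then show ?case by (simp add: Us)
  qed
  obtain u where u: "F_bound k \<epsilon> u"
    "\<And>j x. \<bar>u x - U j x\<bar> + norm (gradient u x - gradient (U j) x) \<le> 2 * \<epsilon> * (1 / 2) ^ j * (1 + norm x) powr - k"
    using F_bound_limit[of k \<epsilon> \<epsilon> U, OF k(1) _ U step] \<epsilon> by auto
  have "T u x - u x = 0" for x
  proof (rule halving_zero[of _ "2 * \<epsilon>"])
    fix j
    have "\<bar>T u x - T (U j) x\<bar> + norm (gradient (T u) x - gradient (T (U j)) x) \<le> 2 * \<epsilon> * (1 / 2) ^ j / 2 * (1 + norm x) powr - k"
      using \<epsilon> by (intro T_contraction u U) auto
    also have "\<dots> \<le> 2 * \<epsilon> * (1 / 2) ^ j / 2" using \<epsilon> weight_le_1[of x] by (intro mult_left_le) auto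
    finally have 1: "\<bar>T u x - U (Suc j) x\<bar> \<le> \<epsilon> * (1 / 2) ^ j"
      using norm_ge_zero[of "gradient (T u) x - gradient (T (U j)) x"] unfolding Us by linarith
    have "2 * \<epsilon> * (1 / 2) ^ Suc j * (1 + norm x) powr - k \<le> 2 * \<epsilon> * (1 / 2) ^ Suc j"
      using \<epsilon> weight_le_1[of x] by (intro mult_left_le) auto
    then have "\<bar>u x - U (Suc j) x\<bar> \<le> \<epsilon> * (1 / 2) ^ j"
      using u(2)[of x "Suc j"] norm_ge_zero[of "gradient u x - gradient (U (Suc j)) x"] unfolding power_Suc by linarith
    with 1 show "\<bar>T u x - u x\<bar> \<le> 2 * \<epsilon> * (1 / 2) ^ j" by linarith
  qed
  then have "T u = u" by (auto simp: fun_eq_iff)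
  with u(1) show ?thesis by blast
qed

text \<open>Applying \<open>T\<close> leaves both fixed points in place but halves the bound on
  their weighted distance, which starts at \<open>2 * \<epsilon>\<close>.\<close>

lemma fixed_point_unique:
  assumes u: "F_bound k \<epsilon> u" "T u = u" and v: "F_bound k \<epsilon> v" "T v = v"
  shows "v = u"
proof -
  have D: "\<bar>v x - u x\<bar> + norm (gradient v x - gradient u x) \<le> 2 * \<epsilon> * (1 / 2) ^ j * (1 + norm x) powr - k" for j x
  proof (induction j arbitrary: x)
    case 0
    have "\<bar>v x - u x\<bar> + norm (gradient v x - gradient u x) \<le> (\<bar>v x\<bar> + norm (gradient v x)) + (\<bar>u x\<bar> + norm (gradient u x))"
      using norm_triangle_ineq4[of "gradient v x" "gradient u x"] by simp
    also have "\<dots> \<le> \<epsilon> * (1 + norm x) powr - k + \<epsilon> * (1 + norm x) powr - k"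
      using u(1) v(1) unfolding F_bound_def by (intro add_mono) auto
    finally show ?case by simp
  next
    case (Suc j)
    have "\<bar>T v x - T u x\<bar> + norm (gradient (T v) x - gradient (T u) x) \<le> 2 * \<epsilon> * (1 / 2) ^ j / 2 * (1 + norm x) powr - k"
      using \<epsilon> by (intro T_contraction u v Suc) auto
    then show ?case unfolding u(2) v(2) by simp
  qed
  have "v x - u x = 0" for x
  proof (rule halving_zero[of _ "2 * \<epsilon>"])
    fix j
    have "2 * \<epsilon> * (1 / 2) ^ j * (1 + norm x) powr - k \<le> 2 * \<epsilon> * (1 / 2) ^ j"
      using \<epsilon> weight_le_1[of x] by (intro mult_left_le) auto
    then show "\<bar>v x - u x\<bar> \<le> 2 * \<epsilon> * (1 / 2) ^ j"
      using D[of x j] norm_ge_zero[of "gradient v x - gradient u x"] by linarith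
  qed
  then show ?thesis by (auto simp: fun_eq_iff)
qed

lemma F_bound_tendsto_0:
  fixes u :: "'a \<Rightarrow> real"
  assumes "F_bound k \<epsilon> u"
  shows "(u \<longlongrightarrow> 0) at_infinity"
proof (rule Lim_null_comparison)
  show "\<forall>\<^sub>F x in at_infinity. norm (u x) \<le> \<epsilon> * (1 + norm x) powr - k"
  proof (rule always_eventually, rule allI)
    fix x
    have "\<bar>u x\<bar> + norm (gradient u x) \<le> \<epsilon> * (1 + norm x) powr - k"
      using assms unfolding F_bound_def by blast
    then show "norm (u x) \<le> \<epsilon> * (1 + norm x) powr - k"
      using norm_ge_zero[of "gradient u x"] unfolding real_norm_def by linarith
  qed
  have "filterlim (\<lambda>x::'a. 1 + norm x) at_top at_infinity"
    by (rule filterlim_tendsto_add_at_top[OF tendsto_const filterlim_norm_at_top])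
  from tendsto_neg_powr[OF _ this, of "- k"] k(1)
  show "((\<lambda>x::'a. \<epsilon> * (1 + norm x) powr - k) \<longlongrightarrow> 0) at_infinity"
    by (intro tendsto_mult_right_zero) simp
qed

lemma fixed_point_weak:
  assumes u: "F_bound k \<epsilon> u" "T u = u"
  shows "weak_solution g u"
  unfolding weak_solution_def
proof (intro conjI allI impI)
  show "Ck_on 1 UNIV u" using u(1) by (simp add: F_bound_def)
  show "(u \<longlongrightarrow> 0) at_infinity" by (rule F_bound_tendsto_0[OF u(1)])
  interpret D: decaying_density "k + 2" "2 * \<epsilon> * Q" "borel_superpos u"
    by unfold_locales (use exponent_range borel_superpos[OF u(1)] in auto)
  fix \<phi> :: "'a \<Rightarrow> real" assume \<phi>: "test_function \<phi>"
  have C1: "Ck_on (Suc 0) UNIV \<phi>" using \<phi> unfolding test_function_def by blast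
  note d = Ck_on_differentiable[OF C1] and gc = Ck_on_1_continuous_gradient[OF C1] and c = Ck_on_continuous[OF C1]
  have "bounded (support_on UNIV \<phi>)"
    using \<phi> compact_imp_bounded bounded_subset closure_subset unfolding test_function_def by blast
  then obtain R where R: "\<And>x. x \<in> support_on UNIV \<phi> \<Longrightarrow> norm x \<le> R" unfolding bounded_iff by blast
  have z: "\<phi> x = 0" if "R < norm x" for x
    using R[of x] that unfolding support_on_def by fastforce
  note gz = gradient_support[OF z]
  have bs: "integrable lborel h" if h: "continuous_on UNIV h" and hz: "\<And>x. R < norm x \<Longrightarrow> h x = 0" for h :: "'a \<Rightarrow> real"
  proof -
    obtain B where B: "B > 0" "\<And>x. norm x \<le> R \<Longrightarrow> norm (h x) \<le> B"
      using continuous_bounded_on_cball[OF h] by metis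
    have "\<bar>h x\<bar> \<le> B" for x using B hz[of x] by (cases "norm x \<le> R") auto
    then show ?thesis
      using borel_measurable_continuous_onI[OF h] hz by (intro integrable_bounded_support[of _ B R]) auto
  qed
  have guc: "continuous_on UNIV (\<lambda>x. gradient u x \<bullet> gradient \<phi> x)"
    by (intro continuous_on_inner F_bound_continuous_gradient[OF u(1)] gc)
  have m1: "(\<lambda>x. gradient u x \<bullet> gradient \<phi> x) \<in> borel_measurable lborel"
    using borel_measurable_continuous_onI[OF guc] by simp
  have i1: "integrable lborel (\<lambda>x. gradient u x \<bullet> gradient \<phi> x)"
    by (rule bs[OF guc]) (simp add: gz)
  then show "integrable lebesgue (\<lambda>x. gradient u x \<bullet> gradient \<phi> x)"
    by (subst integrable_completion[OF m1])
  have [measurable]: "borel_superpos u \<in> borel_measurable borel" "\<phi> \<in> borel_measurable borel"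
    using D.f_measurable borel_measurable_continuous_onI[OF c] by auto
  have m2: "(\<lambda>x. borel_superpos u x * \<phi> x) \<in> borel_measurable lborel" by measurable
  have "integrable lborel (\<lambda>x. borel_superpos u x * \<phi> x)"
  proof -
    obtain B where B: "\<And>y. norm y \<le> R \<Longrightarrow> \<bar>borel_superpos u y\<bar> \<le> B"
      using D.f_loc_bounded unfolding loc_bounded_def by meson
    show ?thesis
    proof (rule Bochner_Integration.integrable_bound[OF _ m2])
      show "integrable lborel (\<lambda>x. \<bar>B\<bar> * \<bar>\<phi> x\<bar>)" by (rule bs) (use c z in \<open>auto intro!: continuous_intros\<close>)
      show "AE x in lborel. norm (borel_superpos u x * \<phi> x) \<le> norm (\<bar>B\<bar> * \<bar>\<phi> x\<bar>)"
      proof (rule AE_I2)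
        fix x
        show "norm (borel_superpos u x * \<phi> x) \<le> norm (\<bar>B\<bar> * \<bar>\<phi> x\<bar>)"
          using B[of x] z[of x] by (cases "norm x \<le> R") (auto simp: abs_mult intro!: mult_right_mono)
      qed
    qed
  qed
  then have i2: "integrable lebesgue (\<lambda>x. borel_superpos u x * \<phi> x)" by (subst integrable_completion[OF m2])
  have ae: "AE x in lebesgue. borel_superpos u x * \<phi> x = superpos u x * \<phi> x"
    using AE_completion[OF borel_superpos(2)[OF u(1)]] by eventually_elim simp
  have m3: "(\<lambda>x. superpos u x * \<phi> x) \<in> borel_measurable lebesgue"
    by (intro borel_measurable_times superpos_measurable[OF u(1)], rule measurable_completion) simp
  have "integrable lebesgue (\<lambda>x. superpos u x * \<phi> x)"
    by (rule integrable_cong_AE_imp[OF i2 m3]) (use ae in \<open>eventually_elim, simp\<close>)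
  then show "integrable lebesgue (\<lambda>x. g x (u x) (gradient u x) * \<phi> x)" by (simp add: superpos_def)
  have "(LINT x|lebesgue. gradient u x \<bullet> gradient \<phi> x) = (\<integral>x. gradient (newton (borel_superpos u)) x \<bullet> gradient \<phi> x \<partial>lborel)"
    using u(2) unfolding integral_completion[OF m1] T_def by simp
  also have "\<dots> = (\<integral>x. borel_superpos u x * \<phi> x \<partial>lborel)" by (rule D.newton_weak[OF d gc z])
  also have "\<dots> = (LINT x|lebesgue. borel_superpos u x * \<phi> x)" by (rule integral_completion[OF m2, symmetric])
  also have "\<dots> = (LINT x|lebesgue. superpos u x * \<phi> x)"
    by (rule integral_cong_AE[OF borel_measurable_integrable[OF i2] m3 ae])
  finally show "(LINT x|lebesgue. gradient u x \<bullet> gradient \<phi> x) = (LINT x|lebesgue. g x (u x) (gradient u x) * \<phi> x)"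
    by (simp add: superpos_def)
qed

text \<open>The exponent \<alpha> is reached in two rounds. The gradient of \<open>u\<close> is at
  first only known to be Hoelder of exponent 1/2, which makes the density Hoelder of exponent
  \<alpha> / 2 and \<open>u\<close> of class \<open>C^2\<close>. Then \<open>\<Phi>\<close> is of
  class \<open>C^1\<close>, so composing \<open>g\<close> with it no longer lowers \<alpha>, and
  each further round gains one order until that of \<open>g\<close> is exhausted.\<close>

lemma fixed_point_regular:
  assumes u: "F_bound k \<epsilon> u" "T u = u" and \<alpha>: "0 < \<alpha>" "\<alpha> < 1"
    and G: "Ckalpha_loc m \<alpha> (\<lambda>(x, z, p). g x z p)"
  shows "Ckalpha_loc (m + 2) \<alpha> u" and "classical_solution g u"
proof -
  let ?G = "\<lambda>(x, z, p). g x z p"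
  define \<Phi> where "\<Phi> x = (x, u x, gradient u x)" for x
  define f where "f = superpos u"
  have f\<Phi>: "f = (\<lambda>x. ?G (\<Phi> x))" by (simp add: f_def superpos_def \<Phi>_def fun_eq_iff)
  \<comment> \<open>The coordinates of \<open>\<Phi>\<close> are those of \<open>x\<close>, the
    function \<open>u\<close> and its partial derivatives. The property \<open>P\<close> is
    arbitrary because the case distinction is reused for Hoelder continuity, \<open>C^1\<close> and
    the Hoelder classes.\<close>
  have comp: "P (\<lambda>x. \<Phi> x \<bullet> e)"
    if "e \<in> Basis" "\<And>b. b \<in> Basis \<Longrightarrow> P (\<lambda>x. x \<bullet> b)" "P u" "\<And>b. b \<in> Basis \<Longrightarrow> P (\<lambda>x. gradient u x \<bullet> b)"
    for e and P :: "('a \<Rightarrow> real) \<Rightarrow> bool"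
    using that by (auto simp: \<Phi>_def Basis_prod_def)
  have G0: "ball_Hoelder \<alpha> ?G"
    using Ckalpha_loc_mono[OF G _ \<alpha>(1), of 0] \<alpha> by (simp add: locally_Hoelder_iff)
  have fc: "continuous_on UNIV f"
    unfolding f\<Phi>
  proof (rule continuous_on_compose2[OF ball_Hoelder_continuous[OF G0 \<alpha>(1)]])
    show "continuous_on UNIV \<Phi>"
      unfolding \<Phi>_def by (intro continuous_intros F_bound_continuous[OF u(1)] F_bound_continuous_gradient[OF u(1)])
  qed simp
  \<comment> \<open>Continuity upgrades the bound from almost everywhere to everywhere: the set of
    violation is open and null, hence empty. So \<open>f\<close> itself can take the place of its
    Borel representative.\<close>
  have f: "decaying (k + 2) (2 * \<epsilon> * Q) f"
    unfolding decaying_def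
  proof
    show "f \<in> borel_measurable borel" by (rule borel_measurable_continuous_onI[OF fc])
    let ?B = "{x. 2 * \<epsilon> * Q * (1 + norm x) powr - (k + 2) < \<bar>f x\<bar>}"
    have "1 + norm x \<noteq> 0" for x :: 'a using norm_ge_zero[of x] by linarith
    then have "open ?B" by (intro open_Collect_less continuous_intros fc) auto
    moreover have "negligible ?B"
    proof -
      have "AE x in lebesgue. x \<notin> ?B" using superpos_bound[OF u(1)] by eventually_elim (simp add: f_def)
      then have "?B \<in> null_sets lebesgue"
        using \<open>open ?B\<close> by (subst AE_iff_null_sets) auto
      then show ?thesis by (simp add: negligible_iff_null_sets)
    qed
    ultimately have "?B = {}" using open_not_negligible by blast
    then show "\<forall>y. \<bar>f y\<bar> \<le> 2 * \<epsilon> * Q * (1 + norm y) powr - (k + 2)" by (auto simp: not_less)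
  qed
  interpret D: decaying_density "k + 2" "2 * \<epsilon> * Q" f
    by unfold_locales (use exponent_range f in auto)
  have uf: "u = newton f"
  proof -
    have "borel_superpos u \<in> borel_measurable borel" using borel_superpos(1)[OF u(1)] by (simp add: decaying_def)
    moreover have "AE x in lborel. f x = borel_superpos u x" using borel_superpos(2)[OF u(1)] by (simp add: f_def)
    ultimately have "newton f = newton (borel_superpos u)" by (rule newton_AE_cong[OF D.f_measurable])
    then show ?thesis using u(2) by (simp add: T_def)
  qed
  have half: "ball_Hoelder (1 / 2) \<Phi>"
  proof (rule ball_Hoelder_componentI, rule comp)
    show "ball_Hoelder (1 / 2) (\<lambda>x. x \<bullet> b)" for b :: 'a
      by (rule ball_Hoelder_mono[OF Ck_on_ball_Hoelder[OF Ck_on_inner_left[of "Suc 0" b]]]) simp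
    show "ball_Hoelder (1 / 2) u"
      using u(1) by (intro ball_Hoelder_mono[OF Ck_on_ball_Hoelder[of 0]]) (auto simp: F_bound_def)
    show "ball_Hoelder (1 / 2) (\<lambda>x. gradient u x \<bullet> b)" if "b \<in> Basis" for b
      unfolding uf by (rule D.gradient_newton_Hoelder) (use that in auto)
  qed
  have fh: "ball_Hoelder (\<alpha> * (1 / 2)) f"
    unfolding f\<Phi> by (rule ball_Hoelder_compose[OF G0 half \<alpha>(1)]) simp
  have "Ckalpha_loc (Suc (Suc 0)) (\<alpha> * (1 / 2)) u"
    unfolding uf by (rule D.newton_Ckalpha) (use fh \<alpha> in \<open>auto simp: locally_Hoelder_iff\<close>)
  then have C2: "Ck_on (Suc (Suc 0)) UNIV u" by (rule Ckalpha_loc_imp_Ck_on) (use \<alpha> in simp)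
  have \<Phi>1: "Ck_on 1 UNIV (\<lambda>x. \<Phi> x \<bullet> e)" if "e \<in> Basis" for e
    using that
  proof (rule comp)
    show "Ck_on 1 UNIV (\<lambda>x. x \<bullet> b)" for b :: 'a by (rule Ck_on_inner_left)
    show "Ck_on 1 UNIV u" using u(1) by (simp add: F_bound_def)
    show "Ck_on 1 UNIV (\<lambda>x. gradient u x \<bullet> b)" if "b \<in> Basis" for b
      using C2 that unfolding Ck_on.simps(2)[of "Suc 0"] One_nat_def by blast
  qed
  have boot: "Ckalpha_loc (Suc (Suc j)) \<alpha> u" if "j \<le> m" for j
    using that
  proof (induction j)
    case 0
    have "Ckalpha_loc 0 \<alpha> f"
      unfolding f\<Phi>
    proof (rule Ckalpha_loc_compose[OF \<alpha>(1) _ \<Phi>1])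
      show "Ckalpha_loc 0 \<alpha> ?G" by (rule Ckalpha_loc_mono[OF G _ \<alpha>(1)]) (use \<alpha> in auto)
      show "Ckalpha_loc 0 \<alpha> (\<lambda>x. \<Phi> x \<bullet> e)" if "e \<in> Basis" for e
        by (rule Ck_on_imp_Ckalpha_loc) (use \<Phi>1[OF that] \<alpha> in \<open>simp_all only: One_nat_def less_imp_le\<close>)
    qed (use \<alpha> in simp)
    then show ?case unfolding uf by (rule D.newton_Ckalpha[OF _ \<alpha>])
  next
    case (Suc j)
    then have IH: "Ckalpha_loc (Suc (Suc j)) \<alpha> u" by simp
    have "Ckalpha_loc (Suc j) \<alpha> f"
      unfolding f\<Phi>
    proof (rule Ckalpha_loc_compose[OF \<alpha>(1) _ \<Phi>1])
      show "Ckalpha_loc (Suc j) \<alpha> ?G" by (rule Ckalpha_loc_mono[OF G Suc.prems \<alpha>(1)]) (use \<alpha> in simp)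
      show "Ckalpha_loc (Suc j) \<alpha> (\<lambda>x. \<Phi> x \<bullet> e)" if "e \<in> Basis" for e
        using that
      proof (rule comp)
        show "Ckalpha_loc (Suc j) \<alpha> (\<lambda>x. x \<bullet> b)" for b :: 'a
          using \<alpha> by (intro Ck_on_imp_Ckalpha_loc Ck_on_inner_left) simp
        show "Ckalpha_loc (Suc j) \<alpha> u" by (rule Ckalpha_loc_SucD[OF IH \<alpha>(1)]) (use \<alpha> in simp)
        show "Ckalpha_loc (Suc j) \<alpha> (\<lambda>x. gradient u x \<bullet> b)" if "b \<in> Basis" for b
          using IH that unfolding Ckalpha_loc.simps(2)[of "Suc j"] by blast
      qed
    qed (use \<alpha> in simp)
    then show ?case unfolding uf by (rule D.newton_Ckalpha[OF _ \<alpha>])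
  qed
  show "Ckalpha_loc (m + 2) \<alpha> u" using boot[of m] by (simp add: numeral_2_eq_2)
  show "classical_solution g u"
    unfolding classical_solution_def
  proof (intro conjI allI)
    show "Ck_on 2 UNIV u" using C2 by (simp only: numeral_2_eq_2)
    \<comment> \<open>For the equation itself the exponent \<alpha> / 2 of the first round is
      enough.\<close>
    have "laplacian u x = - f x" for x
      unfolding uf by (rule D.newton_classical[OF fh]) (use \<alpha> in auto)
    then show "laplacian u x + g x (u x) (gradient u x) = 0" for x by (simp add: f_def superpos_def)
    show "(u \<longlongrightarrow> 0) at_infinity" by (rule F_bound_tendsto_0[OF u(1)])
  qed
qed

end

theorem theorem1p3:
  fixes k :: real
  assumes "CARD('n::finite) \<ge> 3" and "0 < k" and "k < real CARD('n) - 2"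
  shows "\<exists>Q>0. \<forall>(g :: real ^ 'n \<Rightarrow> real \<Rightarrow> real ^ 'n \<Rightarrow> real) \<epsilon>.
    (\<forall>x. Ck_on 1 (UNIV - {(0, 0)}) (\<lambda>(z, p). g x z p) \<and>
         continuous_on UNIV (\<lambda>(z, p). g x z p)) \<longrightarrow>
    (\<lambda>x. g x 0 0) \<in> E_space (k + 2) \<longrightarrow>
    (\<exists>\<delta>>0. grad_zp_sup k g \<delta> < \<infinity>) \<longrightarrow>
    0 < \<epsilon> \<longrightarrow>
    grad_zp_sup k g \<epsilon> < ennreal Q \<longrightarrow>
    E_norm (k + 2) (\<lambda>x. g x 0 0) \<le> ennreal (\<epsilon> * Q) \<longrightarrow>
    (\<exists>u\<in>F_space k.
       F_norm k u \<le> ennreal \<epsilon> \<and> integral_solution g u \<and>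
       (\<forall>v\<in>F_space k. F_norm k v \<le> ennreal \<epsilon> \<and> integral_solution g v \<longrightarrow> v = u) \<and>
       weak_solution g u \<and>
       (\<forall>m \<alpha>. 0 < \<alpha> \<and> \<alpha> < 1 \<and> Ckalpha_loc m \<alpha> (\<lambda>(x, z, p). g x z p) \<longrightarrow>
          Ckalpha_loc (m + 2) \<alpha> u \<and> classical_solution g u))"
proof -
  have dim: "real DIM(real ^ 'n) = real CARD('n)" by simp
  obtain C where C: "0 < C"
    "\<And>A (f :: real ^ 'n \<Rightarrow> real) x. decaying (k + 2) A f \<Longrightarrow>
      \<bar>newton f x\<bar> + norm (gradient (newton f) x) \<le> C * A * (1 + norm x) powr (2 - (k + 2))"
    using newton_decay[of "k + 2", where ?'a = "real ^ 'n"] assms unfolding dim by auto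
  show ?thesis
  \<comment> \<open>\<open>C\<close> depends only on \<open>k\<close> and the dimension, hence so
    does this threshold, which makes \<open>2 * C * Q\<close> equal to 1.\<close>
  proof (intro exI[of _ "1 / (2 * C)"] conjI allI impI)
    show "0 < 1 / (2 * C)" using C(1) by simp
    fix g :: "real ^ 'n \<Rightarrow> real \<Rightarrow> real ^ 'n \<Rightarrow> real" and \<epsilon> :: real
    assume g: "\<forall>x. Ck_on 1 (UNIV - {(0, 0)}) (\<lambda>(z, p). g x z p) \<and> continuous_on UNIV (\<lambda>(z, p). g x z p)"
      and \<epsilon>: "0 < \<epsilon>" and G: "grad_zp_sup k g \<epsilon> < ennreal (1 / (2 * C))"
      and g0: "E_norm (k + 2) (\<lambda>x. g x 0 0) \<le> ennreal (\<epsilon> * (1 / (2 * C)))"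
    \<comment> \<open>\<open>grad_zp_sup k g \<epsilon>\<close> is finite, being below
      \<open>ennreal Q\<close>, and its real value serves as the constant \<open>L\<close>.\<close>
    let ?L = "enn2real (grad_zp_sup k g \<epsilon>)"
    have L: "grad_zp_sup k g \<epsilon> = ennreal ?L" using G by (cases "grad_zp_sup k g \<epsilon>") auto
    have "ennreal ?L < ennreal (1 / (2 * C))" using G unfolding L[symmetric] .
    then have LQ: "?L \<le> 1 / (2 * C)" by (simp add: ennreal_less_iff)
    interpret contractive_nonlinearity k \<epsilon> ?L "1 / (2 * C)" g C
    proof unfold_locales
      show "grad_zp_sup k g \<epsilon> \<le> ennreal ?L" using L by simp
      show "2 * C * (1 / (2 * C)) \<le> 1" using C(1) by simp
      show "k < real DIM(real ^ 'n) - 2" using assms(3) by simp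
    qed (use assms C \<epsilon> g g0 LQ in \<open>auto simp only: enn2real_nonneg\<close>)
    obtain u where u: "F_bound k \<epsilon> u" "T u = u" using fixed_point_exists by blast
    have F: "F_bound k \<epsilon> v \<longleftrightarrow> v \<in> F_space k \<and> F_norm k v \<le> ennreal \<epsilon>" for v :: "real ^ 'n \<Rightarrow> real"
      using \<epsilon> by (intro F_bound_iff) simp
    show "\<exists>u\<in>F_space k. F_norm k u \<le> ennreal \<epsilon> \<and> integral_solution g u \<and>
       (\<forall>v\<in>F_space k. F_norm k v \<le> ennreal \<epsilon> \<and> integral_solution g v \<longrightarrow> v = u) \<and>
       weak_solution g u \<and>
       (\<forall>m \<alpha>. 0 < \<alpha> \<and> \<alpha> < 1 \<and> Ckalpha_loc m \<alpha> (\<lambda>(x, z, p). g x z p) \<longrightarrow>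
          Ckalpha_loc (m + 2) \<alpha> u \<and> classical_solution g u)"
    proof (rule bexI[of _ u], intro conjI ballI allI impI; (elim conjE)?)
      show "u \<in> F_space k" "F_norm k u \<le> ennreal \<epsilon>" using u(1) F by auto
      show "integral_solution g u" using integral_solution_iff[OF u(1)] u(2) by simp
      show "weak_solution g u" by (rule fixed_point_weak[OF u])
      show "v = u" if "v \<in> F_space k" "F_norm k v \<le> ennreal \<epsilon>" "integral_solution g v" for v
      proof -
        have v: "F_bound k \<epsilon> v" using that F by blast
        show ?thesis by (rule fixed_point_unique[OF u v]) (use integral_solution_iff[OF v] that(3) in simp)
      qed
      show "Ckalpha_loc (m + 2) \<alpha> u" "classical_solution g u"
        if "0 < \<alpha>" "\<alpha> < 1" "Ckalpha_loc m \<alpha> (\<lambda>(x, z, p). g x z p)" for m \<alpha>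
        using fixed_point_regular[OF u that] by auto
    qed
  qed
qed

end
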